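(* Let $L$ be an even lattice of signature $(2,b_{-})$, $m\geq1$ an integer, $\beta\in D_{L}$, and $r<0$ rational with $r\equiv\beta^{2}/2\pmod{\mathbb{Z}}$. Let $s\in\mathbb{C}$ with $\Re s>\frac32+\frac{b_{-}}{4}+\frac m2$, and let $Z\in K_{\mathbb{R}}+iC$ not lie in any $\lambda^{\perp}$ for $\lambda\in L+\beta$ with $\lambda^{2}=2r$. Then, writing $a=s-\frac12+\frac{b_{-}}{4}+\frac m2$, \[\Phi_{L,m,m,0}\big(Z,F_{m,r,\beta}^{L}(\cdot,s)\big)=\frac{2(2|r|)^{s-\frac12+\frac{b_{-}}{4}-\frac m2}\Gamma(a)}{\Gamma(2s)}\sum_{\substack{\lambda\in L+\beta\\ \lambda^{2}=2r}}\frac{(\lambda,\overline{Z_{V,Z}})^{m}/(Y^{2})^{m}}{(2\pi)^{m}|\lambda_{-}^{2}|^{a}}\,{}_{2}F_{1}\Big(a,\,s+\frac12-\frac{b_{-}}{4}+\frac m2;\,2s;\,\frac{2|r|}{|\lambda_{-}^{2}|}\Big).\]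
   Context: $\mathbf{e}(\xi)=e^{2\pi i\xi}$, $\tau=x+iy\in\mathcal{H}$. $L$ is an even lattice (integral symmetric bilinear form $(\cdot,\cdot)$, $\lambda^{2}=(\lambda,\lambda)$ even on $L$) whose real span $L_{\mathbb{R}}$ has signature $(2,b_{-})$; $L^{*}$ dual lattice, $D_{L}=L^{*}/L$, $L+\beta\subset L^{*}$ the coset of $\beta$. Weil representation $\rho_{L}$ of $Mp_{2}(\mathbb{Z})$ on $\mathbb{C}[D_{L}]$: $\rho_{L}(T)e_{\gamma}=\mathbf{e}(\gamma^{2}/2)e_{\gamma}$, $\rho_{L}(S)e_{\gamma}=\frac{\mathbf{e}((b_{-}-2)/8)}{\sqrt{|D_{L}|}}\sum_{\delta}\mathbf{e}(-(\gamma,\delta))e_{\delta}$ with $T=(\binom{1\ 1}{0\ 1},1)$, $S=(\binom{0\ -1}{1\ \ 0},\sqrt\tau)$; slash $f[(A,\phi)]_{k}(\tau)=\rho_{L}(A,\phi)^{-1}\phi(\tau)^{-2k}f(A\tau)$. $\mathcal{M}_{k,s}(t)=t^{-k/2}M_{-k/2,s-1/2}(t)$ with $M_{\nu,\mu}$ the Whittaker function. With $k=1-\frac{b_{-}}{2}+m$ and $\omega=e_{\beta}+(-1)^{m}e_{-\beta}$: $F_{m,r,\beta}^{L}(\tau,s)=\frac{1}{4\Gamma(2s)}\sum_{A\in\langle T\rangle\backslash Mp_{2}(\mathbb{Z})}[\mathbf{e}(rx)\mathcal{M}_{k,s}(4\pi|r|y)\omega][A]_{k}(\tau)$ ($\Re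 s>1$). Fix an isotropic $z\in L_{\mathbb{R}}$ and $\zeta\in L_{\mathbb{R}}$ with $(z,\zeta)=1$; $K_{\mathbb{R}}=\{z,\zeta\}^{\perp}$ (Lorentzian), $C$ a chosen cone of positive-norm vectors in $K_{\mathbb{R}}$. For $Z=X+iY\in K_{\mathbb{R}}+iC$ put $Z_{V,Z}=Z+\zeta-\frac{Z^{2}+\zeta^{2}}{2}z\in L_{\mathbb{C}}$ (forms extended bilinearly); $v_{+}$ is the positive definite plane spanned by $\Re Z_{V,Z},\Im Z_{V,Z}$ and $v_{-}=v_{+}^{\perp}$; $\lambda_{\pm}$ are the orthogonal projections of $\lambda$ to $v_{\pm}$. $\lambda^{\perp}$ (for $\lambda^{2}<0$) is the set of $Z$ with $\lambda\in v_{-}$. Theta function: $\Theta_{L,m,m,0}(\tau,Z)=\sum_{\lambda\in L^{*}}\frac{(\lambda,Z_{V,Z})^{m}}{(Y^{2})^{m}}\mathbf{e}(\tau\lambda_{+}^{2}/2+\overline\tau\lambda_{-}^{2}/2)e_{\lambda+L}$. Theta lift: $\Phi_{L,m,m,0}(Z,F)=\lim_{H\to\infty}\int_{D_{H}}\langle F(\tau),\Theta_{L,m,m,0}(\tau,Z)\rangle y^{m+1}\frac{dx\,dy}{y^{2}}$, $D_{H}=\{|\tau|\geq1,|x|\leq\frac12,y\leq H\}$, $\langle a,b\rangle=\sum_{\gamma}a_{\gamma}\overline{b_{\gamma}}$. ${}_{2}F_{1}(a,b;c;t)=\sum_{n\geq0}\frac{\Gamma(a+n)\Gamma(b+n)\Gamma(c)}{\Gamma(a)\Gamma(b)\Gamma(c+n)}\frac{t^{n}}{n!}$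 is the Gauss hypergeometric series. *)

theory Defs
  imports "HOL-Analysis.Analysis" "HOL-Algebra.Generated_Groups"
begin

text \<open>
  The real span of the lattice is the whole type \<open>'v\<close>, used only as a finite-dimensional real
  vector space: its built-in inner product plays no role, the quadratic space structure is
  the form \<open>B\<close>.
\<close>

definition lattice_in :: "'v::euclidean_space set \<Rightarrow> bool" where
  "lattice_in L \<longleftrightarrow>
     (\<exists>b. independent b \<and> span b = UNIV \<and>
          L = {(\<Sum>v\<in>b. of_int (c v) *\<^sub>R v) | c :: 'v \<Rightarrow> int. True})"

definition signature :: "('v::euclidean_space \<Rightarrow> 'v \<Rightarrow> real) \<Rightarrow> nat \<Rightarrow> nat \<Rightarrow> bool" where
  "signature B p q \<longleftrightarrow>
     (\<exists>V W. subspace V \<and> subspace W \<and> dim V = p \<and> dim W = q \<and>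
        (\<forall>x. \<exists>v\<in>V. \<exists>w\<in>W. x = v + w) \<and>
        (\<forall>v\<in>V. \<forall>w\<in>W. B v w = 0) \<and>
        (\<forall>v\<in>V. v \<noteq> 0 \<longrightarrow> B v v > 0) \<and>
        (\<forall>w\<in>W. w \<noteq> 0 \<longrightarrow> B w w < 0))"

definition even_lattice ::
  "('v::euclidean_space \<Rightarrow> 'v \<Rightarrow> real) \<Rightarrow> 'v set \<Rightarrow> nat \<Rightarrow> nat \<Rightarrow> bool" where
  "even_lattice B L p q \<longleftrightarrow>
     bilinear B \<and> (\<forall>x y. B x y = B y x) \<and> signature B p q \<and> lattice_in L \<and>
     (\<forall>x\<in>L. \<forall>y\<in>L. B x y \<in> \<int>) \<and>
     (\<forall>x\<in>L. \<exists>n::int. B x x = 2 * of_int n)"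

definition dual_lattice :: "('v::euclidean_space \<Rightarrow> 'v \<Rightarrow> real) \<Rightarrow> 'v set \<Rightarrow> 'v set" where
  "dual_lattice B L = {x. \<forall>y\<in>L. B x y \<in> \<int>}"

definition lat_coset :: "'v::euclidean_space set \<Rightarrow> 'v \<Rightarrow> 'v set" where
  "lat_coset L x = (+) x ` L"

definition disc_group :: "('v::euclidean_space \<Rightarrow> 'v \<Rightarrow> real) \<Rightarrow> 'v set \<Rightarrow> 'v set set" where
  "disc_group B L = lat_coset L ` dual_lattice B L"

text \<open>
  The group algebra \<open>\<complex>[D\<^sub>L]\<close> is the space of complex functions on cosets that vanish off the
  discriminant group.
\<close>

definition group_alg ::
  "('v::euclidean_space \<Rightarrow> 'v \<Rightarrow> real) \<Rightarrow> 'v set \<Rightarrow> ('v set \<Rightarrow> complex) set" where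
  "group_alg B L = {f. \<forall>c. c \<notin> disc_group B L \<longrightarrow> f c = 0}"

definition basis_vec :: "'v set \<Rightarrow> 'v set \<Rightarrow> complex" where
  "basis_vec c = (\<lambda>d. if d = c then 1 else 0)"

definition herm_pair ::
  "('v::euclidean_space \<Rightarrow> 'v \<Rightarrow> real) \<Rightarrow> 'v set \<Rightarrow>
   ('v set \<Rightarrow> complex) \<Rightarrow> ('v set \<Rightarrow> complex) \<Rightarrow> complex" where
  "herm_pair B L f g = (\<Sum>c\<in>disc_group B L. f c * cnj (g c))"

definition ee :: "complex \<Rightarrow> complex" where
  "ee \<xi> = exp (2 * of_real pi * \<i> * \<xi>)"

definition upper_half :: "complex set" where
  "upper_half = {\<tau>. Im \<tau> > 0}"

definition autom_factor :: "int^2^2 \<Rightarrow> complex \<Rightarrow> complex" where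
  "autom_factor A \<tau> = of_int (A$2$1) * \<tau> + of_int (A$2$2)"

definition moebius_act :: "int^2^2 \<Rightarrow> complex \<Rightarrow> complex" where
  "moebius_act A \<tau> = (of_int (A$1$1) * \<tau> + of_int (A$1$2)) / autom_factor A \<tau>"

text \<open>
  Elements are pairs \<open>(A, \<phi>)\<close> with \<open>\<phi>\<close> a holomorphic square root of \<open>c\<tau> + d\<close> on the upper
  half plane. Extensionality makes \<open>\<phi>\<close> determined by its values there.
\<close>

type_synonym mp2 = "(int^2^2) \<times> (complex \<Rightarrow> complex)"

definition Mp2Z :: "mp2 monoid" where
  "Mp2Z = \<lparr>carrier = {(A, \<phi>). det A = 1 \<and> \<phi> \<in> extensional upper_half \<and>
                        \<phi> holomorphic_on upper_half \<and>
                        (\<forall>\<tau>\<in>upper_half. (\<phi> \<tau>)\<^sup>2 = autom_factor A \<tau>)},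
           mult = (\<lambda>(A, \<phi>) (A', \<psi>).
                     (A ** A', \<lambda>\<tau>\<in>upper_half. \<phi> (moebius_act A' \<tau>) * \<psi> \<tau>)),
           one = (mat 1, \<lambda>\<tau>\<in>upper_half. 1)\<rparr>"

definition T_elt :: "mp2" where
  "T_elt = (vector [vector [1, 1], vector [0, 1]], \<lambda>\<tau>\<in>upper_half. 1)"

definition S_elt :: "mp2" where
  "S_elt = (vector [vector [0, -1], vector [1, 0]], \<lambda>\<tau>\<in>upper_half. csqrt \<tau>)"

text \<open>
  Since \<open>S\<close> and \<open>T\<close> generate the metaplectic group, these conditions determine \<open>\<rho>\<close> on
  \<open>\<complex>[D\<^sub>L]\<close> uniquely. The coefficient \<open>\<^bold>e(-(\<gamma>, \<delta>))\<close> does not depend on the chosen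
  representative of the coset \<open>\<delta>\<close>.
\<close>

definition weil_representation ::
  "('v::euclidean_space \<Rightarrow> 'v \<Rightarrow> real) \<Rightarrow> 'v set \<Rightarrow> nat \<Rightarrow>
   (mp2 \<Rightarrow> ('v set \<Rightarrow> complex) \<Rightarrow> ('v set \<Rightarrow> complex)) \<Rightarrow> bool" where
  "weil_representation B L b \<rho> \<longleftrightarrow>
     (\<forall>g\<in>carrier Mp2Z. \<forall>f\<in>group_alg B L. \<rho> g f \<in> group_alg B L) \<and>
     (\<forall>g\<in>carrier Mp2Z. \<forall>f\<in>group_alg B L. \<forall>h\<in>group_alg B L. \<forall>p q.
        \<rho> g (\<lambda>c. p * f c + q * h c) = (\<lambda>c. p * \<rho> g f c + q * \<rho> g h c)) \<and>
     (\<forall>f\<in>group_alg B L. \<rho> \<one>\<^bsub>Mp2Z\<^esub> f = f) \<and>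
     (\<forall>g\<in>carrier Mp2Z. \<forall>g'\<in>carrier Mp2Z. \<forall>f\<in>group_alg B L.
        \<rho> (g \<otimes>\<^bsub>Mp2Z\<^esub> g') f = \<rho> g (\<rho> g' f)) \<and>
     (\<forall>\<gamma>\<in>dual_lattice B L.
        \<rho> T_elt (basis_vec (lat_coset L \<gamma>)) =
          (\<lambda>d. ee (of_real (B \<gamma> \<gamma> / 2)) * basis_vec (lat_coset L \<gamma>) d)) \<and>
     (\<forall>\<gamma>\<in>dual_lattice B L.
        \<rho> S_elt (basis_vec (lat_coset L \<gamma>)) =
          (\<lambda>d. ee ((of_nat b - 2) / 8) / of_real (sqrt (real (card (disc_group B L)))) *
               (\<Sum>c\<in>disc_group B L. ee (- of_real (B \<gamma> (SOME \<delta>. \<delta> \<in> c))) * basis_vec c d)))"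

text \<open>The slash operator takes the integer \<open>2k\<close> instead of the half-integral weight \<open>k\<close>.\<close>

definition slash ::
  "('v::euclidean_space \<Rightarrow> 'v \<Rightarrow> real) \<Rightarrow> 'v set \<Rightarrow>
   (mp2 \<Rightarrow> ('v set \<Rightarrow> complex) \<Rightarrow> ('v set \<Rightarrow> complex)) \<Rightarrow>
   int \<Rightarrow> (complex \<Rightarrow> 'v set \<Rightarrow> complex) \<Rightarrow>
   mp2 \<Rightarrow> complex \<Rightarrow> 'v set \<Rightarrow> complex" where
  "slash B L \<rho> two_k f g \<tau> =
     inv_into (group_alg B L) (\<rho> g)
       (\<lambda>c. snd g \<tau> powi (- two_k) * f (moebius_act (fst g) \<tau>) c)"

text \<open>
  Whittaker's \<open>M\<^sub>\<nu>\<^sub>,\<^sub>\<mu>(t) = e\<^sup>-\<^sup>t\<^sup>/\<^sup>2 t\<^bsup>\<mu>+1/2\<^esup> M(\<mu> - \<nu> + 1/2, 1 + 2\<mu>, t)\<close> on the positive reals, with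
  Kummer's confluent series \<open>M(a, c, t)\<close>.
\<close>

definition kummer_M :: "complex \<Rightarrow> complex \<Rightarrow> complex \<Rightarrow> complex" where
  "kummer_M a c t = (\<Sum>n. pochhammer a n / pochhammer c n * t ^ n / fact n)"

definition whittaker_M :: "complex \<Rightarrow> complex \<Rightarrow> real \<Rightarrow> complex" where
  "whittaker_M \<nu> \<mu> t =
     exp (- of_real t / 2) * of_real t powr (\<mu> + 1/2) *
     kummer_M (\<mu> - \<nu> + 1/2) (1 + 2 * \<mu>) (of_real t)"

definition Mks :: "complex \<Rightarrow> complex \<Rightarrow> real \<Rightarrow> complex" where
  "Mks k s t = of_real t powr (- k / 2) * whittaker_M (- k / 2) (s - 1/2) t"

definition hyp2F1 :: "complex \<Rightarrow> complex \<Rightarrow> complex \<Rightarrow> complex \<Rightarrow> complex" where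
  "hyp2F1 a b c t =
     (\<Sum>n. Gamma (a + of_nat n) * Gamma (b + of_nat n) * Gamma c /
          (Gamma a * Gamma b * Gamma (c + of_nat n)) * (t ^ n / fact n))"

text \<open>\<open>2k\<close> for the weight \<open>k = 1 - b/2 + m\<close>.\<close>

definition two_weight :: "nat \<Rightarrow> nat \<Rightarrow> int" where
  "two_weight b m = 2 - int b + 2 * int m"

definition poincare_seed ::
  "'v::euclidean_space set \<Rightarrow> nat \<Rightarrow> nat \<Rightarrow> real \<Rightarrow> 'v \<Rightarrow> complex \<Rightarrow>
   complex \<Rightarrow> 'v set \<Rightarrow> complex" where
  "poincare_seed L b m r \<beta> s \<tau> =
     (\<lambda>c. ee (of_real (r * Re \<tau>)) *
          Mks (of_int (two_weight b m) / 2) s (4 * pi * \<bar>r\<bar> * Im \<tau>) *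
          (basis_vec (lat_coset L \<beta>) c + (-1) ^ m * basis_vec (lat_coset L (- \<beta>)) c))"

text \<open>
  The sum runs over the right cosets \<open>\<langle>T\<rangle>A\<close>. The summand does not depend on the chosen
  representative when \<open>r\<close> is congruent to \<open>\<beta>\<^sup>2/2\<close> modulo 1.
\<close>

definition poincare_F ::
  "('v::euclidean_space \<Rightarrow> 'v \<Rightarrow> real) \<Rightarrow> 'v set \<Rightarrow>
   (mp2 \<Rightarrow> ('v set \<Rightarrow> complex) \<Rightarrow> ('v set \<Rightarrow> complex)) \<Rightarrow>
   nat \<Rightarrow> nat \<Rightarrow> real \<Rightarrow> 'v \<Rightarrow> complex \<Rightarrow> complex \<Rightarrow> 'v set \<Rightarrow> complex" where
  "poincare_F B L \<rho> b m r \<beta> s \<tau> =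
     (\<lambda>c. 1 / (4 * Gamma (2 * s)) *
          (\<Sum>\<^sub>\<infinity>A\<in>rcosets\<^bsub>Mp2Z\<^esub> (generate Mp2Z {T_elt}).
             slash B L \<rho> (two_weight b m) (poincare_seed L b m r \<beta> s) (SOME g. g \<in> A) \<tau> c))"

text \<open>
  The complexification: the pair \<open>(u, w)\<close> stands for \<open>u + iw\<close>. Hence \<open>K\<^sub>\<real> + iC\<close> is \<open>K\<^sub>\<real> \<times> C\<close>.
\<close>

type_synonym 'v cpx = "'v \<times> 'v"

definition cpx_emb :: "'v::euclidean_space \<Rightarrow> 'v cpx" where
  "cpx_emb v = (v, 0)"

definition cpx_scale :: "complex \<Rightarrow> 'v::euclidean_space cpx \<Rightarrow> 'v cpx" where
  "cpx_scale a Z = (Re a *\<^sub>R fst Z - Im a *\<^sub>R snd Z, Re a *\<^sub>R snd Z + Im a *\<^sub>R fst Z)"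

definition cpx_cnj :: "'v::euclidean_space cpx \<Rightarrow> 'v cpx" where
  "cpx_cnj Z = (fst Z, - snd Z)"

definition cpx_form ::
  "('v::euclidean_space \<Rightarrow> 'v \<Rightarrow> real) \<Rightarrow> 'v cpx \<Rightarrow> 'v cpx \<Rightarrow> complex" where
  "cpx_form B Z W =
     Complex (B (fst Z) (fst W) - B (snd Z) (snd W)) (B (fst Z) (snd W) + B (snd Z) (fst W))"

definition orth_compl ::
  "('v::euclidean_space \<Rightarrow> 'v \<Rightarrow> real) \<Rightarrow> 'v set \<Rightarrow> 'v set" where
  "orth_compl B V = {x. \<forall>v\<in>V. B x v = 0}"

definition orth_proj ::
  "('v::euclidean_space \<Rightarrow> 'v \<Rightarrow> real) \<Rightarrow> 'v set \<Rightarrow> 'v \<Rightarrow> 'v" where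
  "orth_proj B V x = (THE u. u \<in> V \<and> x - u \<in> orth_compl B V)"

definition K_space ::
  "('v::euclidean_space \<Rightarrow> 'v \<Rightarrow> real) \<Rightarrow> 'v \<Rightarrow> 'v \<Rightarrow> 'v set" where
  "K_space B z \<zeta> = orth_compl B {z, \<zeta>}"

text \<open>As \<open>K\<^sub>\<real>\<close> is Lorentzian, its vectors of positive norm form two open cones.\<close>

definition positive_cone ::
  "('v::euclidean_space \<Rightarrow> 'v \<Rightarrow> real) \<Rightarrow> 'v \<Rightarrow> 'v \<Rightarrow> 'v set \<Rightarrow> bool" where
  "positive_cone B z \<zeta> C \<longleftrightarrow> C \<in> components {Y \<in> K_space B z \<zeta>. B Y Y > 0}"

definition ZV ::
  "('v::euclidean_space \<Rightarrow> 'v \<Rightarrow> real) \<Rightarrow> 'v \<Rightarrow> 'v \<Rightarrow> 'v cpx \<Rightarrow> 'v cpx" where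
  "ZV B z \<zeta> Z =
     Z + cpx_emb \<zeta> - cpx_scale ((cpx_form B Z Z + of_real (B \<zeta> \<zeta>)) / 2) (cpx_emb z)"

definition v_plus ::
  "('v::euclidean_space \<Rightarrow> 'v \<Rightarrow> real) \<Rightarrow> 'v \<Rightarrow> 'v \<Rightarrow> 'v cpx \<Rightarrow> 'v set" where
  "v_plus B z \<zeta> Z = span {fst (ZV B z \<zeta> Z), snd (ZV B z \<zeta> Z)}"

definition v_minus ::
  "('v::euclidean_space \<Rightarrow> 'v \<Rightarrow> real) \<Rightarrow> 'v \<Rightarrow> 'v \<Rightarrow> 'v cpx \<Rightarrow> 'v set" where
  "v_minus B z \<zeta> Z = orth_compl B (v_plus B z \<zeta> Z)"

definition norm_plus ::
  "('v::euclidean_space \<Rightarrow> 'v \<Rightarrow> real) \<Rightarrow> 'v \<Rightarrow> 'v \<Rightarrow> 'v cpx \<Rightarrow> 'v \<Rightarrow> real" where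
  "norm_plus B z \<zeta> Z x =
     B (orth_proj B (v_plus B z \<zeta> Z) x) (orth_proj B (v_plus B z \<zeta> Z) x)"

definition norm_minus ::
  "('v::euclidean_space \<Rightarrow> 'v \<Rightarrow> real) \<Rightarrow> 'v \<Rightarrow> 'v \<Rightarrow> 'v cpx \<Rightarrow> 'v \<Rightarrow> real" where
  "norm_minus B z \<zeta> Z x =
     B (orth_proj B (v_minus B z \<zeta> Z) x) (orth_proj B (v_minus B z \<zeta> Z) x)"

definition perp_divisor ::
  "('v::euclidean_space \<Rightarrow> 'v \<Rightarrow> real) \<Rightarrow> 'v \<Rightarrow> 'v \<Rightarrow> 'v set \<Rightarrow> 'v \<Rightarrow> 'v cpx set" where
  "perp_divisor B z \<zeta> C x = {Z \<in> K_space B z \<zeta> \<times> C. x \<in> v_minus B z \<zeta> Z}"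

definition theta_L ::
  "('v::euclidean_space \<Rightarrow> 'v \<Rightarrow> real) \<Rightarrow> 'v set \<Rightarrow> 'v \<Rightarrow> 'v \<Rightarrow> nat \<Rightarrow>
   complex \<Rightarrow> 'v cpx \<Rightarrow> 'v set \<Rightarrow> complex" where
  "theta_L B L z \<zeta> m \<tau> Z =
     (\<lambda>c. \<Sum>\<^sub>\<infinity>x\<in>dual_lattice B L.
        cpx_form B (cpx_emb x) (ZV B z \<zeta> Z) ^ m / of_real (B (snd Z) (snd Z)) ^ m *
        ee (\<tau> * of_real (norm_plus B z \<zeta> Z x) / 2 + cnj \<tau> * of_real (norm_minus B z \<zeta> Z x) / 2) *
        basis_vec (lat_coset L x) c)"

definition trunc_domain :: "real \<Rightarrow> complex set" where
  "trunc_domain H = {\<tau> \<in> upper_half. cmod \<tau> \<ge> 1 \<and> \<bar>Re \<tau>\<bar> \<le> 1/2 \<and> Im \<tau> \<le> H}"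

definition lift_integrand ::
  "('v::euclidean_space \<Rightarrow> 'v \<Rightarrow> real) \<Rightarrow> 'v set \<Rightarrow> 'v \<Rightarrow> 'v \<Rightarrow> nat \<Rightarrow> 'v cpx \<Rightarrow>
   (complex \<Rightarrow> 'v set \<Rightarrow> complex) \<Rightarrow> complex \<Rightarrow> complex" where
  "lift_integrand B L z \<zeta> m Z F \<tau> =
     herm_pair B L (F \<tau>) (theta_L B L z \<zeta> m \<tau> Z) * of_real (Im \<tau>) ^ (m + 1) / of_real (Im \<tau>) ^ 2"

definition trunc_lift ::
  "('v::euclidean_space \<Rightarrow> 'v \<Rightarrow> real) \<Rightarrow> 'v set \<Rightarrow> 'v \<Rightarrow> 'v \<Rightarrow> nat \<Rightarrow> 'v cpx \<Rightarrow>
   (complex \<Rightarrow> 'v set \<Rightarrow> complex) \<Rightarrow> real \<Rightarrow> complex" where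
  "trunc_lift B L z \<zeta> m Z F H =
     (LINT \<tau>:trunc_domain H|lborel. lift_integrand B L z \<zeta> m Z F \<tau>)"

text \<open>
  \<open>theta_lift\<close> below is meaningful only under this condition: \<open>Lim\<close> and the Bochner integral
  are total and return arbitrary values otherwise.
\<close>

definition theta_lift_converges ::
  "('v::euclidean_space \<Rightarrow> 'v \<Rightarrow> real) \<Rightarrow> 'v set \<Rightarrow> 'v \<Rightarrow> 'v \<Rightarrow> nat \<Rightarrow> 'v cpx \<Rightarrow>
   (complex \<Rightarrow> 'v set \<Rightarrow> complex) \<Rightarrow> bool" where
  "theta_lift_converges B L z \<zeta> m Z F \<longleftrightarrow>
     (\<forall>H. set_integrable lborel (trunc_domain H) (lift_integrand B L z \<zeta> m Z F)) \<and>
     (\<exists>l. (trunc_lift B L z \<zeta> m Z F \<longlongrightarrow> l) at_top)"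

definition theta_lift ::
  "('v::euclidean_space \<Rightarrow> 'v \<Rightarrow> real) \<Rightarrow> 'v set \<Rightarrow> 'v \<Rightarrow> 'v \<Rightarrow> nat \<Rightarrow> 'v cpx \<Rightarrow>
   (complex \<Rightarrow> 'v set \<Rightarrow> complex) \<Rightarrow> complex" where
  "theta_lift B L z \<zeta> m Z F = Lim at_top (trunc_lift B L z \<zeta> m Z F)"

end

theory Submission
  imports Defs "HOL-Probability.Probability" "HOL-Complex_Analysis.Complex_Analysis"
begin

text \<open>
  Pairing with the theta function turns the Poincare series into the sum of one function \<open>h0\<close> over
  the translates of a point. Summing over cosets and integrating over a fundamental domain amounts to
  integrating \<open>h0\<close> over the strip \<open>|x| < 1/2\<close>; there the \<open>x\<close>-integration keeps only the vectors with
  \<open>\<lambda>\<^sup>2 = 2r\<close>, and the \<open>y\<close>-integration is a Laplace transform of the Whittaker function, which is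
  Gauss's series. As \<open>h0\<close> grows towards \<open>i\<infinity>\<close>, only its restriction to the translates of the unit disc
  is unfolded. The four upper triangular cosets contribute exactly the remaining part of the strip.

  The transformation law of the theta function comes from Poisson summation, proved by adding one
  basis vector at a time with the one-dimensional Jacobi inversion. The indefinite form is reached from
  its majorants by analytic continuation, and the polynomial factor is a Taylor coefficient in an
  auxiliary shift.
\<close>

text \<open>The two definite parts of the majorant carry separate weights, because under
  \<open>S\<close> they become the independent numbers \<open>\<i> / \<tau>\<close> and
  \<open>- \<i> / cnj \<tau>\<close>; each is continued on its own. The shift that generates the
  polynomial runs in the isotropic direction \<open>X + \<i> Y\<close>, where the quadratic term of
  the Gaussian vanishes, so its Taylor coefficient is a pure power of the pairing with
  \<open>Z_V\<close>, without lower terms. No covolume is computed: only the dependence of the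
  Poisson constant on the weights is followed, and the value \<open>1 / sqrt (card DL)\<close> is
  forced by applying \<open>S\<close> twice at its fixed point \<open>\<i>\<close>. Unfolding is
  four to one, since four elements of the metaplectic group act trivially; this cancels the 1/4 of
  the Poincare series. The limit in the height is taken after the \<open>x\<close>-integration,
  because it is for the surviving vectors that the Laplace integrals converge up to infinite height:
  for those, \<open>Z\<close> lying off the divisors means
  \<open>2 * \<bar>r\<bar> < \<bar>nm x\<bar>\<close>, which is also the convergence of Gauss's
  series.\<close>

no_notation Infinite_Set_Sum.abs_summable_on (infix "abs'_summable'_on" 50)
no_notation fps_nth (infixl "$" 75)

section \<open>Infinite sums and integrals\<close>

lemma continuous_on_infsum:
  fixes f :: "'i \<Rightarrow> 'a::topological_space \<Rightarrow> 'b::banach"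
  assumes "\<And>i x. i \<in> A \<Longrightarrow> x \<in> S \<Longrightarrow> norm (f i x) \<le> g i" "g summable_on A"
    and "\<And>i. i \<in> A \<Longrightarrow> continuous_on S (f i)"
  shows "continuous_on S (\<lambda>x. \<Sum>\<^sub>\<infinity>i\<in>A. f i x)"
proof (rule uniform_limit_theorem[OF _ Weierstrass_m_test_general[OF assms(1,2)]])
  show "\<forall>\<^sub>F F in finite_subsets_at_top A. continuous_on S (\<lambda>x. \<Sum>i\<in>F. f i x)"
    by (rule eventually_finite_subsets_at_top_weakI) (auto intro!: continuous_on_sum assms(3))
qed auto

text \<open>Fubini for the product of counting measure on the countable index set with
  \<open>M\<close>: summable \<open>L1\<close> norms make the joint function integrable.
  \<open>infsum\<close> and the Bochner integral both default to 0, so the two agree at every point,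
  also where the family fails to be summable.\<close>

lemma integral_infsum:
  fixes f :: "'i \<Rightarrow> 'a \<Rightarrow> complex"
  assumes A: "countable A" and M: "sigma_finite_measure M"
    and int: "\<And>i. i \<in> A \<Longrightarrow> integrable M (f i)"
    and sum: "(\<lambda>i. LINT x|M. norm (f i x)) summable_on A"
  shows "AE x in M. (\<lambda>i. f i x) abs_summable_on A"
    and "integrable M (\<lambda>x. \<Sum>\<^sub>\<infinity>i\<in>A. f i x)"
    and "(\<lambda>i. LINT x|M. f i x) abs_summable_on A"
    and "(LINT x|M. (\<Sum>\<^sub>\<infinity>i\<in>A. f i x)) = (\<Sum>\<^sub>\<infinity>i\<in>A. LINT x|M. f i x)"
proof -
  interpret M: sigma_finite_measure M by fact
  interpret C: sigma_finite_measure "count_space A"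
    using A by (rule sigma_finite_measure_count_space_countable)
  interpret P: pair_sigma_finite "count_space A" M ..
  have meas: "(\<lambda>(i, x). f i x) \<in> borel_measurable (count_space A \<Otimes>\<^sub>M M)"
    by (rule measurable_pair_measure_countable1) (use A int in auto)
  have eqv: "h abs_summable_on A \<longleftrightarrow> integrable (count_space A) h" for h :: "'i \<Rightarrow> complex"
    by (simp add: abs_summable_equivalent Infinite_Set_Sum.abs_summable_on_def)
  have infs: "infsum h A = (LINT i|count_space A. h i)" for h :: "'i \<Rightarrow> complex"
  proof (cases "h abs_summable_on A")
    case True
    then show ?thesis
      using infsetsum_infsum[of h A] by (simp add: abs_summable_equivalent infsetsum_def)
  next
    case False
    then show ?thesis using eqv[of h]
      by (simp add: infsum_not_exists summable_on_iff_abs_summable_on_complex not_integrable_integral_eq)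
  qed
  have sum': "integrable (count_space A) (\<lambda>i. LINT x|M. norm (f i x))"
  proof -
    have "(\<lambda>i. LINT x|M. norm (f i x)) abs_summable_on A"
      using sum by (simp)
    then show ?thesis
      unfolding abs_summable_equivalent Infinite_Set_Sum.abs_summable_on_def .
  qed
  have I: "integrable (count_space A \<Otimes>\<^sub>M M) (\<lambda>(i, x). f i x)"
  proof (rule P.Fubini_integrable[OF meas])
    show "AE x in count_space A. integrable M (\<lambda>y. case (x, y) of (i, x) \<Rightarrow> f i x)"
      using int by (auto simp: AE_count_space)
  qed (use sum' in auto)
  have 1: "AE x in M. integrable (count_space A) (\<lambda>i. f i x)"
    using P.AE_integrable_snd[OF I] by simp
  then show ae: "AE x in M. (\<lambda>i. f i x) abs_summable_on A" using eqv by simp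
  have J: "integrable M (\<lambda>x. LINT i|count_space A. f i x)"
    using P.integrable_snd[OF I] by simp
  show 3: "(\<lambda>i. LINT x|M. f i x) abs_summable_on A"
    by (rule Infinite_Sum.abs_summable_on_comparison_test'[OF sum]) (simp add: integral_norm_bound)
  show "integrable M (\<lambda>x. \<Sum>\<^sub>\<infinity>i\<in>A. f i x)" using J infs by simp
  have "(LINT x|M. (\<Sum>\<^sub>\<infinity>i\<in>A. f i x)) = (LINT x|M. LINT i|count_space A. f i x)"
    using infs by simp
  also have "\<dots> = (LINT i|count_space A. LINT x|M. f i x)"
    using P.Fubini_integral[OF I] by simp
  also have "\<dots> = (\<Sum>\<^sub>\<infinity>i\<in>A. LINT x|M. f i x)" using infs by simp
  finally show "(LINT x|M. (\<Sum>\<^sub>\<infinity>i\<in>A. f i x)) = (\<Sum>\<^sub>\<infinity>i\<in>A. LINT x|M. f i x)" .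
qed

section \<open>One-dimensional theta inversion\<close>

lemma ee_of_real: "ee (of_real x) = cis (2 * pi * x)"
  by (simp add: ee_def cis_conv_exp mult_ac)

lemma ee_add: "ee (x + y) = ee x * ee y"
  by (simp add: ee_def ring_distribs exp_add)

lemma ee_of_int [simp]: "ee (of_int n) = 1"
  by (simp add: ee_def exp_eq_1 exI[of _ n])

lemma norm_ee: "norm (ee x) = exp (- 2 * pi * Im x)"
  by (simp add: ee_def)

lemma norm_ee_of_real [simp]: "norm (ee (of_real x)) = 1"
  by (simp add: norm_ee)

text \<open>
  The trigonometric polynomials \<open>(1 + cos 2\<pi>x)\<^sup>N\<close> concentrate at \<open>0\<close>, so a continuous periodic
  function orthogonal to all characters vanishes.
\<close>

lemma fourier_uniqueness:
  fixes D :: "real \<Rightarrow> complex"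
  assumes cont: "continuous_on UNIV D"
    and orth: "\<And>a n. integral {a..a+1} (\<lambda>x. D x * ee (of_real (of_int n * x))) = 0"
  shows "D x0 = 0"
proof (rule ccontr)
  assume D0: "D x0 \<noteq> 0"
  define k where "k N x = D x * (1 + of_real (cos (2 * pi * (x - x0)))) ^ N" for N x
  have contee: "continuous_on A (\<lambda>x. ee (of_real (c * x)))" for A c
    unfolding ee_def by (intro continuous_intros)
  have [continuous_intros]: "continuous_on A D" for A using cont continuous_on_subset by blast
  \<comment> \<open>Multiplication by \<open>1 + cos\<close> moves the frequency by 0, 1 and -1, so
    orthogonality to all characters survives each factor.\<close>
  have orthN: "integral {a..a+1} (\<lambda>x. k N x * ee (of_real (of_int n * x))) = 0" for a N and n::int
  proof (induction N arbitrary: n)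
    case 0 then show ?case using orth by (simp add: k_def)
  next
    case (Suc N)
    let ?c = "ee (of_real (- x0)) / 2" and ?d = "ee (of_real x0) / 2"
    have eq: "k (Suc N) x * ee (of_real (of_int n * x)) =
       k N x * ee (of_real (of_int n * x)) + ?c * (k N x * ee (of_real (of_int (n+1) * x)))
         + ?d * (k N x * ee (of_real (of_int (n-1) * x)))" for x
    proof -
      have c: "of_real (cos (2 * pi * (x - x0))) = (ee (of_real (x - x0)) + ee (of_real (x0 - x))) / 2"
        by (simp add: ee_of_real complex_eq_iff cos_diff sin_diff right_diff_distrib del: of_real_diff)
      have e1: "ee (of_real (x - x0)) * ee (of_real (of_int n * x)) = ee (of_real (-x0)) * ee (of_real (of_int (n+1) * x))"
        unfolding ee_add[symmetric] by (rule arg_cong[of _ _ ee]) (simp add: algebra_simps)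
      have e2: "ee (of_real (x0 - x)) * ee (of_real (of_int n * x)) = ee (of_real (x0)) * ee (of_real (of_int (n-1) * x))"
        unfolding ee_add[symmetric] by (rule arg_cong[of _ _ ee]) (simp add: algebra_simps)
      have "k (Suc N) x * ee (of_real (of_int n * x)) = k N x * ee (of_real (of_int n * x)) + 
         k N x * (ee (of_real (x - x0)) * ee (of_real (of_int n * x))) / 2 + k N x * (ee (of_real (x0 - x)) * ee (of_real (of_int n * x))) / 2"
        unfolding k_def c power_Suc by (simp add: field_simps)
      then show ?thesis unfolding e1 e2 by (simp add: mult_ac)
    qed
    have i: "((\<lambda>x. k N x * ee (of_real (of_int m * x))) has_integral 0) {a..a+1}" for m::int
    proof -
      have "(\<lambda>x. k N x * ee (of_real (of_int m * x))) integrable_on {a..a+1}"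
        unfolding k_def by (intro integrable_continuous_interval continuous_intros contee)
      then show ?thesis using Suc[of m] by (metis integrable_integral)
    qed
    have "((\<lambda>x. k (Suc N) x * ee (of_real (of_int n * x))) has_integral 0 + ?c * 0 + ?d * 0) {a..a+1}"
      unfolding eq by (intro has_integral_add has_integral_mult_right i)
    then show ?case by (simp add: integral_unique)
  qed
  \<comment> \<open>Testing against \<open>cnj (D x0)\<close> turns the complex function into a real
    one that is positive at \<open>x0\<close>.\<close>
  define E where "E x = Re (cnj (D x0) * D x)" for x
  have contE: "continuous_on A E" for A unfolding E_def by (intro continuous_intros)
  have "E x0 = (cmod (D x0))\<^sup>2" unfolding E_def cmod_power2 by (simp add: power2_eq_square)
  then have E0: "E x0 > 0" using D0 by simp
  have intE: "integral {x0-1/2..x0+1/2} (\<lambda>x. E x * (1 + cos (2 * pi * (x - x0))) ^ N) = 0" for N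
  proof -
    have i: "(\<lambda>x. k N x) integrable_on {x0-1/2..x0+1/2}"
      unfolding k_def by (intro integrable_continuous_interval continuous_intros)
    have "integral {x0-1/2..x0+1/2} (k N) = 0" using orthN[of "x0-1/2" N 0] by (simp add: ee_def add.commute)
    then have "((k N) has_integral 0) {x0-1/2..x0+1/2}" using i by (metis integrable_integral)
    then have "((\<lambda>x. cnj (D x0) * k N x) has_integral 0) {x0-1/2..x0+1/2}"
      using has_integral_mult_right[of "k N" 0 _ "cnj (D x0)"] by simp
    then have "((Re o (\<lambda>x. cnj (D x0) * k N x)) has_integral Re 0) {x0-1/2..x0+1/2}"
      by (intro has_integral_linear bounded_linear_Re)
    moreover have "Re o (\<lambda>x. cnj (D x0) * k N x) = (\<lambda>x. E x * (1 + cos (2 * pi * (x - x0))) ^ N)"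
    proof
      fix x
      have "(1 + complex_of_real (cos (2 * pi * (x - x0)))) ^ N = of_real ((1 + cos (2 * pi * (x - x0))) ^ N)"
        by simp
      then have eq: "cnj (D x0) * k N x = (cnj (D x0) * D x) * of_real ((1 + cos (2 * pi * (x - x0))) ^ N)"
        unfolding k_def by (simp only: mult.assoc)
      have "Re (w * of_real u) = Re w * u" for w u by simp
      then show "(Re o (\<lambda>x. cnj (D x0) * k N x)) x = E x * (1 + cos (2 * pi * (x - x0))) ^ N"
        unfolding E_def o_def eq .
    qed
    ultimately show ?thesis by (simp add: integral_unique)
  qed
  obtain d0 where d0: "d0 > 0" "\<And>x. \<bar>x - x0\<bar> < d0 \<Longrightarrow> \<bar>E x - E x0\<bar> < E x0 / 2"
    using contE[of UNIV] E0 unfolding continuous_on_iff dist_real_def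
    by (metis UNIV_I half_gt_zero)
  define d where "d = min (d0 / 2) (1/8)"
  have d: "0 < d" "d < d0" "d \<le> 1/8" using d0 by (auto simp: d_def)
  have Ed: "E x \<ge> E x0 / 2" if "\<bar>x - x0\<bar> \<le> d" for x using d0(2)[of x] that d by linarith
  obtain M0 where M0: "\<And>x. x \<in> {x0-1/2..x0+1/2} \<Longrightarrow> norm (E x) \<le> M0"
    using compact_imp_bounded[OF compact_continuous_image[OF contE compact_Icc, of "x0-1/2" "x0+1/2"]]
    unfolding bounded_iff by blast
  define M where "M = max M0 1"
  have M: "\<bar>E x\<bar> \<le> M" "M > 0" if "\<bar>x - x0\<bar> \<le> 1/2" for x
  proof -
    have "x \<in> {x0-1/2..x0+1/2}" using that unfolding atLeastAtMost_iff by linarith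
    from M0[OF this] show "\<bar>E x\<bar> \<le> M" "M > 0" by (auto simp: M_def)
  qed
  \<comment> \<open>\<open>p\<close> bounds the kernel from below for
    \<open>\<bar>x - x0\<bar> \<le> d/2\<close>, and \<open>q\<close> bounds it from above beyond
    distance \<open>d\<close>; the gap between the two radii gives \<open>p > q\<close>. The choice
    \<open>d \<le> 1/8\<close> keeps \<open>q\<close> above 1.\<close>
  define p q where "p = 1 + cos (pi * d)" and "q = 1 + cos (2 * pi * d)"
  have "2*pi*d \<le> 2*pi*(1/8)" using d by (intro mult_left_mono) auto
  moreover have "0 < 2*pi*d" using d by simp
  ultimately have "- (pi/2) < 2*pi*d" "2*pi*d < pi/2" using pi_gt_zero by linarith+
  then have q0: "q > 1" unfolding q_def using cos_gt_zero_pi[of "2*pi*d"] by simp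
  have pq: "p > q" unfolding p_def q_def
    using cos_monotone_0_pi[of "pi*d" "2*pi*d"] d by simp
  have cabs: "cos (2 * pi * (x - x0)) = cos (2 * pi * \<bar>x - x0\<bar>)" for x
    using cos_abs_real[of "2 * pi * (x - x0)"] by (simp add: abs_mult)
  have big: "(1 + cos (2 * pi * (x - x0))) \<ge> p" if "\<bar>x - x0\<bar> \<le> d/2" for x
  proof -
    have "2 * pi * \<bar>x - x0\<bar> \<le> pi * d" using that mult_left_mono[OF that, of "2*pi"] by simp
    moreover have "pi * d \<le> pi" using d by simp
    ultimately show ?thesis unfolding p_def cabs by (simp add: cos_monotone_0_pi_le)
  qed
  have small: "(1 + cos (2 * pi * (x - x0))) \<le> q" if "\<bar>x - x0\<bar> \<ge> d" "\<bar>x - x0\<bar> \<le> 1/2" for x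
  proof -
    have "2 * pi * d \<le> 2 * pi * \<bar>x - x0\<bar>" using that by simp
    moreover have "2 * pi * \<bar>x - x0\<bar> \<le> pi" using that mult_left_mono[OF that(2), of "2*pi"] by simp
    ultimately show ?thesis unfolding q_def cabs using d by (simp add: cos_monotone_0_pi_le)
  qed
  have nn: "0 \<le> 1 + cos t" for t :: real using cos_ge_minus_one[of t] by linarith
  \<comment> \<open>The integral is 0. Its part over the inner interval is at least the left side,
    the part between the two radii is nonnegative, and the part beyond \<open>d\<close> is at least
    minus the right side.\<close>
  have main: "E x0 / 2 * d * p ^ N \<le> M * q ^ N" for N
  proof -
    let ?S = "{x0-1/2..x0+1/2}"
    let ?l = "\<lambda>x. (if x \<in> {x0-d/2..x0+d/2} then E x0 / 2 * p ^ N else 0)"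
    have il: "(?l has_integral (E x0 / 2 * p ^ N * d)) ?S"
    proof -
      have "((\<lambda>x. E x0 / 2 * p ^ N) has_integral (E x0 / 2 * p ^ N * d)) {x0-d/2..x0+d/2}"
        using has_integral_const_real[of "E x0 / 2 * p ^ N" "x0-d/2" "x0+d/2"] d by (simp add: mult_ac)
      moreover have "{x0-d/2..x0+d/2} \<subseteq> ?S" using d by auto
      ultimately show ?thesis by (subst has_integral_restrict) auto
    qed
    have ic: "((\<lambda>x. M * q ^ N) has_integral (M * q ^ N)) ?S"
      using has_integral_const_real[of "M * q ^ N" "x0-1/2" "x0+1/2"] by simp
    have "integral ?S (\<lambda>x. ?l x - M * q ^ N) \<le> integral ?S (\<lambda>x. E x * (1 + cos (2 * pi * (x - x0))) ^ N)"
    proof (rule integral_le)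
      show "(\<lambda>x. ?l x - M * q ^ N) integrable_on ?S"
        by (rule integrable_diff[OF has_integral_integrable[OF il] has_integral_integrable[OF ic]])
      show "(\<lambda>x. E x * (1 + cos (2 * pi * (x - x0))) ^ N) integrable_on ?S"
        by (intro integrable_continuous_interval continuous_intros contE)
      fix x assume "x \<in> ?S"
      then have x: "\<bar>x - x0\<bar> \<le> 1/2" unfolding atLeastAtMost_iff by linarith
      have Mq: "M * q ^ N \<ge> 0" using M(2)[OF x] q0 by simp
      show "?l x - M * q ^ N \<le> E x * (1 + cos (2 * pi * (x - x0))) ^ N"
      proof (cases "\<bar>x - x0\<bar> \<le> d")
        case True
        then have e: "E x \<ge> E x0 / 2" by (rule Ed)
        then have pos: "E x * (1 + cos (2 * pi * (x - x0))) ^ N \<ge> 0"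
          using E0 nn by (intro mult_nonneg_nonneg zero_le_power) auto
        have "E x0 / 2 * p ^ N \<le> E x * (1 + cos (2 * pi * (x - x0))) ^ N" if "\<bar>x - x0\<bar> \<le> d/2"
          using e big[OF that] E0 pq q0 by (intro mult_mono power_mono) auto
        moreover have "\<bar>x - x0\<bar> \<le> d/2" if "x \<in> {x0-d/2..x0+d/2}"
          using that unfolding atLeastAtMost_iff by linarith
        ultimately show ?thesis using pos Mq by (smt (verit))
      next
        case False
        then have "\<bar>E x * (1 + cos (2 * pi * (x - x0))) ^ N\<bar> \<le> M * q ^ N"
          unfolding abs_mult power_abs using small[of x] x M(1)[OF x] M(2)[OF x] nn
          by (intro mult_mono power_mono) auto
        moreover have "x \<notin> {x0-d/2..x0+d/2}" using False d unfolding atLeastAtMost_iff by linarith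
        ultimately show ?thesis by auto
      qed
    qed
    moreover have "integral ?S (\<lambda>x. ?l x - M * q ^ N) = E x0 / 2 * p ^ N * d - M * q ^ N"
      by (rule integral_unique) (intro has_integral_diff il ic)
    ultimately show ?thesis using intE[of N] by (simp add: mult_ac)
  qed
  define c where "c = E x0 / 2 * d"
  have c: "c > 0" using E0 d by (simp add: c_def)
  have pq1: "p / q > 1" using pq q0 by simp
  obtain N where N: "(p / q) ^ N > M / c" using real_arch_pow[OF pq1] by blast
  have "c * p ^ N > M * q ^ N" using N c q0 by (simp add: power_divide field_simps)
  then show False using main[of N] by (simp add: c_def)
qed

lemma summable_on_int_powr:
  fixes p :: real
  assumes "p > 1"
  shows "(\<lambda>n::int. (1 + \<bar>of_int n\<bar>) powr (-p)) summable_on UNIV"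
proof -
  let ?f = "\<lambda>n::int. (1 + \<bar>of_int n\<bar>) powr (-p)"
  have "summable (\<lambda>n. real n powr (-p))" using assms by (simp add: summable_real_powr_iff)
  then have "summable (\<lambda>n. real (Suc n) powr (-p))" by (subst summable_Suc_iff)
  then have s: "(\<lambda>n. real (Suc n) powr (-p)) summable_on UNIV"
    by (intro summable_nonneg_imp_summable_on) auto
  have "?f summable_on range int"
    by (subst summable_on_reindex) (use s in \<open>auto simp: o_def\<close>)
  moreover have "?f summable_on range (\<lambda>n. - int n)"
    by (subst summable_on_reindex) (use s in \<open>auto simp: o_def inj_on_def\<close>)
  ultimately have "?f summable_on (range int \<union> range (\<lambda>n. - int n))"
    by (rule summable_on_union)
  moreover have "range int \<union> range (\<lambda>n. - int n) = UNIV"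
    by (auto simp: image_iff) (metis int_cases2)
  ultimately show ?thesis by simp
qed

lemma summable_on_int_gauss:
  fixes c :: real
  assumes "c > 0"
  shows "(\<lambda>n::int. exp (- c * (of_int n)\<^sup>2)) summable_on UNIV"
proof (rule summable_on_comparison_test)
  let ?C = "2 / min 1 c"
  show "(\<lambda>n::int. ?C * (1 + \<bar>of_int n\<bar>) powr (-2)) summable_on UNIV"
    by (intro summable_on_cmult_right summable_on_int_powr) simp
  fix n :: int
  let ?x = "real_of_int n"
  have "1 + c * ?x\<^sup>2 \<le> exp (c * ?x\<^sup>2)" by (rule exp_ge_add_one_self)
  moreover have "min 1 c * (1 + ?x\<^sup>2) \<le> 1 + c * ?x\<^sup>2"
    using mult_right_mono[of "min 1 c" c "?x\<^sup>2"] by (simp add: distrib_left add_mono)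
  moreover have "min 1 c * ((1 + \<bar>?x\<bar>)\<^sup>2 / 2) \<le> min 1 c * (1 + ?x\<^sup>2)"
  proof -
    have "(1 - \<bar>?x\<bar>)\<^sup>2 \<ge> 0" by simp
    then have "(1 + \<bar>?x\<bar>)\<^sup>2 / 2 \<le> 1 + ?x\<^sup>2" by (simp add: power2_eq_square algebra_simps)
    then show ?thesis using assms by (intro mult_left_mono) auto
  qed
  ultimately have le: "min 1 c * ((1 + \<bar>?x\<bar>)\<^sup>2 / 2) \<le> exp (c * ?x\<^sup>2)" by linarith
  have pos: "min 1 c * ((1 + \<bar>?x\<bar>)\<^sup>2 / 2) > 0" using assms
    by (intro mult_pos_pos divide_pos_pos zero_less_power) (auto simp: add_pos_nonneg)
  have "exp (- c * ?x\<^sup>2) = inverse (exp (c * ?x\<^sup>2))" by (simp add: exp_minus)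
  also have "\<dots> \<le> inverse (min 1 c * ((1 + \<bar>?x\<bar>)\<^sup>2 / 2))"
    using le pos by (rule le_imp_inverse_le)
  also have "\<dots> = ?C * (1 + \<bar>?x\<bar>) powr (-2)"
    by (simp add: powr_minus divide_simps)
  finally show "exp (- c * ?x\<^sup>2) \<le> ?C * (1 + \<bar>?x\<bar>) powr (-2)" .
qed auto

text \<open>After scaling by \<open>c = sqrt (2 * pi * \<alpha>)\<close> the integral is the
  characteristic function of the standard normal distribution.\<close>

lemma gaussian_fourier:
  fixes \<alpha> \<eta> :: real
  assumes \<alpha>: "\<alpha> > 0"
  shows "integrable lborel (\<lambda>x. of_real (exp (- pi * \<alpha> * x\<^sup>2)) * ee (of_real (x * \<eta>)))" (is "integrable _ ?G")
    and "(LINT x|lborel. of_real (exp (- pi * \<alpha> * x\<^sup>2)) * ee (of_real (x * \<eta>))) =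
          of_real (exp (- pi * \<eta>\<^sup>2 / \<alpha>) / sqrt \<alpha>)"
proof -
  define c where "c = sqrt (2 * pi * \<alpha>)"
  have c: "c > 0" and c2: "c\<^sup>2 = 2 * pi * \<alpha>" using \<alpha> by (auto simp: c_def)
  define t where "t = 2 * pi * \<eta> / c"
  interpret real_distribution std_normal_distribution by (rule real_dist_normal_dist)
  let ?f = "\<lambda>u. std_normal_density u *\<^sub>R iexp (t * u)"
  have "integrable std_normal_distribution (\<lambda>u. iexp (t * u))"
    by (rule integrable_iexp) auto
  then have int: "integrable lborel ?f"
    by (subst (asm) integrable_density) auto
  have val: "(LINT u|lborel. ?f u) = of_real (exp (- (t^2) / 2))"
    using fun_cong[OF char_std_normal_distribution, of t] unfolding char_def
    by (subst (asm) integral_density) auto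
  have eq: "?f (0 + c * x) = of_real (1 / sqrt (2*pi)) * ?G x" for x
  proof -
    have 1: "(c * x)\<^sup>2 / 2 = pi * \<alpha> * x\<^sup>2" using c2 by (simp add: power_mult_distrib)
    have 2: "iexp (t * (c * x)) = ee (of_real (x * \<eta>))"
      unfolding ee_def t_def using c by (intro arg_cong[of _ _ exp]) (simp add: field_simps)
    show ?thesis unfolding add_0 2 std_normal_density_def using 1
      by (simp add: scaleR_conv_of_real)
  qed
  have "integrable lborel (\<lambda>x. ?f (0 + c * x))" using int c by (intro lborel_integrable_real_affine) auto
  then have "integrable lborel (\<lambda>x. of_real (1 / sqrt (2*pi)) * ?G x)" unfolding eq .
  then have "integrable lborel (\<lambda>x. of_real (sqrt (2*pi)) * (of_real (1 / sqrt (2*pi)) * ?G x))"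
    by (rule integrable_mult_right)
  moreover have "of_real (sqrt (2*pi)) * (of_real (1 / sqrt (2*pi)) * w) = w" for w :: complex
    by simp
  ultimately show "integrable lborel ?G" by (simp only:)
  have "of_real (exp (- (t^2) / 2)) = c *\<^sub>R (LINT x|lborel. ?f (0 + c * x))"
    using lborel_integral_real_affine[of c ?f 0] c val by simp
  also have "\<dots> = of_real (c / sqrt (2*pi)) * (LINT x|lborel. ?G x)"
    unfolding eq by (simp add: scaleR_conv_of_real)
  also have "c / sqrt (2*pi) = sqrt \<alpha>" by (simp add: c_def real_sqrt_mult)
  finally have "(LINT x|lborel. ?G x) = of_real (exp (- (t^2) / 2) / sqrt \<alpha>)"
    using \<alpha> by (simp add: field_simps)
  also have "t^2 / 2 = pi * \<eta>\<^sup>2 / \<alpha>" unfolding t_def power_divide c2 using \<alpha>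
    by (simp add: field_simps power2_eq_square)
  then have "- (t^2) / 2 = - pi * \<eta>\<^sup>2 / \<alpha>" by simp
  finally show "(LINT x|lborel. ?G x) = of_real (exp (- pi * \<eta>\<^sup>2 / \<alpha>) / sqrt \<alpha>)" .
qed

text \<open>Comes from expanding \<open>(n + 2 * t)\<^sup>2 \<ge> 0\<close>. The bound is uniform
  for \<open>\<bar>t\<bar> \<le> r\<close>, which is the form that the M-test asks for.\<close>

lemma theta_bound:
  fixes a t r :: real
  assumes "\<bar>t\<bar> \<le> r" "a > 0"
  shows "exp (- a * (n + t)\<^sup>2) \<le> exp (a * r\<^sup>2) * exp (- (a/2) * n\<^sup>2)"
proof -
  have "t\<^sup>2 \<le> r\<^sup>2" using assms by (metis abs_ge_zero power2_abs power_mono)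
  moreover have "0 \<le> (n + 2 * t)\<^sup>2" by simp
  then have "n\<^sup>2 / 2 - t\<^sup>2 \<le> (n + t)\<^sup>2" by (simp add: power2_eq_square algebra_simps)
  ultimately have "n\<^sup>2 / 2 - r\<^sup>2 \<le> (n + t)\<^sup>2" by linarith
  from mult_left_mono[OF this, of a] show ?thesis using assms(2)
    by (simp add: exp_add[symmetric] algebra_simps)
qed

text \<open>The line is tiled by the integer translates of a half-open interval, exactly one of
  which contains a given point; the closed interval differs from it by the null set
  \<open>{a+1}\<close>.\<close>

lemma integral_unfold_int:
  fixes H :: "real \<Rightarrow> complex" and g :: "int \<Rightarrow> real"
  assumes H: "integrable lborel H" and cont: "continuous_on UNIV H"
    and bound: "\<And>n x. x \<in> {a..a+1} \<Longrightarrow> norm (H (of_int n + x)) \<le> g n" and g: "g summable_on UNIV"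
  shows "integral {a..a+1} (\<lambda>x. \<Sum>\<^sub>\<infinity>n::int. H (of_int n + x)) = (LINT x|lborel. H x)"
proof -
  have [measurable]: "H \<in> borel_measurable borel" using cont by (rule borel_measurable_continuous_onI)
  define f where "f n x = indicator {a..<a+1} x *\<^sub>R H (of_int n + x)" for n :: int and x
  define f' where "f' n x = indicator {a + of_int n..<a+1 + of_int n} x *\<^sub>R H x" for n :: int and x
  have fi: "integrable lborel (f' n)" for n unfolding f'_def
    using H by (intro integrable_mult_indicator) auto
  have ff: "f' n (of_int n + 1 * x) = f n x" for n x unfolding f_def f'_def by (auto simp: indicator_def add_ac)
  have fi2: "integrable lborel (f n)" for n
    using lborel_integrable_real_affine[OF fi, of 1 n "of_int n"] unfolding ff by simp
  have feq: "(LINT x|lborel. f' n x) = (LINT x|lborel. f n x)" for n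
    using lborel_integral_real_affine[of 1 "f' n" "of_int n"] unfolding ff by simp
  have fneq: "(LINT x|lborel. norm (f' n x)) = (LINT x|lborel. norm (f n x))" for n
    using lborel_integral_real_affine[of 1 "\<lambda>x. norm (f' n x)" "of_int n"] unfolding ff by simp
  have fs: "(\<lambda>n. LINT x|lborel. norm (f n x)) summable_on UNIV"
  proof (rule summable_on_comparison_test[OF g])
    fix n
    have "(LINT x|lborel. norm (f n x)) \<le> (LINT x|lborel. indicator {a..<a+1} x *\<^sub>R g n)"
    proof (rule integral_mono)
      show "integrable lborel (\<lambda>x. indicator {a..<a+1} x *\<^sub>R g n)"
        by (intro integrable_scaleR_left) simp
      show "norm (f n x) \<le> indicator {a..<a+1} x *\<^sub>R g n" for x
        using bound[of x n] by (auto simp: f_def indicator_def)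
    qed (use fi2 in auto)
    also have "\<dots> = g n" by simp
    finally show "(LINT x|lborel. norm (f n x)) \<le> g n" .
  qed auto
  have one: "(\<Sum>\<^sub>\<infinity>n. f' n x) = H x" for x
  proof -
    have "(\<Sum>\<^sub>\<infinity>n. f' n x) = (\<Sum>\<^sub>\<infinity>n\<in>{\<lfloor>x - a\<rfloor>}. f' n x)"
    proof (rule infsum_cong_neutral)
      fix n assume "n \<in> UNIV - {\<lfloor>x - a\<rfloor>}"
      then have "x \<notin> {a + of_int n..<a+1 + of_int n}" by (auto, linarith)
      then show "f' n x = 0" by (simp add: f'_def)
    qed auto
    also have "\<dots> = H x"
    proof -
      have "x \<in> {a + of_int \<lfloor>x - a\<rfloor>..<a+1 + of_int \<lfloor>x - a\<rfloor>}"
        using floor_correct[of "x - a"] unfolding atLeastLessThan_iff by linarith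
      then show ?thesis unfolding f'_def by simp
    qed
    finally show ?thesis .
  qed
  have cu: "countable (UNIV :: int set)" by simp
  note I1 = integral_infsum[OF cu lborel.sigma_finite_measure_axioms fi fs[folded fneq]]
  note I2 = integral_infsum[OF cu lborel.sigma_finite_measure_axioms fi2 fs]
  have "(LINT x|lborel. H x) = (\<Sum>\<^sub>\<infinity>n. LINT x|lborel. f' n x)" using I1(4) unfolding one .
  also have "\<dots> = (LINT x|lborel. (\<Sum>\<^sub>\<infinity>n. f n x))" unfolding feq using I2(4) by simp
  also have "\<dots> = (LINT x:{a..a+1}|lborel. (\<Sum>\<^sub>\<infinity>n. H (of_int n + x)))"
    unfolding set_lebesgue_integral_def
  proof (rule integral_cong_AE)
    let ?P = "\<lambda>x. \<Sum>\<^sub>\<infinity>n. H (of_int n + x)"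
    have *: "(\<Sum>\<^sub>\<infinity>n. f n x) = indicator {a..<a+1} x *\<^sub>R ?P x" for x
      by (auto simp: f_def indicator_def)
    have cP: "continuous_on {a..a+1} ?P"
      by (rule continuous_on_infsum[OF _ g])
         (use bound cont in \<open>auto intro!: continuous_on_compose2[OF cont] continuous_intros\<close>)
    show "(\<lambda>x. \<Sum>\<^sub>\<infinity>n. f n x) \<in> borel_measurable lborel" using I2(2) by auto
    show "(\<lambda>x. indicator {a..a+1} x *\<^sub>R ?P x) \<in> borel_measurable lborel"
      using borel_measurable_continuous_on_indicator[OF _ cP] by simp
    show "AE x in lborel. (\<Sum>\<^sub>\<infinity>n. f n x) = indicator {a..a+1} x *\<^sub>R ?P x"
      using AE_lborel_singleton[of "a+1"]
      by eventually_elim (auto simp: * indicator_def)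
  qed
  also have "\<dots> = integral {a..a+1} (\<lambda>x. \<Sum>\<^sub>\<infinity>n. H (of_int n + x))"
  proof (rule set_borel_integral_eq_integral(2))
    show "set_integrable lborel {a..a+1} (\<lambda>x. \<Sum>\<^sub>\<infinity>n. H (of_int n + x))"
      by (rule borel_integrable_atLeastAtMost')
         (auto intro!: continuous_on_infsum[OF _ g] bound continuous_on_compose2[OF cont] continuous_intros)
  qed
  finally show ?thesis ..
qed

lemma integral_character:
  "integral {a..a+1} (\<lambda>x. ee (of_real (of_int n * x))) = (if n = 0 then 1 else 0)"
proof (cases "n = 0")
  case True then show ?thesis by (simp add: ee_def)
next
  case False
  let ?F = "\<lambda>x. ee (of_real (of_int n * x)) / (2 * pi * \<i> * of_int n)"
  have "((\<lambda>x. ee (of_real (of_int n * x))) has_integral (?F (a+1) - ?F a)) {a..a+1}"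
  proof (rule fundamental_theorem_of_calculus)
    fix x
    have "((\<lambda>z. exp (2 * pi * \<i> * (of_int n * z)) / (2 * pi * \<i> * of_int n)) has_field_derivative
       exp (2 * pi * \<i> * (of_int n * of_real x))) (at (of_real x))"
      by (rule derivative_eq_intros refl | use False in \<open>simp\<close>)+
    from has_vector_derivative_real_field[OF this]
    show "(?F has_vector_derivative ee (of_real (of_int n * x))) (at x within {a..a+1})"
      by (simp add: ee_def)
  qed auto
  moreover have "?F (a+1) = ?F a"
    using ee_add[of "of_real (of_int n * a)" "of_int n"] by (simp add: algebra_simps)
  ultimately show ?thesis using False by (simp add: integral_unique)
qed

text \<open>Both sides are continuous in \<open>t\<close>, and against every integer character their
  integrals over a unit interval agree: on the left, unfolding gives a Gaussian Fourier transform at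
  \<open>\<theta> + k\<close>; on the right, termwise integration picks out \<open>n = -k\<close>.
  \<open>fourier_uniqueness\<close> then applies to the difference.\<close>

lemma jacobi_theta_inversion:
  fixes \<alpha> \<theta> t :: real
  assumes \<alpha>: "\<alpha> > 0"
  shows "(\<Sum>\<^sub>\<infinity>n::int. of_real (exp (- pi * \<alpha> * (of_int n + t)\<^sup>2)) * ee (of_real ((of_int n + t) * \<theta>))) =
    (\<Sum>\<^sub>\<infinity>n::int. of_real (exp (- pi * (of_int n - \<theta>)\<^sup>2 / \<alpha>) / sqrt \<alpha>) * ee (of_real (of_int n * t)))"
proof -
  define G where "G x = of_real (exp (- pi * \<alpha> * x\<^sup>2)) * ee (of_real (x * \<theta>))" for x :: real
  define c where "c n = exp (- pi * (of_int n - \<theta>)\<^sup>2 / \<alpha>) / sqrt \<alpha>" for n :: int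
  define P where "P x = (\<Sum>\<^sub>\<infinity>n::int. G (of_int n + x))" for x
  define R where "R x = (\<Sum>\<^sub>\<infinity>n::int. of_real (c n) * ee (of_real (of_int n * x)))" for x
  have contee: "continuous_on A (\<lambda>x. ee (of_real (c * x)))" for A c
    unfolding ee_def by (intro continuous_intros)
  have Gc: "continuous_on A G" for A
    unfolding G_def ee_def by (intro continuous_intros)
  define g where "g r n = exp (pi * \<alpha> * r\<^sup>2) * exp (- (pi * \<alpha>/2) * (of_int n)\<^sup>2)" for r :: real and n :: int
  have g: "g r summable_on UNIV" for r unfolding g_def
    by (intro summable_on_cmult_right summable_on_int_gauss) (use \<alpha> in auto)
  have Gb: "norm (G (of_int n + x)) \<le> g r n" if "\<bar>x\<bar> \<le> r" for n x r
    using theta_bound[OF that, of "pi * \<alpha>" "of_int n"] \<alpha> unfolding G_def g_def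
    by (simp add: norm_mult del: of_real_mult of_real_add)
  have Pc: "continuous_on {-r..r} P" for r unfolding P_def
    by (rule continuous_on_infsum[OF _ g[of r]])
       (auto intro!: Gb continuous_on_compose2[OF Gc] continuous_intros simp: abs_le_iff)
  have Pc': "continuous_on UNIV P"
  proof (rule continuous_at_imp_continuous_on, rule ballI)
    fix x :: real
    have "x \<in> interior {-(\<bar>x\<bar>+1)..\<bar>x\<bar>+1}" by (auto simp: interior_atLeastAtMost_real)
    then show "isCont P x" using Pc[of "\<bar>x\<bar>+1"] by (rule continuous_on_interior[rotated])
  qed
  have cs: "c summable_on UNIV"
  proof -
    have "(\<lambda>n. exp (pi / \<alpha> * \<bar>\<theta>\<bar>\<^sup>2) * exp (- (pi / \<alpha> / 2) * (of_int n)\<^sup>2) * (1 / sqrt \<alpha>)) summable_on UNIV"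
      by (intro summable_on_cmult_left summable_on_cmult_right summable_on_int_gauss) (use \<alpha> in auto)
    then show ?thesis
    proof (rule summable_on_comparison_test)
      fix n :: int
      show "c n \<le> exp (pi / \<alpha> * \<bar>\<theta>\<bar>\<^sup>2) * exp (- (pi / \<alpha> / 2) * (of_int n)\<^sup>2) * (1 / sqrt \<alpha>)"
        using theta_bound[of "-\<theta>" "\<bar>\<theta>\<bar>" "pi / \<alpha>" "of_int n"] \<alpha>
        unfolding c_def by (simp add: divide_right_mono)
    qed (use \<alpha> in \<open>auto simp: c_def\<close>)
  qed
  have cpos: "c n \<ge> 0" for n using \<alpha> by (simp add: c_def)
  have Rc: "continuous_on A R" for A unfolding R_def
    by (rule continuous_on_infsum[OF _ cs])
       (use cpos in \<open>auto simp: norm_mult simp del: of_real_mult intro!: continuous_intros contee\<close>)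
  have "P x0 - R x0 = 0" for x0
  proof (rule fourier_uniqueness)
    show "continuous_on UNIV (\<lambda>x. P x - R x)" by (intro continuous_intros Pc' Rc)
    fix a :: real and k :: int
    let ?e = "\<lambda>x. ee (of_real (of_int k * x))"
    let ?H = "\<lambda>x. of_real (exp (- pi * \<alpha> * x\<^sup>2)) * ee (of_real (x * (\<theta> + of_int k)))"
    have PH: "P x * ?e x = (\<Sum>\<^sub>\<infinity>n. ?H (of_int n + x))" for x
    proof -
      have "G (of_int n + x) * ?e x = ?H (of_int n + x)" for n
      proof -
        \<comment> \<open>The extra factor \<open>ee (of_int (n * k))\<close> is 1, so the character
          of \<open>x\<close> extends to one of \<open>n + x\<close>.\<close>
        have "ee (of_real ((of_int n + x) * (\<theta> + of_int k))) = 
          ee (of_real ((of_int n + x) * \<theta>)) * (?e x * ee (of_int (n * k)))"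
          unfolding ee_add[symmetric] by (rule arg_cong[of _ _ ee]) (simp add: algebra_simps)
        then show ?thesis unfolding G_def ee_of_int by (simp only: mult.assoc mult_1_right)
      qed
      then show ?thesis unfolding P_def by (simp add: infsum_cmult_left'[symmetric])
    qed
    have iP: "integral {a..a+1} (\<lambda>x. P x * ?e x) = of_real (c (-k))"
    proof -
      have "integral {a..a+1} (\<lambda>x. P x * ?e x) = (LINT x|lborel. ?H x)"
        unfolding PH
      proof (rule integral_unfold_int[OF gaussian_fourier(1)[OF \<alpha>] _ _ g[of "\<bar>a\<bar>+1"]])
        show "continuous_on UNIV ?H" unfolding ee_def by (intro continuous_intros)
        show "norm (?H (of_int n + x)) \<le> g (\<bar>a\<bar>+1) n" if "x \<in> {a..a+1}" for x n
        proof -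
          have "\<bar>x\<bar> \<le> \<bar>a\<bar>+1" using that by auto
          from theta_bound[OF this, of "pi * \<alpha>" "of_int n"] show ?thesis using \<alpha> unfolding g_def
            by (simp only: norm_mult norm_ee_of_real norm_of_real) simp
        qed
      qed
      also have "\<dots> = of_real (c (-k))" unfolding gaussian_fourier(2)[OF \<alpha>] c_def
        by (simp add: power2_commute power2_eq_square algebra_simps)
      finally show ?thesis .
    qed
    have iR: "integral {a..a+1} (\<lambda>x. R x * ?e x) = of_real (c (-k))"
    proof -
      define f where "f n x = indicator {a..a+1} x *\<^sub>R (of_real (c n) * ee (of_real (of_int (n + k) * x)))" for n x
      have RF: "(\<Sum>\<^sub>\<infinity>n. f n x) = indicator {a..a+1} x *\<^sub>R (R x * ?e x)" for x
      proof -
        have "ee (of_real (of_int (n + k) * x)) = ee (of_real (of_int n * x)) * ?e x" for n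
          unfolding ee_add[symmetric] by (rule arg_cong[of _ _ ee]) (simp add: algebra_simps)
        then show ?thesis unfolding f_def R_def
          by (simp add: infsum_cmult_left'[symmetric] infsum_scaleR_right mult.assoc)
      qed
      have fint: "set_integrable lborel {a..a+1} (\<lambda>x. of_real (c n) * ee (of_real (of_int (n + k) * x)))" for n
        by (rule borel_integrable_atLeastAtMost') (intro continuous_intros contee)+
      have ci: "integrable lborel (f n)" for n
        using fint unfolding f_def set_integrable_def .
      have nf: "(LINT x|lborel. norm (f n x)) = c n" for n
      proof -
        have "norm (f n x) = indicator {a..a+1} x *\<^sub>R c n" for x
          using cpos[of n] by (simp add: f_def norm_mult del: of_real_mult of_int_add)
        then show ?thesis by simp
      qed
      have vf: "(LINT x|lborel. f n x) = of_real (c n) * (if n = -k then 1 else 0)" for n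
      proof -
        have "(LINT x|lborel. f n x) = integral {a..a+1} (\<lambda>x. of_real (c n) * ee (of_real (of_int (n + k) * x)))"
          using set_borel_integral_eq_integral(2)[OF fint[of n]] unfolding f_def set_lebesgue_integral_def .
        also have "\<dots> = of_real (c n) * (if n + k = 0 then 1 else 0)"
          by (simp add: integral_character del: of_real_mult of_int_add)
        finally show ?thesis by (simp add: eq_neg_iff_add_eq_0)
      qed
      have cu: "countable (UNIV :: int set)" by simp
      note I = integral_infsum[OF cu lborel.sigma_finite_measure_axioms ci, unfolded nf, OF cs]
      have "integral {a..a+1} (\<lambda>x. R x * ?e x) = (LINT x|lborel. indicator {a..a+1} x *\<^sub>R (R x * ?e x))"
        using set_borel_integral_eq_integral(2)[of "{a..a+1}" "\<lambda>x. R x * ?e x"] I(2)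
        unfolding RF set_integrable_def set_lebesgue_integral_def by simp
      also have "\<dots> = (\<Sum>\<^sub>\<infinity>n. of_real (c n) * (if n = -k then 1 else 0))"
        using I(4) unfolding RF vf .
      also have "\<dots> = (\<Sum>\<^sub>\<infinity>n\<in>{-k}. of_real (c n) * (if n = -k then 1 else 0))"
        by (rule infsum_cong_neutral) auto
      finally show ?thesis by simp
    qed
    have "integral {a..a+1} (\<lambda>x. (P x - R x) * ?e x) = integral {a..a+1} (\<lambda>x. P x * ?e x) - integral {a..a+1} (\<lambda>x. R x * ?e x)"
      unfolding left_diff_distrib
      by (intro integral_diff integrable_continuous_interval continuous_intros contee Rc continuous_on_subset[OF Pc']) auto
    then show "integral {a..a+1} (\<lambda>x. (P x - R x) * ?e x) = 0" using iP iR by simp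
  qed
  then have "P t = R t" by simp
  then show ?thesis unfolding P_def R_def G_def c_def .
qed

section \<open>Poisson summation for positive definite forms\<close>

lemma summable_on_TimesI:
  fixes f :: "'a \<times> 'b \<Rightarrow> real"
  assumes "\<And>x. x \<in> A \<Longrightarrow> (\<lambda>y. f (x, y)) summable_on B"
    and "\<And>x. x \<in> A \<Longrightarrow> (\<Sum>\<^sub>\<infinity>y\<in>B. f (x, y)) \<le> G x" and "G summable_on A"
    and nn: "\<And>x y. x \<in> A \<Longrightarrow> y \<in> B \<Longrightarrow> f (x, y) \<ge> 0"
  shows "f summable_on A \<times> B"
proof (rule summable_on_SigmaI)
  show "((\<lambda>y. f (x, y)) has_sum (\<Sum>\<^sub>\<infinity>y\<in>B. f (x, y))) B" if "x \<in> A" for x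
    using assms(1)[OF that] by simp
  show "(\<lambda>x. \<Sum>\<^sub>\<infinity>y\<in>B. f (x, y)) summable_on A"
    by (rule summable_on_comparison_test[OF assms(3)]) (auto intro!: assms(2) infsum_nonneg nn)
qed (use nn in auto)

lemma infsum_of_real_summable:
  "f summable_on A \<Longrightarrow> (\<Sum>\<^sub>\<infinity>x\<in>A. complex_of_real (f x)) = of_real (infsum f A)"
  by (intro infsumI has_sum_of_real has_sum_infsum)

lemma abs_eq_norm_of_real: "complex_of_real a = w \<Longrightarrow> \<bar>a\<bar> = norm w"
  by (auto simp: norm_of_real)

section \<open>Integer spans, dual sets and the Poisson property\<close>

definition zspan :: "'v::real_vector set \<Rightarrow> 'v set" where
  "zspan S = {(\<Sum>v\<in>S. of_int (c v) *\<^sub>R v) | c :: 'v \<Rightarrow> int. True}"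

lemma zspan_empty [simp]: "zspan {} = {0}"
  by (simp add: zspan_def)

lemma zspan_subset_span: "zspan S \<subseteq> span S"
  unfolding zspan_def by (clarify, intro span_sum span_scale span_base)

lemma zspan_zero: "0 \<in> zspan S"
  unfolding zspan_def by (rule CollectI, rule exI[of _ "\<lambda>_. 0"]) simp

lemma zspan_add: "x \<in> zspan S \<Longrightarrow> y \<in> zspan S \<Longrightarrow> x + y \<in> zspan S"
  unfolding zspan_def
proof safe
  fix c c' :: "'a \<Rightarrow> int"
  show "\<exists>ca. (\<Sum>v\<in>S. real_of_int (c v) *\<^sub>R v) + (\<Sum>v\<in>S. real_of_int (c' v) *\<^sub>R v) = (\<Sum>v\<in>S. real_of_int (ca v) *\<^sub>R v) \<and> True"
    by (rule exI[of _ "\<lambda>v. c v + c' v"]) (simp add: scaleR_left_distrib sum.distrib)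
qed

lemma zspan_uminus: "x \<in> zspan S \<Longrightarrow> - x \<in> zspan S"
  unfolding zspan_def
proof safe
  fix c :: "'a \<Rightarrow> int"
  show "\<exists>ca. - (\<Sum>v\<in>S. real_of_int (c v) *\<^sub>R v) = (\<Sum>v\<in>S. real_of_int (ca v) *\<^sub>R v) \<and> True"
    by (rule exI[of _ "\<lambda>v. - c v"]) (simp add: sum_negf)
qed

lemma zspan_insert_bij:
  assumes "finite C" "b \<notin> span C"
  shows "bij_betw (\<lambda>(n::int, x). x + of_int n *\<^sub>R b) (UNIV \<times> zspan C) (zspan (insert b C))"
  unfolding bij_betw_def
proof
  have bC: "b \<notin> C" using assms span_base by blast
  show "inj_on (\<lambda>(n::int, x). x + of_int n *\<^sub>R b) (UNIV \<times> zspan C)"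
  proof (rule inj_onI, clarify)
    fix n n' :: int and x x' assume x: "x \<in> zspan C" "x' \<in> zspan C" and eq: "x + of_int n *\<^sub>R b = x' + of_int n' *\<^sub>R b"
    have "x' - x = (of_int n - of_int n') *\<^sub>R b" using eq by (simp add: algebra_simps)
    moreover have "x' - x \<in> span C" using x zspan_subset_span by (meson span_diff subsetD)
    ultimately have *: "(real_of_int n - of_int n') *\<^sub>R b \<in> span C" by simp
    have "n = n'"
    proof (rule ccontr)
      assume "n \<noteq> n'"
      then have "b \<in> span C" using span_scale[OF *, of "1 / (of_int n - of_int n')"] by simp
      then show False using assms by simp
    qed
    then show "n = n' \<and> x = x'" using eq by simp
  qed
  show "(\<lambda>(n::int, x). x + of_int n *\<^sub>R b) ` (UNIV \<times> zspan C) = zspan (insert b C)"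
  proof (intro equalityI subsetI)
    fix y assume "y \<in> (\<lambda>(n::int, x). x + of_int n *\<^sub>R b) ` (UNIV \<times> zspan C)"
    then obtain n :: int and c :: "'a \<Rightarrow> int" where y: "y = (\<Sum>v\<in>C. of_int (c v) *\<^sub>R v) + of_int n *\<^sub>R b"
      by (auto simp: zspan_def)
    have "y = (\<Sum>v\<in>insert b C. of_int ((c(b := n)) v) *\<^sub>R v)"
      unfolding y using assms bC by (simp add: add.commute) (auto intro!: sum.cong)
    then show "y \<in> zspan (insert b C)" unfolding zspan_def by blast
  next
    fix y assume "y \<in> zspan (insert b C)"
    then obtain c :: "'a \<Rightarrow> int" where "y = (\<Sum>v\<in>insert b C. of_int (c v) *\<^sub>R v)" by (auto simp: zspan_def)
    then have "y = (\<Sum>v\<in>C. of_int (c v) *\<^sub>R v) + of_int (c b) *\<^sub>R b" using assms bC by simp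
    then show "y \<in> (\<lambda>(n::int, x). x + of_int n *\<^sub>R b) ` (UNIV \<times> zspan C)"
      by (auto simp: zspan_def image_iff)
  qed
qed

text \<open>The dual is taken inside \<open>span S\<close>, so that it makes sense for the partial
  bases met when vectors are added one at a time.\<close>

definition form_dual :: "('v::real_vector \<Rightarrow> 'v \<Rightarrow> real) \<Rightarrow> 'v set \<Rightarrow> 'v set" where
  "form_dual h S = {\<mu> \<in> span S. \<forall>b\<in>S. h \<mu> b \<in> \<int>}"

text \<open>For independent \<open>S\<close>, \<open>\<kappa>\<close> is the reciprocal covolume of
  \<open>zspan S\<close> with respect to \<open>h\<close>, left as a parameter. Summability on both
  sides belongs to the predicate because the step to a larger basis has to interchange sums.\<close>

definition poisson :: "('v::real_vector \<Rightarrow> 'v \<Rightarrow> real) \<Rightarrow> 'v set \<Rightarrow> real \<Rightarrow> bool" where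
  "poisson h S \<kappa> \<longleftrightarrow> \<kappa> > 0 \<and>
    (\<forall>v\<in>span S. (\<lambda>x. exp (- pi * h (x + v) (x + v))) summable_on zspan S) \<and>
    (\<lambda>\<mu>. exp (- pi * h \<mu> \<mu>)) summable_on form_dual h S \<and>
    (\<forall>v\<in>span S. (\<Sum>\<^sub>\<infinity>x\<in>zspan S. complex_of_real (exp (- pi * h (x + v) (x + v)))) =
       of_real \<kappa> * (\<Sum>\<^sub>\<infinity>\<mu>\<in>form_dual h S. of_real (exp (- pi * h \<mu> \<mu>)) * ee (of_real (h \<mu> v))))"

locale pos_form =
  fixes h :: "'v::euclidean_space \<Rightarrow> 'v \<Rightarrow> real"
  assumes bil: "bilinear h" and sym: "h x y = h y x" and pos: "x \<noteq> 0 \<Longrightarrow> h x x > 0"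
begin

lemmas h_simps = bilinear_ladd[OF bil] bilinear_radd[OF bil] bilinear_lsub[OF bil] bilinear_rsub[OF bil]
  bilinear_lmul[OF bil] bilinear_rmul[OF bil] bilinear_lneg[OF bil] bilinear_rneg[OF bil]
  bilinear_lzero[OF bil] bilinear_rzero[OF bil]

lemma nonneg: "h x x \<ge> 0"
  using pos[of x] by (cases "x = 0") (auto simp: h_simps)

lemma span_orth: "x \<in> span S \<Longrightarrow> (\<And>c. c \<in> S \<Longrightarrow> h y c = 0) \<Longrightarrow> h y x = 0"
  by (induction rule: span_induct_alt) (auto simp: h_simps)

lemma h_sum_right: "h y (\<Sum>e\<in>E. f e) = (\<Sum>e\<in>E. h y (f e))"
  by (induction E rule: infinite_finite_induct) (auto simp: h_simps)

lemma orth_projection: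
  assumes "finite E" "0 \<notin> E" "\<And>e f. e \<in> E \<Longrightarrow> f \<in> E \<Longrightarrow> e \<noteq> f \<Longrightarrow> h e f = 0"
  shows "\<exists>p\<in>span E. \<forall>c\<in>span E. h (b - p) c = 0"
proof
  let ?p = "\<Sum>e\<in>E. (h b e / h e e) *\<^sub>R e"
  show "?p \<in> span E" by (intro span_sum span_scale span_base)
  show "\<forall>c\<in>span E. h (b - ?p) c = 0"
  proof
    fix c assume "c \<in> span E"
    then show "h (b - ?p) c = 0"
    proof (rule span_orth)
      fix f assume f: "f \<in> E"
      have "h f ?p = (\<Sum>e\<in>E. (h b e / h e e) * h f e)" by (simp add: h_sum_right h_simps)
      also have "\<dots> = (\<Sum>e\<in>{f}. (h b e / h e e) * h f e)"
        using assms f by (intro sum.mono_neutral_right) auto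
      also have "\<dots> = h b f" using pos[of f] f assms(2) by force
      finally show "h (b - ?p) f = 0" by (simp add: h_simps sym[of _ f])
    qed
  qed
qed

text \<open>Gram-Schmidt for \<open>h\<close>. A zero remainder is dropped, so the process also
  handles dependent sets such as the images of a lattice basis under
  \<open>x - pr x\<close>.\<close>

lemma orth_basis:
  assumes "finite S"
  shows "\<exists>E. finite E \<and> 0 \<notin> E \<and> (\<forall>e\<in>E. \<forall>f\<in>E. e \<noteq> f \<longrightarrow> h e f = 0) \<and> span E = span S"
  using assms
proof induction
  case empty
  then show ?case by (intro exI[of _ "{}"]) auto
next
  case (insert a S)
  then obtain E where E: "finite E" "0 \<notin> E" "\<forall>e\<in>E. \<forall>f\<in>E. e \<noteq> f \<longrightarrow> h e f = 0" "span E = span S" by blast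
  obtain p where p: "p \<in> span E" "\<And>c. c \<in> span E \<Longrightarrow> h (a - p) c = 0"
    using orth_projection[of E a] E by blast
  have sp: "span (insert (a - p) E) = span (insert a S)"
  proof -
    have "span (insert (a - p) E) = span (insert a E)"
      unfolding span_eq
    proof (intro conjI subsetI)
      have pe: "p \<in> span (insert x E)" for x using p(1) span_mono[of E "insert x E"] by auto
      fix x
      {
        assume "x \<in> insert (a - p) E"
        then show "x \<in> span (insert a E)" using span_diff[OF span_base[of a "insert a E"] pe[of a]] span_base[of x "insert a E"] by auto
      }
      assume "x \<in> insert a E"
      moreover have "a \<in> span (insert (a - p) E)"
        using span_add[OF span_base[of "a - p" "insert (a - p) E"] pe[of "a - p"]] by simp
      ultimately show "x \<in> span (insert (a - p) E)" using span_base[of x "insert (a - p) E"] by auto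
    qed
    then show ?thesis using E(4) by (metis span_insert)
  qed
  show ?case
  proof (cases "a - p = 0")
    case True
    then have "span (insert (a - p) E) = span E" by (simp add: span_insert_0)
    then show ?thesis using sp E by metis
  next
    case False
    have 1: "h (a - p) c = 0" "h c (a - p) = 0" if "c \<in> E" for c
      using p(2)[OF span_base[OF that]] sym[of c "a - p"] by auto
    have "\<forall>e\<in>insert (a - p) E. \<forall>f\<in>insert (a - p) E. e \<noteq> f \<longrightarrow> h e f = 0"
      using E(3) 1 by blast
    then show ?thesis using sp E(1,2) False
      by (intro exI[of _ "insert (a - p) E"]) simp
  qed
qed

lemma projection:
  assumes "finite S"
  shows "\<exists>p\<in>span S. \<forall>c\<in>span S. h (b - p) c = 0"
  using orth_basis[OF assms] orth_projection[of _ b] by metis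

text \<open>A dual vector is fixed by its projection \<open>\<mu>\<close> to \<open>span C\<close>
  and by the integer \<open>\<xi>\<close> it pairs to with \<open>b\<close>; the coefficient of
  \<open>b - p\<close> is solved from that pairing.\<close>

lemma form_dual_insert_bij:
  assumes p: "p \<in> span C" "\<And>c. c \<in> span C \<Longrightarrow> h (b - p) c = 0" and b: "b \<notin> span C"
  shows "bij_betw (\<lambda>(\<mu>, \<xi>::int). \<mu> + ((of_int \<xi> - h \<mu> b) / h (b - p) (b - p)) *\<^sub>R (b - p))
    (form_dual h C \<times> UNIV) (form_dual h (insert b C))" (is "bij_betw ?F _ _")
  unfolding bij_betw_def
proof
  let ?d = "b - p" and ?B = "h (b - p) (b - p)"
  have d0: "?d \<noteq> 0" using p(1) b by auto
  have B: "?B > 0" using d0 by (rule pos)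
  have hdb: "h ?d b = ?B" using p(2)[OF p(1)] by (simp add: h_simps)
  have Fb: "h (?F (\<mu>, \<xi>)) b = of_int \<xi>" if "\<mu> \<in> span C" for \<mu> \<xi>
    using B that by (simp add: h_simps(1) h_simps(5) hdb)
  have Fc: "h (?F (\<mu>, \<xi>)) c = h \<mu> c" if "\<mu> \<in> span C" "c \<in> span C" for \<mu> \<xi> c
    using that p(2) by (simp add: h_simps(1) h_simps(5))
  have dspan: "t *\<^sub>R ?d \<in> span C \<Longrightarrow> t = 0" for t
  proof (rule ccontr)
    assume t: "t *\<^sub>R ?d \<in> span C" "t \<noteq> 0"
    then have "?d \<in> span C" using span_scale[OF t(1), of "1/t"] by simp
    then show False using span_add[OF _ p(1)] b by fastforce
  qed
  show "inj_on ?F (form_dual h C \<times> UNIV)"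
  proof (rule inj_onI, clarify)
    fix \<mu> \<mu>' and \<xi> \<xi>' :: int
    assume m: "\<mu> \<in> form_dual h C" "\<mu>' \<in> form_dual h C" and
      eq: "\<mu> + ((of_int \<xi> - h \<mu> b) / ?B) *\<^sub>R ?d = \<mu>' + ((of_int \<xi>' - h \<mu>' b) / ?B) *\<^sub>R ?d"
    have ms: "\<mu> \<in> span C" "\<mu>' \<in> span C" using m by (auto simp: form_dual_def)
    have xi: "\<xi> = \<xi>'" using Fb[OF ms(1), of \<xi>] Fb[OF ms(2), of \<xi>'] eq by simp
    have "\<mu> - \<mu>' = ((of_int \<xi>' - h \<mu>' b) / ?B - (of_int \<xi> - h \<mu> b) / ?B) *\<^sub>R ?d"
      using eq by (simp add: algebra_simps)
    moreover have "\<mu> - \<mu>' \<in> span C" using ms by (rule span_diff)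
    ultimately have "\<mu> - \<mu>' = 0" using dspan by (metis scaleR_zero_left)
    then show "\<mu> = \<mu>' \<and> \<xi> = \<xi>'" using xi by simp
  qed
  show "?F ` (form_dual h C \<times> UNIV) = form_dual h (insert b C)"
  proof (intro equalityI subsetI)
    fix y assume "y \<in> ?F ` (form_dual h C \<times> UNIV)"
    then obtain \<mu> \<xi> where y: "y = ?F (\<mu>, \<xi>)" "\<mu> \<in> form_dual h C" by auto
    then have ms: "\<mu> \<in> span C" "\<forall>c\<in>C. h \<mu> c \<in> \<int>" by (auto simp: form_dual_def)
    have "y \<in> span (insert b C)" 
    proof -
      have "\<mu> \<in> span (insert b C)" "p \<in> span (insert b C)" "b \<in> span (insert b C)"
        using ms(1) p(1) span_mono[of C "insert b C"] span_base[of b "insert b C"] by auto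
      then show ?thesis unfolding y(1) prod.case by (intro span_add span_scale span_diff)
    qed
    moreover have "h y c \<in> \<int>" if "c \<in> insert b C" for c
    proof (cases "c = b")
      case True
      then show ?thesis unfolding y(1) using Fb[OF ms(1)] by simp
    next
      case False
      then have c: "c \<in> C" using that by simp
      show ?thesis unfolding y(1) Fc[OF ms(1) span_base[OF c]] using ms(2) c by blast
    qed
    ultimately show "y \<in> form_dual h (insert b C)" by (simp add: form_dual_def)
  next
    fix y assume y: "y \<in> form_dual h (insert b C)"
    then have "y \<in> span (insert b C)" by (simp add: form_dual_def)
    then obtain t where t: "y - t *\<^sub>R b \<in> span C" by (auto simp: span_insert)
    let ?w = "y - t *\<^sub>R ?d"
    have w: "?w \<in> span C"
      using span_add[OF t span_scale[OF p(1), of t]] by (simp add: algebra_simps)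
    have wc: "h ?w c = h y c" if "c \<in> C" for c
      using p(2)[OF span_base[OF that]] by (simp add: h_simps(3) h_simps(5))
    have wd: "?w \<in> form_dual h C" using w wc y by (auto simp: form_dual_def)
    obtain \<xi> where xi: "h y b = of_int \<xi>" using y by (auto simp: form_dual_def elim: Ints_cases)
    have "h ?w b = of_int \<xi> - t * ?B" using xi hdb by (simp add: h_simps(3) h_simps(5))
    then have "?F (?w, \<xi>) = y" using B by simp
    then show "y \<in> ?F ` (form_dual h C \<times> UNIV)" using wd by (metis (no_types, lifting) SigmaI UNIV_I image_eqI)
  qed
qed

text \<open>Along \<open>b - p\<close> the Gaussian splits off a one-dimensional factor, while the
  component in \<open>span C\<close> is shifted by \<open>n\<close> times \<open>p\<close>. Poisson
  summation over \<open>C\<close> for each fixed \<open>n\<close> turns that shift into a character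
  of \<open>n\<close>, and Jacobi inversion in \<open>n\<close> produces both the new dual
  coordinate and the factor \<open>1 / sqrt B\<close>.\<close>

lemma poisson_insert:
  assumes P: "poisson h C \<kappa>" and fin: "finite C" and b: "b \<notin> span C"
    and p: "p \<in> span C" "\<And>c. c \<in> span C \<Longrightarrow> h (b - p) c = 0"
  shows "poisson h (insert b C) (\<kappa> / sqrt (h (b - p) (b - p)))"
proof -
  let ?d = "b - p"
  define B where "B = h ?d ?d"
  have d0: "?d \<noteq> 0" using p(1) b by auto
  have B: "B > 0" unfolding B_def using d0 by (rule pos)
  have hd0: "h c ?d = 0" if "c \<in> span C" for c using p(2)[OF that] sym by metis
  have k: "\<kappa> > 0" and S1: "\<And>v. v \<in> span C \<Longrightarrow> (\<lambda>x. exp (- pi * h (x + v) (x + v))) summable_on zspan C"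
    and S2: "(\<lambda>\<mu>. exp (- pi * h \<mu> \<mu>)) summable_on form_dual h C"
    and I: "\<And>v. v \<in> span C \<Longrightarrow> (\<Sum>\<^sub>\<infinity>x\<in>zspan C. complex_of_real (exp (- pi * h (x + v) (x + v)))) =
       of_real \<kappa> * (\<Sum>\<^sub>\<infinity>\<mu>\<in>form_dual h C. of_real (exp (- pi * h \<mu> \<mu>)) * ee (of_real (h \<mu> v)))"
    using P by (auto simp: poisson_def)
  define M where "M = (\<Sum>\<^sub>\<infinity>\<mu>\<in>form_dual h C. exp (- pi * h \<mu> \<mu>))"
  have T2: "(\<lambda>\<mu>. norm (of_real (exp (- pi * h \<mu> \<mu>)) * ee (of_real (h \<mu> v)))) summable_on form_dual h C" for v
    using S2 by (simp add: norm_mult)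
  \<comment> \<open>The dual side bounds the sum over a translate independently of \<open>v\<close>;
    the translates met below are infinitely many, one for each \<open>n\<close>.\<close>
  have Ib: "(\<Sum>\<^sub>\<infinity>x\<in>zspan C. exp (- pi * h (x + v) (x + v))) \<le> \<kappa> * M" if "v \<in> span C" for v
  proof -
    have "complex_of_real (\<Sum>\<^sub>\<infinity>x\<in>zspan C. exp (- pi * h (x + v) (x + v))) = 
      of_real \<kappa> * (\<Sum>\<^sub>\<infinity>\<mu>\<in>form_dual h C. of_real (exp (- pi * h \<mu> \<mu>)) * ee (of_real (h \<mu> v)))"
      using I[OF that] unfolding infsum_of_real_summable[OF S1[OF that]] .
    from abs_eq_norm_of_real[OF this] have "\<bar>\<Sum>\<^sub>\<infinity>x\<in>zspan C. exp (- pi * h (x + v) (x + v))\<bar> = 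
      \<kappa> * norm (\<Sum>\<^sub>\<infinity>\<mu>\<in>form_dual h C. of_real (exp (- pi * h \<mu> \<mu>)) * ee (of_real (h \<mu> v)))"
      using k unfolding norm_mult by (simp only: norm_of_real abs_of_pos)
    also have "\<dots> \<le> \<kappa> * M" unfolding M_def using norm_infsum_bound[OF T2[of v]] k
      by (intro mult_left_mono) (auto simp: norm_mult)
    finally show ?thesis by linarith
  qed
  have gs: "(\<lambda>n::int. exp (- pi * B * (of_int n + t)\<^sup>2)) summable_on UNIV" for t
  proof (rule summable_on_comparison_test)
    show "(\<lambda>n::int. exp (pi * B * \<bar>t\<bar>\<^sup>2) * exp (- (pi * B/2) * (of_int n)\<^sup>2)) summable_on UNIV"
      by (intro summable_on_cmult_right summable_on_int_gauss) (use B in auto)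
    show "exp (- pi * B * (of_int n + t)\<^sup>2) \<le> exp (pi * B * \<bar>t\<bar>\<^sup>2) * exp (- (pi * B/2) * (of_int n)\<^sup>2)" for n :: int
      using theta_bound[of t "\<bar>t\<bar>" "pi * B" "of_int n"] B by simp
  qed auto
  have gs2: "(\<lambda>n::int. exp (- pi * (of_int n - \<theta>)\<^sup>2 / B) / sqrt B) summable_on UNIV" for \<theta>
  proof (rule summable_on_comparison_test)
    show "(\<lambda>n::int. exp (pi / B * \<bar>\<theta>\<bar>\<^sup>2) * exp (- (pi / B/2) * (of_int n)\<^sup>2) * (1 / sqrt B)) summable_on UNIV"
      by (intro summable_on_cmult_left summable_on_cmult_right summable_on_int_gauss) (use B in auto)
    show "exp (- pi * (of_int n - \<theta>)\<^sup>2 / B) / sqrt B \<le> exp (pi / B * \<bar>\<theta>\<bar>\<^sup>2) * exp (- (pi / B/2) * (of_int n)\<^sup>2) * (1 / sqrt B)" for n :: int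
      using theta_bound[of "-\<theta>" "\<bar>\<theta>\<bar>" "pi / B" "of_int n"] B by (simp add: divide_right_mono)
  qed (use B in auto)
  have decomp: "\<exists>t v0. v0 \<in> span C \<and> v = v0 + t *\<^sub>R ?d" if "v \<in> span (insert b C)" for v
  proof -
    from that obtain t where t: "v - t *\<^sub>R b \<in> span C" by (auto simp: span_insert)
    have "v = (v - t *\<^sub>R b + t *\<^sub>R p) + t *\<^sub>R ?d" by (simp add: algebra_simps)
    then show ?thesis using span_add[OF t span_scale[OF p(1), of t]] by blast
  qed
  note bij1 = zspan_insert_bij[OF fin b]
  note bij2 = form_dual_insert_bij[OF p b]
  \<comment> \<open>Pythagoras: the part of the argument in \<open>span C\<close> collects
    \<open>n\<close> times \<open>p\<close>, and the orthogonal part is \<open>n + t\<close> times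
    \<open>b - p\<close>.\<close>
  have hx: "h (x + of_int n *\<^sub>R b + (v0 + t *\<^sub>R ?d)) (x + of_int n *\<^sub>R b + (v0 + t *\<^sub>R ?d)) = 
      h (x + (of_int n *\<^sub>R p + v0)) (x + (of_int n *\<^sub>R p + v0)) + B * (of_int n + t)\<^sup>2"
    if "x \<in> span C" "v0 \<in> span C" for x v0 n t
  proof -
    let ?w = "x + (of_int n *\<^sub>R p + v0)" and ?s = "of_int n + t"
    have w: "?w \<in> span C" using that p(1) by (intro span_add span_scale)
    have "x + of_int n *\<^sub>R b + (v0 + t *\<^sub>R ?d) = ?w + ?s *\<^sub>R ?d" by (simp add: algebra_simps)
    moreover have "h (?w + ?s *\<^sub>R ?d) (?w + ?s *\<^sub>R ?d) = h ?w ?w + B * ?s\<^sup>2"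
      unfolding h_simps(1)[of ?w] h_simps(2)[of _ ?w] h_simps(5) h_simps(6)
      using hd0[OF w] p(2)[OF w] by (simp add: B_def power2_eq_square)
    ultimately show ?thesis by (simp only:)
  qed
  have LS: "(\<lambda>(n::int, x). exp (- pi * h (x + of_int n *\<^sub>R b + (v0 + t *\<^sub>R ?d)) (x + of_int n *\<^sub>R b + (v0 + t *\<^sub>R ?d))))
      summable_on UNIV \<times> zspan C" if v0: "v0 \<in> span C" for v0 t
  proof (rule summable_on_TimesI)
    have vs: "of_int n *\<^sub>R p + v0 \<in> span C" for n :: int using v0 p(1) by (intro span_add span_scale)
    have eq: "exp (- pi * h (x + of_int n *\<^sub>R b + (v0 + t *\<^sub>R ?d)) (x + of_int n *\<^sub>R b + (v0 + t *\<^sub>R ?d))) =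
       exp (- pi * h (x + (of_int n *\<^sub>R p + v0)) (x + (of_int n *\<^sub>R p + v0))) * exp (- pi * B * (of_int n + t)\<^sup>2)"
      if "x \<in> zspan C" for x and n :: int
      using hx[OF _ v0, of x n t] that zspan_subset_span[of C] by (auto simp: exp_add[symmetric] algebra_simps)
    fix n :: int
    show "(\<lambda>y. case (n, y) of (n, x) \<Rightarrow> exp (- pi * h (x + of_int n *\<^sub>R b + (v0 + t *\<^sub>R ?d)) (x + of_int n *\<^sub>R b + (v0 + t *\<^sub>R ?d)))) summable_on zspan C"
      unfolding prod.case
      by (subst summable_on_cong[OF eq], assumption, rule summable_on_cmult_left[OF S1[OF vs[of n]]])
    show "(\<Sum>\<^sub>\<infinity>y\<in>zspan C. case (n, y) of (n, x) \<Rightarrow> exp (- pi * h (x + of_int n *\<^sub>R b + (v0 + t *\<^sub>R ?d)) (x + of_int n *\<^sub>R b + (v0 + t *\<^sub>R ?d))))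
      \<le> \<kappa> * M * exp (- pi * B * (of_int n + t)\<^sup>2)"
      unfolding prod.case
      by (subst infsum_cong[OF eq], assumption, unfold infsum_cmult_left', intro mult_right_mono Ib vs) simp
    show "(\<lambda>n::int. \<kappa> * M * exp (- pi * B * (of_int n + t)\<^sup>2)) summable_on UNIV"
      by (rule summable_on_cmult_right[OF gs])
  qed auto
  have DS: "(\<lambda>(\<mu>, n::int). exp (- pi * h \<mu> \<mu>) * (exp (- pi * (of_int n - h \<mu> b)\<^sup>2 / B) / sqrt B)) summable_on form_dual h C \<times> UNIV"
  proof (rule summable_on_TimesI)
    fix \<mu>
    show "(\<lambda>y. case (\<mu>, y) of (\<mu>, n::int) \<Rightarrow> exp (- pi * h \<mu> \<mu>) * (exp (- pi * (of_int n - h \<mu> b)\<^sup>2 / B) / sqrt B)) summable_on UNIV"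
      using summable_on_cmult_right[OF gs2[of "h \<mu> b"]] by simp
    \<comment> \<open>Jacobi inversion read backwards bounds the inner dual sum by a theta value
      independent of \<open>\<mu>\<close>, so the outer sum converges like that of
      \<open>C\<close>.\<close>
    have "complex_of_real (\<Sum>\<^sub>\<infinity>n::int. exp (- pi * (of_int n - h \<mu> b)\<^sup>2 / B) / sqrt B) = 
       (\<Sum>\<^sub>\<infinity>n::int. of_real (exp (- pi * B * (of_int n + 0)\<^sup>2)) * ee (of_real ((of_int n + 0) * h \<mu> b)))"
      unfolding jacobi_theta_inversion[OF B] infsum_of_real_summable[OF gs2, symmetric] by (simp add: ee_def)
    then have "\<bar>\<Sum>\<^sub>\<infinity>n::int. exp (- pi * (of_int n - h \<mu> b)\<^sup>2 / B) / sqrt B\<bar> = norm \<dots>"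
      by (rule abs_eq_norm_of_real)
    also have "\<dots> \<le> (\<Sum>\<^sub>\<infinity>n::int. exp (- pi * B * (of_int n + 0)\<^sup>2))"
      using norm_infsum_bound[of "\<lambda>n::int. of_real (exp (- pi * B * (of_int n + 0)\<^sup>2)) * ee (of_real ((of_int n + 0) * h \<mu> b))" UNIV] gs[of 0]
      by (simp only: norm_mult norm_ee_of_real norm_of_real abs_exp_cancel mult_1_right)
    finally show "(\<Sum>\<^sub>\<infinity>y. case (\<mu>, y) of (\<mu>, n::int) \<Rightarrow> exp (- pi * h \<mu> \<mu>) * (exp (- pi * (of_int n - h \<mu> b)\<^sup>2 / B) / sqrt B))
      \<le> exp (- pi * h \<mu> \<mu>) * (\<Sum>\<^sub>\<infinity>n::int. exp (- pi * B * (of_int n + 0)\<^sup>2))"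
      unfolding prod.case infsum_cmult_right' by (intro mult_left_mono) (linarith, simp)
    show "(\<lambda>\<mu>. exp (- pi * h \<mu> \<mu>) * (\<Sum>\<^sub>\<infinity>n::int. exp (- pi * B * (of_int n + 0)\<^sup>2))) summable_on form_dual h C"
      by (rule summable_on_cmult_left[OF S2])
  qed (use B in auto)
  have F: "h (\<mu> + ((of_int n - h \<mu> b) / B) *\<^sub>R ?d) (\<mu> + ((of_int n - h \<mu> b) / B) *\<^sub>R ?d) = h \<mu> \<mu> + (of_int n - h \<mu> b)\<^sup>2 / B"
    "h (\<mu> + ((of_int n - h \<mu> b) / B) *\<^sub>R ?d) (v0 + t *\<^sub>R ?d) = h \<mu> v0 + (of_int n - h \<mu> b) * t"
    if "\<mu> \<in> span C" "v0 \<in> span C" for \<mu> v0 n t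
    unfolding h_simps(1)[of \<mu>] h_simps(2)[of _ \<mu>] h_simps(2)[of _ v0] h_simps(5) h_simps(6)
    using hd0[OF that(1)] p(2)[OF that(1)] p(2)[OF that(2)] B by (simp_all add: B_def[symmetric] power2_eq_square)
  have fds: "\<mu> \<in> span C" if "\<mu> \<in> form_dual h C" for \<mu> using that by (simp add: form_dual_def)
  have DS': "(\<lambda>\<mu>. exp (- pi * h \<mu> \<mu>)) summable_on form_dual h (insert b C)"
  proof -
    have "(\<lambda>(\<mu>, n::int). exp (- pi * h (\<mu> + ((of_int n - h \<mu> b) / B) *\<^sub>R ?d) (\<mu> + ((of_int n - h \<mu> b) / B) *\<^sub>R ?d))) summable_on form_dual h C \<times> UNIV
      \<longleftrightarrow> (\<lambda>z. sqrt B * (case z of (\<mu>, n::int) \<Rightarrow> exp (- pi * h \<mu> \<mu>) * (exp (- pi * (of_int n - h \<mu> b)\<^sup>2 / B) / sqrt B))) summable_on form_dual h C \<times> UNIV"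
    proof (intro summable_on_cong, clarify)
      fix \<mu> and n :: int assume m: "\<mu> \<in> form_dual h C"
      have "exp (- pi * (h \<mu> \<mu> + (of_int n - h \<mu> b)\<^sup>2 / B)) = exp (- pi * h \<mu> \<mu>) * exp (- pi * (of_int n - h \<mu> b)\<^sup>2 / B)"
        by (simp add: exp_add[symmetric] algebra_simps)
      then show "exp (- pi * h (\<mu> + ((of_int n - h \<mu> b) / B) *\<^sub>R ?d) (\<mu> + ((of_int n - h \<mu> b) / B) *\<^sub>R ?d)) =
        sqrt B * (exp (- pi * h \<mu> \<mu>) * (exp (- pi * (of_int n - h \<mu> b)\<^sup>2 / B) / sqrt B))"
        unfolding F(1)[OF fds[OF m] fds[OF m]] using B by simp
    qed
    then have "(\<lambda>(\<mu>, n::int). exp (- pi * h (\<mu> + ((of_int n - h \<mu> b) / B) *\<^sub>R ?d) (\<mu> + ((of_int n - h \<mu> b) / B) *\<^sub>R ?d))) summable_on form_dual h C \<times> UNIV"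
      using summable_on_cmult_right[OF DS] by blast
    then show ?thesis
      using iffD1[OF summable_on_reindex_bij_betw[OF bij2, of "\<lambda>\<mu>. exp (- pi * h \<mu> \<mu>)"]]
      unfolding B_def by (simp add: case_prod_unfold)
  qed
  have LS': "(\<lambda>x. exp (- pi * h (x + v) (x + v))) summable_on zspan (insert b C)" if vin: "v \<in> span (insert b C)" for v
  proof -
    obtain t v0 where "v0 \<in> span C" "v = v0 + t *\<^sub>R ?d" using decomp[OF vin] by blast
    then show ?thesis using LS[of v0 t]
        iffD1[OF summable_on_reindex_bij_betw[OF bij1, of "\<lambda>x. exp (- pi * h (x + v) (x + v))"]]
      by (simp add: case_prod_unfold)
  qed
  have main: "(\<Sum>\<^sub>\<infinity>x\<in>zspan (insert b C). complex_of_real (exp (- pi * h (x + v) (x + v)))) =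
       of_real (\<kappa> / sqrt B) * (\<Sum>\<^sub>\<infinity>\<mu>\<in>form_dual h (insert b C). of_real (exp (- pi * h \<mu> \<mu>)) * ee (of_real (h \<mu> v)))"
    if vin: "v \<in> span (insert b C)" for v
  proof -
    obtain t v0 where v0: "v0 \<in> span C" and v: "v = v0 + t *\<^sub>R ?d" using decomp[OF vin] by blast
    have vs: "of_int n *\<^sub>R p + v0 \<in> span C" for n :: int using v0 p(1) by (intro span_add span_scale)
    let ?g = "\<lambda>n::int. complex_of_real (exp (- pi * B * (of_int n + t)\<^sup>2))"
    let ?e = "\<lambda>\<mu>. complex_of_real (exp (- pi * h \<mu> \<mu>))"
    have hmp: "h \<mu> p = h \<mu> b" if "\<mu> \<in> form_dual h C" for \<mu>
      using hd0[OF fds[OF that]] by (simp add: h_simps)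
    have "(\<Sum>\<^sub>\<infinity>x\<in>zspan (insert b C). complex_of_real (exp (- pi * h (x + v) (x + v)))) = 
      (\<Sum>\<^sub>\<infinity>(n::int, x)\<in>UNIV \<times> zspan C. complex_of_real (exp (- pi * h (x + of_int n *\<^sub>R b + v) (x + of_int n *\<^sub>R b + v))))"
      using infsum_reindex_bij_betw[OF bij1, of "\<lambda>x. complex_of_real (exp (- pi * h (x + v) (x + v)))"]
      by (simp add: case_prod_unfold)
    also have "\<dots> = (\<Sum>\<^sub>\<infinity>n::int. \<Sum>\<^sub>\<infinity>x\<in>zspan C. complex_of_real (exp (- pi * h (x + of_int n *\<^sub>R b + v) (x + of_int n *\<^sub>R b + v))))"
    proof (subst infsum_Sigma_banach[symmetric])
      show "(\<lambda>(n::int, x). complex_of_real (exp (- pi * h (x + of_int n *\<^sub>R b + v) (x + of_int n *\<^sub>R b + v)))) summable_on UNIV \<times> zspan C"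
        using summable_on_of_real[OF LS[OF v0, of t]] unfolding v case_prod_unfold .
    qed (simp add: case_prod_unfold)
    \<comment> \<open>For fixed \<open>n\<close> this is Poisson summation for \<open>C\<close> at
      the shift \<open>of_int n *\<^sub>R p + v0\<close>.\<close>
    also have "\<dots> = (\<Sum>\<^sub>\<infinity>n::int. \<Sum>\<^sub>\<infinity>\<mu>\<in>form_dual h C. of_real \<kappa> * (?g n * (?e \<mu> * ee (of_real (h \<mu> (of_int n *\<^sub>R p + v0))))))"
    proof (rule infsum_cong)
      fix n :: int
      have "(\<Sum>\<^sub>\<infinity>x\<in>zspan C. complex_of_real (exp (- pi * h (x + of_int n *\<^sub>R b + v) (x + of_int n *\<^sub>R b + v)))) = 
        (\<Sum>\<^sub>\<infinity>x\<in>zspan C. ?g n * complex_of_real (exp (- pi * h (x + (of_int n *\<^sub>R p + v0)) (x + (of_int n *\<^sub>R p + v0)))))"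
        unfolding v using hx[OF _ v0, of _ n t] zspan_subset_span[of C]
        by (intro infsum_cong) (auto simp: exp_add[symmetric] of_real_mult[symmetric] algebra_simps simp del: of_real_mult)
      also have "\<dots> = ?g n * (of_real \<kappa> * (\<Sum>\<^sub>\<infinity>\<mu>\<in>form_dual h C. ?e \<mu> * ee (of_real (h \<mu> (of_int n *\<^sub>R p + v0)))))"
        unfolding infsum_cmult_right' I[OF vs] ..
      also have "\<dots> = (\<Sum>\<^sub>\<infinity>\<mu>\<in>form_dual h C. of_real \<kappa> * (?g n * (?e \<mu> * ee (of_real (h \<mu> (of_int n *\<^sub>R p + v0))))))"
        unfolding infsum_cmult_right' by (simp only: mult.left_commute)
      finally show "(\<Sum>\<^sub>\<infinity>x\<in>zspan C. complex_of_real (exp (- pi * h (x + of_int n *\<^sub>R b + v) (x + of_int n *\<^sub>R b + v)))) = \<dots>" .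
    qed
    also have "\<dots> = (\<Sum>\<^sub>\<infinity>\<mu>\<in>form_dual h C. \<Sum>\<^sub>\<infinity>n::int. of_real \<kappa> * (?g n * (?e \<mu> * ee (of_real (h \<mu> (of_int n *\<^sub>R p + v0))))))"
    proof (rule infsum_swap_banach, rule abs_summable_summable)
      have "(\<lambda>(n::int, \<mu>). \<kappa> * (exp (- pi * B * (of_int n + t)\<^sup>2) * exp (- pi * h \<mu> \<mu>))) summable_on UNIV \<times> form_dual h C"
        by (rule summable_on_TimesI[where G="\<lambda>n. \<kappa> * exp (- pi * B * (of_int n + t)\<^sup>2) * M"])
           (use k in \<open>auto simp only: prod.case infsum_cmult_right' M_def mult.assoc less_imp_le mult_nonneg_nonneg exp_ge_zero order_refl
              intro!: summable_on_cmult_right summable_on_cmult_left[OF gs, unfolded mult.assoc] S2\<close>)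
      then show "(\<lambda>z. norm (case z of (n, \<mu>) \<Rightarrow> of_real \<kappa> * (?g n * (?e \<mu> * ee (of_real (h \<mu> (of_int n *\<^sub>R p + v0))))))) summable_on UNIV \<times> form_dual h C"
        using k by (simp add: case_prod_unfold norm_mult del: of_real_mult of_real_add)
    qed
    \<comment> \<open>Jacobi inversion in \<open>n\<close> with frequency \<open>h \<mu> b\<close>.
      This frequency is also \<open>h \<mu> p\<close>, because \<open>\<mu>\<close> is orthogonal to
      \<open>b - p\<close>.\<close>
    also have "\<dots> = (\<Sum>\<^sub>\<infinity>\<mu>\<in>form_dual h C. \<Sum>\<^sub>\<infinity>n::int. of_real \<kappa> * (?e \<mu> * (of_real (exp (- pi * (of_int n - h \<mu> b)\<^sup>2 / B) / sqrt B)
        * ee (of_real (h \<mu> v0 + (of_int n - h \<mu> b) * t)))))"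
    proof (rule infsum_cong)
      fix \<mu> assume m: "\<mu> \<in> form_dual h C"
      let ?\<theta> = "h \<mu> b"
      have e1: "ee (of_real (h \<mu> (of_int n *\<^sub>R p + v0))) = ee (of_real (h \<mu> v0 - t * ?\<theta>)) * ee (of_real ((of_int n + t) * ?\<theta>))" for n :: int
        unfolding ee_add[symmetric] of_real_add[symmetric]
        using hmp[OF m] by (intro arg_cong[of _ _ ee] arg_cong[of _ _ of_real]) (simp add: h_simps algebra_simps)
      have e2: "ee (of_real (h \<mu> v0 + (of_int n - ?\<theta>) * t)) = ee (of_real (h \<mu> v0 - t * ?\<theta>)) * ee (of_real (of_int n * t))" for n :: int
        unfolding ee_add[symmetric] of_real_add[symmetric]
        by (intro arg_cong[of _ _ ee] arg_cong[of _ _ of_real]) (simp add: algebra_simps)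
      have "(\<Sum>\<^sub>\<infinity>n::int. of_real \<kappa> * (?g n * (?e \<mu> * ee (of_real (h \<mu> (of_int n *\<^sub>R p + v0)))))) = 
        (\<Sum>\<^sub>\<infinity>n::int. (of_real \<kappa> * ?e \<mu> * ee (of_real (h \<mu> v0 - t * ?\<theta>))) * (?g n * ee (of_real ((of_int n + t) * ?\<theta>))))"
        unfolding e1 by (intro infsum_cong) (simp only: mult_ac)
      also have "\<dots> = (\<Sum>\<^sub>\<infinity>n::int. (of_real \<kappa> * ?e \<mu> * ee (of_real (h \<mu> v0 - t * ?\<theta>))) * 
          (of_real (exp (- pi * (of_int n - h \<mu> b)\<^sup>2 / B) / sqrt B) * ee (of_real (of_int n * t))))"
        unfolding infsum_cmult_right' jacobi_theta_inversion[OF B] ..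
      also have "\<dots> = (\<Sum>\<^sub>\<infinity>n::int. of_real \<kappa> * (?e \<mu> * (of_real (exp (- pi * (of_int n - h \<mu> b)\<^sup>2 / B) / sqrt B)
        * ee (of_real (h \<mu> v0 + (of_int n - h \<mu> b) * t)))))"
        unfolding e2 by (intro infsum_cong) (simp only: mult_ac)
      finally show "(\<Sum>\<^sub>\<infinity>n::int. of_real \<kappa> * (?g n * (?e \<mu> * ee (of_real (h \<mu> (of_int n *\<^sub>R p + v0)))))) = \<dots>" .
    qed
    also have "\<dots> = (\<Sum>\<^sub>\<infinity>(\<mu>, n::int)\<in>form_dual h C \<times> UNIV. of_real \<kappa> * (?e \<mu> * (of_real (exp (- pi * (of_int n - h \<mu> b)\<^sup>2 / B) / sqrt B)
        * ee (of_real (h \<mu> v0 + (of_int n - h \<mu> b) * t)))))"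
    proof (subst infsum_Sigma_banach[symmetric])
      have "(\<lambda>z. norm (case z of (\<mu>, n::int) \<Rightarrow> of_real \<kappa> * (?e \<mu> * (of_real (exp (- pi * (of_int n - h \<mu> b)\<^sup>2 / B) / sqrt B)
        * ee (of_real (h \<mu> v0 + (of_int n - h \<mu> b) * t)))))) summable_on form_dual h C \<times> UNIV"
        using summable_on_cmult_right[OF DS, of \<kappa>] k B
        by (simp add: case_prod_unfold norm_mult norm_divide del: of_real_mult of_real_add of_real_divide)
      then show "(\<lambda>(\<mu>, n::int). of_real \<kappa> * (?e \<mu> * (of_real (exp (- pi * (of_int n - h \<mu> b)\<^sup>2 / B) / sqrt B)
        * ee (of_real (h \<mu> v0 + (of_int n - h \<mu> b) * t))))) summable_on form_dual h C \<times> UNIV"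
        by (rule abs_summable_summable)
    qed (simp add: case_prod_unfold)
    also have "\<dots> = (\<Sum>\<^sub>\<infinity>(\<mu>, n::int)\<in>form_dual h C \<times> UNIV. of_real (\<kappa> / sqrt B) * 
        (?e (\<mu> + ((of_int n - h \<mu> b) / B) *\<^sub>R ?d) * ee (of_real (h (\<mu> + ((of_int n - h \<mu> b) / B) *\<^sub>R ?d) v))))"
    proof (rule infsum_cong, clarify)
      fix \<mu> and n :: int assume m: "\<mu> \<in> form_dual h C"
      have "exp (- pi * (h \<mu> \<mu> + (of_int n - h \<mu> b)\<^sup>2 / B)) = exp (- pi * h \<mu> \<mu>) * exp (- pi * (of_int n - h \<mu> b)\<^sup>2 / B)"
        by (simp add: exp_add[symmetric] algebra_simps)
      then show "of_real \<kappa> * (?e \<mu> * (of_real (exp (- pi * (of_int n - h \<mu> b)\<^sup>2 / B) / sqrt B)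
        * ee (of_real (h \<mu> v0 + (of_int n - h \<mu> b) * t)))) = of_real (\<kappa> / sqrt B) * 
        (?e (\<mu> + ((of_int n - h \<mu> b) / B) *\<^sub>R ?d) * ee (of_real (h (\<mu> + ((of_int n - h \<mu> b) / B) *\<^sub>R ?d) v)))"
        unfolding v F(1)[OF fds[OF m] v0] F(2)[OF fds[OF m] v0] by simp
    qed
    also have "\<dots> = (\<Sum>\<^sub>\<infinity>\<mu>\<in>form_dual h (insert b C). of_real (\<kappa> / sqrt B) * (?e \<mu> * ee (of_real (h \<mu> v))))"
      using infsum_reindex_bij_betw[OF bij2, of "\<lambda>\<mu>. of_real (\<kappa> / sqrt B) * (?e \<mu> * ee (of_real (h \<mu> v)))"]
      unfolding B_def by (simp add: case_prod_unfold)
    finally show ?thesis unfolding infsum_cmult_right' .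
  qed
  show ?thesis
    unfolding poisson_def using k B LS' DS' main unfolding B_def[symmetric] by auto
qed

lemma poisson_empty: "poisson h {} 1"
  by (simp add: poisson_def form_dual_def h_simps ee_def)

lemma poisson_exists: "finite S \<Longrightarrow> independent S \<Longrightarrow> \<exists>\<kappa>. poisson h S \<kappa>"
proof (induction S rule: finite_induct)
  case (insert b C)
  then have b: "b \<notin> span C" and "independent C" by (auto simp: independent_insert)
  with insert obtain \<kappa> where "poisson h C \<kappa>" by blast
  moreover obtain p where "p \<in> span C" "\<And>c. c \<in> span C \<Longrightarrow> h (b - p) c = 0" using projection[OF insert(1)] by blast
  ultimately show ?case using poisson_insert[OF _ insert(1) b] by blast
qed (use poisson_empty in blast)

text \<open>At \<open>v = 0\<close> the left side is a sum of positive terms including 1, so the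
  dual sum is nonzero and can be cancelled.\<close>

lemma poisson_unique:
  assumes "poisson h S \<kappa>" "poisson h S \<kappa>'"
  shows "\<kappa> = \<kappa>'"
proof -
  let ?L = "\<Sum>\<^sub>\<infinity>x\<in>zspan S. complex_of_real (exp (- pi * h (x + 0) (x + 0)))"
  have s: "(\<lambda>x. exp (- pi * h (x + 0) (x + 0))) summable_on zspan S"
    using assms(1) span_zero unfolding poisson_def by blast
  have "(\<Sum>x\<in>{0}. exp (- pi * h (x + 0) (x + 0))) \<le> (\<Sum>\<^sub>\<infinity>x\<in>zspan S. exp (- pi * h (x + 0) (x + 0)))"
    by (rule finite_sum_le_infsum[OF s]) (auto simp: zspan_zero)
  then have "(\<Sum>\<^sub>\<infinity>x\<in>zspan S. exp (- pi * h (x + 0) (x + 0))) \<noteq> 0" by (simp add: h_simps)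
  then have "?L \<noteq> 0" unfolding infsum_of_real_summable[OF s] by (simp only: of_real_eq_0_iff not_False_eq_True)
  moreover have 1: "?L = of_real \<kappa> * (\<Sum>\<^sub>\<infinity>\<mu>\<in>form_dual h S. of_real (exp (- pi * h \<mu> \<mu>)) * ee (of_real (h \<mu> 0)))" (is "_ = _ * ?X")
    using assms(1) span_zero unfolding poisson_def by blast
  moreover have 2: "?L = of_real \<kappa>' * ?X"
    using assms(2) span_zero unfolding poisson_def by blast
  ultimately have "?X \<noteq> 0" by auto
  moreover have "of_real \<kappa> * ?X = of_real \<kappa>' * ?X" using 1 2 by (simp only:)
  ultimately show ?thesis by simp
qed

text \<open>Each new vector is its own orthogonal part, so \<open>poisson_insert\<close> applies
  with \<open>p = 0\<close>. Only for such bases does the constant have to be known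
  explicitly.\<close>

lemma poisson_orth:
  assumes "finite E" "0 \<notin> E" "\<forall>e\<in>E. \<forall>f\<in>E. e \<noteq> f \<longrightarrow> h e f = 0"
  shows "poisson h E (\<Prod>e\<in>E. 1 / sqrt (h e e)) \<and> independent E"
  using assms
proof (induction E rule: finite_induct)
  case empty
  then show ?case by (simp add: poisson_empty independent_empty)
next
  case (insert b C)
  have orth: "h b c = 0" if "c \<in> span C" for c
  proof (rule span_orth[OF that])
    fix c assume c: "c \<in> C"
    then have "b \<noteq> c" using insert.hyps(2) by metis
    moreover have "b \<noteq> c \<longrightarrow> h b c = 0"
      by (rule bspec[OF bspec[OF insert.prems(2)]]) (use c in simp_all)
    ultimately show "h b c = 0" by (rule rev_mp)
  qed
  have "b \<noteq> 0" using insert.prems(1) by blast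
  then have b: "b \<notin> span C" using orth[of b] pos[of b] by force
  have IH: "poisson h C (\<Prod>e\<in>C. 1 / sqrt (h e e))" "independent C"
  proof -
    have "\<forall>e\<in>C. \<forall>f\<in>C. e \<noteq> f \<longrightarrow> h e f = 0"
    proof (intro ballI)
      fix e f assume ef: "e \<in> C" "f \<in> C"
      show "e \<noteq> f \<longrightarrow> h e f = 0"
        by (rule bspec[OF bspec[OF insert.prems(2)]]) (use ef in simp_all)
    qed
    then show "poisson h C (\<Prod>e\<in>C. 1 / sqrt (h e e))" "independent C"
      using insert.IH insert.prems(1) by simp_all
  qed
  have "poisson h (insert b C) ((\<Prod>e\<in>C. 1 / sqrt (h e e)) / sqrt (h (b - 0) (b - 0)))"
  proof (rule poisson_insert[OF IH(1) insert(1) b span_zero])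
    fix c assume "c \<in> span C"
    then show "h (b - 0) c = 0" using orth by (simp only: diff_zero)
  qed
  then show ?case using insert.hyps b IH(2) by (simp add: independent_insert mult.commute)
qed

text \<open>The part of the new vector orthogonal to \<open>span C\<close> is \<open>c\<close> times
  that of \<open>e\<close>, so only the last factor of the constant changes. The point is that
  \<open>1 / \<bar>c\<bar>\<close> does not involve \<open>h\<close>.\<close>

lemma poisson_exchange:
  assumes P: "poisson h (insert e C) \<kappa>" and fin: "finite C" and ind: "independent C" and e: "e \<notin> span C"
    and u: "u \<in> span C" and c: "c \<noteq> 0"
  shows "poisson h (insert (c *\<^sub>R e + u) C) (\<kappa> / \<bar>c\<bar>)"
proof -
  let ?b = "c *\<^sub>R e + u"
  obtain \<kappa>0 where k0: "poisson h C \<kappa>0" using poisson_exists[OF fin ind] by blast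
  obtain p where p: "p \<in> span C" "\<And>x. x \<in> span C \<Longrightarrow> h (e - p) x = 0" using projection[OF fin] by blast
  have 1: "\<kappa> = \<kappa>0 / sqrt (h (e - p) (e - p))"
    using poisson_unique[OF P poisson_insert[OF k0 fin e p]] .
  have b: "?b \<notin> span C"
  proof
    assume "?b \<in> span C"
    then have "(1/c) *\<^sub>R (?b - u) \<in> span C" using u by (intro span_scale span_diff)
    then show False using e c by simp
  qed
  let ?q = "c *\<^sub>R p + u"
  have bq: "?b - ?q = c *\<^sub>R (e - p)" by (simp add: algebra_simps)
  have "poisson h (insert ?b C) (\<kappa>0 / sqrt (h (?b - ?q) (?b - ?q)))"
  proof (rule poisson_insert[OF k0 fin b])
    show "?q \<in> span C" using p(1) u by (intro span_add span_scale)
    show "h (?b - ?q) x = 0" if "x \<in> span C" for x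
      unfolding bq h_simps(5) using p(2)[OF that] by simp
  qed
  moreover have "sqrt (h (?b - ?q) (?b - ?q)) = \<bar>c\<bar> * sqrt (h (e - p) (e - p))"
    unfolding bq h_simps(5) h_simps(6) by (simp add: real_sqrt_mult[symmetric] real_sqrt_abs2[symmetric] mult.assoc del: real_sqrt_abs2)
  ultimately show ?thesis using 1 by (simp add: mult.commute)
qed

end

text \<open>
  Replacing one basis vector at a time changes \<open>\<kappa>\<close> by a factor that does not depend on the form;
  this substitutes for the determinant of the change of basis.
\<close>

lemma poisson_change_basis:
  fixes A :: "'v::euclidean_space set"
  assumes A: "independent A" "span A = UNIV" and E: "independent E" "span E = UNIV"
  shows "\<exists>r>0. \<forall>h \<kappa>. pos_form h \<longrightarrow> poisson h E \<kappa> \<longrightarrow> poisson h A (r * \<kappa>)"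
  using E
proof (induction "card (A - E)" arbitrary: E rule: less_induct)
  case (less E)
  have finA: "finite A" and finE: "finite E" using A less.prems independent_imp_finite by auto
  show ?case
  proof (cases "A \<subseteq> E")
    case True
    have "E \<subseteq> A"
    proof
      fix e assume e: "e \<in> E"
      show "e \<in> A"
      proof (rule ccontr)
        assume "e \<notin> A"
        then have "A \<subseteq> E - {e}" using True by auto
        then have "e \<in> span (E - {e})" using A(2) span_mono by blast
        then show False using less.prems(1) e unfolding dependent_def by blast
      qed
    qed
    then have "A = E" using True by auto
    then show ?thesis by (intro exI[of _ 1]) auto
  next
    case False
    then obtain b where b: "b \<in> A" "b \<notin> E" by auto
    have "b \<in> span E" using less.prems by auto
    then obtain c where c: "b = (\<Sum>e\<in>E. c e *\<^sub>R e)" using finE by (auto simp: span_finite)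
    \<comment> \<open>Steinitz exchange: were all coefficients outside \<open>A\<close> zero,
      \<open>b\<close> would depend on the other members of \<open>A\<close>.\<close>
    have "\<exists>e\<in>E - A. c e \<noteq> 0"
    proof (rule ccontr)
      assume "\<not> ?thesis"
      then have "b = (\<Sum>e\<in>E \<inter> A. c e *\<^sub>R e)" unfolding c
        using finE by (intro sum.mono_neutral_right) auto
      moreover have "(\<Sum>e\<in>E \<inter> A. c e *\<^sub>R e) \<in> span (E \<inter> A)" by (intro span_sum span_scale span_base)
      ultimately have "b \<in> span (E \<inter> A)" by simp
      moreover have "E \<inter> A \<subseteq> A - {b}" using b by auto
      ultimately have "b \<in> span (A - {b})" using span_mono by blast
      then show False using A(1) b unfolding dependent_def by blast
    qed
    then obtain e where e: "e \<in> E" "e \<notin> A" "c e \<noteq> 0" by auto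
    define C where "C = E - {e}"
    define u where "u = (\<Sum>x\<in>C. c x *\<^sub>R x)"
    have EC: "E = insert e C" "e \<notin> C" "finite C" using e finE by (auto simp: C_def)
    have u: "u \<in> span C" unfolding u_def by (intro span_sum span_scale span_base)
    have bu: "b = c e *\<^sub>R e + u" unfolding c u_def C_def using finE e by (simp add: sum.remove)
    have iC: "independent C" and eC: "e \<notin> span C" using less.prems(1) EC by (auto simp: independent_insert)
    have bC: "b \<notin> span C"
    proof
      assume "b \<in> span C"
      then have "(1/c e) *\<^sub>R (b - u) \<in> span C" using u by (intro span_scale span_diff)
      then show False using eC e bu by simp
    qed
    have i': "independent (insert b C)" using iC bC by (simp add: independent_insertI)
    have s': "span (insert b C) = UNIV"
    proof -
      have "e \<in> span (insert b C)"
      proof -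
        have "e = (1/c e) *\<^sub>R (b - u)" using e bu by simp
        moreover have "u \<in> span (insert b C)" using u span_mono[of C "insert b C"] by auto
        ultimately show ?thesis by (metis span_scale span_diff span_base insertI1)
      qed
      then have "insert e C \<subseteq> span (insert b C)" using span_superset[of "insert b C"] by auto
      then show ?thesis using less.prems(2) EC(1) span_minimal[OF _ subspace_span] by blast
    qed
    have "A - insert b C = A - E - {b}" using e EC by auto
    then have "card (A - insert b C) < card (A - E)" using b finA
      by (metis DiffI card_Diff1_less finite_Diff)
    from less.hyps[OF this i' s'] obtain r where r: "r > 0"
      "\<And>h \<kappa>. pos_form h \<Longrightarrow> poisson h (insert b C) \<kappa> \<Longrightarrow> poisson h A (r * \<kappa>)" by blast
    show ?thesis
    proof (intro exI[of _ "r / \<bar>c e\<bar>"] conjI allI impI)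
      show "0 < r / \<bar>c e\<bar>" using r e by simp
      fix h :: "'v \<Rightarrow> 'v \<Rightarrow> real" and \<kappa> assume h: "pos_form h" "poisson h E \<kappa>"
      have "poisson h (insert b C) (\<kappa> / \<bar>c e\<bar>)"
        using pos_form.poisson_exchange[OF h(1) _ EC(3) iC eC u e(3), of \<kappa>] h(2) EC(1) bu by simp
      from r(2)[OF h(1) this] show "poisson h A (r / \<bar>c e\<bar> * \<kappa>)" by simp
    qed
  qed
qed

section \<open>The lattice and its majorants\<close>

lemma (in pos_form) cauchy_schwarz: "(h x y)\<^sup>2 \<le> h x x * h y y"
proof (cases "y = 0")
  case True then show ?thesis by (simp add: h_simps)
next
  case False
  let ?t = "h x y / h y y"
  have p: "h y y > 0" using pos[OF False] .
  have "0 \<le> h (x - ?t *\<^sub>R y) (x - ?t *\<^sub>R y)" by (rule nonneg)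
  also have "\<dots> = h x x - (h x y)\<^sup>2 / h y y"
    unfolding h_simps(3,4,5,6) using p sym[of y x] by (simp add: field_simps power2_eq_square)
  finally show ?thesis using p by (simp add: field_simps)
qed

section \<open>The quadratic space split along v_+ and v_-\<close>

locale quad =
  fixes B :: "'v::euclidean_space \<Rightarrow> 'v \<Rightarrow> real" and L :: "'v set" and z \<zeta> :: 'v and Z :: "'v cpx" and b :: nat
  assumes lattice: "even_lattice B L 2 b"
    and zz: "B z z = 0" and zzeta: "B z \<zeta> = 1"
    and ZK: "fst Z \<in> K_space B z \<zeta>" "snd Z \<in> K_space B z \<zeta>"
    and Ypos: "B (snd Z) (snd Z) > 0"
begin

lemma bilB: "bilinear B" and symB: "B x y = B y x"
  using lattice by (auto simp: even_lattice_def)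

lemmas B_simps = bilinear_ladd[OF bilB] bilinear_radd[OF bilB] bilinear_lsub[OF bilB] bilinear_rsub[OF bilB]
  bilinear_lmul[OF bilB] bilinear_rmul[OF bilB] bilinear_lneg[OF bilB] bilinear_rneg[OF bilB]
  bilinear_lzero[OF bilB] bilinear_rzero[OF bilB]

definition "X = fst (ZV B z \<zeta> Z)"
text \<open>This is the imaginary part of \<open>Z_V\<close>, not of \<open>Z\<close>; both have
  norm \<open>q\<close>.\<close>

definition "Y = snd (ZV B z \<zeta> Z)"
definition "q = B (snd Z) (snd Z)"

lemma q_pos: "q > 0" using Ypos by (simp add: q_def)

text \<open>The multiple of \<open>z\<close> in \<open>Z_V\<close> is the one that makes
  \<open>Z_V\<close> isotropic for the bilinear form, so its real and imaginary parts are orthogonal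
  and of equal norm.\<close>

lemma B_XY: "B X X = q" "B Y Y = q" "B X Y = 0" "B Y X = 0"
proof -
  define x y where "x = fst Z" and "y = snd Z"
  note Z = x_def[symmetric] y_def[symmetric]
  have o: "B x z = 0" "B x \<zeta> = 0" "B y z = 0" "B y \<zeta> = 0" "B z x = 0" "B \<zeta> x = 0" "B z y = 0" "B \<zeta> y = 0"
  proof -
    have K: "w \<in> K_space B z \<zeta> \<Longrightarrow> B w z = 0 \<and> B w \<zeta> = 0" for w by (simp add: K_space_def orth_compl_def)
    have "x \<in> K_space B z \<zeta>" "y \<in> K_space B z \<zeta>" using ZK unfolding Z .
    then show "B x z = 0" "B x \<zeta> = 0" "B y z = 0" "B y \<zeta> = 0" using K by blast+
    then show "B z x = 0" "B \<zeta> x = 0" "B z y = 0" "B \<zeta> y = 0"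
      by (simp_all only: symB[of z] symB[of \<zeta>])
  qed
  have zz': "B \<zeta> z = 1" using zzeta symB[of \<zeta> z] by simp
  let ?r = "(B x x - B y y + B \<zeta> \<zeta>) / 2"
  have X: "X = x + \<zeta> - ?r *\<^sub>R z" and Y: "Y = y - B x y *\<^sub>R z"
    by (simp_all add: X_def Y_def x_def y_def ZV_def cpx_emb_def cpx_scale_def cpx_form_def symB[of "snd Z" "fst Z"])
  show "B X X = q" "B Y Y = q" "B X Y = 0"
    unfolding X Y B_simps o q_def Z using zz zzeta zz' symB[of y x] by (simp_all add: o field_simps)
  then show "B Y X = 0" using symB[of Y X] by simp
qed

lemma XY_nonzero: "X \<noteq> 0" "Y \<noteq> 0"
  using B_XY q_pos B_simps(9) by force+

text \<open>Explicit formulas in the orthogonal basis \<open>X\<close>, \<open>Y\<close> of v_+: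
  \<open>np\<close> and \<open>nm\<close> are the norms of the two projections, \<open>PB\<close>
  polarizes \<open>np\<close>, and \<open>pr\<close> projects to v_+. Agreement with the abstract
  projections is shown in \<open>norm_plus_eq\<close> and \<open>norm_minus_eq\<close>.\<close>

definition "np x = ((B x X)\<^sup>2 + (B x Y)\<^sup>2) / q"
definition "nm x = B x x - np x"
definition "PB x w = (B x X * B w X + B x Y * B w Y) / q"
definition "pr x = (B x X / q) *\<^sub>R X + (B x Y / q) *\<^sub>R Y"

lemma np_nonneg: "np x \<ge> 0" using q_pos by (simp add: np_def)

lemma PB_self: "PB x x = np x" by (simp add: PB_def np_def power2_eq_square)

lemma B_pr: "B (pr x) w = PB x w" "B w (pr x) = PB x w"
proof -
  show "B (pr x) w = PB x w"
    unfolding pr_def PB_def B_simps(1,5) symB[of X w] symB[of Y w] by (simp add: add_divide_distrib)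
  then show "B w (pr x) = PB x w" using symB[of w "pr x"] by simp
qed

lemma PB_XY: "PB x X = B x X" "PB x Y = B x Y"
  using q_pos B_XY by (auto simp: PB_def)

lemma PB_sym: "PB x w = PB w x" by (simp add: PB_def mult.commute)

lemma PB_pr: "PB (pr x) w = PB x w"
proof -
  have "B (pr x) X = B x X" "B (pr x) Y = B x Y" unfolding B_pr PB_XY by auto
  then show ?thesis by (simp add: PB_def)
qed

lemma sig: "signature B 2 b" using lattice by (simp add: even_lattice_def)

lemma DIM_eq: "DIM('v) = 2 + b"
proof -
  obtain V W where VW: "subspace V" "subspace W" "dim V = 2" "dim W = b" "\<forall>x. \<exists>v\<in>V. \<exists>w\<in>W. x = v + w"
    "\<forall>v\<in>V. \<forall>w\<in>W. B v w = 0" "\<forall>v\<in>V. v \<noteq> 0 \<longrightarrow> B v v > 0" "\<forall>w\<in>W. w \<noteq> 0 \<longrightarrow> B w w < 0"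
    using sig unfolding signature_def by (elim exE conjE) (rule that)
  have "V \<inter> W \<subseteq> {0}" 
  proof
    fix x assume "x \<in> V \<inter> W"
    then have "x \<noteq> 0 \<Longrightarrow> B x x > 0" "x \<noteq> 0 \<Longrightarrow> B x x < 0" using VW(7,8) by blast+
    then show "x \<in> {0}" by (cases "x = 0") auto
  qed
  then have "dim (V \<inter> W) = 0" using dim_subset[of "V \<inter> W" "{0}"] by simp
  moreover have "{x + y |x y. x \<in> V \<and> y \<in> W} = UNIV" using VW(5) by blast
  ultimately show ?thesis using dim_sums_Int[OF VW(1,2)] VW(3,4) by (simp del: dim_eq_0)
qed

text \<open>Inertia: otherwise \<open>v\<close>, \<open>X\<close>, \<open>Y\<close> would span a
  three-dimensional space without vectors of negative norm, and for dimension reasons it would meet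
  the negative definite \<open>W\<close> of codimension 2.\<close>

lemma neg_on_orth:
  assumes v: "B v X = 0" "B v Y = 0" "v \<noteq> 0"
  shows "B v v < 0"
proof (rule ccontr)
  assume "\<not> ?thesis"
  then have nn: "B v v \<ge> 0" by simp
  obtain V W where VW: "subspace V" "subspace W" "dim V = 2" "dim W = b" "\<forall>x. \<exists>v\<in>V. \<exists>w\<in>W. x = v + w"
    "\<forall>v\<in>V. \<forall>w\<in>W. B v w = 0" "\<forall>v\<in>V. v \<noteq> 0 \<longrightarrow> B v v > 0" "\<forall>w\<in>W. w \<noteq> 0 \<longrightarrow> B w w < 0"
    using sig unfolding signature_def by (elim exE conjE) (rule that)
  let ?T = "span {v, Y, X}"
  have sX: "\<exists>c. x = c *\<^sub>R X" if "x \<in> span {X}" for x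
    using that by (auto simp: span_singleton)
  have Yn: "Y \<notin> span {X}"
  proof
    assume "Y \<in> span {X}"
    then obtain c where c: "Y = c *\<^sub>R X" using sX by blast
    then have "B X Y = c * q" by (simp add: B_simps B_XY)
    then have "c = 0" using B_XY q_pos by simp
    then show False using c XY_nonzero by simp
  qed
  have sXY: "\<exists>c d. x = c *\<^sub>R X + d *\<^sub>R Y" if "x \<in> span {Y, X}" for x
  proof -
    from that obtain k where "x - k *\<^sub>R Y \<in> span {X}" by (auto simp: span_insert)
    then obtain c where "x - k *\<^sub>R Y = c *\<^sub>R X" using sX by blast
    then have "x = c *\<^sub>R X + k *\<^sub>R Y" by (simp add: algebra_simps)
    then show ?thesis by blast
  qed
  have vn: "v \<notin> span {Y, X}"
  proof
    assume "v \<in> span {Y, X}"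
    then obtain c d where cd: "v = c *\<^sub>R X + d *\<^sub>R Y" using sXY by blast
    then have "B v X = c * q" "B v Y = d * q" by (simp_all add: B_simps B_XY)
    then have "c = 0" "d = 0" using v q_pos by auto
    then show False using cd v by simp
  qed
  have "independent {X}" using XY_nonzero by (simp add: independent_insert independent_empty)
  then have "independent {Y, X}" using Yn by (rule independent_insertI[rotated])
  then have ind: "independent {v, Y, X}" using vn by (rule independent_insertI[rotated])
  have "v \<noteq> Y" "v \<noteq> X" "Y \<noteq> X" 
    using vn Yn span_base[of v "{Y, X}"] span_base[of Y "{X}"] by auto
  then have "dim ?T = 3" using ind by (simp add: dim_eq_card_independent)
  moreover have "dim {x + y |x y. x \<in> ?T \<and> y \<in> W} \<le> 2 + b" 
    using dim_subset_UNIV[of "{x + y |x y. x \<in> ?T \<and> y \<in> W}"] DIM_eq by simp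
  ultimately have "dim (?T \<inter> W) > 0" using dim_sums_Int[OF subspace_span VW(2), of "{v, Y, X}"] VW(4) by linarith
  then have "\<not> ?T \<inter> W \<subseteq> {0}" using dim_eq_0[of "?T \<inter> W"] by linarith
  then obtain w where w: "w \<in> ?T" "w \<in> W" "w \<noteq> 0" by blast
  from w(1) obtain k where "w - k *\<^sub>R v \<in> span {Y, X}" by (auto simp: span_insert[of v "{Y, X}"])
  then obtain c d where "w - k *\<^sub>R v = c *\<^sub>R X + d *\<^sub>R Y" using sXY by blast
  then have weq: "w = k *\<^sub>R v + (c *\<^sub>R X + d *\<^sub>R Y)" by (simp add: algebra_simps)
  have "B X v = 0" "B Y v = 0" using v symB by metis+
  then have "B w w = k * k * B v v + c * c * q + d * d * q" unfolding weq using v by (simp add: B_simps B_XY)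
  also have "\<dots> \<ge> 0" using nn q_pos by (intro add_nonneg_nonneg mult_nonneg_nonneg[of "_ * _"]) auto
  finally show False using VW(8) w by force
qed

lemma PB_pr2: "PB x (pr w) = PB x w"
  using PB_pr[of w x] PB_sym[of x "pr w"] PB_sym[of x w] by simp

lemma orth_rest: "B (x - pr x) X = 0" "B (x - pr x) Y = 0"
  by (simp_all add: B_simps B_pr PB_XY)

lemma nm_alt: "nm x = B (x - pr x) (x - pr x)"
proof -
  have "PB x (x - pr x) = 0" by (simp add: PB_def orth_rest)
  then show ?thesis by (simp add: B_simps(3)[of x] B_simps(4)[of x x] B_pr PB_self nm_def)
qed

lemma nm_neg: "x \<noteq> pr x \<Longrightarrow> nm x < 0"
  unfolding nm_alt using neg_on_orth[OF orth_rest, of x] by simp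

lemma nm_nonpos: "nm x \<le> 0"
  using nm_neg[of x] by (cases "x = pr x") (auto simp: nm_alt B_simps)

text \<open>The weights on the two definite parts stay independent, since they later become
  different complex numbers.\<close>

definition "H s t x w = s * PB x w - t * (B x w - PB x w)"

lemma PB_lin: "PB (x + y) w = PB x w + PB y w" "PB (c *\<^sub>R x) w = c * PB x w"
  by (auto simp: PB_def B_simps add_divide_distrib ring_distribs)

lemma H_self: "H s t x x = s * np x - t * nm x"
  by (simp add: H_def PB_self nm_def)

lemma H_pos_form: assumes "s > 0" "t > 0" shows "pos_form (H s t)"
proof
  show sym: "H s t x w = H s t w x" for x w unfolding H_def using PB_sym symB by metis
  have lin: "linear (\<lambda>x. H s t x w)" for w
    by (rule linearI) (simp_all add: H_def PB_lin B_simps algebra_simps)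
  have eq: "H s t x = (\<lambda>w. H s t w x)" for x using sym by (intro ext)
  have lin': "linear (H s t x)" for x by (subst eq) (rule lin)
  show "bilinear (H s t)" unfolding bilinear_def using lin lin' by blast
  show "H s t x x > 0" if "x \<noteq> 0" for x
  proof (cases "x = pr x")
    case False
    then show ?thesis unfolding H_self using nm_neg[OF False] np_nonneg[of x] assms
      by (smt (verit) mult_nonneg_nonneg mult_pos_neg)
  next
    case True
    then have "np x \<noteq> 0"
    proof -
      have "\<not> (B x X = 0 \<and> B x Y = 0)" using True that by (auto simp: pr_def)
      then show ?thesis using q_pos by (auto simp: np_def add_nonneg_eq_0_iff)
    qed
    moreover have "nm x = 0" using True unfolding nm_alt by (simp add: B_simps)
    ultimately show ?thesis unfolding H_self using np_nonneg[of x] assms by simp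
  qed
qed

definition "Q x = np x - nm x"

lemma Q_eq: "Q x = H 1 1 x x" by (simp add: H_self Q_def)

sublocale Hf: pos_form "H 1 1" by (rule H_pos_form) auto

lemma Q_nonneg: "Q x \<ge> 0" using Q_eq Hf.nonneg by simp

lemma Q_pos: "x \<noteq> 0 \<Longrightarrow> Q x > 0" using Q_eq Hf.pos by simp

text \<open>The involution \<open>J\<close> turns the majorant into \<open>B\<close>.\<close>

definition "J x = 2 *\<^sub>R pr x - x"

lemma H_J: "H 1 1 x w = B (J x) w"
  by (simp add: H_def J_def B_simps B_pr)

lemma J_J: "J (J x) = x"
proof -
  have "pr (pr x) = pr x" unfolding pr_def[of "pr x"] B_pr PB_XY by (simp add: pr_def)
  moreover have "pr (2 *\<^sub>R pr x - x) = 2 *\<^sub>R pr (pr x) - pr x"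
    by (simp add: pr_def B_simps algebra_simps diff_divide_distrib)
  ultimately show ?thesis by (simp add: J_def scaleR_2)
qed

text \<open>Cauchy-Schwarz for the majorant, applied to \<open>J w\<close> and \<open>x\<close>; the
  involution \<open>J\<close> preserves \<open>Q\<close>.\<close>

lemma B_le: "(B x w)\<^sup>2 \<le> Q x * Q w"
proof -
  have "H 1 1 (J w) x = B x w" using H_J[of "J w" x] J_J symB[of x w] by simp
  moreover have "Q (J w) = Q w" unfolding Q_eq using H_J[of "J w" "J w"] J_J[of w] H_J[of w w] symB[of w "J w"] by simp
  ultimately show ?thesis using Hf.cauchy_schwarz[of "J w" x] Q_eq by (metis mult.commute)
qed

lemma nondeg: assumes "\<And>y. B x y = 0" shows "x = 0"
proof (rule ccontr)
  assume "x \<noteq> 0"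
  then have "H 1 1 x x > 0" by (rule Hf.pos)
  moreover have "H 1 1 x x = B x (J x)" using H_J[of x x] symB[of x "J x"] by simp
  ultimately show False using assms by simp
qed

lemma v_minus_iff: "x \<in> v_minus B z \<zeta> Z \<longleftrightarrow> B x X = 0 \<and> B x Y = 0"
proof
  show "x \<in> v_minus B z \<zeta> Z \<Longrightarrow> B x X = 0 \<and> B x Y = 0"
    by (simp add: v_minus_def v_plus_def orth_compl_def X_def Y_def span_base)
  assume a: "B x X = 0 \<and> B x Y = 0"
  have "B x y = 0" if "y \<in> span {X, Y}" for y
    using that by (induction rule: span_induct_alt) (use a in \<open>auto simp: B_simps\<close>)
  then show "x \<in> v_minus B z \<zeta> Z" by (simp add: v_minus_def v_plus_def orth_compl_def X_def Y_def)
qed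

lemma pr_in_plus: "pr x \<in> v_plus B z \<zeta> Z"
  unfolding pr_def v_plus_def X_def[symmetric] Y_def[symmetric]
  by (intro span_add span_scale span_base) auto

text \<open>Uniqueness behind the description by \<open>THE\<close>: the difference of two
  candidates lies in v_+ and in its complement, so it has norm 0 in a negative definite
  space.\<close>

lemma norm_plus_eq: "norm_plus B z \<zeta> Z x = np x"
proof -
  have "orth_proj B (v_plus B z \<zeta> Z) x = pr x"
    unfolding orth_proj_def
  proof (rule the_equality)
    show "pr x \<in> v_plus B z \<zeta> Z \<and> x - pr x \<in> orth_compl B (v_plus B z \<zeta> Z)"
      using pr_in_plus v_minus_iff[of "x - pr x"] orth_rest by (auto simp: v_minus_def)
    fix u assume u: "u \<in> v_plus B z \<zeta> Z \<and> x - u \<in> orth_compl B (v_plus B z \<zeta> Z)"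
    then have xu: "B (x - u) X = 0" "B (x - u) Y = 0" using v_minus_iff[of "x - u"] by (auto simp: v_minus_def)
    have "u - pr x \<in> v_plus B z \<zeta> Z" using u pr_in_plus[of x] unfolding v_plus_def by (intro span_diff) auto
    moreover have w: "u - pr x \<in> v_minus B z \<zeta> Z"
      using xu orth_rest[of x] unfolding v_minus_iff by (simp add: B_simps)
    ultimately have "B (u - pr x) (u - pr x) = 0" unfolding v_minus_def orth_compl_def by blast
    then show "u = pr x" using neg_on_orth[of "u - pr x"] w unfolding v_minus_iff by auto
  qed
  then show ?thesis unfolding norm_plus_def by (simp add: B_pr PB_pr2 PB_self)
qed

lemma norm_minus_eq: "norm_minus B z \<zeta> Z x = nm x"
proof -
  have "orth_proj B (v_minus B z \<zeta> Z) x = x - pr x"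
    unfolding orth_proj_def
  proof (rule the_equality)
    have "B (pr x) v = 0" if "v \<in> v_minus B z \<zeta> Z" for v
      using that unfolding v_minus_iff B_pr PB_def by simp
    then show a: "x - pr x \<in> v_minus B z \<zeta> Z \<and> x - (x - pr x) \<in> orth_compl B (v_minus B z \<zeta> Z)"
      using orth_rest[of x] unfolding v_minus_iff by (auto simp: orth_compl_def v_minus_iff)
    fix u assume u: "u \<in> v_minus B z \<zeta> Z \<and> x - u \<in> orth_compl B (v_minus B z \<zeta> Z)"
    let ?w = "u - (x - pr x)"
    have w: "?w \<in> v_minus B z \<zeta> Z" using u a unfolding v_minus_iff by (auto simp: B_simps)
    moreover have "x - (x - pr x) - (x - u) = ?w" by simp
    moreover have "B (x - (x - pr x)) v = 0" "B (x - u) v = 0" if "v \<in> v_minus B z \<zeta> Z" for v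
      using u a that by (auto simp: orth_compl_def)
    ultimately have "B ?w ?w = 0" by (metis B_simps(3) diff_self)
    then show "u = x - pr x" using neg_on_orth[of ?w] w unfolding v_minus_iff by auto
  qed
  then show ?thesis unfolding norm_minus_def by (simp add: nm_alt)
qed

lemma form_ZV: "cpx_form B (cpx_emb x) (ZV B z \<zeta> Z) = Complex (B x X) (B x Y)"
  by (simp add: cpx_form_def cpx_emb_def X_def Y_def B_simps)

lemma form_ZV_cnj: "cpx_form B (cpx_emb x) (cpx_cnj (ZV B z \<zeta> Z)) = cnj (Complex (B x X) (B x Y))"
  by (simp add: cpx_form_def cpx_emb_def cpx_cnj_def X_def Y_def B_simps complex_eq_iff)

definition "pZ x = Complex (B x X) (B x Y)"

lemma norm_pZ: "(norm (pZ x))\<^sup>2 = q * np x"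
  using q_pos by (simp add: pZ_def np_def cmod_power2)

section \<open>Lattice basis, dual lattice and discriminant group\<close>

definition "bs = (SOME bs. independent bs \<and> span bs = UNIV \<and> L = zspan bs)"

lemma bs: "independent bs" "span bs = UNIV" "L = zspan bs" "finite bs"
proof -
  have "\<exists>bs. independent bs \<and> span bs = UNIV \<and> L = zspan bs"
    using lattice unfolding even_lattice_def lattice_in_def zspan_def by blast
  from someI_ex[OF this] show 1: "independent bs" "span bs = UNIV" "L = zspan bs" by (auto simp: bs_def)
  show "finite bs" using 1(1) by (rule independent_imp_finite)
qed

lemma L_iff: "x \<in> L \<longleftrightarrow> (\<exists>c :: 'v \<Rightarrow> int. x = (\<Sum>v\<in>bs. of_int (c v) *\<^sub>R v))"
  by (subst bs(3)) (auto simp: zspan_def)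

lemma card_bs: "card bs = 2 + b"
  using bs dim_eq_card_independent[of bs] DIM_eq by (metis dim_UNIV dim_span)

lemma bs_in_L: "v \<in> bs \<Longrightarrow> v \<in> L"
  unfolding L_iff
proof (rule exI[of _ "\<lambda>w. if w = v then 1 else 0"])
  assume "v \<in> bs"
  then have "v = (\<Sum>w\<in>bs. if w = v then v else 0)" using bs(4) by simp
  also have "\<dots> = (\<Sum>w\<in>bs. of_int (if w = v then 1 else 0) *\<^sub>R w)" by (rule sum.cong) auto
  finally show "v = (\<Sum>w\<in>bs. of_int (if w = v then 1 else 0) *\<^sub>R w)" .
qed

abbreviation "Ld \<equiv> dual_lattice B L"

lemma dual_iff: "x \<in> Ld \<longleftrightarrow> (\<forall>v\<in>bs. B x v \<in> \<int>)"
proof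
  show "x \<in> Ld \<Longrightarrow> \<forall>v\<in>bs. B x v \<in> \<int>" using bs_in_L by (auto simp: dual_lattice_def)
  have lin: "B x (sum f A) = (\<Sum>v\<in>A. B x (f v))" for f A
    by (induction A rule: infinite_finite_induct) (auto simp: B_simps)
  assume "\<forall>v\<in>bs. B x v \<in> \<int>"
  then show "x \<in> Ld" unfolding dual_lattice_def
    by (auto simp: L_iff lin B_simps intro!: Ints_sum Ints_mult)
qed

lemma B_int: "x \<in> Ld \<Longrightarrow> y \<in> L \<Longrightarrow> B x y \<in> \<int>" by (simp add: dual_lattice_def)

lemma L_sub_Ld: "L \<subseteq> Ld"
  using lattice by (auto simp: dual_lattice_def even_lattice_def)

lemma L_even: "x \<in> L \<Longrightarrow> B x x / 2 \<in> \<int>"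
  using lattice by (force simp: even_lattice_def)

lemma L_closed: "0 \<in> L" "x \<in> L \<Longrightarrow> y \<in> L \<Longrightarrow> x + y \<in> L" "x \<in> L \<Longrightarrow> - x \<in> L"
  using zspan_zero[of bs, folded bs(3)] zspan_add[of x bs y, folded bs(3)] zspan_uminus[of x bs, folded bs(3)] by auto

lemma Ld_closed: "0 \<in> Ld" "x \<in> Ld \<Longrightarrow> y \<in> Ld \<Longrightarrow> x + y \<in> Ld" "x \<in> Ld \<Longrightarrow> - x \<in> Ld" "x \<in> Ld \<Longrightarrow> y \<in> Ld \<Longrightarrow> x - y \<in> Ld"
  by (auto simp: dual_lattice_def B_simps)

lemma coset_eq_iff: "lat_coset L x = lat_coset L y \<longleftrightarrow> x - y \<in> L"
proof
  assume "lat_coset L x = lat_coset L y"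
  moreover have "x \<in> lat_coset L x" using L_closed(1) by (force simp: lat_coset_def)
  ultimately obtain l where "l \<in> L" "x = y + l" by (auto simp: lat_coset_def)
  then show "x - y \<in> L" by simp
next
  assume a: "x - y \<in> L"
  then have a': "y - x \<in> L" using L_closed(3) by fastforce
  have "w \<in> lat_coset L y" if "w \<in> lat_coset L x" "x - y \<in> L" for w x y
  proof -
    from that obtain l where "l \<in> L" "w = x + l" by (auto simp: lat_coset_def)
    then have "w = y + (x - y + l)" "x - y + l \<in> L" using that L_closed by auto
    then show ?thesis unfolding lat_coset_def by (rule image_eqI)
  qed
  then show "lat_coset L x = lat_coset L y" using a a' by blast
qed

lemma mem_coset: "w \<in> lat_coset L x \<longleftrightarrow> w - x \<in> L"
  unfolding lat_coset_def by (auto simp: image_iff) (metis add.commute diff_add_cancel)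

lemma coset_sub_Ld: "x \<in> Ld \<Longrightarrow> lat_coset L x \<subseteq> Ld"
  using L_sub_Ld Ld_closed by (auto simp: lat_coset_def)

text \<open>From \<open>v\<close> its majorant projection to the other basis vectors is removed;
  \<open>J\<close> turns orthogonality for the majorant into orthogonality for
  \<open>B\<close>.\<close>

lemma dual_basis:
  assumes "v \<in> bs"
  shows "\<exists>v'. B v' v = 1 \<and> (\<forall>w\<in>bs. w \<noteq> v \<longrightarrow> B v' w = 0)"
proof -
  obtain p where p: "p \<in> span (bs - {v})" "\<forall>c\<in>span (bs - {v}). H 1 1 (v - p) c = 0"
    using Hf.projection[of "bs - {v}" v] bs(4) by auto
  have "v \<notin> span (bs - {v})" using bs(1) assms unfolding dependent_def by blast
  then have "v - p \<noteq> 0" using p(1) by auto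
  then have pos: "H 1 1 (v - p) (v - p) > 0" by (rule Hf.pos)
  moreover have "H 1 1 (v - p) v = H 1 1 (v - p) (v - p)" using p by (simp add: Hf.h_simps)
  ultimately have pos': "H 1 1 (v - p) v > 0" by simp
  let ?v = "(1 / H 1 1 (v - p) v) *\<^sub>R J (v - p)"
  have "B ?v v = 1" using pos' by (simp add: B_simps H_J)
  moreover have "B ?v w = 0" if "w \<in> bs" "w \<noteq> v" for w
    using p(2) span_base[of w "bs - {v}"] that by (simp add: B_simps H_J[symmetric])
  ultimately show ?thesis by blast
qed

text \<open>Pairing with the dual basis reads off the coefficients of \<open>x\<close>.\<close>

lemma bidual: assumes "\<And>y. y \<in> Ld \<Longrightarrow> B y x \<in> \<int>" shows "x \<in> L"
proof -
  have "x \<in> span bs" using bs by simp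
  then obtain c where c: "x = (\<Sum>v\<in>bs. c v *\<^sub>R v)" using bs(4) by (auto simp: span_finite)
  have lin: "B y (sum f A) = (\<Sum>v\<in>A. B y (f v))" for f A y
    by (induction A rule: infinite_finite_induct) (auto simp: B_simps)
  have "c v \<in> \<int>" if v: "v \<in> bs" for v
  proof -
    obtain v' where v': "B v' v = 1" "\<forall>w\<in>bs. w \<noteq> v \<longrightarrow> B v' w = 0" using dual_basis[OF v] by blast
    have "v' \<in> Ld" unfolding dual_iff
    proof
      fix w assume "w \<in> bs"
      then show "B v' w \<in> \<int>" using v' by (cases "w = v") auto
    qed
    then have "B v' x \<in> \<int>" by (rule assms)
    moreover have "B v' x = c v"
    proof -
      have "B v' x = (\<Sum>w\<in>bs. c w * B v' w)" unfolding c lin by (simp add: B_simps)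
      also have "\<dots> = (\<Sum>w\<in>{v}. c w * B v' w)"
        using bs(4) v v'(2) by (intro sum.mono_neutral_right) auto
      finally show ?thesis using v'(1) by simp
    qed
    ultimately show ?thesis by simp
  qed
  then have "\<forall>v\<in>bs. \<exists>n::int. c v = of_int n" by (auto elim: Ints_cases)
  then obtain n :: "'v \<Rightarrow> int" where n: "\<And>v. v \<in> bs \<Longrightarrow> c v = of_int (n v)" by metis
  have "x = (\<Sum>v\<in>bs. of_int (n v) *\<^sub>R v)" unfolding c using n by (intro sum.cong) auto
  then show ?thesis unfolding L_iff by blast
qed

text \<open>On the dual lattice the pairings with the basis are integers, so the floor only makes
  the map total. It embeds \<open>Ld\<close> into integer vectors, where counting and convergence
  are elementary.\<close>

definition "coord x = (\<lambda>v\<in>bs. \<lfloor>B x v\<rfloor>)"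

lemma coord: "x \<in> Ld \<Longrightarrow> v \<in> bs \<Longrightarrow> of_int (coord x v) = B x v"
  unfolding dual_iff coord_def by (auto elim!: ballE Ints_cases)

lemma B_eq_on_bs: assumes "\<And>v. v \<in> bs \<Longrightarrow> B x v = B y v" shows "x = y"
proof -
  have "B (x - y) w = 0" for w
  proof -
    have "w \<in> span bs" using bs by simp
    then show ?thesis
      by (induction rule: span_induct_alt) (use assms in \<open>auto simp: B_simps\<close>)
  qed
  then show ?thesis using nondeg[of "x - y"] by simp
qed

lemma coord_inj: "inj_on coord Ld"
  by (rule inj_onI, rule B_eq_on_bs) (metis coord)

lemma coord_PiE: "coord ` A \<subseteq> PiE bs (\<lambda>_. UNIV)" by (auto simp: coord_def)

lemma countable_Ld: "countable Ld"
proof -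
  have "countable (PiE bs (\<lambda>_. UNIV :: int set))" using bs(4) by (intro countable_PiE) auto
  then have "countable (coord ` Ld)" using coord_PiE countable_subset by blast
  then show ?thesis using coord_inj countable_image_inj_on by blast
qed

text \<open>By \<open>B_le\<close>, a bound on \<open>Q\<close> confines the integer coordinates to
  a box.\<close>

lemma Q_finite: "finite {x \<in> Ld. Q x \<le> R}"
proof (rule finite_imageD[OF _ inj_on_subset[OF coord_inj]])
  define M where "M = Max (insert 1 (Q ` bs))"
  have M: "Q v \<le> M" "M \<ge> 1" if "v \<in> bs" for v using bs(4) that by (auto simp: M_def)
  let ?N = "\<lceil>\<bar>R\<bar> * M + 1\<rceil>"
  have "coord x \<in> PiE bs (\<lambda>_. {- ?N..?N})" if x: "x \<in> Ld" "Q x \<le> R" for x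
  proof (rule PiE_I)
    fix v assume v: "v \<in> bs"
    have "(B x v)\<^sup>2 \<le> Q x * Q v" by (rule B_le)
    also have "\<dots> \<le> \<bar>R\<bar> * M" using x M[OF v] Q_nonneg by (intro mult_mono) auto
    finally have "(B x v)\<^sup>2 \<le> \<bar>R\<bar> * M" .
    moreover have "\<bar>B x v\<bar> \<le> (B x v)\<^sup>2 + 1"
    proof -
      have "0 \<le> (\<bar>B x v\<bar> - 1/2)\<^sup>2" by simp
      then show ?thesis by (simp add: power2_eq_square algebra_simps)
    qed
    ultimately have "\<bar>of_int (coord x v)\<bar> \<le> \<bar>R\<bar> * M + 1" using coord[OF x(1) v] by simp
    then have "\<bar>real_of_int (coord x v)\<bar> \<le> of_int ?N" using le_of_int_ceiling[of "\<bar>R\<bar> * M + 1"] by linarith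
    then show "coord x v \<in> {- ?N..?N}" by (simp add: abs_le_iff)
  qed (auto simp: coord_def)
  then have "coord ` {x \<in> Ld. Q x \<le> R} \<subseteq> PiE bs (\<lambda>_. {- ?N..?N})" by auto
  then show "finite (coord ` {x \<in> Ld. Q x \<le> R})"
    by (rule finite_subset) (simp add: finite_PiE bs(4))
qed auto

text \<open>The decay is distributed evenly over the \<open>2 + b\<close> coordinates: each factor
  has exponent \<open>e = 2 * p / n > 1\<close>, so a product of one-dimensional series
  dominates.\<close>

lemma Q_summable:
  assumes p: "p > real (2 + b) / 2"
  shows "(\<lambda>x. (1 + Q x) powr (-p)) summable_on Ld"
proof -
  define n where "n = real (2 + b)"
  define e where "e = 2 * p / n"
  have n: "n > 0" by (simp add: n_def)
  have e: "e > 1" using p n by (simp add: e_def n_def field_simps)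
  define M where "M = Max (insert 1 (Q ` bs))"
  have M: "Q v \<le> M" "M \<ge> 1" if "v \<in> bs" for v using bs(4) that by (auto simp: M_def)
  have M1: "M \<ge> 1" using bs(4) by (auto simp: M_def)
  let ?f = "\<lambda>k::int. (1 + \<bar>real_of_int k\<bar>) powr (-e)"
  have "(\<lambda>g. \<Prod>v\<in>bs. ?f (g v)) abs_summable_on PiE bs (\<lambda>_. UNIV)"
    unfolding abs_summable_equivalent
    by (rule abs_summable_on_prod_PiE) (use bs(4) summable_on_int_powr[OF e] in \<open>auto simp: abs_summable_equivalent[symmetric]\<close>)
  then have "(\<lambda>g. \<Prod>v\<in>bs. ?f (g v)) summable_on PiE bs (\<lambda>_. UNIV)" by (rule abs_summable_summable)
  then have "(\<lambda>g. \<Prod>v\<in>bs. ?f (g v)) summable_on coord ` Ld" using coord_PiE by (rule summable_on_subset)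
  then have "(\<lambda>x. \<Prod>v\<in>bs. ?f (coord x v)) summable_on Ld"
    using summable_on_reindex[OF coord_inj, of "\<lambda>g. \<Prod>v\<in>bs. ?f (g v)"] by (simp add: o_def)
  then have "(\<lambda>x. (2 * M) powr p * (\<Prod>v\<in>bs. ?f (coord x v))) summable_on Ld" by (rule summable_on_cmult_right)
  then show ?thesis
  proof (rule summable_on_comparison_test)
    fix x assume x: "x \<in> Ld"
    have Q1: "1 + Q x > 0" using Q_nonneg[of x] by simp
    have b1: "(1 + Q x) powr (- p / n) \<le> (2 * M) powr (p / n) * ?f (coord x v)" if v: "v \<in> bs" for v
    proof -
      have "(1 + \<bar>B x v\<bar>)\<^sup>2 \<le> 2 * (1 + (B x v)\<^sup>2)"
        using zero_le_power2[of "\<bar>B x v\<bar> - 1"] by (simp add: power2_eq_square algebra_simps)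
      also have "\<dots> \<le> 2 * (M * (1 + Q x))"
      proof -
        have "(B x v)\<^sup>2 \<le> Q x * M" using B_le[of x v] M(1)[OF v] Q_nonneg[of x]
          by (meson mult_left_mono order_trans)
        then show ?thesis using M1 by (simp add: algebra_simps)
      qed
      finally have "(1 + \<bar>B x v\<bar>)\<^sup>2 \<le> (2 * M) * (1 + Q x)" by simp
      then have "((1 + \<bar>B x v\<bar>)\<^sup>2) powr (p / n) \<le> ((2 * M) * (1 + Q x)) powr (p / n)"
        using p n by (intro powr_mono2) (auto simp: n_def)
      also have "((1 + \<bar>B x v\<bar>)\<^sup>2) powr (p / n) = (1 + \<bar>B x v\<bar>) powr e"
        unfolding e_def by (simp add: powr_powr flip: powr_numeral)
      also have "((2 * M) * (1 + Q x)) powr (p / n) = (2 * M) powr (p / n) * (1 + Q x) powr (p / n)"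
        using M1 Q1 by (simp add: powr_mult)
      finally have "(1 + \<bar>B x v\<bar>) powr e \<le> (2 * M) powr (p / n) * (1 + Q x) powr (p / n)" .
      then show ?thesis using Q1 coord[OF x v] by (simp add: powr_minus field_simps add_pos_nonneg)
    qed
    have "(1 + Q x) powr (- p) = (\<Prod>v\<in>bs. (1 + Q x) powr (- p / n))"
    proof -
      have "(1 + Q x) powr (- p) = (1 + Q x) powr (real (2 + b) * (- p / n))" using n by (simp add: n_def)
      also have "\<dots> = ((1 + Q x) powr (- p / n)) ^ (2 + b)" by (rule powr_power[symmetric]) (use Q1 in simp)
      finally show ?thesis unfolding prod_constant card_bs .
    qed
    also have "\<dots> \<le> (\<Prod>v\<in>bs. (2 * M) powr (p / n) * ?f (coord x v))"
      using b1 by (intro prod_mono) auto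
    also have "\<dots> = (2 * M) powr p * (\<Prod>v\<in>bs. ?f (coord x v))"
    proof -
      have "(2 * M) powr p = (2 * M) powr (real (2 + b) * (p / n))" using n by (simp add: n_def)
      also have "\<dots> = ((2 * M) powr (p / n)) ^ (2 + b)" by (rule powr_power[symmetric]) (use M1 in simp)
      finally show ?thesis unfolding prod.distrib prod_constant card_bs by simp
    qed
    finally show "(1 + Q x) powr (- p) \<le> (2 * M) powr p * (\<Prod>v\<in>bs. ?f (coord x v))" .
  qed auto
qed

abbreviation "DL \<equiv> disc_group B L"

text \<open>Every class has a representative whose coordinates in \<open>bs\<close> are fractional
  parts; the triangle inequality bounds its \<open>Q\<close>, and \<open>Q_finite\<close>
  applies.\<close>

lemma finite_DL: "finite DL"
proof -
  define M where "M = (\<Sum>v\<in>bs. sqrt (Q v))"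
  have "\<exists>y\<in>{y \<in> Ld. Q y \<le> M\<^sup>2}. lat_coset L y = lat_coset L x" if x: "x \<in> Ld" for x
  proof -
    have "x \<in> span bs" using bs by simp
    then obtain c where c: "x = (\<Sum>v\<in>bs. c v *\<^sub>R v)" using bs(4) by (auto simp: span_finite)
    let ?l = "\<Sum>v\<in>bs. of_int \<lfloor>c v\<rfloor> *\<^sub>R v" and ?y = "\<Sum>v\<in>bs. frac (c v) *\<^sub>R v"
    have l: "?l \<in> L" unfolding L_iff by (rule exI[of _ "\<lambda>v. \<lfloor>c v\<rfloor>"]) simp
    have xy: "x = ?y + ?l" unfolding c sum.distrib[symmetric] scaleR_left_distrib[symmetric]
      by (simp add: frac_def)
    have y: "?y \<in> Ld" using Ld_closed(4)[OF x, of ?l] l L_sub_Ld xy by auto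
    have tri: "sqrt (Q (u + w)) \<le> sqrt (Q u) + sqrt (Q w)" for u w
    proof -
      have "\<bar>H 1 1 u w\<bar> \<le> sqrt (Q u) * sqrt (Q w)"
        using Hf.cauchy_schwarz[of u w] unfolding Q_eq[symmetric] real_sqrt_mult[symmetric]
        by (rule real_le_rsqrt[of "\<bar>H 1 1 u w\<bar>", unfolded power2_abs])
      then have "Q (u + w) \<le> (sqrt (Q u) + sqrt (Q w))\<^sup>2"
        using Q_nonneg Hf.sym[of w u] unfolding Q_eq Hf.h_simps(1,2) unfolding Q_eq[symmetric]
        by (simp add: power2_sum)
      then show ?thesis using Q_nonneg by (intro real_le_lsqrt) auto
    qed
    have "sqrt (Q (\<Sum>v\<in>A. frac (c v) *\<^sub>R v)) \<le> (\<Sum>v\<in>A. sqrt (Q v))" if "finite A" for A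
      using that
    proof induction
      case empty then show ?case by (simp add: Q_eq Hf.h_simps)
    next
      case (insert a A)
      have "sqrt (Q (frac (c a) *\<^sub>R a)) = frac (c a) * sqrt (Q a)"
        by (simp add: Q_eq Hf.h_simps real_sqrt_mult mult.assoc[symmetric])
      also have "\<dots> \<le> 1 * sqrt (Q a)" using frac_lt_1[of "c a"] Q_nonneg[of a] by (intro mult_right_mono) auto
      finally have "sqrt (Q (frac (c a) *\<^sub>R a)) \<le> sqrt (Q a)" by simp
      from order_trans[OF tri add_mono[OF this insert.IH]] show ?case unfolding sum.insert[OF insert.hyps] .
    qed
    from this[OF bs(4)] have "sqrt (Q ?y) \<le> M" by (simp add: M_def)
    then have "(sqrt (Q ?y))\<^sup>2 \<le> M\<^sup>2" using Q_nonneg by (intro power_mono) auto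
    then have "Q ?y \<le> M\<^sup>2" using Q_nonneg by simp
    moreover have "lat_coset L ?y = lat_coset L x"
    proof -
      have "?y - x = - ?l" by (subst xy) simp
      then show ?thesis unfolding coset_eq_iff using L_closed(3)[OF l] by (simp only:)
    qed
    ultimately show ?thesis using y by blast
  qed
  then have "lat_coset L x \<in> lat_coset L ` {y \<in> Ld. Q y \<le> M\<^sup>2}" if "x \<in> Ld" for x
    using that by (metis (no_types, lifting) imageI)
  then have "DL \<subseteq> lat_coset L ` {y \<in> Ld. Q y \<le> M\<^sup>2}" unfolding disc_group_def by (rule image_subsetI)
  then show ?thesis using Q_finite finite_surj by blast
qed

definition "rep c = (SOME \<delta>. \<delta> \<in> c)"

lemma rep: assumes "c \<in> DL" shows "rep c \<in> Ld" "lat_coset L (rep c) = c" "rep c \<in> c"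
proof -
  obtain x where x: "x \<in> Ld" "c = lat_coset L x" using assms by (auto simp: disc_group_def)
  have "x \<in> c" using x L_closed(1) by (simp add: mem_coset)
  then show r: "rep c \<in> c" unfolding rep_def by (rule someI)
  show "rep c \<in> Ld" using r x coset_sub_Ld by blast
  show "lat_coset L (rep c) = c" using r unfolding x(2) coset_eq_iff mem_coset .
qed

lemma ee_eqI: "x - y \<in> \<int> \<Longrightarrow> ee (of_real x) = ee (of_real y)"
proof -
  assume "x - y \<in> \<int>"
  then obtain n :: int where "x - y = of_int n" by (auto elim: Ints_cases)
  then have "x = y + of_int n" by simp
  then show ?thesis by (simp add: ee_add)
qed

lemma ee_pair_cong: "g \<in> Ld \<Longrightarrow> x - y \<in> L \<Longrightarrow> ee (of_real (B g x)) = ee (of_real (B g y))"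
  by (rule ee_eqI) (use B_int[of g "x - y"] in \<open>simp add: B_simps\<close>)

text \<open>For \<open>d\<close> outside \<open>L\<close>, \<open>bidual\<close> supplies a
  \<open>g\<close> at which the character is not 1; translating the sum by \<open>g\<close>
  multiplies it by that value.\<close>

lemma char_sum:
  assumes d: "d \<in> Ld"
  shows "(\<Sum>c\<in>DL. ee (of_real (B d (rep c)))) = (if d \<in> L then of_nat (card DL) else 0)"
proof (cases "d \<in> L")
  case True
  have "ee (of_real (B d (rep c))) = 1" if "c \<in> DL" for c
    using ee_eqI[of "B d (rep c)" 0] B_int[OF rep(1)[OF that] True] symB[of d "rep c"] by (simp add: ee_def)
  then show ?thesis using True by simp
next
  case False
  then obtain g where g: "g \<in> Ld" "B g d \<notin> \<int>" using bidual by blast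
  let ?T = "\<lambda>c. lat_coset L (rep c + g)"
  have Tin: "?T c \<in> DL" if "c \<in> DL" for c
    using rep[OF that] g Ld_closed by (auto simp: disc_group_def)
  have inj: "inj_on ?T DL"
  proof (rule inj_onI)
    fix c c' assume c: "c \<in> DL" "c' \<in> DL" "?T c = ?T c'"
    then have "rep c - rep c' \<in> L" by (simp add: coset_eq_iff)
    then show "c = c'" using rep(2)[OF c(1)] rep(2)[OF c(2)] coset_eq_iff by metis
  qed
  have bij: "bij_betw ?T DL DL"
    using inj Tin finite_DL by (simp add: bij_betw_def endo_inj_surj image_subsetI)
  let ?S = "\<Sum>c\<in>DL. ee (of_real (B d (rep c)))"
  have "?S = (\<Sum>c\<in>DL. ee (of_real (B d (rep (?T c)))))" using sum.reindex_bij_betw[OF bij, symmetric] .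
  also have "\<dots> = (\<Sum>c\<in>DL. ee (of_real (B d g)) * ee (of_real (B d (rep c))))"
  proof (rule sum.cong[OF refl])
    fix c assume c: "c \<in> DL"
    have "rep (?T c) - (rep c + g) \<in> L" using rep(3)[OF Tin[OF c]] unfolding mem_coset .
    from ee_pair_cong[OF d this] show "ee (of_real (B d (rep (?T c)))) = ee (of_real (B d g)) * ee (of_real (B d (rep c)))"
      by (simp add: B_simps ee_add mult.commute)
  qed
  also have "\<dots> = ee (of_real (B d g)) * ?S" by (simp add: sum_distrib_left)
  finally have "(1 - ee (of_real (B d g))) * ?S = 0" by (simp add: algebra_simps)
  moreover have "ee (of_real (B d g)) \<noteq> 1"
  proof
    assume "ee (of_real (B d g)) = 1"
    then obtain n :: int where "2 * pi * B d g = of_int (2 * n) * pi"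
      by (auto simp: ee_def exp_eq_1)
    then have "B d g = of_int n" by simp
    then show False using g symB by (metis Ints_of_int)
  qed
  ultimately show ?thesis using False by simp
qed

end

section \<open>Analytic continuation of exponential sums\<close>

text \<open>On a disc of radius \<open>e\<close> around \<open>z0\<close>,
  \<open>exp (Re z * l i)\<close> is at most the sum of its values at \<open>z0 + e\<close> and
  \<open>z0 - e\<close>. Summability at these two points yields a majorant for the whole disc, hence
  locally uniform convergence.\<close>

lemma exp_sum_holomorphic:
  fixes c :: "'i \<Rightarrow> complex" and l :: "'i \<Rightarrow> real"
  assumes S: "open S"
    and sum: "\<And>z. z \<in> S \<Longrightarrow> (\<lambda>i. norm (c i) * exp (Re z * l i)) summable_on A"
  shows "(\<lambda>z. \<Sum>\<^sub>\<infinity>i\<in>A. c i * exp (z * of_real (l i))) holomorphic_on S"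
proof -
  let ?f = "\<lambda>z. \<Sum>\<^sub>\<infinity>i\<in>A. c i * exp (z * of_real (l i))"
  have "?f field_differentiable (at z0)" if z0: "z0 \<in> S" for z0
  proof -
    obtain e where e: "e > 0" "cball z0 e \<subseteq> S" using S z0 open_contains_cball by blast
    have mem: "z0 + of_real e \<in> S" "z0 - of_real e \<in> S"
      using e by (auto simp: dist_norm intro!: subsetD[OF e(2)])
    let ?g = "\<lambda>i. norm (c i) * exp (Re (z0 + of_real e) * l i) + norm (c i) * exp (Re (z0 - of_real e) * l i)"
    have g: "?g summable_on A" by (intro summable_on_add sum mem)
    have ul: "uniform_limit (cball z0 e) (\<lambda>F z. \<Sum>i\<in>F. c i * exp (z * of_real (l i))) ?f (finite_subsets_at_top A)"
    proof (rule Weierstrass_m_test_general[OF _ g])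
      fix i z assume z: "z \<in> cball z0 e"
      have "\<bar>Re z - Re z0\<bar> \<le> e" using z abs_Re_le_cmod[of "z - z0"] by (simp add: dist_norm norm_minus_commute)
      then have a: "Re z0 - e \<le> Re z" "Re z \<le> Re z0 + e" by linarith+
      have "exp (Re z * l i) \<le> exp (Re (z0 + of_real e) * l i) + exp (Re (z0 - of_real e) * l i)"
      proof (cases "l i \<ge> 0")
        case True
        then have "Re z * l i \<le> Re (z0 + of_real e) * l i" using a by (intro mult_right_mono) auto
        then show ?thesis by (smt (verit) exp_gt_zero exp_le_cancel_iff)
      next
        case False
        then have "Re z * l i \<le> Re (z0 - of_real e) * l i" using a by (intro mult_right_mono_neg) auto
        then show ?thesis by (smt (verit) exp_gt_zero exp_le_cancel_iff)
      qed
      from mult_left_mono[OF this, of "norm (c i)"] show "norm (c i * exp (z * of_real (l i))) \<le> ?g i"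
        by (simp add: norm_mult distrib_left)
    qed
    have "?f holomorphic_on ball z0 e"
      by (rule holomorphic_uniform_limit[OF _ ul])
         (auto intro!: eventually_finite_subsets_at_top_weakI holomorphic_intros continuous_intros)
    then show ?thesis using e by (auto simp: holomorphic_on_def at_within_open[OF _ open_ball] dest!: bspec[of _ _ z0])
  qed
  then show ?thesis by (simp add: holomorphic_on_def field_differentiable_at_within)
qed

lemma real_line_continuation:
  assumes hol: "f holomorphic_on S" "g holomorphic_on S" and S: "open S" "connected S"
    and x: "of_real x0 \<in> S" and eq: "\<And>x. of_real x \<in> S \<Longrightarrow> f (of_real x) = g (of_real x)" and w: "w \<in> S"
  shows "f w = (g w :: complex)"
proof -
  let ?U = "S \<inter> range complex_of_real"
  have "of_real x0 islimpt ?U"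
    unfolding islimpt_approachable
  proof (intro allI impI)
    fix e :: real assume e: "e > 0"
    obtain d where d: "d > 0" "ball (of_real x0) d \<subseteq> S" using S x open_contains_ball by blast
    let ?y = "x0 + min d e / 2"
    have "of_real ?y \<in> S" using d e by (intro subsetD[OF d(2)]) (auto simp: dist_norm simp flip: of_real_diff of_real_add)
    moreover have "dist (complex_of_real ?y) (of_real x0) < e" "complex_of_real ?y \<noteq> of_real x0" using d e 
      by (auto simp: dist_norm simp flip: of_real_diff of_real_add)
    ultimately show "\<exists>x'\<in>?U. x' \<noteq> complex_of_real x0 \<and> dist x' (complex_of_real x0) < e" by blast
  qed
  then have "(\<lambda>z. f z - g z) w = 0"
    by (rule analytic_continuation[rotated 5]) (use hol S x w eq in \<open>auto intro!: holomorphic_intros\<close>)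
  then show ?thesis by simp
qed

lemma power_series_coeff_unique:
  fixes a :: "nat \<Rightarrow> complex"
  assumes "\<And>z. (\<lambda>n. a n * z ^ n) sums 0"
  shows "a m = 0"
proof (cases "m = 0")
  case True
  have "(\<lambda>n. a n * 0 ^ n) sums 0" by (rule assms)
  then show ?thesis using True by (simp add: powser_sums_zero_iff)
next
  case False
  show ?thesis
  proof (rule ccontr)
    assume m: "a m \<noteq> 0"
    obtain s where s: "0 < s" "\<And>z. z \<in> cball (0::complex) s - {0} \<Longrightarrow> (\<lambda>_. 0::complex) z \<noteq> 0"
      by (rule powser_0_nonzero[of 1 "0::complex" a "\<lambda>_. 0" m]) (use assms m False in auto)
    from s(2)[of "of_real s"] s(1) show False by (auto simp: dist_norm)
  qed
qed

lemma exp_sum_power_series: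
  fixes a p :: "'i \<Rightarrow> complex"
  assumes sum: "\<And>t. (\<lambda>i. norm (a i) * exp (t * norm (p i))) summable_on A"
  shows "(\<lambda>n. (\<Sum>\<^sub>\<infinity>i\<in>A. a i * p i ^ n) / fact n * c ^ n) sums (\<Sum>\<^sub>\<infinity>i\<in>A. a i * exp (c * p i))"
proof -
  let ?F = "\<lambda>(i, n). a i * ((c * p i) ^ n / fact n)"
  have e: "((\<lambda>n. w ^ n / fact n) has_sum exp w) UNIV" "((\<lambda>n. norm (w ^ n / fact n)) has_sum exp (norm w)) UNIV" for w :: complex
  proof -
    have 1: "(\<lambda>n. norm w ^ n / fact n) sums exp (norm w)" using exp_converges[of "norm w"] by (simp add: divide_inverse mult.commute)
    show 2: "((\<lambda>n. norm (w ^ n / fact n)) has_sum exp (norm w)) UNIV"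
      using 1 by (intro sums_nonneg_imp_has_sum) (auto simp: norm_divide norm_power)
    have "(\<lambda>n. w ^ n / fact n) sums exp w" using exp_converges[of w] by (simp add: scaleR_conv_of_real divide_inverse mult.commute)
    then show "((\<lambda>n. w ^ n / fact n) has_sum exp w) UNIV"
      using 2 by (intro norm_summable_imp_has_sum) (auto intro: summable_on_imp_summable has_sum_imp_summable)
  qed
  have S: "(\<lambda>z. norm (?F z)) summable_on A \<times> UNIV"
  proof (rule summable_on_SigmaI)
    show "((\<lambda>y. norm (?F (i, y))) has_sum norm (a i) * exp (norm c * norm (p i))) UNIV" for i
      using has_sum_cmult_right[OF e(2)[of "c * p i"], of "norm (a i)"]
      unfolding prod.case norm_mult[of "a i"] norm_mult[of c] .
  qed (use sum in auto)
  then have S': "?F summable_on A \<times> UNIV" by (rule abs_summable_summable)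
  have "(?F has_sum infsum ?F (A \<times> UNIV)) (A \<times> UNIV)" using S' by simp
  moreover have "infsum ?F (A \<times> UNIV) = (\<Sum>\<^sub>\<infinity>i\<in>A. a i * exp (c * p i))"
    using infsum_Sigma_banach[OF S'] infsumI[OF has_sum_cmult_right[OF e(1)]] by simp
  ultimately have "((\<lambda>(n, i). a i * ((c * p i) ^ n / fact n)) has_sum (\<Sum>\<^sub>\<infinity>i\<in>A. a i * exp (c * p i))) (UNIV \<times> A)"
    by (subst has_sum_swap) (simp add: case_prod_unfold)
  then have "((\<lambda>n. \<Sum>\<^sub>\<infinity>i\<in>A. a i * ((c * p i) ^ n / fact n)) has_sum (\<Sum>\<^sub>\<infinity>i\<in>A. a i * exp (c * p i))) UNIV"
  proof (rule has_sum_SigmaD)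
    fix n :: nat
    have "(\<lambda>(n, i). a i * ((c * p i) ^ n / fact n)) summable_on (UNIV \<times> A)"
      using S' by (subst summable_on_swap) (simp add: case_prod_unfold)
    from summable_on_SigmaD1[OF this, of n]
    show "((\<lambda>i. case (n, i) of (n, i) \<Rightarrow> a i * ((c * p i) ^ n / fact n)) has_sum (\<Sum>\<^sub>\<infinity>i\<in>A. a i * ((c * p i) ^ n / fact n))) A"
      by simp
  qed
  moreover have "(\<Sum>\<^sub>\<infinity>i\<in>A. a i * ((c * p i) ^ n / fact n)) = (\<Sum>\<^sub>\<infinity>i\<in>A. a i * p i ^ n) / fact n * c ^ n" for n
  proof -
    have "(\<Sum>\<^sub>\<infinity>i\<in>A. a i * ((c * p i) ^ n / fact n)) = (\<Sum>\<^sub>\<infinity>i\<in>A. (a i * p i ^ n) * (c ^ n / fact n))"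
      by (intro infsum_cong) (simp add: power_mult_distrib)
    then show ?thesis unfolding infsum_cmult_left' by simp
  qed
  ultimately show ?thesis by (simp add: has_sum_imp_sums)
qed

text \<open>Both sides of the hypothesis are entire in \<open>c\<close>, and the coefficients of
  \<open>c ^ m\<close> are compared. This is the passage from a generating exponential to a
  polynomial factor.\<close>

lemma exp_sum_coeff:
  fixes a p :: "'i \<Rightarrow> complex" and d q :: "'j \<Rightarrow> complex"
  assumes "\<And>t. (\<lambda>i. norm (a i) * exp (t * norm (p i))) summable_on A"
    and "\<And>t. (\<lambda>j. norm (d j) * exp (t * norm (q j))) summable_on A'"
    and eq: "\<And>c. (\<Sum>\<^sub>\<infinity>i\<in>A. a i * exp (c * p i)) = K * (\<Sum>\<^sub>\<infinity>j\<in>A'. d j * exp (c * q j))"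
  shows "(\<Sum>\<^sub>\<infinity>i\<in>A. a i * p i ^ m) = K * (\<Sum>\<^sub>\<infinity>j\<in>A'. d j * q j ^ m)"
proof -
  let ?a = "\<lambda>n. (\<Sum>\<^sub>\<infinity>i\<in>A. a i * p i ^ n) / fact n - K * ((\<Sum>\<^sub>\<infinity>j\<in>A'. d j * q j ^ n) / fact n)"
  have "(\<lambda>n. ?a n * c ^ n) sums 0" for c
    using sums_diff[OF exp_sum_power_series[OF assms(1), of c] sums_mult[OF exp_sum_power_series[OF assms(2), of c], of K]]
    by (simp add: eq left_diff_distrib mult.assoc)
  from power_series_coeff_unique[OF this, of m] show ?thesis by (simp add: field_simps)
qed

section \<open>Gaussian sums and Poisson summation for the majorants\<close>

context quad
begin

text \<open>The factor \<open>exp (- c * t)\<close> beats both \<open>exp (k * sqrt t)\<close> and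
  any power of \<open>1 + t\<close>, so the terms are dominated by those of
  \<open>Q_summable\<close>.\<close>

lemma gauss_summable:
  assumes c: "c > 0"
  shows "(\<lambda>x. exp (- c * Q x + k * sqrt (Q x))) summable_on Ld"
proof -
  define p where "p = real (2 + b)"
  have pn: "p > real (2 + b) / 2" by (simp add: p_def)
  define f where "f t = (1 + t) powr p * exp (- c * t + k * sqrt t)" for t :: real
  have "(f \<longlongrightarrow> 0) at_top" unfolding f_def using c by real_asymp
  then have "eventually (\<lambda>t. f t < 1) at_top" by (rule order_tendstoD) simp
  then obtain t0 where t0: "\<And>t. t \<ge> t0 \<Longrightarrow> f t < 1" by (auto simp: eventually_at_top_linorder)
  have "continuous_on {0..max 0 t0} f" unfolding f_def by (intro continuous_intros) auto
  then have "compact (f ` {0..max 0 t0})" by (intro compact_continuous_image) auto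
  then obtain M where M: "\<And>t. t \<in> {0..max 0 t0} \<Longrightarrow> norm (f t) \<le> M"
    by (meson bounded_iff compact_imp_bounded imageI)
  have fb: "f t \<le> max 1 M" if "t \<ge> 0" for t
    using M[of t] t0[of t] that by (cases "t \<le> t0") (auto simp: max_def)
  have "(\<lambda>x. max 1 M * (1 + Q x) powr (- p)) summable_on Ld"
    by (intro summable_on_cmult_right Q_summable pn)
  then show ?thesis
  proof (rule summable_on_comparison_test)
    fix x
    show "exp (- c * Q x + k * sqrt (Q x)) \<le> max 1 M * (1 + Q x) powr (- p)"
      using fb[OF Q_nonneg[of x]] Q_nonneg[of x] unfolding f_def by (simp add: powr_minus field_simps)
  qed auto
qed

lemma B_XY_le: "\<bar>B x X\<bar> \<le> sqrt q * sqrt (Q x)" "\<bar>B x Y\<bar> \<le> sqrt q * sqrt (Q x)" "norm (pZ x) \<le> sqrt q * sqrt (Q x)"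
proof -
  have "(norm (pZ x))\<^sup>2 \<le> q * Q x" using norm_pZ[of x] q_pos nm_nonpos[of x] by (simp add: Q_def)
  then show 3: "norm (pZ x) \<le> sqrt q * sqrt (Q x)" unfolding real_sqrt_mult[symmetric] by (rule real_le_rsqrt)
  show "\<bar>B x X\<bar> \<le> sqrt q * sqrt (Q x)" using 3 abs_Re_le_cmod[of "pZ x"] by (simp add: pZ_def)
  show "\<bar>B x Y\<bar> \<le> sqrt q * sqrt (Q x)" using 3 abs_Im_le_cmod[of "pZ x"] by (simp add: pZ_def)
qed

lemma np_nm_ge: "s > 0 \<Longrightarrow> t > 0 \<Longrightarrow> s * np x - t * nm x \<ge> min s t * Q x"
proof -
  assume "s > 0" "t > 0"
  have "min s t * np x \<le> s * np x" using np_nonneg by (intro mult_right_mono) auto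
  moreover have "t * nm x \<le> min s t * nm x" using nm_nonpos by (intro mult_right_mono_neg) auto
  ultimately show ?thesis by (simp add: Q_def algebra_simps)
qed

text \<open>The linear terms anticipate the complex shifts along \<open>X\<close> and
  \<open>Y\<close> and the generating exponential of \<open>pZ\<close>. All of them are of order
  \<open>sqrt (Q x)\<close>.\<close>

lemma theta_summable:
  assumes "s > 0" "t > 0"
  shows "(\<lambda>x. norm (pZ x) ^ n * exp (- (s * np x - t * nm x) + k1 * B x X + k2 * B x Y + k3 * norm (pZ x))) summable_on Ld"
proof (rule summable_on_comparison_test)
  let ?k = "(\<bar>k1\<bar> + \<bar>k2\<bar> + \<bar>k3\<bar>) * sqrt q + real n * sqrt q"
  show "(\<lambda>x. exp (- min s t * Q x + ?k * sqrt (Q x))) summable_on Ld"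
    by (rule gauss_summable) (use assms in auto)
  fix x
  have "norm (pZ x) \<le> exp (norm (pZ x))" using exp_ge_add_one_self[of "norm (pZ x)"] by linarith
  also have "\<dots> \<le> exp (sqrt q * sqrt (Q x))" using B_XY_le(3) by simp
  finally have "norm (pZ x) ^ n \<le> exp (sqrt q * sqrt (Q x)) ^ n" by (rule power_mono) simp
  also have "\<dots> = exp (real n * sqrt q * sqrt (Q x))" by (simp add: exp_of_nat_mult[symmetric] mult_ac)
  finally have 1: "norm (pZ x) ^ n \<le> exp (real n * sqrt q * sqrt (Q x))" .
  have m: "k * y \<le> \<bar>k\<bar> * (sqrt q * sqrt (Q x))" if "\<bar>y\<bar> \<le> sqrt q * sqrt (Q x)" for k y :: real
    using mult_left_mono[OF that, of "\<bar>k\<bar>"] abs_ge_self[of "k * y"] by (simp add: abs_mult)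
  have 2: "- (s * np x - t * nm x) + k1 * B x X + k2 * B x Y + k3 * norm (pZ x) \<le> - min s t * Q x + (\<bar>k1\<bar> + \<bar>k2\<bar> + \<bar>k3\<bar>) * sqrt q * sqrt (Q x)"
    using np_nm_ge[OF assms, of x] m[OF B_XY_le(1)[of x], of k1] m[OF B_XY_le(2)[of x], of k2] m[of "norm (pZ x)" k3] B_XY_le(3)[of x]
    by (simp add: algebra_simps)
  have "norm (pZ x) ^ n * exp (- (s * np x - t * nm x) + k1 * B x X + k2 * B x Y + k3 * norm (pZ x))
     \<le> exp (real n * sqrt q * sqrt (Q x)) * exp (- min s t * Q x + (\<bar>k1\<bar> + \<bar>k2\<bar> + \<bar>k3\<bar>) * sqrt q * sqrt (Q x))"
    using 1 2 by (intro mult_mono) auto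
  also have "\<dots> = exp (- min s t * Q x + ?k * sqrt (Q x))" by (simp add: exp_add[symmetric] algebra_simps)
  finally show "norm (pZ x) ^ n * exp (- (s * np x - t * nm x) + k1 * B x X + k2 * B x Y + k3 * norm (pZ x)) \<le> exp (- min s t * Q x + ?k * sqrt (Q x))" .
qed auto

lemma pr_lin: "pr (x + y) = pr x + pr y" "pr (c *\<^sub>R x) = c *\<^sub>R pr x"
  by (simp_all add: pr_def B_simps scaleR_left_distrib scaleR_right_distrib add_divide_distrib mult.assoc)

lemma pr_pr: "pr (pr x) = pr x"
  unfolding pr_def[of "pr x"] B_pr PB_XY by (simp add: pr_def)

text \<open>An orthogonal basis made of \<open>X\<close>, \<open>Y\<close> and vectors of v_- is
  orthogonal for every \<open>H s t\<close> at once. In it \<open>X\<close> and \<open>Y\<close>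
  together contribute \<open>1 / s\<close> and the \<open>b\<close> other vectors
  \<open>1 / sqrt t\<close> each, up to constants; passing to \<open>bs\<close> costs a factor that
  does not depend on \<open>s\<close> and \<open>t\<close>.\<close>

lemma poisson_bs:
  "\<exists>r>0. \<forall>s>0. \<forall>t>0. poisson (H s t) bs (r / (s * sqrt t ^ b))"
proof -
  obtain F where F: "finite F" "0 \<notin> F" "\<forall>e\<in>F. \<forall>f\<in>F. e \<noteq> f \<longrightarrow> H 1 1 e f = 0" "span F = span ((\<lambda>x. x - pr x) ` bs)"
    using Hf.orth_basis[of "(\<lambda>x. x - pr x) ` bs"] bs(4) by blast
  have Fo: "B e X = 0" "B e Y = 0" if "e \<in> F" for e
  proof -
    have "e \<in> span ((\<lambda>x. x - pr x) ` bs)" using F(4) span_base[OF that] by simp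
    then have "B e X = 0 \<and> B e Y = 0"
      by (induction rule: span_induct_alt) (auto simp: B_simps(1,5) B_simps(9) orth_rest)
    then show "B e X = 0" "B e Y = 0" by auto
  qed
  have PBF: "PB e w = 0" if "e \<in> F" for e w using Fo[OF that] by (simp add: PB_def)
  let ?E = "insert X (insert Y F)"
  have XF: "X \<notin> insert Y F" "Y \<notin> F"
    using Fo B_XY q_pos by auto
  have spanE: "span ?E = UNIV"
  proof -
    have "v \<in> span ?E" if "v \<in> bs" for v
    proof -
      have "v - pr v \<in> span F" unfolding F(4) using that by (intro span_base) auto
      then have "v - pr v \<in> span ?E" using span_mono[of F ?E] by auto
      moreover have "pr v \<in> span ?E" unfolding pr_def by (intro span_add span_scale span_base) auto
      ultimately have "(v - pr v) + pr v \<in> span ?E" by (rule span_add)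
      then show ?thesis by simp
    qed
    then have "span bs \<subseteq> span ?E" by (intro span_minimal) auto
    then show ?thesis using bs(2) by auto
  qed
  have orth: "\<forall>e\<in>?E. \<forall>f\<in>?E. e \<noteq> f \<longrightarrow> H s t e f = 0" if "s > 0" "t > 0" for s t
  proof -
    interpret h: pos_form "H s t" by (rule H_pos_form[OF that])
    have 1: "H s t X Y = 0" using B_XY by (simp add: H_def PB_def)
    have 2: "H s t e X = 0" "H s t e Y = 0" if "e \<in> F" for e using Fo[OF that] PBF[OF that] by (simp_all add: H_def)
    have 3: "H s t e f = t * H 1 1 e f" if "e \<in> F" for e f using PBF[OF that] by (simp add: H_def)
    have 4: "H s t e f = 0" if "e \<in> F" "f \<in> F" "e \<noteq> f" for e f using 3[OF that(1)] F(3) that by simp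
    have 5: "H s t X e = 0" "H s t Y e = 0" if "e \<in> F" for e
      using 2[OF that] h.sym[of e X] h.sym[of e Y] by simp_all
    have 6: "H s t Y X = 0" using 1 h.sym[of X Y] by simp
    show ?thesis
    proof (intro ballI impI)
      fix e f assume "e \<in> ?E" "f \<in> ?E" "e \<noteq> f"
      then show "H s t e f = 0" unfolding insert_iff
        by (elim disjE) (simp_all add: 1 2 4 5 6)
    qed
  qed
  have zE: "0 \<notin> ?E" "finite ?E" using XY_nonzero F by auto
  have indE: "independent ?E" using Hf.poisson_orth[OF zE(2,1) orth] by auto
  have "card ?E = 2 + b" using indE spanE DIM_eq dim_eq_card_independent[of ?E] by (metis dim_UNIV dim_span)
  then have cF: "card F = b" using XF F(1) by simp
  define c where "c = 1 / q * (\<Prod>e\<in>F. 1 / sqrt (H 1 1 e e))"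
  have cpos: "c > 0" unfolding c_def using q_pos F(2) Hf.pos by (intro mult_pos_pos prod_pos) (auto, metis)
  have PE: "poisson (H s t) ?E (c / (s * sqrt t ^ b))" if st: "s > 0" "t > 0" for s t
  proof -
    interpret h: pos_form "H s t" by (rule H_pos_form[OF st])
    have "poisson (H s t) ?E (\<Prod>e\<in>?E. 1 / sqrt (H s t e e))" using h.poisson_orth[OF zE(2,1) orth[OF st]] by simp
    moreover have "(\<Prod>e\<in>?E. 1 / sqrt (H s t e e)) = c / (s * sqrt t ^ b)"
    proof -
      have "H s t X X = s * q" "H s t Y Y = s * q" by (simp_all add: H_def PB_XY B_XY)
      then have "(\<Prod>e\<in>?E. 1 / sqrt (H s t e e)) = 1 / (s * q) * (\<Prod>e\<in>F. 1 / sqrt (H s t e e))"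
        using XF F(1) st q_pos by simp
      also have "(\<Prod>e\<in>F. 1 / sqrt (H s t e e)) = (\<Prod>e\<in>F. 1 / sqrt t * (1 / sqrt (H 1 1 e e)))"
        by (rule prod.cong[OF refl]) (simp add: H_def PBF real_sqrt_mult[symmetric])
      also have "\<dots> = (1 / sqrt t) ^ b * (\<Prod>e\<in>F. 1 / sqrt (H 1 1 e e))"
        unfolding prod.distrib prod_constant cF ..
      finally show ?thesis by (simp add: c_def power_divide)
    qed
    ultimately show ?thesis by simp
  qed
  obtain r where r: "r > 0" "\<And>h \<kappa>. pos_form h \<Longrightarrow> poisson h ?E \<kappa> \<Longrightarrow> poisson h bs (r * \<kappa>)"
    using poisson_change_basis[OF bs(1,2) indE spanE] by blast
  show ?thesis
  proof (intro exI[of _ "r * c"] conjI allI impI)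
    show "r * c > 0" using r(1) cpos by simp
    fix s t :: real assume st: "s > 0" "t > 0"
    show "poisson (H s t) bs (r * c / (s * sqrt t ^ b))" using r(2)[OF H_pos_form[OF st] PE[OF st]] by simp
  qed
qed

text \<open>Pairing with \<open>\<nu>\<close> under \<open>B\<close> equals pairing with this vector
  under \<open>H s t\<close>, so it carries the dual lattice of \<open>B\<close> to that of
  \<open>H s t\<close>.\<close>

definition "Gd s t \<nu> = (1/s) *\<^sub>R pr \<nu> - (1/t) *\<^sub>R (\<nu> - pr \<nu>)"

lemma form_dual_bij:
  assumes st: "s > 0" "t > 0"
  shows "bij_betw (Gd s t) Ld (form_dual (H s t) bs)"
    and "H s t (Gd s t \<nu>) w = B \<nu> w" and "H s t (Gd s t \<nu>) (Gd s t \<nu>) = np \<nu> / s - nm \<nu> / t"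
proof -
  let ?A = "\<lambda>\<mu>. s *\<^sub>R pr \<mu> - t *\<^sub>R (\<mu> - pr \<mu>)"
  have HA: "H s t \<mu> w = B (?A \<mu>) w" for \<mu> w by (simp add: H_def B_simps B_pr)
  have prG: "pr (Gd s t \<nu>) = (1/s) *\<^sub>R pr \<nu>" "pr (?A \<nu>) = s *\<^sub>R pr \<nu>" for \<nu>
  proof -
    have d: "pr (x - y) = pr x - pr y" for x y using pr_lin(1)[of "x - y" y] by simp
    show "pr (Gd s t \<nu>) = (1/s) *\<^sub>R pr \<nu>" "pr (?A \<nu>) = s *\<^sub>R pr \<nu>" by (simp_all add: Gd_def d pr_lin pr_pr)
  qed
  have AG: "?A (Gd s t \<nu>) = \<nu>" for \<nu> unfolding prG using st by (simp add: Gd_def algebra_simps)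
  have GA: "Gd s t (?A \<nu>) = \<nu>" for \<nu> unfolding Gd_def prG using st by (simp add: algebra_simps)
  show HG: "H s t (Gd s t \<nu>) w = B \<nu> w" for \<nu> w unfolding HA AG ..
  show "H s t (Gd s t \<nu>) (Gd s t \<nu>) = np \<nu> / s - nm \<nu> / t" unfolding HG
    by (simp add: Gd_def B_simps B_pr PB_self nm_def diff_divide_distrib)
  show "bij_betw (Gd s t) Ld (form_dual (H s t) bs)"
  proof (rule bij_betw_byWitness[of _ ?A])
    show "Gd s t ` Ld \<subseteq> form_dual (H s t) bs" using bs(2) dual_iff by (auto simp: form_dual_def HG)
    show "?A ` form_dual (H s t) bs \<subseteq> Ld" using bs(2) by (auto simp: form_dual_def dual_iff HA)
  qed (use AG GA in auto)
qed

text \<open>Existence suffices here; \<open>kap_eq\<close> finds the value from the action of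
  \<open>S\<close>.\<close>

definition "kap = (SOME r. r > 0 \<and> (\<forall>s>0. \<forall>t>0. poisson (H s t) bs (r / (s * sqrt t ^ b))))"

lemma kap: "kap > 0" "s > 0 \<Longrightarrow> t > 0 \<Longrightarrow> poisson (H s t) bs (kap / (s * sqrt t ^ b))"
  using someI_ex[OF poisson_bs] unfolding kap_def by auto

lemma np_shift: "np (w + (s *\<^sub>R X + u *\<^sub>R Y)) = np w + 2 * (s * B w X + u * B w Y) + q * (s\<^sup>2 + u\<^sup>2)"
    "nm (w + (s *\<^sub>R X + u *\<^sub>R Y)) = nm w"
proof -
  show 1: "np (w + (s *\<^sub>R X + u *\<^sub>R Y)) = np w + 2 * (s * B w X + u * B w Y) + q * (s\<^sup>2 + u\<^sup>2)"
    using q_pos by (simp add: np_def B_simps B_XY field_simps power2_eq_square)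
  show "nm (w + (s *\<^sub>R X + u *\<^sub>R Y)) = nm w"
    using 1 symB[of X w] symB[of Y w] unfolding nm_def by (simp add: B_simps B_XY power2_eq_square algebra_simps)
qed

lemma coset_bij: "bij_betw (\<lambda>x. x + g) L (lat_coset L g)"
  unfolding bij_betw_def lat_coset_def by (auto simp: inj_on_def add.commute image_iff)

text \<open>Poisson summation at the shift by \<open>g\<close>, \<open>u\<close> times
  \<open>X\<close> and \<open>v\<close> times \<open>Y\<close>. The term quadratic in
  \<open>u\<close>, \<open>v\<close> is pulled out, so that each summand is a pure exponential in
  \<open>u\<close> and \<open>v\<close>.\<close>

lemma poisson_real:
  assumes st: "s > 0" "t > 0" and g: "g \<in> Ld"
  shows "(\<Sum>\<^sub>\<infinity>w\<in>lat_coset L g. of_real (exp (- pi * (s * np w - t * nm w) - 2 * pi * s * (u * B w X + v * B w Y)))) * of_real (exp (- pi * s * q * (u\<^sup>2 + v\<^sup>2)))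
    = of_real (kap / (s * sqrt t ^ b)) *
      (\<Sum>\<^sub>\<infinity>\<nu>\<in>Ld. of_real (exp (- pi * (np \<nu> / s - nm \<nu> / t))) * ee (of_real (B \<nu> g)) * ee (of_real (u * B \<nu> X + v * B \<nu> Y)))"
proof -
  let ?v = "g + (u *\<^sub>R X + v *\<^sub>R Y)"
  have "(\<Sum>\<^sub>\<infinity>x\<in>L. complex_of_real (exp (- pi * H s t (x + ?v) (x + ?v)))) =
       of_real (kap / (s * sqrt t ^ b)) * (\<Sum>\<^sub>\<infinity>\<mu>\<in>form_dual (H s t) bs. of_real (exp (- pi * H s t \<mu> \<mu>)) * ee (of_real (H s t \<mu> ?v)))"
    using kap(2)[OF st] bs(2,3) by (simp add: poisson_def)
  also have "(\<Sum>\<^sub>\<infinity>\<mu>\<in>form_dual (H s t) bs. of_real (exp (- pi * H s t \<mu> \<mu>)) * ee (of_real (H s t \<mu> ?v))) =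
    (\<Sum>\<^sub>\<infinity>\<nu>\<in>Ld. of_real (exp (- pi * (np \<nu> / s - nm \<nu> / t))) * ee (of_real (B \<nu> ?v)))"
    unfolding infsum_reindex_bij_betw[OF form_dual_bij(1)[OF st], symmetric] form_dual_bij(3)[OF st] unfolding form_dual_bij(2)[OF st] ..
  also have "\<dots> = (\<Sum>\<^sub>\<infinity>\<nu>\<in>Ld. of_real (exp (- pi * (np \<nu> / s - nm \<nu> / t))) * ee (of_real (B \<nu> g)) * ee (of_real (u * B \<nu> X + v * B \<nu> Y)))"
    by (intro infsum_cong) (simp add: B_simps ee_add[symmetric] mult.assoc)
  also have "(\<Sum>\<^sub>\<infinity>x\<in>L. complex_of_real (exp (- pi * H s t (x + ?v) (x + ?v)))) = 
    (\<Sum>\<^sub>\<infinity>w\<in>lat_coset L g. complex_of_real (exp (- pi * H s t (w + (u *\<^sub>R X + v *\<^sub>R Y)) (w + (u *\<^sub>R X + v *\<^sub>R Y)))))"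
    unfolding infsum_reindex_bij_betw[OF coset_bij, symmetric] by (simp add: add.assoc)
  also have "\<dots> = (\<Sum>\<^sub>\<infinity>w\<in>lat_coset L g. of_real (exp (- pi * (s * np w - t * nm w) - 2 * pi * s * (u * B w X + v * B w Y)))) * of_real (exp (- pi * s * q * (u\<^sup>2 + v\<^sup>2)))"
    unfolding infsum_cmult_left'[symmetric] of_real_mult[symmetric] exp_add[symmetric] H_self np_shift
    by (intro infsum_cong arg_cong[of _ _ complex_of_real] arg_cong[of _ _ exp]) (simp add: algebra_simps)
  finally show ?thesis .
qed

end

lemma finite_sum_infsum:
  fixes f :: "'d \<Rightarrow> 'i \<Rightarrow> complex"
  assumes "finite D" "\<And>d. d \<in> D \<Longrightarrow> f d summable_on A"
  shows "(\<lambda>x. \<Sum>d\<in>D. f d x) summable_on A \<and> (\<Sum>\<^sub>\<infinity>x\<in>A. \<Sum>d\<in>D. f d x) = (\<Sum>d\<in>D. \<Sum>\<^sub>\<infinity>x\<in>A. f d x)"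
  using assms by (induction D rule: finite_induct) (auto simp: infsum_add intro: summable_on_add)

text \<open>The root of \<open>\<tau>\<close> lies in the open first quadrant, so turning it by
  \<open>- pi / 4\<close> keeps its real part positive and stays on the principal branch.\<close>

lemma csqrt_neg_ii:
  assumes "Im \<tau> > 0"
  shows "csqrt (- \<i> * \<tau>) = csqrt \<tau> * cis (- (pi / 4))"
proof (rule csqrt_unique)
  define w where "w = csqrt \<tau>"
  have w2: "w\<^sup>2 = \<tau>" by (simp add: w_def)
  have "(cis (- (pi/4)))\<^sup>2 = - \<i>" by (simp add: power2_eq_square cis_mult complex_eq_iff)
  then show "(csqrt \<tau> * cis (- (pi / 4)))\<^sup>2 = - \<i> * \<tau>" unfolding w_def[symmetric] by (simp add: power_mult_distrib w2)
  have "Re w * Im w > 0" using assms unfolding w2[symmetric] by (simp add: power2_eq_square mult.commute[of "Im w"])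
  moreover have "Re w \<ge> 0" unfolding w_def by (rule Re_csqrt)
  ultimately have pos: "Re w > 0" "Im w > 0" by (auto simp: zero_less_mult_iff)
  have "Re (w * cis (- (pi / 4))) = (sqrt 2 / 2) * (Re w + Im w)"
    by (simp add: cos_45 sin_45 algebra_simps)
  also have "\<dots> > 0" using pos by (intro mult_pos_pos add_pos_pos) auto
  finally show "0 < Re (csqrt \<tau> * cis (- (pi / 4))) \<or> Re (csqrt \<tau> * cis (- (pi / 4))) = 0 \<and> 0 \<le> Im (csqrt \<tau> * cis (- (pi / 4)))"
    unfolding w_def[symmetric] ..
qed

lemma csqrt_inverse_pos:
  assumes "Re v > 0"
  shows "csqrt (inverse v) = inverse (csqrt v)"
proof (rule csqrt_unique)
  define w where "w = csqrt v"
  have w2: "w\<^sup>2 = v" by (simp add: w_def)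
  have "(Re w)\<^sup>2 - (Im w)\<^sup>2 > 0" using assms unfolding w2[symmetric] by (simp add: power2_eq_square)
  then have "Re w \<noteq> 0" by auto
  moreover have "Re w \<ge> 0" unfolding w_def by (rule Re_csqrt)
  ultimately have "Re w > 0" by simp
  then have "Re (inverse w) > 0" by (auto simp: add_pos_nonneg intro!: divide_pos_pos)
  then show "0 < Re (inverse (csqrt v)) \<or> Re (inverse (csqrt v)) = 0 \<and> 0 \<le> Im (inverse (csqrt v))"
    unfolding w_def[symmetric] ..
  show "(inverse (csqrt v))\<^sup>2 = inverse v" by (simp add: power_inverse)
qed

context quad
begin

text \<open>Both sides are entire in each shift. The identity is continued from real to complex
  \<open>u\<close> for real \<open>v\<close>, and then in \<open>v\<close> for every complex
  \<open>u\<close>.\<close>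

lemma poisson_complex_shift:
  fixes u v :: complex
  assumes st: "s > 0" "t > 0" and g: "g \<in> Ld"
  shows "(\<Sum>\<^sub>\<infinity>w\<in>lat_coset L g. of_real (exp (- pi * (s * np w - t * nm w))) * exp (of_real (- 2 * pi * s) * (u * of_real (B w X) + v * of_real (B w Y)))) * exp (of_real (- pi * s * q) * (u\<^sup>2 + v\<^sup>2))
    = of_real (kap / (s * sqrt t ^ b)) *
      (\<Sum>\<^sub>\<infinity>\<nu>\<in>Ld. of_real (exp (- pi * (np \<nu> / s - nm \<nu> / t))) * ee (of_real (B \<nu> g)) * exp (of_real (2 * pi) * \<i> * (u * of_real (B \<nu> X) + v * of_real (B \<nu> Y))))"
proof -
  let ?K = "complex_of_real (kap / (s * sqrt t ^ b))"
  define C where "C w = complex_of_real (exp (- pi * (s * np w - t * nm w)))" for w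
  define D where "D \<nu> = complex_of_real (exp (- pi * (np \<nu> / s - nm \<nu> / t))) * ee (of_real (B \<nu> g))" for \<nu>
  define F where "F u v = (\<Sum>\<^sub>\<infinity>w\<in>lat_coset L g. C w * exp (of_real (- 2 * pi * s) * (u * of_real (B w X) + v * of_real (B w Y)))) * exp (of_real (- pi * s * q) * (u\<^sup>2 + v\<^sup>2))"
    for u v :: complex
  define G where "G u v = ?K * (\<Sum>\<^sub>\<infinity>\<nu>\<in>Ld. D \<nu> * exp (of_real (2 * pi) * \<i> * (u * of_real (B \<nu> X) + v * of_real (B \<nu> Y))))"
    for u v :: complex
  have nC: "norm (C w) = exp (- (pi * s * np w - pi * t * nm w))" for w by (simp add: C_def algebra_simps)
  have nD: "norm (D w) = exp (- (pi / s * np w - pi / t * nm w))" for w by (simp add: D_def norm_mult algebra_simps)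
  have sub: "lat_coset L g \<subseteq> Ld" by (rule coset_sub_Ld[OF g])
  have pst: "pi * s > 0" "pi * t > 0" "pi / s > 0" "pi / t > 0" using st by auto
  have S1: "(\<lambda>w. exp (- (pi * s * np w - pi * t * nm w) + k1 * B w X + k2 * B w Y)) summable_on lat_coset L g" for k1 k2
    by (rule summable_on_subset[OF _ sub]) (use theta_summable[OF pst(1,2), of 0 k1 k2 0] in simp)
  have S2: "(\<lambda>w. exp (- (pi / s * np w - pi / t * nm w) + k1 * B w X + k2 * B w Y)) summable_on Ld" for k1 k2
    using theta_summable[OF pst(3,4), of 0 k1 k2 0] by simp
  have FX: "C w * exp (of_real (- 2 * pi * s) * (u * of_real (B w X) + v * of_real (B w Y))) =
     (C w * exp (of_real (- 2 * pi * s * B w Y) * v)) * exp (u * of_real (- 2 * pi * s * B w X))" for w and u v :: complex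
    by (simp add: mult.assoc exp_add[symmetric] algebra_simps)
  have FY: "C w * exp (of_real (- 2 * pi * s) * (u * of_real (B w X) + v * of_real (B w Y))) =
     (C w * exp (of_real (- 2 * pi * s * B w X) * u)) * exp (v * of_real (- 2 * pi * s * B w Y))" for w and u v :: complex
    by (simp add: mult.assoc exp_add[symmetric] algebra_simps)
  have GX: "D w * exp (of_real (2 * pi) * \<i> * (u * of_real (B w X) + v * of_real (B w Y))) =
     (D w * exp (of_real (2 * pi * B w Y) * (\<i> * v))) * exp ((of_real (2 * pi) * \<i> * u) * of_real (B w X))" for w and u v :: complex
    by (simp add: mult.assoc exp_add[symmetric] algebra_simps)
  have GY: "D w * exp (of_real (2 * pi) * \<i> * (u * of_real (B w X) + v * of_real (B w Y))) =
     (D w * exp (of_real (2 * pi * B w X) * (\<i> * u))) * exp ((of_real (2 * pi) * \<i> * v) * of_real (B w Y))" for w and u v :: complex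
    by (simp add: mult.assoc exp_add[symmetric] algebra_simps)
  have hFX: "(\<lambda>u. F u v) holomorphic_on UNIV" for v
    unfolding F_def FX
  proof (intro holomorphic_on_mult exp_sum_holomorphic open_UNIV)
    fix u :: complex
    show "(\<lambda>w. norm (C w * exp (of_real (- 2 * pi * s * B w Y) * v)) * exp (Re u * (- 2 * pi * s * B w X))) summable_on lat_coset L g"
      using S1[of "- 2 * pi * s * Re u" "- 2 * pi * s * Re v"]
      by (rule summable_on_cong[THEN iffD1, rotated]) (simp add: norm_mult nC exp_add[symmetric] algebra_simps)
  qed (intro holomorphic_intros)
  have hFY: "(\<lambda>v. F u v) holomorphic_on UNIV" for u
    unfolding F_def FY
  proof (intro holomorphic_on_mult exp_sum_holomorphic open_UNIV)
    fix v :: complex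
    show "(\<lambda>w. norm (C w * exp (of_real (- 2 * pi * s * B w X) * u)) * exp (Re v * (- 2 * pi * s * B w Y))) summable_on lat_coset L g"
      using S1[of "- 2 * pi * s * Re u" "- 2 * pi * s * Re v"]
      by (rule summable_on_cong[THEN iffD1, rotated]) (simp add: norm_mult nC exp_add[symmetric] algebra_simps)
  qed (intro holomorphic_intros)
  have comp: "f holomorphic_on UNIV \<Longrightarrow> (\<lambda>u. f (of_real (2 * pi) * \<i> * u)) holomorphic_on UNIV" for f
    using holomorphic_on_compose_gen[of "\<lambda>u. of_real (2 * pi) * \<i> * u" UNIV f UNIV] by (auto simp: o_def intro: holomorphic_intros)
  have hGX: "(\<lambda>u. G u v) holomorphic_on UNIV" for v
    unfolding G_def GX
  proof (intro holomorphic_on_mult holomorphic_on_const comp[where f="\<lambda>z. \<Sum>\<^sub>\<infinity>\<nu>\<in>Ld. (D \<nu> * exp (of_real (2 * pi * B \<nu> Y) * (\<i> * v))) * exp (z * of_real (B \<nu> X))"] exp_sum_holomorphic open_UNIV)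
    fix z :: complex
    show "(\<lambda>\<nu>. norm (D \<nu> * exp (of_real (2 * pi * B \<nu> Y) * (\<i> * v))) * exp (Re z * B \<nu> X)) summable_on Ld"
      using S2[of "Re z" "- 2 * pi * Im v"]
      by (rule summable_on_cong[THEN iffD1, rotated]) (simp add: norm_mult nD exp_add[symmetric] algebra_simps)
  qed
  have hGY: "(\<lambda>v. G u v) holomorphic_on UNIV" for u
    unfolding G_def GY
  proof (intro holomorphic_on_mult holomorphic_on_const comp[where f="\<lambda>z. \<Sum>\<^sub>\<infinity>\<nu>\<in>Ld. (D \<nu> * exp (of_real (2 * pi * B \<nu> X) * (\<i> * u))) * exp (z * of_real (B \<nu> Y))"] exp_sum_holomorphic open_UNIV)
    fix z :: complex
    show "(\<lambda>\<nu>. norm (D \<nu> * exp (of_real (2 * pi * B \<nu> X) * (\<i> * u))) * exp (Re z * B \<nu> Y)) summable_on Ld"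
      using S2[of "- 2 * pi * Im u" "Re z"]
      by (rule summable_on_cong[THEN iffD1, rotated]) (simp add: norm_mult nD exp_add[symmetric] algebra_simps)
  qed
  have real: "F (of_real x) (of_real y) = G (of_real x) (of_real y)" for x y
  proof -
    have e1: "C w * exp (of_real (- 2 * pi * s) * (of_real x * of_real (B w X) + of_real y * of_real (B w Y)))
       = of_real (exp (- pi * (s * np w - t * nm w) - 2 * pi * s * (x * B w X + y * B w Y)))" for w
    proof -
      have "of_real (- 2 * pi * s) * (complex_of_real x * of_real (B w X) + of_real y * of_real (B w Y)) = of_real (- 2 * pi * s * (x * B w X + y * B w Y))"
        by simp
      then show ?thesis unfolding C_def by (simp only: exp_of_real of_real_mult[symmetric] exp_add[symmetric]) (simp add: exp_add[symmetric])
    qed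
    have e2: "exp (of_real (- pi * s * q) * ((complex_of_real x)\<^sup>2 + (of_real y)\<^sup>2)) = of_real (exp (- pi * s * q * (x\<^sup>2 + y\<^sup>2)))"
      by (simp flip: exp_of_real)
    have e3: "ee (of_real (x * B w X + y * B w Y)) = exp (of_real (2 * pi) * \<i> * (of_real x * of_real (B w X) + of_real y * of_real (B w Y)))" for w
      by (simp add: ee_def)
    show ?thesis unfolding F_def G_def e1 e2 D_def e3[symmetric] by (rule poisson_real[OF st g])
  qed
  have r1: "F u (of_real y) = G u (of_real y)" for u y
    by (rule real_line_continuation[OF hFX hGX open_UNIV connected_UNIV, of 0]) (auto intro: real)
  have "F u v = G u v"
    by (rule real_line_continuation[OF hFY hGY open_UNIV connected_UNIV, of 0]) (auto intro: r1)
  then show ?thesis unfolding F_def G_def C_def D_def .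
qed

text \<open>At the shift \<open>(c, c * \<i>)\<close> the term \<open>u\<^sup>2 + v\<^sup>2\<close>
  vanishes and the linear form becomes \<open>c * pZ w\<close>; comparing coefficients of
  \<open>c ^ m\<close> leaves \<open>pZ ^ m\<close> on both sides. The quotient of the scalings
  \<open>2 * pi * \<i>\<close> and \<open>- 2 * pi * s\<close> is the base of the power
  \<open>(- \<i> / s) ^ m\<close>.\<close>

lemma poisson_poly_real:
  assumes st: "s > 0" "t > 0" and g: "g \<in> Ld"
  shows "(\<Sum>\<^sub>\<infinity>w\<in>lat_coset L g. of_real (exp (- pi * (s * np w - t * nm w))) * pZ w ^ m)
    = of_real (kap / (s * sqrt t ^ b)) * (- \<i> / of_real s) ^ m *
      (\<Sum>\<^sub>\<infinity>\<nu>\<in>Ld. of_real (exp (- pi * (np \<nu> / s - nm \<nu> / t))) * ee (of_real (B \<nu> g)) * pZ \<nu> ^ m)"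
proof -
  let ?K = "complex_of_real (kap / (s * sqrt t ^ b))"
  define C where "C w = complex_of_real (exp (- pi * (s * np w - t * nm w)))" for w
  define D where "D \<nu> = complex_of_real (exp (- pi * (np \<nu> / s - nm \<nu> / t))) * ee (of_real (B \<nu> g))" for \<nu>
  have nC: "norm (C w) = exp (- (pi * s * np w - pi * t * nm w))" for w by (simp add: C_def algebra_simps)
  have nD: "norm (D w) = exp (- (pi / s * np w - pi / t * nm w))" for w by (simp add: D_def norm_mult algebra_simps)
  have sub: "lat_coset L g \<subseteq> Ld" by (rule coset_sub_Ld[OF g])
  have pst: "pi * s > 0" "pi * t > 0" "pi / s > 0" "pi / t > 0" using st by auto
  let ?k1 = "complex_of_real (- 2 * pi * s)" and ?k2 = "complex_of_real (2 * pi) * \<i>"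
  let ?SC = "\<Sum>\<^sub>\<infinity>w\<in>lat_coset L g. C w * pZ w ^ m" and ?SD = "\<Sum>\<^sub>\<infinity>\<nu>\<in>Ld. D \<nu> * pZ \<nu> ^ m"
  have "(\<Sum>\<^sub>\<infinity>w\<in>lat_coset L g. C w * (?k1 * pZ w) ^ m) = ?K * (\<Sum>\<^sub>\<infinity>\<nu>\<in>Ld. D \<nu> * (?k2 * pZ \<nu>) ^ m)"
  proof (rule exp_sum_coeff)
    fix x :: real
    have "(\<lambda>w. norm (pZ w) ^ 0 * exp (- (pi * s * np w - pi * t * nm w) + 0 * B w X + 0 * B w Y + (2 * pi * s * x) * norm (pZ w))) summable_on lat_coset L g"
      by (rule summable_on_subset[OF theta_summable[OF pst(1,2)] sub])
    then show "(\<lambda>w. norm (C w) * exp (x * norm (?k1 * pZ w))) summable_on lat_coset L g"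
      by (rule summable_on_cong[THEN iffD1, rotated]) (use st in \<open>simp add: nC norm_mult exp_add[symmetric] algebra_simps\<close>)
    have "(\<lambda>w. norm (pZ w) ^ 0 * exp (- (pi / s * np w - pi / t * nm w) + 0 * B w X + 0 * B w Y + (2 * pi * x) * norm (pZ w))) summable_on Ld"
      by (rule theta_summable[OF pst(3,4)])
    then show "(\<lambda>\<nu>. norm (D \<nu>) * exp (x * norm (?k2 * pZ \<nu>))) summable_on Ld"
      by (rule summable_on_cong[THEN iffD1, rotated]) (simp add: nD norm_mult exp_add[symmetric] algebra_simps)
  next
    fix c :: complex
    have i: "c * of_real (B w X) + c * \<i> * of_real (B w Y) = c * pZ w" for w
      by (simp add: pZ_def complex_eq_iff algebra_simps)
    have i2: "c\<^sup>2 + (c * \<i>)\<^sup>2 = 0" by (simp add: power_mult_distrib)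
    have i3: "k * (c * pZ w) = c * (k * pZ w)" for k w by (simp only: mult.left_commute)
    show "(\<Sum>\<^sub>\<infinity>w\<in>lat_coset L g. C w * exp (c * (?k1 * pZ w))) = ?K * (\<Sum>\<^sub>\<infinity>\<nu>\<in>Ld. D \<nu> * exp (c * (?k2 * pZ \<nu>)))"
      using poisson_complex_shift[OF st g, of c "c * \<i>"] unfolding i i2 i3 C_def[symmetric] D_def[symmetric]
      by (simp only: mult_zero_right exp_zero mult_1_right)
  qed
  then have "?k1 ^ m * ?SC = ?K * (?k2 ^ m * ?SD)"
    by (simp only: power_mult_distrib mult.left_commute[of "C _"] mult.left_commute[of "D _"] infsum_cmult_right')
  moreover have nz: "?k1 ^ m \<noteq> 0" using st by simp
  moreover have "k1 \<noteq> 0 \<Longrightarrow> k1 * S = K * (k2 * T) \<Longrightarrow> S = K * (k2 / k1) * T" for k1 k2 K S T :: complex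
    by (simp add: field_simps)
  ultimately have "?SC = ?K * (?k2 ^ m / ?k1 ^ m) * ?SD" by blast
  also have "?k2 ^ m / ?k1 ^ m = (- \<i> / of_real s) ^ m"
    unfolding power_divide[symmetric] using st by (intro arg_cong[of _ _ "\<lambda>z. z ^ m"]) (simp add: field_simps)
  finally show ?thesis unfolding C_def D_def .
qed

text \<open>Continuation from positive weights to the right half plane, first in
  \<open>\<alpha>\<close> for real \<open>\<beta>\<close> and then in \<open>\<beta>\<close>. The
  principal root of \<open>\<beta>\<close> is holomorphic there.\<close>

lemma poisson_poly_complex:
  fixes \<alpha> \<beta> :: complex
  assumes \<alpha>: "Re \<alpha> > 0" and \<beta>: "Re \<beta> > 0" and g: "g \<in> Ld"
  shows "(\<Sum>\<^sub>\<infinity>w\<in>lat_coset L g. pZ w ^ m * exp (\<alpha> * of_real (- pi * np w) + \<beta> * of_real (pi * nm w)))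
    = of_real kap * (- \<i>) ^ m / (\<alpha> ^ Suc m * csqrt \<beta> ^ b) *
      (\<Sum>\<^sub>\<infinity>\<nu>\<in>Ld. pZ \<nu> ^ m * ee (of_real (B \<nu> g)) * exp ((1 / \<alpha>) * of_real (- pi * np \<nu>) + (1 / \<beta>) * of_real (pi * nm \<nu>)))"
proof -
  define F where "F \<alpha> \<beta> = (\<Sum>\<^sub>\<infinity>w\<in>lat_coset L g. pZ w ^ m * exp (\<alpha> * of_real (- pi * np w) + \<beta> * of_real (pi * nm w)))" for \<alpha> \<beta> :: complex
  define G where "G \<alpha> \<beta> = of_real kap * (- \<i>) ^ m / (\<alpha> ^ Suc m * csqrt \<beta> ^ b) *
      (\<Sum>\<^sub>\<infinity>\<nu>\<in>Ld. pZ \<nu> ^ m * ee (of_real (B \<nu> g)) * exp ((1 / \<alpha>) * of_real (- pi * np \<nu>) + (1 / \<beta>) * of_real (pi * nm \<nu>)))" for \<alpha> \<beta> :: complex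
  let ?S = "{z :: complex. Re z > 0}"
  have S: "open ?S" "connected ?S" by (auto intro!: open_halfspace_Re_gt convex_connected convex_halfspace_Re_gt)
  have one: "complex_of_real 1 \<in> ?S" by simp
  have sub: "lat_coset L g \<subseteq> Ld" by (rule coset_sub_Ld[OF g])
  have Sm: "(\<lambda>w. norm (pZ w) ^ m * exp (- (pi * s * np w - pi * t * nm w))) summable_on Ld" if "s > 0" "t > 0" for s t
    using theta_summable[of "pi * s" "pi * t" m 0 0 0] that by simp
  have Reinv: "Re (1 / z) > 0" if "Re z > 0" for z :: complex
    using that by (auto simp: Re_divide add_pos_nonneg intro!: divide_pos_pos)
  have FB: "pZ w ^ m * exp (\<alpha> * of_real (- pi * np w) + \<beta> * of_real (pi * nm w)) = (pZ w ^ m * exp (\<alpha> * of_real (- pi * np w))) * exp (\<beta> * of_real (pi * nm w))" for w and \<alpha> \<beta> :: complex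
    by (simp only: exp_add mult.assoc)
  have FA: "pZ w ^ m * exp (\<alpha> * of_real (- pi * np w) + \<beta> * of_real (pi * nm w)) = (pZ w ^ m * exp (\<beta> * of_real (pi * nm w))) * exp (\<alpha> * of_real (- pi * np w))" for w and \<alpha> \<beta> :: complex
    by (simp only: exp_add mult_ac)
  have GB: "c * e * exp (\<alpha> * of_real (- pi * np w) + \<beta> * of_real (pi * nm w)) = (c * e * exp (\<alpha> * of_real (- pi * np w))) * exp (\<beta> * of_real (pi * nm w))" for w and \<alpha> \<beta> c e :: complex
    by (simp only: exp_add mult.assoc)
  have GA: "c * e * exp (\<alpha> * of_real (- pi * np w) + \<beta> * of_real (pi * nm w)) = (c * e * exp (\<beta> * of_real (pi * nm w))) * exp (\<alpha> * of_real (- pi * np w))" for w and \<alpha> \<beta> c e :: complex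
    by (simp only: exp_add mult_ac)
  have nrm: "norm (exp (z * of_real k)) = exp (Re z * k)" for z :: complex and k by simp
  have hFA: "(\<lambda>\<alpha>. F \<alpha> \<beta>) holomorphic_on ?S" if b: "Re \<beta> > 0" for \<beta>
    unfolding F_def FA
  proof (rule exp_sum_holomorphic[OF S(1)])
    fix z assume "z \<in> ?S"
    then have "(\<lambda>w. norm (pZ w) ^ m * exp (- (pi * Re z * np w - pi * Re \<beta> * nm w))) summable_on lat_coset L g"
      using b by (intro summable_on_subset[OF Sm sub]) auto
    then show "(\<lambda>w. norm (pZ w ^ m * exp (\<beta> * of_real (pi * nm w))) * exp (Re z * (- pi * np w))) summable_on lat_coset L g"
      unfolding norm_mult norm_power nrm
      by (rule summable_on_cong[THEN iffD1, rotated]) (simp only: mult.assoc exp_add[symmetric] mult_1_left, intro arg_cong2[of _ _ _ _ "(*)"] arg_cong[of _ _ exp] refl, simp add: algebra_simps)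
  qed
  have hFB: "(\<lambda>\<beta>. F \<alpha> \<beta>) holomorphic_on ?S" if b: "Re \<alpha> > 0" for \<alpha>
    unfolding F_def FB
  proof (rule exp_sum_holomorphic[OF S(1)])
    fix z assume "z \<in> ?S"
    then have "(\<lambda>w. norm (pZ w) ^ m * exp (- (pi * Re \<alpha> * np w - pi * Re z * nm w))) summable_on lat_coset L g"
      using b by (intro summable_on_subset[OF Sm sub]) auto
    then show "(\<lambda>w. norm (pZ w ^ m * exp (\<alpha> * of_real (- pi * np w))) * exp (Re z * (pi * nm w))) summable_on lat_coset L g"
      unfolding norm_mult norm_power nrm
      by (rule summable_on_cong[THEN iffD1, rotated]) (simp only: mult.assoc exp_add[symmetric] mult_1_left, intro arg_cong2[of _ _ _ _ "(*)"] arg_cong[of _ _ exp] refl, simp add: algebra_simps)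
  qed
  have comp: "f holomorphic_on ?S \<Longrightarrow> (\<lambda>z. f (1 / z)) holomorphic_on ?S" for f
  proof -
    assume f: "f holomorphic_on ?S"
    have "(\<lambda>z. 1 / z) holomorphic_on ?S" by (intro holomorphic_intros) auto
    moreover have "(\<lambda>z. 1 / z) ` ?S \<subseteq> ?S" using Reinv by auto
    ultimately show "(\<lambda>z. f (1 / z)) holomorphic_on ?S"
      using holomorphic_on_compose_gen[OF _ f, of "\<lambda>z. 1 / z" ?S] by (simp add: o_def)
  qed
  have hGA: "(\<lambda>\<alpha>. G \<alpha> \<beta>) holomorphic_on ?S" if b: "Re \<beta> > 0" for \<beta>
    unfolding G_def GA
  proof (rule holomorphic_on_mult)
    show "(\<lambda>\<alpha>. of_real kap * (- \<i>) ^ m / (\<alpha> ^ Suc m * csqrt \<beta> ^ b)) holomorphic_on ?S"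
      using b by (intro holomorphic_intros) auto
    show "(\<lambda>\<alpha>. \<Sum>\<^sub>\<infinity>\<nu>\<in>Ld. (pZ \<nu> ^ m * ee (of_real (B \<nu> g)) * exp ((1 / \<beta>) * of_real (pi * nm \<nu>))) * exp ((1 / \<alpha>) * of_real (- pi * np \<nu>))) holomorphic_on ?S"
    proof (rule comp, rule exp_sum_holomorphic[OF S(1)])
      fix z assume "z \<in> ?S"
      then have "(\<lambda>w. norm (pZ w) ^ m * exp (- (pi * Re z * np w - pi * Re (1 / \<beta>) * nm w))) summable_on Ld"
        using Reinv[OF b] by (intro Sm) auto
      then show "(\<lambda>\<nu>. norm (pZ \<nu> ^ m * ee (of_real (B \<nu> g)) * exp ((1 / \<beta>) * of_real (pi * nm \<nu>))) * exp (Re z * (- pi * np \<nu>))) summable_on Ld"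
        unfolding norm_mult norm_power nrm norm_ee_of_real
        by (rule summable_on_cong[THEN iffD1, rotated]) (simp only: mult.assoc exp_add[symmetric] mult_1_left, intro arg_cong2[of _ _ _ _ "(*)"] arg_cong[of _ _ exp] refl, simp add: algebra_simps)
    qed
  qed
  have hGB: "(\<lambda>\<beta>. G \<alpha> \<beta>) holomorphic_on ?S" if b: "Re \<alpha> > 0" for \<alpha>
    unfolding G_def GB
  proof (rule holomorphic_on_mult)
    show "(\<lambda>\<beta>. of_real kap * (- \<i>) ^ m / (\<alpha> ^ Suc m * csqrt \<beta> ^ b)) holomorphic_on ?S"
      using b by (intro holomorphic_intros) (auto simp: complex_nonpos_Reals_iff)
    show "(\<lambda>\<beta>. \<Sum>\<^sub>\<infinity>\<nu>\<in>Ld. (pZ \<nu> ^ m * ee (of_real (B \<nu> g)) * exp ((1 / \<alpha>) * of_real (- pi * np \<nu>))) * exp ((1 / \<beta>) * of_real (pi * nm \<nu>))) holomorphic_on ?S"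
    proof (rule comp, rule exp_sum_holomorphic[OF S(1)])
      fix z assume "z \<in> ?S"
      then have "(\<lambda>w. norm (pZ w) ^ m * exp (- (pi * Re (1 / \<alpha>) * np w - pi * Re z * nm w))) summable_on Ld"
        using Reinv[OF b] by (intro Sm) auto
      then show "(\<lambda>\<nu>. norm (pZ \<nu> ^ m * ee (of_real (B \<nu> g)) * exp ((1 / \<alpha>) * of_real (- pi * np \<nu>))) * exp (Re z * (pi * nm \<nu>))) summable_on Ld"
        unfolding norm_mult norm_power nrm norm_ee_of_real
        by (rule summable_on_cong[THEN iffD1, rotated]) (simp only: mult.assoc exp_add[symmetric] mult_1_left, intro arg_cong2[of _ _ _ _ "(*)"] arg_cong[of _ _ exp] refl, simp add: algebra_simps)
    qed
  qed
  have real: "F (of_real x) (of_real y) = G (of_real x) (of_real y)" if xy: "x > 0" "y > 0" for x y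
  proof -
    have e: "exp (of_real x * of_real (- pi * np w) + of_real y * of_real (pi * nm w)) = complex_of_real (exp (- pi * (x * np w - y * nm w)))" for w
      unfolding exp_of_real[symmetric] by (intro arg_cong[of _ _ exp]) (simp add: algebra_simps)
    have e2: "exp ((1 / of_real x) * of_real (- pi * np w) + (1 / of_real y) * of_real (pi * nm w)) = complex_of_real (exp (- pi * (np w / x - nm w / y)))" for w
      unfolding exp_of_real[symmetric] by (intro arg_cong[of _ _ exp]) (simp add: algebra_simps)
    have k: "complex_of_real kap * (- \<i>) ^ m / (of_real x ^ Suc m * csqrt (of_real y) ^ b) = of_real (kap / (x * sqrt y ^ b)) * (- \<i> / of_real x) ^ m"
      unfolding power_divide using xy by (simp add: csqrt_of_real_nonneg field_simps)
    have a: "c * f * complex_of_real d = complex_of_real d * f * c" for c d f by (simp only: mult_ac)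
    show ?thesis unfolding F_def G_def e e2 k unfolding mult.commute[of "pZ _ ^ m" "of_real _"] a
      by (rule poisson_poly_real[OF xy g, of m])
  qed
  have r1: "F \<alpha> (of_real y) = G \<alpha> (of_real y)" if a: "Re \<alpha> > 0" and y: "y > 0" for \<alpha> y
    by (rule real_line_continuation[OF hFA hGA S one]) (use a y real in auto)
  have "F \<alpha> \<beta> = G \<alpha> \<beta>"
    by (rule real_line_continuation[OF hFB[OF \<alpha>] hGB[OF \<alpha>] S one]) (use \<alpha> \<beta> r1 in auto)
  then show ?thesis unfolding F_def G_def .
qed

end

section \<open>The metaplectic group\<close>

lemma det2: "det (A::int^2^2) = A$1$1 * A$2$2 - A$1$2 * A$2$1"
  by (rule det_2)

lemma mm2:
  fixes A M :: "int^2^2"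
  shows "(A ** M)$1$1 = A$1$1 * M$1$1 + A$1$2 * M$2$1" "(A ** M)$1$2 = A$1$1 * M$1$2 + A$1$2 * M$2$2"
    "(A ** M)$2$1 = A$2$1 * M$1$1 + A$2$2 * M$2$1" "(A ** M)$2$2 = A$2$1 * M$1$2 + A$2$2 * M$2$2"
  by (simp_all add: matrix_matrix_mult_def sum_2)

lemma mat1_2 [simp]: "(mat 1 :: int^2^2)$1$1 = 1" "(mat 1 :: int^2^2)$1$2 = 0" "(mat 1 :: int^2^2)$2$1 = 0" "(mat 1 :: int^2^2)$2$2 = 1"
  by (simp_all add: mat_def)

definition mat2 :: "int \<Rightarrow> int \<Rightarrow> int \<Rightarrow> int \<Rightarrow> int^2^2" where
  "mat2 a b c d = vector [vector [a, b], vector [c, d]]"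

lemma mat2_nth [simp]: "mat2 a b c d $1$1 = a" "mat2 a b c d $1$2 = b" "mat2 a b c d $2$1 = c" "mat2 a b c d $2$2 = d"
  by (simp_all add: mat2_def)

lemma mat2_eqI:
  fixes A M :: "int^2^2"
  assumes "A$1$1 = M$1$1" "A$1$2 = M$1$2" "A$2$1 = M$2$1" "A$2$2 = M$2$2"
  shows "A = M"
  using assms by (simp add: vec_eq_iff forall_2)

lemma autom_nonzero:
  assumes "det A = 1" "Im \<tau> > 0"
  shows "autom_factor A \<tau> \<noteq> 0"
proof
  assume "autom_factor A \<tau> = 0"
  then have "Im (autom_factor A \<tau>) = 0" "Re (autom_factor A \<tau>) = 0" by auto
  then have "A$2$1 = 0" "A$2$2 = 0" using assms(2) by (auto simp: autom_factor_def)
  then show False using assms(1) by (simp add: det2)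
qed

lemma Im_moebius:
  assumes "det A = 1" "Im \<tau> > 0"
  shows "Im (moebius_act A \<tau>) = Im \<tau> / (norm (autom_factor A \<tau>))\<^sup>2"
proof -
  let ?w = "autom_factor A \<tau>" and ?v = "of_int (A$1$1) * \<tau> + of_int (A$1$2)"
  have d: "of_int (A$1$1) * of_int (A$2$2) - of_int (A$1$2) * of_int (A$2$1) = (1::real)"
    using arg_cong[OF assms(1)[unfolded det2], of real_of_int] by simp
  have "Im (?v / ?w) = (Im ?v * Re ?w - Re ?v * Im ?w) / (norm ?w)\<^sup>2" by (simp add: Im_divide cmod_power2)
  also have "Im ?v * Re ?w - Re ?v * Im ?w = Im \<tau> * (of_int (A$1$1) * of_int (A$2$2) - of_int (A$1$2) * of_int (A$2$1))"
    by (simp add: autom_factor_def algebra_simps)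
  finally show ?thesis unfolding d moebius_act_def by simp
qed

lemma moebius_upper: "det A = 1 \<Longrightarrow> \<tau> \<in> upper_half \<Longrightarrow> moebius_act A \<tau> \<in> upper_half"
  using Im_moebius[of A \<tau>] autom_nonzero[of A \<tau>] by (auto simp: upper_half_def)

lemma autom_mult:
  assumes "det M = 1" "\<tau> \<in> upper_half"
  shows "autom_factor (A ** M) \<tau> = autom_factor A (moebius_act M \<tau>) * autom_factor M \<tau>"
proof -
  have nz: "autom_factor M \<tau> \<noteq> 0" using assms by (intro autom_nonzero) (auto simp: upper_half_def)
  have "autom_factor A (moebius_act M \<tau>) * autom_factor M \<tau> = of_int (A$2$1) * (of_int (M$1$1) * \<tau> + of_int (M$1$2)) + of_int (A$2$2) * autom_factor M \<tau>"
    using nz unfolding autom_factor_def[of A] moebius_act_def by (simp add: field_simps)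
  then show ?thesis unfolding autom_factor_def by (simp add: mm2 algebra_simps)
qed

lemma moebius_mult:
  assumes "det M = 1" "\<tau> \<in> upper_half" "det A = 1"
  shows "moebius_act (A ** M) \<tau> = moebius_act A (moebius_act M \<tau>)"
proof -
  have nz: "autom_factor M \<tau> \<noteq> 0" using assms by (intro autom_nonzero) (auto simp: upper_half_def)
  have "(of_int (A$1$1) * moebius_act M \<tau> + of_int (A$1$2)) * autom_factor M \<tau> = of_int (A$1$1) * (of_int (M$1$1) * \<tau> + of_int (M$1$2)) + of_int (A$1$2) * autom_factor M \<tau>"
    using nz unfolding moebius_act_def by (simp add: field_simps)
  also have "\<dots> = of_int ((A ** M)$1$1) * \<tau> + of_int ((A ** M)$1$2)"
    unfolding autom_factor_def by (simp add: mm2 algebra_simps)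
  finally have E: "of_int ((A ** M)$1$1) * \<tau> + of_int ((A ** M)$1$2) = (of_int (A$1$1) * moebius_act M \<tau> + of_int (A$1$2)) * autom_factor M \<tau>" ..
  show ?thesis
    unfolding moebius_act_def[of "A ** M"] autom_mult[OF assms(1,2)] moebius_act_def[of A "moebius_act M \<tau>"] E
    using nz by simp
qed

lemma moebius_one [simp]: "moebius_act (mat 1) \<tau> = \<tau>" by (simp add: moebius_act_def autom_factor_def)

lemma autom_one [simp]: "autom_factor (mat 1) \<tau> = 1" by (simp add: autom_factor_def)

lemma det_mm: "det (A ** M) = det A * det (M::int^2^2)" by (rule det_mul)

lemma moebius_holo: "det A = 1 \<Longrightarrow> moebius_act A holomorphic_on upper_half"
proof -
  assume A: "det A = 1"
  have "(\<lambda>\<tau>. (of_int (A$1$1) * \<tau> + of_int (A$1$2)) / autom_factor A \<tau>) holomorphic_on upper_half"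
    unfolding autom_factor_def
    by (intro holomorphic_intros) (use autom_nonzero[OF A] in \<open>auto simp: upper_half_def autom_factor_def\<close>)
  then show ?thesis by (simp add: moebius_act_def[abs_def])
qed

abbreviation mp2_times :: "mp2 \<Rightarrow> mp2 \<Rightarrow> mp2" (infixl "\<star>" 70) where "g \<star> h \<equiv> g \<otimes>\<^bsub>Mp2Z\<^esub> h"
abbreviation act :: "mp2 \<Rightarrow> complex \<Rightarrow> complex" where "act g \<equiv> moebius_act (fst g)"

lemma mp2_iff: "g \<in> carrier Mp2Z \<longleftrightarrow> det (fst g) = 1 \<and> snd g \<in> extensional upper_half \<and>
    snd g holomorphic_on upper_half \<and> (\<forall>\<tau>\<in>upper_half. (snd g \<tau>)\<^sup>2 = autom_factor (fst g) \<tau>)"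
  by (cases g) (simp add: Mp2Z_def)

lemma mp2_mult: "g \<star> h = (fst g ** fst h, \<lambda>\<tau>\<in>upper_half. snd g (act h \<tau>) * snd h \<tau>)"
  by (cases g; cases h) (simp add: Mp2Z_def)

lemma mp2_one: "\<one>\<^bsub>Mp2Z\<^esub> = (mat 1, \<lambda>\<tau>\<in>upper_half. 1)" by (simp add: Mp2Z_def)

lemma holo_restrict: "f holomorphic_on upper_half \<Longrightarrow> (\<lambda>\<tau>\<in>upper_half. f \<tau>) holomorphic_on upper_half"
  by (rule holomorphic_transform) auto

lemma mp2_phi_nonzero: "g \<in> carrier Mp2Z \<Longrightarrow> \<tau> \<in> upper_half \<Longrightarrow> snd g \<tau> \<noteq> 0"
  using autom_nonzero[of "fst g" \<tau>] unfolding mp2_iff upper_half_def by force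

definition inv2 :: "int^2^2 \<Rightarrow> int^2^2" where "inv2 A = mat2 (A$2$2) (- A$1$2) (- A$2$1) (A$1$1)"

lemma inv2: "det A = 1 \<Longrightarrow> det (inv2 A) = 1" "det A = 1 \<Longrightarrow> inv2 A ** A = mat 1" "det A = 1 \<Longrightarrow> A ** inv2 A = mat 1"
proof -
  show "det A = 1 \<Longrightarrow> det (inv2 A) = 1" by (simp add: det2 inv2_def algebra_simps)
  show "det A = 1 \<Longrightarrow> inv2 A ** A = mat 1" "det A = 1 \<Longrightarrow> A ** inv2 A = mat 1"
    by (auto intro!: mat2_eqI simp: mm2 inv2_def det2 algebra_simps)
qed

lemma mp2_closed: assumes g: "g \<in> carrier Mp2Z" and h: "h \<in> carrier Mp2Z" shows "g \<star> h \<in> carrier Mp2Z"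
proof -
  have dh: "det (fst h) = 1" and dg: "det (fst g) = 1" using g h by (auto simp: mp2_iff)
  have "(\<lambda>\<tau>. snd g (act h \<tau>)) holomorphic_on upper_half"
    using holomorphic_on_compose_gen[OF moebius_holo[OF dh], of "snd g" upper_half] g moebius_upper[OF dh]
    by (auto simp: mp2_iff o_def)
  then have "(\<lambda>\<tau>\<in>upper_half. snd g (act h \<tau>) * snd h \<tau>) holomorphic_on upper_half"
    using h by (intro holo_restrict holomorphic_intros) (auto simp: mp2_iff)
  moreover have "(snd g (act h \<tau>) * snd h \<tau>)\<^sup>2 = autom_factor (fst g ** fst h) \<tau>" if "\<tau> \<in> upper_half" for \<tau>
    using g h autom_mult[OF dh that] moebius_upper[OF dh that] that by (simp add: mp2_iff power_mult_distrib)
  ultimately show ?thesis using dg dh by (simp add: mp2_mult mp2_iff det_mm)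
qed

lemma group_Mp2Z: "group Mp2Z"
proof (rule groupI)
  show "\<one>\<^bsub>Mp2Z\<^esub> \<in> carrier Mp2Z" by (auto simp: mp2_iff mp2_one det2 intro!: holo_restrict)
  fix g h k assume g: "g \<in> carrier Mp2Z" and h: "h \<in> carrier Mp2Z" and k: "k \<in> carrier Mp2Z"
  have d: "det (fst g) = 1" "det (fst h) = 1" "det (fst k) = 1" using g h k by (auto simp: mp2_iff)
  show "g \<star> h \<star> k = g \<star> (h \<star> k)"
    using d by (auto simp: mp2_mult matrix_mul_assoc moebius_mult moebius_upper intro!: restrict_ext)
next
  fix g assume g: "g \<in> carrier Mp2Z"
  have d: "det (fst g) = 1" using g by (auto simp: mp2_iff)
  have ext: "(\<lambda>\<tau>\<in>upper_half. snd g \<tau>) = snd g" using g by (simp add: mp2_iff extensional_restrict)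
  show "\<one>\<^bsub>Mp2Z\<^esub> \<star> g = g"
  proof -
    have "(\<lambda>\<tau>\<in>upper_half. (\<lambda>\<tau>\<in>upper_half. 1) (act g \<tau>) * snd g \<tau>) = (\<lambda>\<tau>\<in>upper_half. snd g \<tau>)"
      using moebius_upper[OF d] by (intro restrict_ext) auto
    then show ?thesis by (simp add: mp2_mult mp2_one ext matrix_mul_lid)
  qed
  let ?h = "(inv2 (fst g), \<lambda>\<tau>\<in>upper_half. 1 / snd g (moebius_act (inv2 (fst g)) \<tau>))"
  have di: "det (inv2 (fst g)) = 1" using inv2(1)[OF d] .
  have ad: "autom_factor (inv2 (fst g)) \<tau> = 1 / autom_factor (fst g) (moebius_act (inv2 (fst g)) \<tau>)" if "\<tau> \<in> upper_half" for \<tau>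
  proof -
    have "x * y = 1 \<Longrightarrow> y = 1 / x" for x y :: complex by (cases "x = 0") (auto simp: field_simps)
    then show ?thesis using autom_mult[OF di that, of "fst g"] inv2(3)[OF d] by simp
  qed
  have "?h \<in> carrier Mp2Z"
    unfolding mp2_iff fst_conv snd_conv
  proof (intro conjI ballI di)
    have "(\<lambda>\<tau>. snd g (moebius_act (inv2 (fst g)) \<tau>)) holomorphic_on upper_half"
      using holomorphic_on_compose_gen[OF moebius_holo[OF di], of "snd g" upper_half] g moebius_upper[OF di]
      by (auto simp: mp2_iff o_def)
    then show "(\<lambda>\<tau>\<in>upper_half. 1 / snd g (moebius_act (inv2 (fst g)) \<tau>)) holomorphic_on upper_half"
      by (intro holo_restrict holomorphic_intros) (use mp2_phi_nonzero[OF g] moebius_upper[OF di] in auto)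
    fix \<tau> assume t: "\<tau> \<in> upper_half"
    show "((\<lambda>\<tau>\<in>upper_half. 1 / snd g (moebius_act (inv2 (fst g)) \<tau>)) \<tau>)\<^sup>2 = autom_factor (inv2 (fst g)) \<tau>"
      using g t moebius_upper[OF di t] by (simp add: ad mp2_iff power_divide)
  qed auto
  moreover have "?h \<star> g = \<one>\<^bsub>Mp2Z\<^esub>"
  proof -
    have "moebius_act (inv2 (fst g)) (act g \<tau>) = \<tau>" if "\<tau> \<in> upper_half" for \<tau>
      using moebius_mult[OF d that di] inv2(2)[OF d] by simp
    then show ?thesis using mp2_phi_nonzero[OF g] moebius_upper[OF d]
      by (auto simp: mp2_mult mp2_one inv2(2)[OF d] intro!: restrict_ext)
  qed
  ultimately show "\<exists>h\<in>carrier Mp2Z. h \<star> g = \<one>\<^bsub>Mp2Z\<^esub>" by blast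
qed (rule mp2_closed)

interpretation Mp: group Mp2Z by (rule group_Mp2Z)

section \<open>Translations, inversion and generation by S and T\<close>

definition Tpow :: "int \<Rightarrow> mp2" where "Tpow n = (mat2 1 n 0 1, \<lambda>\<tau>\<in>upper_half. 1)"

lemma Tpow_carrier: "Tpow n \<in> carrier Mp2Z"
  by (auto simp: mp2_iff Tpow_def det2 autom_factor_def intro!: holo_restrict)

lemma moebius_Tpow: "act (Tpow n) \<tau> = \<tau> + of_int n"
  by (simp add: Tpow_def moebius_act_def autom_factor_def)

lemma Tpow_add: "Tpow n \<star> Tpow k = Tpow (n + k)"
proof -
  have "mat2 1 n 0 1 ** mat2 1 k 0 1 = mat2 1 (n + k) 0 1" by (rule mat2_eqI) (auto simp: mm2)
  moreover have "\<tau> + of_int k \<in> upper_half" if "\<tau> \<in> upper_half" for \<tau> using that by (simp add: upper_half_def)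
  ultimately show ?thesis by (auto simp: mp2_mult Tpow_def moebius_act_def autom_factor_def intro!: restrict_ext)
qed

lemma Tpow_0: "Tpow 0 = \<one>\<^bsub>Mp2Z\<^esub>"
  by (auto simp: Tpow_def mp2_one intro!: mat2_eqI)

lemma Tpow_1: "Tpow 1 = T_elt" by (simp add: Tpow_def T_elt_def mat2_def)

lemma Tpow_inv: "inv\<^bsub>Mp2Z\<^esub> (Tpow n) = Tpow (- n)"
  by (rule Mp.inv_equality) (simp_all add: Tpow_add Tpow_0 Tpow_carrier)

lemma generate_T: "generate Mp2Z {T_elt} = range Tpow"
proof
  show "generate Mp2Z {T_elt} \<subseteq> range Tpow"
  proof
    fix x assume "x \<in> generate Mp2Z {T_elt}"
    then show "x \<in> range Tpow"
    proof (induction rule: generate.induct)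
      case one
      show ?case unfolding Tpow_0[symmetric] by (rule rangeI)
    next
      case (incl h)
      then have "h = Tpow 1" by (simp add: Tpow_1)
      then show ?case by blast
    next
      case (inv h)
      then have "inv\<^bsub>Mp2Z\<^esub> h = Tpow (-1)" using Tpow_inv[of 1] by (simp add: Tpow_1)
      then show ?case by blast
    next
      case (eng h1 h2)
      then show ?case using Tpow_add by (metis (no_types, lifting) rangeE rangeI)
    qed
  qed
  have "Tpow n \<in> generate Mp2Z {T_elt}" for n
  proof (induction n rule: int_induct[where k=0])
    case base then show ?case unfolding Tpow_0 by (rule generate.one)
  next
    case (step1 i)
    have "T_elt \<in> generate Mp2Z {T_elt}" by (rule generate.incl) simp
    from generate.eng[OF step1(2) this] show ?case unfolding Tpow_1[symmetric] Tpow_add .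
  next
    case (step2 i)
    have "inv\<^bsub>Mp2Z\<^esub> T_elt \<in> generate Mp2Z {T_elt}" by (rule generate.inv) simp
    from generate.eng[OF step2(2) this] show ?case unfolding Tpow_1[symmetric] Tpow_inv Tpow_add by simp
  qed
  then show "range Tpow \<subseteq> generate Mp2Z {T_elt}" by auto
qed

lemma S_carrier: "S_elt \<in> carrier Mp2Z"
proof -
  have "csqrt holomorphic_on upper_half"
    by (rule holomorphic_on_subset[OF holomorphic_on_csqrt]) (auto simp: upper_half_def complex_nonpos_Reals_iff)
  then show ?thesis
    by (auto simp: mp2_iff S_elt_def det2 autom_factor_def intro!: holo_restrict)
qed

lemma fst_S: "fst S_elt = mat2 0 (-1) 1 0" by (simp add: S_elt_def mat2_def)

lemma moebius_S: "act S_elt \<tau> = - 1 / \<tau>"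
  by (simp add: fst_S moebius_act_def autom_factor_def)

lemma mp2_eqI: "g \<in> carrier Mp2Z \<Longrightarrow> h \<in> carrier Mp2Z \<Longrightarrow> fst g = fst h \<Longrightarrow> (\<And>\<tau>. \<tau> \<in> upper_half \<Longrightarrow> snd g \<tau> = snd h \<tau>) \<Longrightarrow> g = h"
  unfolding mp2_iff by (metis extensionalityI prod.expand)

lemma upper_half_convex: "convex upper_half"
  unfolding upper_half_def by (rule convex_halfspace_Im_gt)

lemma upper_half_open: "open upper_half"
  unfolding upper_half_def by (rule open_halfspace_Im_gt)

lemma ii_upper: "\<i> \<in> upper_half" by (simp add: upper_half_def)

text \<open>The quotient of the two roots squares to 1 and is continuous on the connected half
  plane, so it is a constant sign.\<close>

lemma mp2_same_matrix:
  assumes g: "g \<in> carrier Mp2Z" and h: "h \<in> carrier Mp2Z" and eq: "fst g = fst h"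
  shows "\<exists>e\<in>{1, -1}. \<forall>\<tau>\<in>upper_half. snd g \<tau> = e * snd h \<tau>"
proof -
  let ?f = "\<lambda>\<tau>. snd g \<tau> / snd h \<tau>"
  have nz: "snd h \<tau> \<noteq> 0" if "\<tau> \<in> upper_half" for \<tau> using mp2_phi_nonzero[OF h that] .
  have "(?f \<tau>)\<^sup>2 = 1" if "\<tau> \<in> upper_half" for \<tau>
    using g h that nz[OF that] eq by (simp add: mp2_iff power_divide) (metis divide_self power_not_zero)
  then have r: "?f \<tau> \<in> {1, -1}" if "\<tau> \<in> upper_half" for \<tau> using that by (simp add: power2_eq_1_iff)
  have "?f constant_on upper_half"
  proof (rule continuous_finite_range_constant)
    show "connected upper_half" using upper_half_convex by (rule convex_connected)
    have "?f holomorphic_on upper_half" using g h nz by (intro holomorphic_intros) (auto simp: mp2_iff)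
    then show "continuous_on upper_half ?f" by (rule holomorphic_on_imp_continuous_on)
    have "?f ` upper_half \<subseteq> {1, -1}" using r by blast
    then show "finite (?f ` upper_half)" by (rule finite_subset) simp
  qed
  then obtain e where e: "\<And>\<tau>. \<tau> \<in> upper_half \<Longrightarrow> ?f \<tau> = e" by (auto simp: constant_on_def)
  have "e \<in> {1, -1}" using r[OF ii_upper] unfolding e[OF ii_upper] .
  moreover have "snd g \<tau> = e * snd h \<tau>" if "\<tau> \<in> upper_half" for \<tau> using e[OF that] nz[OF that] by (simp add: field_simps)
  ultimately show ?thesis by blast
qed

text \<open>Euclid's algorithm on the lower row: \<open>S\<close> and \<open>T\<close> generate.\<close>

lemma mp2_induct:
  assumes g: "g \<in> carrier Mp2Z" and PS: "P S_elt" and PT: "P T_elt" and P1: "P \<one>\<^bsub>Mp2Z\<^esub>"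
    and mult: "\<And>g h. g \<in> carrier Mp2Z \<Longrightarrow> h \<in> carrier Mp2Z \<Longrightarrow> P g \<Longrightarrow> P h \<Longrightarrow> P (g \<star> h)"
    and inv: "\<And>g. g \<in> carrier Mp2Z \<Longrightarrow> P g \<Longrightarrow> P (inv\<^bsub>Mp2Z\<^esub> g)"
  shows "P g"
proof -
  have PTn: "P (Tpow n)" for n
  proof (induction n rule: int_induct[where k=0])
    case base then show ?case using P1 by (simp add: Tpow_0)
  next
    case (step1 i)
    then show ?case using mult[OF Tpow_carrier Tpow_carrier, of i 1] PT by (simp add: Tpow_1 flip: Tpow_add)
  next
    case (step2 i)
    have "P (Tpow (-1))" using inv[OF Tpow_carrier, of 1] PT by (simp add: Tpow_1 flip: Tpow_inv)
    then show ?case using mult[OF Tpow_carrier Tpow_carrier, of i "-1"] step2 by (simp add: Tpow_add)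
  qed
  \<comment> \<open>Right multiplication by an element satisfying \<open>P\<close> can be undone, so
    \<open>g\<close> may be reduced from the right.\<close>
  have canc: "P g" if "g \<in> carrier Mp2Z" "h \<in> carrier Mp2Z" "P h" "P (g \<star> h)" for g h
  proof -
    have 1: "P ((g \<star> h) \<star> inv\<^bsub>Mp2Z\<^esub> h)" by (rule mult[OF mp2_closed[OF that(1,2)] Mp.inv_closed[OF that(2)] that(4) inv[OF that(2,3)]])
    have "(g \<star> h) \<star> inv\<^bsub>Mp2Z\<^esub> h = g \<star> (h \<star> inv\<^bsub>Mp2Z\<^esub> h)"
      using that by (intro Mp.m_assoc Mp.inv_closed)
    also have "\<dots> = g" unfolding Mp.r_inv[OF that(2)] by (rule Mp.r_one[OF that(1)])
    finally show ?thesis using 1 by (simp only:)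
  qed
  \<comment> \<open>\<open>?S2\<close> has the matrix -1, and \<open>?S4\<close> has the identity
    matrix with root -1. They supply the missing sign of the matrix and the missing sign of the
    root.\<close>
  let ?S2 = "S_elt \<star> S_elt"
  let ?S4 = "?S2 \<star> ?S2"
  have S2c: "?S2 \<in> carrier Mp2Z" "?S4 \<in> carrier Mp2Z" using S_carrier by auto
  have PS2: "P ?S2" "P ?S4" using mult S_carrier PS S2c by blast+
  have fS2: "fst ?S2 = mat2 (-1) 0 0 (-1)" by (rule mat2_eqI) (auto simp: mp2_mult fst_S mm2)
  have fS4: "fst ?S4 = mat2 1 0 0 1" by (rule mat2_eqI) (simp_all only: mp2_mult[of ?S2] fst_conv fS2 mm2, simp_all)
  have sS4: "snd ?S4 \<tau> = -1" if t: "\<tau> \<in> upper_half" for \<tau>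
  proof -
    have "moebius_act (mat2 (-1) 0 0 (-1)) \<tau> = \<tau>" by (simp add: moebius_act_def autom_factor_def)
    then have "snd ?S4 \<tau> = (snd ?S2 \<tau>)\<^sup>2" using t unfolding mp2_mult[of ?S2] fS2 by (simp add: power2_eq_square)
    also have "\<dots> = autom_factor (mat2 (-1) 0 0 (-1)) \<tau>" using S2c(1) t unfolding mp2_iff fS2 by blast
    finally show ?thesis by (simp add: autom_factor_def)
  qed
  have d1: "P g" if g: "g \<in> carrier Mp2Z" and c: "fst g$2$1 = 0" and d: "fst g$2$2 = 1" for g
  proof -
    have "fst g$1$1 = 1" using g c d by (simp add: mp2_iff det2)
    then have f: "fst g = fst (Tpow (fst g$1$2))" using c d by (intro mat2_eqI) (auto simp: Tpow_def)
    obtain e where e: "e \<in> {1, -1}" "\<forall>\<tau>\<in>upper_half. snd g \<tau> = e * snd (Tpow (fst g$1$2)) \<tau>"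
      using mp2_same_matrix[OF g Tpow_carrier f] by blast
    show ?thesis
    proof (cases "e = 1")
      case True
      then have "g = Tpow (fst g$1$2)" using e f by (intro mp2_eqI[OF g Tpow_carrier]) auto
      then show ?thesis using PTn by metis
    next
      case False
      then have e1: "e = -1" using e by auto
      let ?h = "?S4 \<star> Tpow (fst g$1$2)"
      have hc: "?h \<in> carrier Mp2Z" using S2c Tpow_carrier by auto
      have fh: "fst ?h = fst (Tpow (fst g$1$2))" unfolding mp2_mult[of ?S4] fst_conv fS4
        by (rule mat2_eqI) (auto simp: mm2 Tpow_def)
      have "g = ?h"
      proof (rule mp2_eqI[OF g hc])
        show "fst g = fst ?h" using f fh by simp
        fix \<tau> assume t: "\<tau> \<in> upper_half"
        have tt: "act (Tpow (fst g$1$2)) \<tau> \<in> upper_half" using t by (simp add: moebius_Tpow upper_half_def)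
        have "snd ?h \<tau> = snd ?S4 (act (Tpow (fst g$1$2)) \<tau>) * snd (Tpow (fst g$1$2)) \<tau>"
          unfolding mp2_mult[of ?S4] using t by simp
        then show "snd g \<tau> = snd ?h \<tau>" using e(2) t e1 unfolding sS4[OF tt] by simp
      qed
      then show ?thesis using mult[OF S2c(2) Tpow_carrier PS2(2) PTn] by metis
    qed
  qed
  have c0: "P g" if g: "g \<in> carrier Mp2Z" and c: "fst g$2$1 = 0" for g
  proof -
    have "fst g$1$1 * fst g$2$2 = 1" using g c by (simp add: mp2_iff det2)
    then have "fst g$2$2 = 1 \<or> fst g$2$2 = -1" by (metis zmult_eq_1_iff)
    then show ?thesis
    proof
      assume "fst g$2$2 = -1"
      have "P (g \<star> ?S2)"
      proof (rule d1)
        show "g \<star> ?S2 \<in> carrier Mp2Z" using g S2c by auto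
        show "fst (g \<star> ?S2)$2$1 = 0" "fst (g \<star> ?S2)$2$2 = 1"
          unfolding mp2_mult[of g] fst_conv fS2 using c \<open>fst g$2$2 = -1\<close> by (simp_all add: mm2)
      qed
      then show ?thesis using canc[OF g S2c(1) PS2(1)] by blast
    qed (use d1 g c in auto)
  qed
  have "P g" if "g \<in> carrier Mp2Z" "nat \<bar>fst g$2$1\<bar> = n" for g n
    using that
  proof (induction n arbitrary: g rule: less_induct)
    case (less n)
    show ?case
    proof (cases "fst g$2$1 = 0")
      case True then show ?thesis using c0 less.prems by blast
    next
      case False
      let ?c = "fst g$2$1" and ?d = "fst g$2$2"
      \<comment> \<open>With this exponent the lower left entry of \<open>g\<close> times
        \<open>?h\<close> becomes \<open>?d mod ?c\<close>.\<close>
      let ?k = "- (?d div ?c)"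
      let ?h = "Tpow ?k \<star> S_elt"
      have hc: "?h \<in> carrier Mp2Z" using Tpow_carrier S_carrier by auto
      have Ph: "P ?h" by (rule mult[OF Tpow_carrier S_carrier PTn PS])
      have gh: "g \<star> ?h \<in> carrier Mp2Z" using less.prems hc by auto
      have "fst (g \<star> ?h)$2$1 = ?d mod ?c"
        by (simp add: mp2_mult fst_S Tpow_def mm2 minus_div_mult_eq_mod[symmetric] algebra_simps)
      then have "nat \<bar>fst (g \<star> ?h)$2$1\<bar> < n" using False less.prems abs_mod_less[of ?c ?d] by simp
      then have "P (g \<star> ?h)" using less.IH gh by blast
      then show ?thesis using canc[OF less.prems(1) hc Ph] by blast
    qed
  qed
  then show ?thesis using g by blast
qed

section \<open>The theta function and the Weil representation\<close>

context quad
begin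

definition T :: "nat \<Rightarrow> complex \<Rightarrow> 'v \<Rightarrow> complex" where
  "T m \<tau> x = pZ x ^ m * ee (\<tau> * of_real (np x) / 2 + cnj \<tau> * of_real (nm x) / 2)"

text \<open>The theta function of the statement without its constant denominator, which
  \<open>theta_L_eq\<close> restores.\<close>

definition Th :: "nat \<Rightarrow> complex \<Rightarrow> 'v set \<Rightarrow> complex" where
  "Th m \<tau> c = (\<Sum>\<^sub>\<infinity>x\<in>Ld. T m \<tau> x * basis_vec (lat_coset L x) c)"

lemma cis_mhalf: "cis (- (pi / 2)) = - \<i>" by (simp add: complex_eq_iff)

lemma norm_T: "norm (T m \<tau> x) = norm (pZ x) ^ m * exp (- pi * Im \<tau> * Q x)"
  by (simp add: T_def norm_mult norm_power norm_ee Q_def algebra_simps)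

lemma T_summable:
  assumes "Im \<tau> > 0"
  shows "(\<lambda>x. norm (T m \<tau> x)) summable_on Ld"
proof -
  have "(\<lambda>x. norm (pZ x) ^ m * exp (- (pi * Im \<tau> * np x - pi * Im \<tau> * nm x) + 0 * B x X + 0 * B x Y + 0 * norm (pZ x))) summable_on Ld"
    by (rule theta_summable) (use assms in auto)
  then show ?thesis by (simp add: norm_T Q_def algebra_simps)
qed

lemma T_bounded_summable:
  assumes "Im \<tau> > 0" "\<And>x. norm (f x) \<le> 1"
  shows "(\<lambda>x. T m \<tau> x * f x) summable_on Ld"
  by (rule abs_summable_summable, rule summable_on_comparison_test[OF T_summable[OF assms(1)]])
     (use assms(2) in \<open>auto simp: norm_mult intro: mult_left_le\<close>)

lemma norm_basis_vec: "norm (basis_vec c d) \<le> 1" by (simp add: basis_vec_def)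

lemma coset_in_DL: "x \<in> Ld \<Longrightarrow> lat_coset L x \<in> DL" by (auto simp: disc_group_def)

lemma Th_coset:
  assumes "g \<in> Ld"
  shows "Th m \<tau> (lat_coset L g) = (\<Sum>\<^sub>\<infinity>x\<in>lat_coset L g. T m \<tau> x)"
  unfolding Th_def
proof (rule infsum_cong_neutral)
  fix x assume "x \<in> Ld - lat_coset L g"
  then show "T m \<tau> x * basis_vec (lat_coset L x) (lat_coset L g) = 0"
    by (auto simp: basis_vec_def coset_eq_iff mem_coset dest: L_closed(3))
next
  fix x assume "x \<in> Ld \<inter> lat_coset L g"
  then have "lat_coset L x = lat_coset L g" by (simp add: coset_eq_iff mem_coset)
  then show "T m \<tau> x * basis_vec (lat_coset L x) (lat_coset L g) = T m \<tau> x" by (simp add: basis_vec_def)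
qed (use coset_sub_Ld[OF assms] in auto)

lemma Th_outside: "c \<notin> DL \<Longrightarrow> Th m \<tau> c = 0"
  unfolding Th_def by (rule infsum_0) (use coset_in_DL in \<open>auto simp: basis_vec_def\<close>)

lemma Th_weighted:
  assumes "Im \<tau> > 0"
  shows "(\<Sum>\<^sub>\<infinity>x\<in>Ld. T m \<tau> x * \<phi> (lat_coset L x)) = (\<Sum>d\<in>DL. \<phi> d * Th m \<tau> d)"
proof -
  have s: "(\<lambda>x. \<phi> d * (T m \<tau> x * basis_vec (lat_coset L x) d)) summable_on Ld" for d
    by (intro summable_on_cmult_right T_bounded_summable assms norm_basis_vec)
  have "(\<Sum>\<^sub>\<infinity>x\<in>Ld. T m \<tau> x * \<phi> (lat_coset L x)) = (\<Sum>\<^sub>\<infinity>x\<in>Ld. \<Sum>d\<in>DL. \<phi> d * (T m \<tau> x * basis_vec (lat_coset L x) d))"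
  proof (rule infsum_cong)
    fix x assume "x \<in> Ld"
    then have "lat_coset L x \<in> DL" by (rule coset_in_DL)
    then have "(\<Sum>d\<in>DL. \<phi> d * (T m \<tau> x * basis_vec (lat_coset L x) d)) = (\<Sum>d\<in>{lat_coset L x}. \<phi> d * (T m \<tau> x * basis_vec (lat_coset L x) d))"
      by (intro sum.mono_neutral_right finite_DL) (auto simp: basis_vec_def)
    then show "T m \<tau> x * \<phi> (lat_coset L x) = (\<Sum>d\<in>DL. \<phi> d * (T m \<tau> x * basis_vec (lat_coset L x) d))"
      by (simp add: basis_vec_def mult.commute)
  qed
  also have "\<dots> = (\<Sum>d\<in>DL. \<Sum>\<^sub>\<infinity>x\<in>Ld. \<phi> d * (T m \<tau> x * basis_vec (lat_coset L x) d))"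
    using finite_sum_infsum[where f="\<lambda>d x. \<phi> d * (T m \<tau> x * basis_vec (lat_coset L x) d)", OF finite_DL s] by blast
  also have "\<dots> = (\<Sum>d\<in>DL. \<phi> d * Th m \<tau> d)" unfolding Th_def infsum_cmult_right' ..
  finally show ?thesis .
qed

lemma T_uminus: "T m \<tau> (- x) = (-1) ^ m * T m \<tau> x"
proof -
  have "pZ (- x) = - pZ x" by (simp add: pZ_def B_simps complex_eq_iff)
  moreover have n: "np (- x) = np x" by (simp add: np_def B_simps)
  moreover have "nm (- x) = nm x" using n by (simp add: nm_def B_simps)
  ultimately show ?thesis by (simp add: T_def power_minus[of "pZ x"])
qed

lemma uminus_bij: "bij_betw uminus Ld Ld"
  by (rule bij_betw_byWitness[of _ uminus]) (auto intro: Ld_closed)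

lemma Th_uminus:
  assumes "g \<in> Ld"
  shows "Th m \<tau> (lat_coset L (- g)) = (-1) ^ m * Th m \<tau> (lat_coset L g)"
proof -
  have "Th m \<tau> (lat_coset L (- g)) = (\<Sum>\<^sub>\<infinity>x\<in>Ld. T m \<tau> (- x) * basis_vec (lat_coset L (- x)) (lat_coset L (- g)))"
    unfolding Th_def by (rule infsum_reindex_bij_betw[OF uminus_bij, symmetric])
  also have "\<dots> = (\<Sum>\<^sub>\<infinity>x\<in>Ld. (-1) ^ m * (T m \<tau> x * basis_vec (lat_coset L x) (lat_coset L g)))"
  proof (rule infsum_cong)
    fix x
    have "lat_coset L (- x) = lat_coset L (- g) \<longleftrightarrow> lat_coset L x = lat_coset L g"
      unfolding coset_eq_iff using L_closed(3)[of "- x - - g"] L_closed(3)[of "x - g"] by auto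
    then show "T m \<tau> (- x) * basis_vec (lat_coset L (- x)) (lat_coset L (- g)) = (-1) ^ m * (T m \<tau> x * basis_vec (lat_coset L x) (lat_coset L g))"
      by (auto simp: T_uminus basis_vec_def)
  qed
  finally show ?thesis unfolding infsum_cmult_right' Th_def .
qed

text \<open>Within one coset the values \<open>B x x / 2\<close> differ by integers because
  \<open>L\<close> is even.\<close>

lemma Th_T:
  assumes c: "c \<in> DL"
  shows "Th m (\<tau> + 1) c = ee (of_real (B (rep c) (rep c) / 2)) * Th m \<tau> c"
proof -
  let ?g = "rep c"
  have g: "?g \<in> Ld" "lat_coset L ?g = c" using rep[OF c] by auto
  have "T m (\<tau> + 1) x = ee (of_real (B ?g ?g / 2)) * T m \<tau> x" if x: "x \<in> lat_coset L ?g" for x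
  proof -
    from x have l: "x - ?g \<in> L" by (simp add: mem_coset)
    have "B x x / 2 - B ?g ?g / 2 = B ?g (x - ?g) + B (x - ?g) (x - ?g) / 2"
      using symB[of x ?g] by (simp add: B_simps field_simps)
    also have "\<dots> \<in> \<int>" by (intro Ints_add B_int[OF g(1) l] L_even[OF l])
    finally have e: "ee (of_real (B x x / 2)) = ee (of_real (B ?g ?g / 2))" by (rule ee_eqI)
    have "(\<tau> + 1) * of_real (np x) / 2 + cnj (\<tau> + 1) * of_real (nm x) / 2 =
      of_real (B x x / 2) + (\<tau> * of_real (np x) / 2 + cnj \<tau> * of_real (nm x) / 2)"
      by (simp add: nm_def field_simps)
    then have "ee ((\<tau> + 1) * of_real (np x) / 2 + cnj (\<tau> + 1) * of_real (nm x) / 2) = ee (of_real (B ?g ?g / 2)) * ee (\<tau> * of_real (np x) / 2 + cnj \<tau> * of_real (nm x) / 2)"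
      by (simp only: ee_add e)
    then show ?thesis unfolding T_def by simp
  qed
  then have "(\<Sum>\<^sub>\<infinity>x\<in>lat_coset L ?g. T m (\<tau> + 1) x) = (\<Sum>\<^sub>\<infinity>x\<in>lat_coset L ?g. ee (of_real (B ?g ?g / 2)) * T m \<tau> x)"
    by (rule infsum_cong)
  moreover have "Th m t c = (\<Sum>\<^sub>\<infinity>x\<in>lat_coset L ?g. T m t x)" for t using Th_coset[OF g(1), of m t] g(2) by simp
  ultimately show ?thesis by (simp only: infsum_cmult_right')
qed

text \<open>Holomorphic weight \<open>1 + m\<close> and antiholomorphic weight \<open>b / 2\<close>.
  Written in powers of the root, the factor carries over to every element of the metaplectic
  group.\<close>

definition "Jm m \<tau> = csqrt \<tau> ^ (2 + 2 * m) * cnj (csqrt \<tau>) ^ b"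

text \<open>At \<open>- 1 / \<tau>\<close> the two weights of the majorant are
  \<open>\<i> / \<tau>\<close> and \<open>- \<i> / cnj \<tau>\<close>, both in the right half plane,
  and their reciprocals reproduce the exponents at \<open>\<tau>\<close>.\<close>

lemma Th_S:
  assumes \<tau>: "Im \<tau> > 0" and c: "c \<in> DL"
  shows "Th m (- 1 / \<tau>) c = Jm m \<tau> * (ee ((of_nat b - 2) / 8) * of_real kap) *
    (\<Sum>d\<in>DL. ee (of_real (- B (rep c) (rep d))) * Th m \<tau> d)"
proof -
  let ?g = "rep c"
  have g: "?g \<in> Ld" "lat_coset L ?g = c" using rep[OF c] by auto
  define \<alpha> where "\<alpha> = \<i> / \<tau>"
  define \<beta> where "\<beta> = - \<i> / cnj \<tau>"
  have t0: "\<tau> \<noteq> 0" using \<tau> by auto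
  have n0: "(Re \<tau>)\<^sup>2 + (Im \<tau>)\<^sup>2 > 0" using \<tau> by (simp add: add_nonneg_pos)
  have pos: "Re \<alpha> > 0" "Re \<beta> > 0" using \<tau> n0 by (simp_all add: \<alpha>_def \<beta>_def Re_divide)
  have e1: "T m (- 1 / \<tau>) x = pZ x ^ m * exp (\<alpha> * of_real (- pi * np x) + \<beta> * of_real (pi * nm x))" for x
    unfolding T_def ee_def \<alpha>_def \<beta>_def using t0
    by (intro arg_cong2[of _ _ _ _ "(*)"] arg_cong[of _ _ exp] refl) (simp add: field_simps)
  have i1: "1 / \<alpha> = - \<i> * \<tau>" "1 / \<beta> = \<i> * cnj \<tau>" using t0 by (simp_all add: \<alpha>_def \<beta>_def field_simps)
  have e2: "T m \<tau> x = pZ x ^ m * exp ((1 / \<alpha>) * of_real (- pi * np x) + (1 / \<beta>) * of_real (pi * nm x))" for x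
    unfolding T_def ee_def i1
    by (intro arg_cong2[of _ _ _ _ "(*)"] arg_cong[of _ _ exp] refl) (simp add: field_simps)
  \<comment> \<open>\<open>1 / \<beta>\<close> is conjugate to \<open>- \<i> * \<tau>\<close>, which
    lies in the right half plane; there the principal root commutes with conjugation and
    inversion.\<close>
  have cb: "csqrt \<beta> = inverse (cnj (csqrt \<tau>) * cis (pi / 4))"
  proof -
    have "\<beta> = inverse (cnj (- \<i> * \<tau>))" using t0 by (simp add: \<beta>_def field_simps)
    moreover have "Re (cnj (- \<i> * \<tau>)) > 0" using \<tau> by simp
    ultimately have "csqrt \<beta> = inverse (csqrt (cnj (- \<i> * \<tau>)))" using csqrt_inverse_pos by metis
    also have "csqrt (cnj (- \<i> * \<tau>)) = cnj (csqrt (- \<i> * \<tau>))"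
    proof (rule csqrt_unique)
      define w where "w = csqrt (- \<i> * \<tau>)"
      have w2: "w\<^sup>2 = - \<i> * \<tau>" by (simp add: w_def)
      have "(Re w)\<^sup>2 - (Im w)\<^sup>2 > 0" using \<tau> arg_cong[OF w2, of Re] by (simp add: power2_eq_square)
      then have "Re w \<noteq> 0" by auto
      moreover have "Re w \<ge> 0" unfolding w_def by (rule Re_csqrt)
      ultimately have "Re w > 0" by simp
      then show "0 < Re (cnj (csqrt (- \<i> * \<tau>))) \<or> Re (cnj (csqrt (- \<i> * \<tau>))) = 0 \<and> 0 \<le> Im (cnj (csqrt (- \<i> * \<tau>)))"
        unfolding w_def[symmetric] by simp
      show "(cnj (csqrt (- \<i> * \<tau>)))\<^sup>2 = cnj (- \<i> * \<tau>)" unfolding w_def[symmetric] complex_cnj_power[symmetric] w2 ..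
    qed
    also have "\<dots> = cnj (csqrt \<tau>) * cis (pi / 4)" unfolding csqrt_neg_ii[OF \<tau>] by (simp add: cis_cnj)
    finally show ?thesis .
  qed
  \<comment> \<open>The powers of \<open>\<i>\<close> and the eighth roots of unity from
    \<open>csqrt \<beta>\<close> combine to the constant of the Weil representation, up to
    \<open>(-1) ^ m\<close>.\<close>
  have K: "of_real kap * (- \<i>) ^ m / (\<alpha> ^ Suc m * csqrt \<beta> ^ b) = Jm m \<tau> * (ee ((of_nat b - 2) / 8) * of_real kap) * (-1) ^ m"
  proof -
    have "(- \<i>) ^ m / \<alpha> ^ Suc m = (-1) ^ m * (- \<i>) * \<tau> ^ Suc m"
    proof -
      have "1 / \<alpha> ^ Suc m = (- \<i>) ^ Suc m * \<tau> ^ Suc m" 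
      proof -
        have "1 / \<alpha> ^ Suc m = (1 / \<alpha>) ^ Suc m" by (simp add: power_divide)
        then show ?thesis by (simp only: i1(1) power_mult_distrib)
      qed
      moreover have "(- \<i>) ^ m / \<alpha> ^ Suc m = (- \<i>) ^ m * (1 / \<alpha> ^ Suc m)" by simp
      ultimately have "(- \<i>) ^ m / \<alpha> ^ Suc m = (- \<i>) ^ m * (- \<i>) ^ m * (- \<i>) * \<tau> ^ Suc m" by (simp only: power_Suc mult_ac)
      also have "(- \<i>) ^ m * (- \<i>) ^ m = (-1) ^ m" by (simp flip: power_mult_distrib)
      finally show ?thesis .
    qed
    moreover have "1 / csqrt \<beta> ^ b = cnj (csqrt \<tau>) ^ b * cis (pi / 4) ^ b"
      unfolding cb by (simp add: power_inverse power_mult_distrib field_simps)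
    moreover have "csqrt \<tau> ^ (2 + 2 * m) = \<tau> ^ Suc m"
      using power_mult[of "csqrt \<tau>" 2 "Suc m"] by simp
    moreover have "ee ((of_nat b - 2) / 8) = cis (pi / 4) ^ b * (- \<i>)"
    proof -
      have "ee ((of_nat b - 2) / 8) = ee (of_real ((real b - 2) / 8))" by simp
      also have "\<dots> = cis (real b * (pi / 4)) * cis (- (pi / 2))" unfolding ee_of_real cis_mult
        by (intro arg_cong[of _ _ cis]) (simp add: field_simps)
      finally show ?thesis unfolding cis_mhalf by (simp only: Complex.DeMoivre)
    qed
    moreover have "of_real kap * (- \<i>) ^ m / (\<alpha> ^ Suc m * csqrt \<beta> ^ b) = of_real kap * ((- \<i>) ^ m / \<alpha> ^ Suc m) * (1 / csqrt \<beta> ^ b)"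
      by simp
    ultimately show ?thesis unfolding Jm_def by (simp only: mult_ac)
  qed
  have "Th m (- 1 / \<tau>) c = (\<Sum>\<^sub>\<infinity>x\<in>lat_coset L ?g. T m (- 1 / \<tau>) x)" using Th_coset[OF g(1)] g(2) by simp
  also have "\<dots> = Jm m \<tau> * (ee ((of_nat b - 2) / 8) * of_real kap) * (-1) ^ m * (\<Sum>\<^sub>\<infinity>x\<in>Ld. pZ x ^ m * ee (of_real (B x ?g)) * exp ((1 / \<alpha>) * of_real (- pi * np x) + (1 / \<beta>) * of_real (pi * nm x)))"
    unfolding e1 poisson_poly_complex[OF pos g(1)] K ..
  also have "(\<Sum>\<^sub>\<infinity>x\<in>Ld. pZ x ^ m * ee (of_real (B x ?g)) * exp ((1 / \<alpha>) * of_real (- pi * np x) + (1 / \<beta>) * of_real (pi * nm x)))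
     = (\<Sum>\<^sub>\<infinity>x\<in>Ld. T m \<tau> x * ee (of_real (B x ?g)))"
    unfolding e2 by (intro infsum_cong) (simp only: mult_ac)
  \<comment> \<open>Replacing \<open>x\<close> by \<open>- x\<close> gives the character the sign of
    the Weil representation and brings a second \<open>(-1) ^ m\<close>, which cancels the
    first.\<close>
  also have "\<dots> = (\<Sum>\<^sub>\<infinity>x\<in>Ld. T m \<tau> (- x) * ee (of_real (B (- x) ?g)))"
    by (rule infsum_reindex_bij_betw[OF uminus_bij, symmetric])
  also have "\<dots> = (\<Sum>\<^sub>\<infinity>x\<in>Ld. (-1) ^ m * (T m \<tau> x * ee (of_real (- B ?g (rep (lat_coset L x))))))"
  proof (rule infsum_cong)
    fix x assume x: "x \<in> Ld"
    have "rep (lat_coset L x) - x \<in> L" using rep(3)[OF coset_in_DL[OF x]] by (simp add: mem_coset)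
    then have "B ?g (rep (lat_coset L x) - x) \<in> \<int>" by (rule B_int[OF g(1)])
    then have "B (- x) ?g - (- B ?g (rep (lat_coset L x))) \<in> \<int>" using symB[of x ?g] by (simp add: B_simps)
    from ee_eqI[OF this] show "T m \<tau> (- x) * ee (of_real (B (- x) ?g)) = (-1) ^ m * (T m \<tau> x * ee (of_real (- B ?g (rep (lat_coset L x)))))"
      unfolding T_uminus by (simp only: mult.assoc)
  qed
  also have "\<dots> = (-1) ^ m * (\<Sum>d\<in>DL. ee (of_real (- B ?g (rep d))) * Th m \<tau> d)"
    unfolding infsum_cmult_right' Th_weighted[OF \<tau>, of m "\<lambda>d. ee (of_real (- B ?g (rep d)))"] ..
  finally have "Th m (- 1 / \<tau>) c = Jm m \<tau> * (ee ((of_nat b - 2) / 8) * of_real kap) * ((-1) ^ m * (-1) ^ m) * (\<Sum>d\<in>DL. ee (of_real (- B ?g (rep d))) * Th m \<tau> d)"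
    by (simp only: mult.assoc)
  moreover have "(-1) ^ m * (-1) ^ m = (1 :: complex)" by (simp flip: power_mult_distrib)
  ultimately show ?thesis by simp
qed

lemma char_sum_minus:
  assumes "d \<in> Ld"
  shows "(\<Sum>c\<in>DL. ee (of_real (- B (rep c) d))) = (if d \<in> L then of_nat (card DL) else 0)"
proof -
  have "- B (rep c) d = B (- d) (rep c)" for c using symB[of d "rep c"] by (simp add: B_simps)
  moreover have "- d \<in> L \<longleftrightarrow> d \<in> L" using L_closed(3)[of d] L_closed(3)[of "- d"] by auto
  ultimately show ?thesis using char_sum[OF Ld_closed(3)[OF assms]] by simp
qed

lemma L_in_DL: "L \<in> DL"
proof -
  have "lat_coset L 0 = L" by (simp add: lat_coset_def)
  then show ?thesis using coset_in_DL[OF Ld_closed(1)] by simp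
qed

lemma card_DL_pos: "card DL > 0"
  using L_in_DL finite_DL card_gt_0_iff by blast

lemma rep_in_L_iff: "c \<in> DL \<Longrightarrow> rep c \<in> L \<longleftrightarrow> c = L"
proof -
  assume c: "c \<in> DL"
  have L0: "lat_coset L 0 = L" by (simp add: lat_coset_def)
  show ?thesis using rep(2)[OF c] coset_eq_iff[of "rep c" 0] L0 by auto
qed

text \<open>\<open>S\<close> fixes \<open>\<i>\<close>, where for \<open>m = 0\<close> the
  automorphy factor and the root of unity cancel. Applying the formula for \<open>S\<close> twice at
  the trivial class gives \<open>kap * kap * card DL = 1\<close>, since the theta value there is a
  sum of positive terms and can be cancelled.\<close>

lemma kap_eq: "kap = 1 / sqrt (real (card DL))"
proof -
  let ?a = "Th 0 \<i>"
  have J1: "Jm 0 \<i> * (ee ((of_nat b - 2) / 8) * of_real kap) = of_real kap"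
  proof -
    have ci: "csqrt \<i> = cis (pi / 4)"
      by (rule csqrt_unique) (simp_all add: power2_eq_square cis_mult complex_eq_iff cos_45)
    have "ee ((of_nat b - 2) / 8) = ee (of_real ((real b - 2) / 8))" by simp
    also have "\<dots> = cis (real b * (pi / 4)) * cis (- (pi / 2))" unfolding ee_of_real cis_mult
      by (intro arg_cong[of _ _ cis]) (simp add: field_simps)
    finally have e: "ee ((of_nat b - 2) / 8) = cis (pi / 4) ^ b * (- \<i>)" unfolding cis_mhalf by (simp only: Complex.DeMoivre)
    have "cnj (cis (pi / 4)) * cis (pi / 4) = 1" by (simp add: cis_cnj cis_mult)
    then have "cnj (cis (pi / 4)) ^ b * cis (pi / 4) ^ b = 1" by (metis power_mult_distrib power_one)
    moreover have "cis (pi / 4) ^ 2 = \<i>" by (simp add: power2_eq_square cis_mult complex_eq_iff)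
    ultimately show ?thesis unfolding Jm_def ci e by (simp add: mult_ac)
  qed
  have Sa: "?a c = of_real kap * (\<Sum>d\<in>DL. ee (of_real (- B (rep c) (rep d))) * ?a d)" if "c \<in> DL" for c
    using Th_S[of \<i> c 0] that J1 by simp
  \<comment> \<open>The trivial class pairs integrally with every class, so all characters in its
    row are 1.\<close>
  have "?a L = of_real kap * (\<Sum>d\<in>DL. ?a d)"
  proof -
    have "ee (of_real (- B (rep L) (rep d))) = 1" if "d \<in> DL" for d
    proof -
      have "rep L \<in> L" using rep_in_L_iff[OF L_in_DL] by simp
      then have "B (rep d) (rep L) \<in> \<int>" using B_int[OF rep(1)[OF that]] by simp
      then have "- B (rep L) (rep d) - 0 \<in> \<int>" using symB[of "rep L" "rep d"] by simp
      from ee_eqI[OF this] show ?thesis by (simp add: ee_def)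
    qed
    then show ?thesis using Sa[OF L_in_DL] by simp
  qed
  also have "(\<Sum>d\<in>DL. ?a d) = (\<Sum>c\<in>DL. of_real kap * (\<Sum>d\<in>DL. ee (of_real (- B (rep c) (rep d))) * ?a d))"
    by (rule sum.cong[OF refl]) (rule Sa)
  also have "\<dots> = of_real kap * (\<Sum>d\<in>DL. (\<Sum>c\<in>DL. ee (of_real (- B (rep c) (rep d)))) * ?a d)"
    unfolding sum_distrib_left[symmetric] sum_distrib_right by (subst sum.swap) simp
  also have "(\<Sum>d\<in>DL. (\<Sum>c\<in>DL. ee (of_real (- B (rep c) (rep d)))) * ?a d) = (\<Sum>d\<in>DL. (if d = L then of_nat (card DL) * ?a L else 0))"
    using char_sum_minus[OF rep(1)] rep_in_L_iff by (intro sum.cong) auto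
  also have "\<dots> = of_nat (card DL) * ?a L" using finite_DL L_in_DL by simp
  finally have 1: "?a L = of_real (kap * kap * card DL) * ?a L" by (simp add: mult_ac)
  have "?a L \<noteq> 0"
  proof -
    have eq: "T 0 \<i> x = of_real (exp (- pi * Q x))" for x
    proof -
      have "2 * complex_of_real pi * \<i> * (\<i> * of_real (np x) / 2 + cnj \<i> * of_real (nm x) / 2) = of_real (- pi * Q x)"
        by (simp add: complex_eq_iff Q_def algebra_simps)
      then show ?thesis unfolding T_def ee_def exp_of_real[symmetric] by simp
    qed
    have "?a L = (\<Sum>\<^sub>\<infinity>x\<in>L. of_real (exp (- pi * Q x)))"
      using Th_coset[OF Ld_closed(1), of 0 \<i>] unfolding eq by (simp add: lat_coset_def)
    moreover have s: "(\<lambda>x. exp (- pi * Q x)) summable_on L"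
      by (rule summable_on_subset[OF _ L_sub_Ld]) (use T_summable[of \<i> 0] in \<open>simp add: norm_T\<close>)
    moreover have "(\<Sum>x\<in>{0}. exp (- pi * Q x)) \<le> (\<Sum>\<^sub>\<infinity>x\<in>L. exp (- pi * Q x))"
      by (rule finite_sum_le_infsum[OF s]) (auto simp: L_closed(1))
    ultimately show ?thesis using infsum_of_real_summable[OF s] by (auto simp: Q_eq Hf.h_simps)
  qed
  then have "kap * kap * card DL = 1" using 1 by (metis mult_cancel_right1 of_real_eq_1_iff)
  then have "kap\<^sup>2 = 1 / card DL" using card_DL_pos by (simp add: field_simps power2_eq_square)
  then have "sqrt (kap\<^sup>2) = sqrt (1 / card DL)" by simp
  then show ?thesis using kap(1) by (simp add: real_sqrt_divide)
qed

end

section \<open>Unitarity of the Weil representation and the transformation law\<close>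

locale quad_weil = quad +
  fixes \<rho> :: "mp2 \<Rightarrow> ('a set \<Rightarrow> complex) \<Rightarrow> ('a set \<Rightarrow> complex)"
  assumes weil: "weil_representation B L b \<rho>"
begin

abbreviation "GA \<equiv> group_alg B L"
abbreviation "herm \<equiv> herm_pair B L"

lemma rho_closed: "g \<in> carrier Mp2Z \<Longrightarrow> f \<in> GA \<Longrightarrow> \<rho> g f \<in> GA"
  and rho_lin: "g \<in> carrier Mp2Z \<Longrightarrow> f \<in> GA \<Longrightarrow> h \<in> GA \<Longrightarrow> \<rho> g (\<lambda>c. p * f c + q' * h c) = (\<lambda>c. p * \<rho> g f c + q' * \<rho> g h c)"
  and rho_one: "f \<in> GA \<Longrightarrow> \<rho> \<one>\<^bsub>Mp2Z\<^esub> f = f"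
  and rho_mult: "g \<in> carrier Mp2Z \<Longrightarrow> g' \<in> carrier Mp2Z \<Longrightarrow> f \<in> GA \<Longrightarrow> \<rho> (g \<star> g') f = \<rho> g (\<rho> g' f)"
  and rho_T: "\<gamma> \<in> Ld \<Longrightarrow> \<rho> T_elt (basis_vec (lat_coset L \<gamma>)) = (\<lambda>d. ee (of_real (B \<gamma> \<gamma> / 2)) * basis_vec (lat_coset L \<gamma>) d)"
  and rho_S: "\<gamma> \<in> Ld \<Longrightarrow> \<rho> S_elt (basis_vec (lat_coset L \<gamma>)) =
          (\<lambda>d. ee ((of_nat b - 2) / 8) / of_real (sqrt (real (card DL))) *
               (\<Sum>c\<in>DL. ee (- of_real (B \<gamma> (SOME \<delta>. \<delta> \<in> c))) * basis_vec c d))"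
  using weil unfolding weil_representation_def by blast+

lemma basis_GA: "c \<in> DL \<Longrightarrow> basis_vec c \<in> GA" by (auto simp: group_alg_def basis_vec_def)

lemma scale_GA: "f \<in> GA \<Longrightarrow> (\<lambda>c. p * f c) \<in> GA" by (auto simp: group_alg_def)

lemma zero_GA: "(\<lambda>c. 0) \<in> GA" by (auto simp: group_alg_def)

lemma Th_GA: "Th m \<tau> \<in> GA" using Th_outside by (auto simp: group_alg_def)

lemma rho_scale: "g \<in> carrier Mp2Z \<Longrightarrow> f \<in> GA \<Longrightarrow> \<rho> g (\<lambda>c. p * f c) = (\<lambda>c. p * \<rho> g f c)"
  using rho_lin[of g f f p 0] by simp

lemma sum_GA: "finite D \<Longrightarrow> (\<And>d. d \<in> D \<Longrightarrow> f d \<in> GA) \<Longrightarrow> (\<lambda>c. \<Sum>d\<in>D. f d c) \<in> GA"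
  by (auto simp: group_alg_def)

lemma rho_sum:
  assumes "finite D" "g \<in> carrier Mp2Z" "\<And>d. d \<in> D \<Longrightarrow> f d \<in> GA"
  shows "\<rho> g (\<lambda>c. \<Sum>d\<in>D. p d * f d c) = (\<lambda>c. \<Sum>d\<in>D. p d * \<rho> g (f d) c)"
  using assms
proof (induction D rule: finite_induct)
  case empty
  then show ?case using rho_lin[OF empty(1) zero_GA zero_GA, of 0 0] by simp
next
  case (insert x D)
  have 1: "(\<lambda>c. \<Sum>d\<in>D. p d * f d c) \<in> GA" using insert by (intro sum_GA scale_GA) auto
  have "\<rho> g (\<lambda>c. \<Sum>d\<in>insert x D. p d * f d c) = \<rho> g (\<lambda>c. p x * f x c + 1 * (\<Sum>d\<in>D. p d * f d c))"
    using insert.hyps by simp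
  also have "\<dots> = (\<lambda>c. p x * \<rho> g (f x) c + 1 * \<rho> g (\<lambda>c. \<Sum>d\<in>D. p d * f d c) c)"
    using insert.prems by (intro rho_lin 1) auto
  also have "\<rho> g (\<lambda>c. \<Sum>d\<in>D. p d * f d c) = (\<lambda>c. \<Sum>d\<in>D. p d * \<rho> g (f d) c)"
    using insert.IH insert.prems by simp
  finally show ?case using insert.hyps by simp
qed

lemma GA_expand: "f \<in> GA \<Longrightarrow> f = (\<lambda>c. \<Sum>d\<in>DL. f d * basis_vec d c)"
proof
  fix c assume f: "f \<in> GA"
  show "f c = (\<Sum>d\<in>DL. f d * basis_vec d c)"
  proof (cases "c \<in> DL")
    case True
    have "(\<Sum>d\<in>DL. f d * basis_vec d c) = (\<Sum>d\<in>{c}. f d * basis_vec d c)"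
      using True by (intro sum.mono_neutral_right finite_DL) (auto simp: basis_vec_def)
    then show ?thesis by (simp add: basis_vec_def)
  next
    case False
    then have "(\<Sum>d\<in>DL. f d * basis_vec d c) = 0" by (intro sum.neutral) (auto simp: basis_vec_def)
    then show ?thesis using f False by (simp add: group_alg_def)
  qed
qed

lemma rho_expand:
  assumes "g \<in> carrier Mp2Z" "f \<in> GA"
  shows "\<rho> g f = (\<lambda>c. \<Sum>d\<in>DL. f d * \<rho> g (basis_vec d) c)"
  by (subst GA_expand[OF assms(2)]) (rule rho_sum[OF finite_DL assms(1) basis_GA])

lemma T_carrier: "T_elt \<in> carrier Mp2Z" using Tpow_carrier[of 1] by (simp add: Tpow_1)

lemma rho_T_apply:
  assumes "f \<in> GA"
  shows "\<rho> T_elt f = (\<lambda>c. ee (of_real (B (rep c) (rep c) / 2)) * f c)"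
proof
  fix c
  have "\<rho> T_elt f c = (\<Sum>d\<in>DL. f d * (ee (of_real (B (rep d) (rep d) / 2)) * basis_vec d c))"
    unfolding rho_expand[OF T_carrier assms]
  proof (rule sum.cong[OF refl])
    fix d assume "d \<in> DL"
    then show "f d * \<rho> T_elt (basis_vec d) c = f d * (ee (of_real (B (rep d) (rep d) / 2)) * basis_vec d c)"
      using rho_T[OF rep(1)] rep(2) by metis
  qed
  also have "\<dots> = ee (of_real (B (rep c) (rep c) / 2)) * (\<Sum>d\<in>DL. f d * basis_vec d c)"
    unfolding sum_distrib_left by (rule sum.cong) (auto simp: basis_vec_def)
  also have "(\<Sum>d\<in>DL. f d * basis_vec d c) = f c" using fun_cong[OF GA_expand[OF assms], of c] by simp
  finally show "\<rho> T_elt f c = ee (of_real (B (rep c) (rep c) / 2)) * f c" .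
qed

definition "kS = ee ((of_nat b - 2) / 8) * of_real kap"

lemma norm_kS: "kS * cnj kS * of_nat (card DL) = 1"
proof -
  have "ee ((of_nat b - 2) / 8) = ee (of_real ((real b - 2) / 8))" by simp
  then have "norm (ee ((of_nat b - 2) / 8)) = 1" by (simp only: norm_ee_of_real)
  then have "norm kS = kap" using kap(1) by (simp add: kS_def norm_mult)
  then have "kS * cnj kS = of_real (kap\<^sup>2)" by (simp add: complex_norm_square[symmetric])
  also have "kap\<^sup>2 = 1 / card DL" unfolding kap_eq by (simp add: power_divide)
  finally show ?thesis using card_DL_pos by simp
qed

lemma rho_S_apply:
  assumes "f \<in> GA" "c \<in> DL"
  shows "\<rho> S_elt f c = kS * (\<Sum>d\<in>DL. ee (of_real (- B (rep d) (rep c))) * f d)"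
proof -
  have k: "ee ((of_nat b - 2) / 8) / of_real (sqrt (real (card DL))) = kS"
    unfolding kS_def kap_eq by simp
  have "\<rho> S_elt (basis_vec d) c = kS * ee (of_real (- B (rep d) (rep c)))" if d: "d \<in> DL" for d
  proof -
    have "\<rho> S_elt (basis_vec d) c = kS * (\<Sum>e\<in>DL. ee (- of_real (B (rep d) (rep e))) * basis_vec e c)"
      using fun_cong[OF rho_S[OF rep(1)[OF d]], of c] unfolding rep(2)[OF d] k rep_def[symmetric] .
    also have "(\<Sum>e\<in>DL. ee (- of_real (B (rep d) (rep e))) * basis_vec e c) = (\<Sum>e\<in>{c}. ee (- of_real (B (rep d) (rep e))) * basis_vec e c)"
      using assms(2) by (intro sum.mono_neutral_right finite_DL) (auto simp: basis_vec_def)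
    finally show ?thesis by (simp add: basis_vec_def)
  qed
  then show ?thesis unfolding rho_expand[OF S_carrier assms(1)] sum_distrib_left
    by (intro sum.cong) (auto simp: mult_ac)
qed

lemma herm_T: assumes "f \<in> GA" "h \<in> GA" shows "herm (\<rho> T_elt f) (\<rho> T_elt h) = herm f h"
proof -
  have "ee (of_real x) * cnj (ee (of_real x)) = 1" for x
    using norm_ee_of_real[of x] by (simp add: complex_norm_square[symmetric])
  then have "(ee (of_real x) * u) * cnj (ee (of_real x) * v) = u * cnj v" for x u v
    by (metis (no_types, lifting) complex_cnj_mult mult.assoc mult.left_commute mult_1)
  then show ?thesis unfolding herm_pair_def rho_T_apply[OF assms(1)] rho_T_apply[OF assms(2)] by (simp only:)
qed

text \<open>Plancherel on the discriminant group: orthogonality of characters leaves the diagonal,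
  and \<open>norm_kS\<close> is the matching normalization.\<close>

lemma herm_S: assumes f: "f \<in> GA" and h: "h \<in> GA" shows "herm (\<rho> S_elt f) (\<rho> S_elt h) = herm f h"
proof -
  let ?E = "\<lambda>d c. ee (of_real (- B (rep d) (rep c)))"
  have cn: "cnj (ee (of_real x)) = ee (of_real (- x))" for x by (simp add: ee_def exp_cnj)
  have E: "?E d c * cnj (?E e c) = ee (of_real (B (rep e - rep d) (rep c)))" for d e c
    unfolding cn ee_add[symmetric] by (intro arg_cong[of _ _ ee]) (simp add: B_simps)
  have "herm (\<rho> S_elt f) (\<rho> S_elt h) = (\<Sum>c\<in>DL. (kS * (\<Sum>d\<in>DL. ?E d c * f d)) * cnj (kS * (\<Sum>e\<in>DL. ?E e c * h e)))"
    unfolding herm_pair_def by (rule sum.cong[OF refl]) (simp only: rho_S_apply[OF f] rho_S_apply[OF h])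
  also have "\<dots> = (\<Sum>c\<in>DL. kS * cnj kS * (\<Sum>d\<in>DL. \<Sum>e\<in>DL. (f d * cnj (h e)) * ee (of_real (B (rep e - rep d) (rep c)))))"
    unfolding complex_cnj_mult cnj_sum E[symmetric]
    by (intro sum.cong refl) (simp add: sum_product mult_ac)
  also have "\<dots> = kS * cnj kS * (\<Sum>d\<in>DL. \<Sum>e\<in>DL. (f d * cnj (h e)) * (\<Sum>c\<in>DL. ee (of_real (B (rep e - rep d) (rep c)))))"
  proof -
    have "(\<Sum>c\<in>DL. \<Sum>d\<in>DL. \<Sum>e\<in>DL. h c d e) = (\<Sum>d\<in>DL. \<Sum>e\<in>DL. \<Sum>c\<in>DL. h c d e)" for h :: "'a set \<Rightarrow> 'a set \<Rightarrow> 'a set \<Rightarrow> complex"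
      by (rule trans[OF sum.swap], rule sum.cong[OF refl], rule sum.swap)
    then show ?thesis unfolding sum_distrib_left[symmetric] by (simp only: sum_distrib_left)
  qed
  also have "(\<Sum>d\<in>DL. \<Sum>e\<in>DL. (f d * cnj (h e)) * (\<Sum>c\<in>DL. ee (of_real (B (rep e - rep d) (rep c))))) = (\<Sum>d\<in>DL. f d * cnj (h d) * of_nat (card DL))"
  proof (rule sum.cong[OF refl])
    fix d assume d: "d \<in> DL"
    have "(\<Sum>c\<in>DL. ee (of_real (B (rep e - rep d) (rep c)))) = (if e = d then of_nat (card DL) else 0)" if e: "e \<in> DL" for e
    proof -
      have "rep e - rep d \<in> L \<longleftrightarrow> e = d" using rep(2)[OF e] rep(2)[OF d] coset_eq_iff[of "rep e" "rep d"] by metis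
      then show ?thesis using char_sum[OF Ld_closed(4)[OF rep(1)[OF e] rep(1)[OF d]]] by simp
    qed
    then have "(\<Sum>e\<in>DL. (f d * cnj (h e)) * (\<Sum>c\<in>DL. ee (of_real (B (rep e - rep d) (rep c))))) = (\<Sum>e\<in>DL. if e = d then f d * cnj (h d) * of_nat (card DL) else 0)"
      by (intro sum.cong) auto
    then show "(\<Sum>e\<in>DL. (f d * cnj (h e)) * (\<Sum>c\<in>DL. ee (of_real (B (rep e - rep d) (rep c))))) = f d * cnj (h d) * of_nat (card DL)"
      using finite_DL d by simp
  qed
  also have "\<dots> = herm f h * of_nat (card DL)" unfolding herm_pair_def sum_distrib_right ..
  finally show ?thesis using norm_kS by (simp add: mult_ac)
qed

text \<open>\<open>Jm\<close> with the root belonging to \<open>S\<close> replaced by that of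
  \<open>g\<close>.\<close>

definition "jf m g \<tau> = snd g \<tau> ^ (2 + 2 * m) * cnj (snd g \<tau>) ^ b"

lemma jf_mult: "\<tau> \<in> upper_half \<Longrightarrow> jf m (g \<star> h) \<tau> = jf m g (act h \<tau>) * jf m h \<tau>"
  by (simp add: jf_def mp2_mult power_mult_distrib mult_ac)

text \<open>Unitarity and the transformation law are bundled so that one induction over the
  generators gives both.\<close>

definition good :: "nat \<Rightarrow> mp2 \<Rightarrow> bool" where
  "good m g \<longleftrightarrow> (\<forall>f\<in>GA. \<forall>h\<in>GA. herm (\<rho> g f) (\<rho> g h) = herm f h) \<and>
     (\<forall>\<tau>\<in>upper_half. Th m (act g \<tau>) = (\<lambda>c. jf m g \<tau> * \<rho> g (Th m \<tau>) c))"

lemma good_all: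
  assumes g: "g \<in> carrier Mp2Z"
  shows "good m g"
proof (rule mp2_induct[OF g])
  show "good m \<one>\<^bsub>Mp2Z\<^esub>"
    unfolding good_def by (auto simp: rho_one Th_GA jf_def) (auto simp: mp2_one)
  show "good m T_elt"
    unfolding good_def
  proof (intro conjI ballI herm_T)
    fix \<tau> assume "\<tau> \<in> upper_half"
    then have "jf m T_elt \<tau> = 1" by (simp add: jf_def T_elt_def)
    moreover have "act T_elt \<tau> = \<tau> + 1" using moebius_Tpow[of 1 \<tau>] by (simp add: Tpow_1)
    moreover have "Th m (\<tau> + 1) c = ee (of_real (B (rep c) (rep c) / 2)) * Th m \<tau> c" for c
      using Th_T[of c m \<tau>] Th_outside[of c m] by (cases "c \<in> DL") auto
    ultimately show "Th m (act T_elt \<tau>) = (\<lambda>c. jf m T_elt \<tau> * \<rho> T_elt (Th m \<tau>) c)"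
      unfolding rho_T_apply[OF Th_GA] by auto
  qed
  show "good m S_elt"
    unfolding good_def
  proof (intro conjI ballI herm_S ext)
    fix \<tau> c assume t: "\<tau> \<in> upper_half"
    then have "jf m S_elt \<tau> = Jm m \<tau>" by (simp add: jf_def Jm_def S_elt_def)
    moreover have "Th m (- 1 / \<tau>) c = Jm m \<tau> * \<rho> S_elt (Th m \<tau>) c"
    proof (cases "c \<in> DL")
      case True
      have "B (rep c) (rep d) = B (rep d) (rep c)" for d by (rule symB)
      then show ?thesis unfolding rho_S_apply[OF Th_GA True] kS_def using Th_S[of \<tau> c m] t True
        by (simp add: upper_half_def mult_ac)
    next
      case False
      then have "\<rho> S_elt (Th m \<tau>) c = 0" using rho_closed[OF S_carrier Th_GA, of m \<tau>] by (auto simp: group_alg_def)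
      then show ?thesis using Th_outside[OF False] by simp
    qed
    ultimately show "Th m (act S_elt \<tau>) c = jf m S_elt \<tau> * \<rho> S_elt (Th m \<tau>) c"
      unfolding moebius_S by simp
  qed
next
  fix g h assume gh: "g \<in> carrier Mp2Z" "h \<in> carrier Mp2Z" "good m g" "good m h"
  have d: "det (fst g) = 1" "det (fst h) = 1" using gh by (auto simp: mp2_iff)
  show "good m (g \<star> h)"
    unfolding good_def
  proof (intro conjI ballI)
    fix f k assume fk: "f \<in> GA" "k \<in> GA"
    show "herm (\<rho> (g \<star> h) f) (\<rho> (g \<star> h) k) = herm f k"
      unfolding rho_mult[OF gh(1,2) fk(1)] rho_mult[OF gh(1,2) fk(2)]
      using gh rho_closed[OF gh(2) fk(1)] rho_closed[OF gh(2) fk(2)] fk unfolding good_def by simp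
  next
    fix \<tau> assume t: "\<tau> \<in> upper_half"
    let ?s = "act h \<tau>"
    have s: "?s \<in> upper_half" by (rule moebius_upper[OF d(2) t])
    have m: "act (g \<star> h) \<tau> = act g ?s"
      unfolding mp2_mult fst_conv by (rule moebius_mult[OF d(2) t d(1)])
    have h: "Th m ?s = (\<lambda>c. jf m h \<tau> * \<rho> h (Th m \<tau>) c)" using gh(4) t unfolding good_def by blast
    have "Th m (act g ?s) = (\<lambda>c. jf m g ?s * \<rho> g (Th m ?s) c)" using gh(3) s unfolding good_def by blast
    also have "\<rho> g (Th m ?s) = (\<lambda>c. jf m h \<tau> * \<rho> g (\<rho> h (Th m \<tau>)) c)"
      unfolding h by (rule rho_scale[OF gh(1) rho_closed[OF gh(2) Th_GA]])
    finally show "Th m (act (g \<star> h) \<tau>) = (\<lambda>c. jf m (g \<star> h) \<tau> * \<rho> (g \<star> h) (Th m \<tau>) c)"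
      unfolding m jf_mult[OF t] rho_mult[OF gh(1,2) Th_GA] by (simp only: mult.assoc)
  qed
next
  fix g assume g: "g \<in> carrier Mp2Z" "good m g"
  let ?i = "inv\<^bsub>Mp2Z\<^esub> g"
  have i: "?i \<in> carrier Mp2Z" using g by simp
  have gi: "g \<star> ?i = \<one>\<^bsub>Mp2Z\<^esub>" "?i \<star> g = \<one>\<^bsub>Mp2Z\<^esub>" using g by simp_all
  have d: "det (fst g) = 1" "det (fst ?i) = 1" using g i by (auto simp: mp2_iff)
  have ri: "\<rho> g (\<rho> ?i f) = f" "\<rho> ?i (\<rho> g f) = f" if "f \<in> GA" for f
    using rho_mult[OF g(1) i that] rho_mult[OF i g(1) that] rho_one[OF that] gi by auto
  show "good m ?i"
    unfolding good_def
  proof (intro conjI ballI)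
    fix f k assume fk: "f \<in> GA" "k \<in> GA"
    have "herm (\<rho> g (\<rho> ?i f)) (\<rho> g (\<rho> ?i k)) = herm (\<rho> ?i f) (\<rho> ?i k)"
      using g(2) rho_closed[OF i fk(1)] rho_closed[OF i fk(2)] unfolding good_def by blast
    then show "herm (\<rho> ?i f) (\<rho> ?i k) = herm f k" using ri fk by simp
  next
    fix \<tau> assume t: "\<tau> \<in> upper_half"
    let ?s = "act ?i \<tau>"
    have s: "?s \<in> upper_half" by (rule moebius_upper[OF d(2) t])
    have ms: "act g ?s = \<tau>"
      using moebius_mult[OF d(2) t d(1)] gi(1) by (simp add: mp2_mult mp2_one)
    have j1: "jf m g ?s * jf m ?i \<tau> = 1"
      using jf_mult[OF t, of m g ?i] t unfolding gi(1) by (simp add: jf_def mp2_one)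
    have "Th m \<tau> = (\<lambda>c. jf m g ?s * \<rho> g (Th m ?s) c)" using g(2) s ms unfolding good_def by metis
    then have "\<rho> ?i (Th m \<tau>) = (\<lambda>c. jf m g ?s * \<rho> ?i (\<rho> g (Th m ?s)) c)"
      using rho_scale[OF i rho_closed[OF g(1) Th_GA], of "jf m g ?s" m ?s] by simp
    then have "\<rho> ?i (Th m \<tau>) = (\<lambda>c. jf m g ?s * Th m ?s c)" unfolding ri(2)[OF Th_GA] .
    then show "Th m ?s = (\<lambda>c. jf m ?i \<tau> * \<rho> ?i (Th m \<tau>) c)"
      using j1 by (simp add: mult.assoc[symmetric] mult.commute[of "jf m ?i \<tau>"])
  qed
qed

text \<open>\<open>\<rho> g\<close> is a bijection of \<open>GA\<close> whose inverse belongs to the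
  inverse group element, so the \<open>inv_into\<close> in the slash operator is an honest
  inverse.\<close>

lemma slash_eq:
  assumes g: "g \<in> carrier Mp2Z" and F: "\<And>t. F t \<in> GA"
  shows "slash B L \<rho> k F g \<tau> = \<rho> (inv\<^bsub>Mp2Z\<^esub> g) (\<lambda>c. snd g \<tau> powi (- k) * F (act g \<tau>) c)"
    "slash B L \<rho> k F g \<tau> \<in> GA"
proof -
  let ?i = "inv\<^bsub>Mp2Z\<^esub> g" and ?u = "\<lambda>c. snd g \<tau> powi (- k) * F (act g \<tau>) c"
  have i: "?i \<in> carrier Mp2Z" using g by simp
  have u: "?u \<in> GA" by (rule scale_GA[OF F])
  have ri: "\<rho> g (\<rho> ?i f) = f" "\<rho> ?i (\<rho> g f) = f" if "f \<in> GA" for f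
    using rho_mult[OF g(1) i that] rho_mult[OF i g(1) that] rho_one[OF that] g by auto
  have inj: "inj_on (\<rho> g) GA" by (rule inj_on_inverseI[of _ "\<rho> ?i"]) (rule ri(2))
  have "inv_into GA (\<rho> g) ?u = \<rho> ?i ?u"
    by (rule inv_into_f_eq[OF inj]) (rule rho_closed[OF i u], rule ri(1)[OF u])
  then show "slash B L \<rho> k F g \<tau> = \<rho> ?i ?u" by (simp add: slash_def)
  then show "slash B L \<rho> k F g \<tau> \<in> GA" using rho_closed[OF i u] by simp
qed

text \<open>Unitarity moves \<open>\<rho> g\<close> to the theta side. The factor
  \<open>p ^ b\<close> of the slash cancels the conjugate of \<open>cnj p ^ b\<close>; what is left
  is the absolute value of \<open>p\<close> to the power \<open>- 4 * (m + 1)\<close>, which is how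
  \<open>Im \<tau> ^ (m + 1)\<close> changes.\<close>

lemma slash_pairing:
  assumes g: "g \<in> carrier Mp2Z" and F: "\<And>t. F t \<in> GA" and t: "\<tau> \<in> upper_half"
  shows "herm (slash B L \<rho> (two_weight b m) F g \<tau>) (Th m \<tau>) * of_real (Im \<tau>) ^ (m + 1) =
    herm (F (act g \<tau>)) (Th m (act g \<tau>)) * of_real (Im (act g \<tau>)) ^ (m + 1)"
proof -
  let ?s = "act g \<tau>" and ?i = "inv\<^bsub>Mp2Z\<^esub> g"
  define p where "p = snd g \<tau>"
  have p0: "p \<noteq> 0" unfolding p_def by (rule mp2_phi_nonzero[OF g t])
  have d: "det (fst g) = 1" using g by (simp add: mp2_iff)
  have i: "?i \<in> carrier Mp2Z" using g by simp
  let ?u = "\<lambda>c. p powi (- two_weight b m) * F ?s c"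
  have u: "?u \<in> GA" by (rule scale_GA[OF F])
  have gm: "good m g" using good_all[OF g] .
  have ri: "\<rho> g (\<rho> ?i f) = f" if "f \<in> GA" for f
    using rho_mult[OF g(1) i that] rho_one[OF that] g by auto
  have "herm (slash B L \<rho> (two_weight b m) F g \<tau>) (Th m \<tau>) = herm (\<rho> ?i ?u) (Th m \<tau>)"
    unfolding slash_eq(1)[OF g F] p_def ..
  also have "\<dots> = herm (\<rho> g (\<rho> ?i ?u)) (\<rho> g (Th m \<tau>))"
    using gm rho_closed[OF i u] Th_GA unfolding good_def by simp
  also have "\<dots> = herm ?u (\<rho> g (Th m \<tau>))" unfolding ri[OF u] ..
  also have "\<rho> g (Th m \<tau>) = (\<lambda>c. Th m ?s c / (p ^ (2 + 2 * m) * cnj p ^ b))"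
  proof -
    have "Th m ?s = (\<lambda>c. (p ^ (2 + 2 * m) * cnj p ^ b) * \<rho> g (Th m \<tau>) c)"
      using gm t unfolding good_def jf_def p_def by blast
    then show ?thesis using p0 by (simp add: fun_eq_iff)
  qed
  also have "herm ?u (\<lambda>c. Th m ?s c / (p ^ (2 + 2 * m) * cnj p ^ b)) =
      p powi (- two_weight b m) / cnj (p ^ (2 + 2 * m) * cnj p ^ b) * herm (F ?s) (Th m ?s)"
    unfolding herm_pair_def sum_distrib_left by (intro sum.cong refl) simp
  also have "p powi (- two_weight b m) / cnj (p ^ (2 + 2 * m) * cnj p ^ b) = 1 / of_real ((norm p)\<^sup>2 ^ (2 + 2 * m))"
  proof -
    have "p powi (- two_weight b m) = p powi (int b) / p powi (int (2 + 2 * m))"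
    proof -
      have "- two_weight b m = int b - int (2 + 2 * m)" by (simp add: two_weight_def)
      then show ?thesis using power_int_diff[of p "int b" "int (2 + 2 * m)"] p0 by (simp only: simp_thms)
    qed
    then have "p powi (- two_weight b m) = p ^ b / p ^ (2 + 2 * m)" by (simp only: power_int_of_nat)
    then have "p powi (- two_weight b m) / cnj (p ^ (2 + 2 * m) * cnj p ^ b) = 1 / (p ^ (2 + 2 * m) * cnj p ^ (2 + 2 * m))"
      using p0 by (simp add: field_simps)
    also have "p ^ (2 + 2 * m) * cnj p ^ (2 + 2 * m) = (p * cnj p) ^ (2 + 2 * m)" by (simp only: power_mult_distrib)
    also have "p * cnj p = of_real ((norm p)\<^sup>2)" by (rule complex_norm_square[symmetric])
    finally show ?thesis by (simp only: of_real_power)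
  qed
  finally have E: "herm (slash B L \<rho> (two_weight b m) F g \<tau>) (Th m \<tau>) = 1 / of_real ((norm p)\<^sup>2 ^ (2 + 2 * m)) * herm (F ?s) (Th m ?s)" .
  have "p\<^sup>2 = autom_factor (fst g) \<tau>" using g t unfolding mp2_iff p_def by blast
  then have "norm (autom_factor (fst g) \<tau>) = (norm p)\<^sup>2" by (simp flip: norm_power)
  then have "Im ?s = Im \<tau> / ((norm p)\<^sup>2)\<^sup>2" using Im_moebius[OF d, of \<tau>] t by (simp add: upper_half_def)
  then have "Im ?s ^ (m + 1) = Im \<tau> ^ (m + 1) / (norm p)\<^sup>2 ^ (2 + 2 * m)"
  proof -
    have "((norm p)\<^sup>2)\<^sup>2 ^ (m + 1) = (norm p)\<^sup>2 ^ (2 + 2 * m)"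
      unfolding power_mult[symmetric] by (rule arg_cong[of _ _ "power (norm p)"]) simp
    then show ?thesis using \<open>Im ?s = _\<close> by (simp only: power_divide)
  qed
  then have "complex_of_real (Im ?s) ^ (m + 1) = of_real (Im \<tau>) ^ (m + 1) / of_real ((norm p)\<^sup>2 ^ (2 + 2 * m))"
    by (metis of_real_divide of_real_power)
  then show ?thesis unfolding E by simp
qed

lemma herm_self: "herm f f = of_real (\<Sum>c\<in>DL. (norm (f c))\<^sup>2)"
  unfolding herm_pair_def of_real_sum by (intro sum.cong refl complex_norm_square[symmetric])

text \<open>\<open>\<rho>\<close> preserves the square-sum norm; \<open>sqrt (card DL)\<close> is
  the price for comparing it with the maximum norm.\<close>

lemma slash_norm:
  assumes g: "g \<in> carrier Mp2Z" and F: "\<And>t. F t \<in> GA" and t: "\<tau> \<in> upper_half"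
    and b: "\<And>c. norm (F (act g \<tau>) c) \<le> M"
  shows "norm (slash B L \<rho> k F g \<tau> c) \<le> norm (snd g \<tau>) powi (- k) * sqrt (card DL) * M"
proof -
  let ?s = "act g \<tau>" and ?i = "inv\<^bsub>Mp2Z\<^esub> g"
  let ?u = "\<lambda>c. snd g \<tau> powi (- k) * F ?s c"
  let ?f = "slash B L \<rho> k F g \<tau>"
  have i: "?i \<in> carrier Mp2Z" using g by simp
  have u: "?u \<in> GA" by (rule scale_GA[OF F])
  have M: "M \<ge> 0" using b[of c] norm_ge_zero order_trans by blast
  let ?N = "norm (snd g \<tau>) powi (- k)"
  have N: "?N \<ge> 0" by simp
  have "herm ?f ?f = herm ?u ?u" using good_all[OF i, of 0] u unfolding good_def slash_eq(1)[OF g F] by blast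
  then have eq: "(\<Sum>c\<in>DL. (norm (?f c))\<^sup>2) = (\<Sum>c\<in>DL. (norm (?u c))\<^sup>2)" unfolding herm_self by (simp only: of_real_eq_iff)
  show ?thesis
  proof (cases "c \<in> DL")
    case False
    then have "?f c = 0" using slash_eq(2)[where F=F, OF g F] by (auto simp: group_alg_def)
    then show ?thesis using M N by simp
  next
    case True
    have "(norm (?f c))\<^sup>2 \<le> (\<Sum>c\<in>DL. (norm (?f c))\<^sup>2)"
      by (rule member_le_sum[OF True]) (auto simp: finite_DL)
    also have "\<dots> \<le> (\<Sum>c\<in>DL. (?N * M)\<^sup>2)" unfolding eq
      by (intro sum_mono power_mono) (auto simp: norm_mult norm_power_int intro!: mult_left_mono b)
    also have "\<dots> = (?N * sqrt (card DL) * M)\<^sup>2" by (simp add: power_mult_distrib)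
    finally show ?thesis by (rule power2_le_imp_le) (use M N in \<open>intro mult_nonneg_nonneg; simp\<close>)
  qed
qed

end

section \<open>The hyperbolic measure\<close>

text \<open>Substitution on the compact intervals from \<open>exp (- n)\<close> to
  \<open>exp n\<close>, followed by monotone convergence.\<close>

lemma nn_integral_exp_substitution:
  fixes G :: "real \<Rightarrow> ennreal"
  assumes [measurable]: "G \<in> borel_measurable borel"
  shows "(\<integral>\<^sup>+y. G y * indicator {0<..} y * ennreal (1 / y) \<partial>lborel) = (\<integral>\<^sup>+t. G (exp t) \<partial>lborel)"
proof -
  let ?f = "\<lambda>y. G y * ennreal (1 / y)"
  have ind: "(SUP n::nat. h * indicator {a - real n..a + real n} x) = h" for h :: ennreal and a x :: real
  proof (rule antisym)
    show "(SUP n::nat. h * indicator {a - real n..a + real n} x) \<le> h" by (rule SUP_least) (auto simp: indicator_def)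
    obtain n :: nat where "\<bar>x - a\<bar> \<le> real n" using real_arch_simple by blast
    then have "x \<in> {a - real n..a + real n}" unfolding atLeastAtMost_iff by linarith
    then have "h = h * indicator {a - real n..a + real n} x" by simp
    also have "\<dots> \<le> (SUP n::nat. h * indicator {a - real n..a + real n} x)" by (rule SUP_upper) simp
    finally show "h \<le> (SUP n::nat. h * indicator {a - real n..a + real n} x)" .
  qed
  have ind2: "(SUP n::nat. h * indicator {exp (- real n)..exp (real n)} x) = h * indicator {0<..} x" for h :: ennreal and x :: real
  proof (cases "x > 0")
    case True
    then have "indicator {exp (- real n)..exp (real n)} x = (indicator {0 - real n..0 + real n} (ln x) :: ennreal)" for n
      using ln_ge_iff[of x "- real n"] by (auto simp: indicator_def ln_le_cancel_iff[symmetric] simp del: ln_le_cancel_iff)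
    then show ?thesis using ind[of h 0 "ln x"] True by simp
  next
    case False
    then have "x \<notin> {exp (- real n)..exp (real n)}" for n :: nat using exp_gt_zero[of "- real n"] by (auto simp del: exp_gt_zero)
    then show ?thesis using False by simp
  qed
  have "(\<integral>\<^sup>+y. ?f y * indicator {exp (- real n)..exp (real n)} y \<partial>lborel) = (\<integral>\<^sup>+t. G (exp t) * indicator {0 - real n..0 + real n} t \<partial>lborel)" for n
  proof (cases "n = 0")
    case True
    have "(\<integral>\<^sup>+y. ?f y * indicator {1::real} y \<partial>lborel) = 0" "(\<integral>\<^sup>+t. G (exp t) * indicator {0::real} t \<partial>lborel) = 0"
      by (rule nn_integral_null_set; simp add: null_sets_def)+
    then show ?thesis using True by simp
  next
    case False
    have "(\<integral>\<^sup>+y. ?f y * indicator {exp (- real n)..exp (real n)} y \<partial>lborel) = (\<integral>\<^sup>+t. ?f (exp t) * ennreal (exp t) * indicator {- real n..real n} t \<partial>lborel)"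
      by (rule nn_integral_substitution_aux[where g=exp and g'=exp]) (use False in \<open>auto intro!: derivative_eq_intros continuous_intros\<close>)
    moreover have "?f (exp t) * ennreal (exp t) = G (exp t)" for t
      by (simp add: mult.assoc ennreal_mult[symmetric])
    ultimately show ?thesis by simp
  qed
  moreover have "{exp (- real m)..exp (real m)} \<subseteq> {exp (- real n)..exp (real n)}" if "m \<le> n" for m n :: nat
    using that by (auto intro: order_trans[of _ "exp (real m)"] order_trans[of "exp (- real n)" "exp (- real m)"])
  note sub = subsetD[OF this]
  ultimately have "(SUP n. \<integral>\<^sup>+y. ?f y * indicator {exp (- real n)..exp (real n)} y \<partial>lborel) = (SUP n. \<integral>\<^sup>+t. G (exp t) * indicator {0 - real n..0 + real n} t \<partial>lborel)" by simp
  moreover have "(SUP n. \<integral>\<^sup>+y. ?f y * indicator {exp (- real n)..exp (real n)} y \<partial>lborel) = (\<integral>\<^sup>+y. (SUP n. ?f y * indicator {exp (- real n)..exp (real n)} y) \<partial>lborel)"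
    by (rule nn_integral_monotone_convergence_SUP[symmetric]) (use sub in \<open>auto simp: incseq_def le_fun_def split: split_indicator\<close>)
  moreover have "(SUP n. \<integral>\<^sup>+t. G (exp t) * indicator {0 - real n..0 + real n} t \<partial>lborel) = (\<integral>\<^sup>+t. (SUP n. G (exp t) * indicator {0 - real n..0 + real n} t) \<partial>lborel)"
    by (rule nn_integral_monotone_convergence_SUP[symmetric]) (auto simp: incseq_def le_fun_def indicator_def intro: order_trans)
  ultimately show ?thesis unfolding ind ind2 by (simp add: mult_ac)
qed

text \<open>In the coordinate \<open>t = ln y\<close> the map is the reflection taking
  \<open>t\<close> to \<open>- ln c - t\<close>.\<close>

lemma nn_integral_mult_inverse:
  fixes G :: "real \<Rightarrow> ennreal"
  assumes [measurable]: "G \<in> borel_measurable borel" and c: "c > 0"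
  shows "(\<integral>\<^sup>+y. G (1 / (c * y)) * indicator {0<..} y * ennreal (1 / y) \<partial>lborel) = (\<integral>\<^sup>+y. G y * indicator {0<..} y * ennreal (1 / y) \<partial>lborel)"
proof -
  have "(\<integral>\<^sup>+t. G (exp t) \<partial>lborel) = (\<integral>\<^sup>+t. G (exp (- ln c + (-1) * t)) \<partial>lborel)"
    using nn_integral_real_affine[of "\<lambda>t. G (exp t)" "-1" "- ln c"] by simp
  moreover have "exp (- ln c + (-1) * t) = 1 / (c * exp t)" for t
    using c by (simp add: exp_add exp_diff exp_minus field_simps)
  ultimately show ?thesis
    using nn_integral_exp_substitution[of G] nn_integral_exp_substitution[of "\<lambda>y. G (1 / (c * y))"] by simp
qed

lemma measurable_Complex [measurable (raw)]:
  assumes [measurable]: "f \<in> borel_measurable M" "g \<in> borel_measurable M"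
  shows "(\<lambda>x. Complex (f x) (g x)) \<in> borel_measurable M"
proof -
  have "(\<lambda>x. Complex (f x) (g x)) = (\<lambda>x. of_real (f x) + \<i> * of_real (g x))" by (simp add: fun_eq_iff complex_eq_iff)
  then show ?thesis by simp
qed

lemma lborel_complex_eq: "(lborel :: complex measure) = distr (lborel \<Otimes>\<^sub>M lborel) borel (\<lambda>(x, y). Complex x y)"
proof (rule lborel_eqI)
  fix l u :: complex
  assume le: "\<And>b. b \<in> Basis \<Longrightarrow> l \<bullet> b \<le> u \<bullet> b"
  have le': "Re l \<le> Re u" "Im l \<le> Im u" using le[of 1] le[of \<i>] by (auto simp: Basis_complex_def inner_complex_def)
  have "emeasure (distr (lborel \<Otimes>\<^sub>M lborel) borel (\<lambda>(x, y). Complex x y)) (box l u) =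
    emeasure (lborel \<Otimes>\<^sub>M lborel) ({Re l<..<Re u} \<times> {Im l<..<Im u})"
    by (subst emeasure_distr) (auto intro!: arg_cong2[of _ _ _ _ emeasure] simp: space_pair_measure box_def Basis_complex_def inner_complex_def)
  also have "\<dots> = ennreal (Re u - Re l) * ennreal (Im u - Im l)"
    using le' by (subst lborel.emeasure_pair_measure_Times) auto
  also have "\<dots> = ennreal (\<Prod>b\<in>Basis. (u - l) \<bullet> b)"
    using le' by (simp add: Basis_complex_def inner_complex_def ennreal_mult)
  finally show "emeasure (distr (lborel \<Otimes>\<^sub>M lborel) borel (\<lambda>(x, y). Complex x y)) (box l u) = ennreal (\<Prod>b\<in>Basis. (u - l) \<bullet> b)" .
qed simp

lemma nn_integral_complex:
  assumes [measurable]: "f \<in> borel_measurable borel"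
  shows "(\<integral>\<^sup>+\<tau>. f \<tau> \<partial>(lborel :: complex measure)) = (\<integral>\<^sup>+y. \<integral>\<^sup>+x. f (Complex x y) \<partial>lborel \<partial>lborel)"
proof -
  have "(\<integral>\<^sup>+\<tau>. f \<tau> \<partial>(lborel :: complex measure)) = (\<integral>\<^sup>+z. f (case z of (x, y) \<Rightarrow> Complex x y) \<partial>(lborel \<Otimes>\<^sub>M lborel))"
    by (subst lborel_complex_eq, subst nn_integral_distr) auto
  also have "\<dots> = (\<integral>\<^sup>+y. \<integral>\<^sup>+x. f (Complex x y) \<partial>lborel \<partial>lborel)"
    by (subst lborel_pair.nn_integral_snd[symmetric]) auto
  finally show ?thesis .
qed

text \<open>Hyperbolic area integral for nonnegative functions, for which invariance can be proved
  without integrability conditions.\<close>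

definition hint :: "(complex \<Rightarrow> ennreal) \<Rightarrow> ennreal" where
  "hint f = (\<integral>\<^sup>+\<tau>. f \<tau> * (indicator upper_half \<tau> * ennreal (1 / (Im \<tau>)\<^sup>2)) \<partial>lborel)"

lemma upper_half_sets [measurable]: "upper_half \<in> sets borel"
  using upper_half_open by simp

lemma hint_cong: "(\<And>\<tau>. \<tau> \<in> upper_half \<Longrightarrow> f \<tau> = g \<tau>) \<Longrightarrow> hint f = hint g"
  unfolding hint_def by (intro nn_integral_cong) (auto simp: indicator_def)

lemma ind_uh: "indicator upper_half (Complex x y) = (indicator {0<..} y :: ennreal)"
  by (auto simp: indicator_def upper_half_def)

text \<open>With \<open>x = y * u\<close> the measure becomes \<open>du dy / y\<close>. In these
  coordinates inversion takes \<open>u\<close> to \<open>- u\<close> and \<open>y\<close> to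
  \<open>1 / ((1 + u\<^sup>2) * y)\<close>, for fixed \<open>u\<close> a reflection in
  \<open>ln y\<close>; this is what \<open>hint_S\<close> uses.\<close>

lemma hint_coords:
  assumes [measurable]: "f \<in> borel_measurable borel"
  shows "hint f = (\<integral>\<^sup>+u. \<integral>\<^sup>+y. f (Complex (y * u) y) * indicator {0<..} y * ennreal (1 / y) \<partial>lborel \<partial>lborel)"
proof -
  have "hint f = (\<integral>\<^sup>+y. \<integral>\<^sup>+x. f (Complex x y) * (indicator {0<..} y * ennreal (1 / y\<^sup>2)) \<partial>lborel \<partial>lborel)"
    unfolding hint_def by (subst nn_integral_complex) (auto simp: ind_uh)
  also have "\<dots> = (\<integral>\<^sup>+y. \<integral>\<^sup>+u. f (Complex (y * u) y) * indicator {0<..} y * ennreal (1 / y) \<partial>lborel \<partial>lborel)"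
  proof (rule nn_integral_cong)
    fix y :: real
    show "(\<integral>\<^sup>+x. f (Complex x y) * (indicator {0<..} y * ennreal (1 / y\<^sup>2)) \<partial>lborel) = (\<integral>\<^sup>+u. f (Complex (y * u) y) * indicator {0<..} y * ennreal (1 / y) \<partial>lborel)"
    proof (cases "y > 0")
      case True
      have "(\<integral>\<^sup>+x. f (Complex x y) * (indicator {0<..} y * ennreal (1 / y\<^sup>2)) \<partial>lborel) = ennreal y * (\<integral>\<^sup>+u. f (Complex (y * u) y) * ennreal (1 / y\<^sup>2) \<partial>lborel)"
        using True nn_integral_real_affine[of "\<lambda>x. f (Complex x y) * (indicator {0<..} y * ennreal (1 / y\<^sup>2))" y 0] by simp
      also have "\<dots> = (\<integral>\<^sup>+u. f (Complex (y * u) y) * (ennreal y * ennreal (1 / y\<^sup>2)) \<partial>lborel)"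
        by (subst nn_integral_cmult[symmetric]) (auto simp: mult_ac)
      also have "ennreal y * ennreal (1 / y\<^sup>2) = ennreal (1 / y)"
        using True by (simp add: ennreal_mult[symmetric] power2_eq_square)
      finally show ?thesis using True by simp
    qed auto
  qed
  also have "\<dots> = (\<integral>\<^sup>+u. \<integral>\<^sup>+y. f (Complex (y * u) y) * indicator {0<..} y * ennreal (1 / y) \<partial>lborel \<partial>lborel)"
    by (rule lborel_pair.Fubini') measurable
  finally show ?thesis .
qed

lemma hint_S:
  assumes [measurable]: "f \<in> borel_measurable borel"
  shows "hint (\<lambda>\<tau>. f (- 1 / \<tau>)) = hint f"
proof -
  have [measurable]: "(\<lambda>\<tau>. f (- 1 / \<tau>)) \<in> borel_measurable borel" by measurable
  have "hint (\<lambda>\<tau>. f (- 1 / \<tau>)) = (\<integral>\<^sup>+u. \<integral>\<^sup>+y. f (- 1 / Complex (y * u) y) * indicator {0<..} y * ennreal (1 / y) \<partial>lborel \<partial>lborel)"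
    by (rule hint_coords) measurable
  also have "\<dots> = (\<integral>\<^sup>+u. \<integral>\<^sup>+y. f (Complex (y * (- u)) y) * indicator {0<..} y * ennreal (1 / y) \<partial>lborel \<partial>lborel)"
  proof (rule nn_integral_cong)
    fix u :: real
    have c: "1 + u\<^sup>2 > 0" by (simp add: add_pos_nonneg)
    have e: "- 1 / Complex (y * u) y = Complex ((1 / ((1 + u\<^sup>2) * y)) * (- u)) (1 / ((1 + u\<^sup>2) * y))" if "y > 0" for y
    proof -
      have "Complex (y * u) y * Complex ((1 / ((1 + u\<^sup>2) * y)) * (- u)) (1 / ((1 + u\<^sup>2) * y)) = -1"
        using that c by (simp add: complex_eq_iff power2_eq_square divide_simps)
      moreover have "Complex (y * u) y \<noteq> 0" using that by (simp add: complex_eq_iff)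
      moreover have "a * b = -1 \<Longrightarrow> a \<noteq> 0 \<Longrightarrow> - 1 / a = b" for a b :: complex by (simp add: field_simps)
      ultimately show ?thesis by blast
    qed
    have "(\<integral>\<^sup>+y. f (- 1 / Complex (y * u) y) * indicator {0<..} y * ennreal (1 / y) \<partial>lborel) = (\<integral>\<^sup>+y. (\<lambda>y. f (Complex (y * (- u)) y)) (1 / ((1 + u\<^sup>2) * y)) * indicator {0<..} y * ennreal (1 / y) \<partial>lborel)"
    proof (rule nn_integral_cong)
      fix y :: real
      show "f (- 1 / Complex (y * u) y) * indicator {0<..} y * ennreal (1 / y) = f (Complex ((1 / ((1 + u\<^sup>2) * y)) * (- u)) (1 / ((1 + u\<^sup>2) * y))) * indicator {0<..} y * ennreal (1 / y)"
      proof (cases "y > 0")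
        case True
        show ?thesis by (simp only: e[OF True])
      qed auto
    qed
    also have "\<dots> = (\<integral>\<^sup>+y. f (Complex (y * (- u)) y) * indicator {0<..} y * ennreal (1 / y) \<partial>lborel)"
      by (rule nn_integral_mult_inverse[OF _ c]) measurable
    finally show "(\<integral>\<^sup>+y. f (- 1 / Complex (y * u) y) * indicator {0<..} y * ennreal (1 / y) \<partial>lborel) = \<dots>" .
  qed
  also have "\<dots> = (\<integral>\<^sup>+u. \<integral>\<^sup>+y. f (Complex (y * u) y) * indicator {0<..} y * ennreal (1 / y) \<partial>lborel \<partial>lborel)"
    using nn_integral_real_affine[of "\<lambda>u. \<integral>\<^sup>+y. f (Complex (y * u) y) * indicator {0<..} y * ennreal (1 / y) \<partial>lborel" "-1" 0]
    by simp
  also have "\<dots> = hint f" by (rule hint_coords[symmetric]) measurable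
  finally show ?thesis .
qed

lemma hint_translate:
  assumes [measurable]: "f \<in> borel_measurable borel"
  shows "hint (\<lambda>\<tau>. f (\<tau> + of_real a)) = hint f"
proof -
  have h: "hint g = (\<integral>\<^sup>+y. \<integral>\<^sup>+x. g (Complex x y) * (indicator {0<..} y * ennreal (1 / y\<^sup>2)) \<partial>lborel \<partial>lborel)"
    if [measurable]: "g \<in> borel_measurable borel" for g
    unfolding hint_def by (subst nn_integral_complex) (auto simp: ind_uh)
  have e: "Complex x y + of_real a = Complex (a + 1 * x) y" for x y by (simp add: complex_eq_iff)
  have "(\<integral>\<^sup>+x. f (Complex (a + 1 * x) y) * (indicator {0<..} y * ennreal (1 / y\<^sup>2)) \<partial>lborel) = (\<integral>\<^sup>+x. f (Complex x y) * (indicator {0<..} y * ennreal (1 / y\<^sup>2)) \<partial>lborel)" for y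
    using nn_integral_real_affine[of "\<lambda>x. f (Complex x y) * (indicator {0<..} y * ennreal (1 / y\<^sup>2))" 1 a] by simp
  then show ?thesis by (subst (1 2) h) (auto simp: e)
qed

lemma measurable_moebius [measurable]: "moebius_act A \<in> borel_measurable borel"
  unfolding moebius_act_def[abs_def] autom_factor_def by measurable

lemma hint_invariant:
  assumes g: "g \<in> carrier Mp2Z" and f: "f \<in> borel_measurable borel"
  shows "hint (\<lambda>\<tau>. f (act g \<tau>)) = hint f"
proof -
  let ?P = "\<lambda>g. \<forall>f. f \<in> borel_measurable borel \<longrightarrow> hint (\<lambda>\<tau>. f (act g \<tau>)) = hint f"
  have "?P g"
  proof (rule mp2_induct[OF g])
    show "?P S_elt" using hint_S by (simp add: moebius_S)
    show "?P T_elt" using hint_translate[of _ 1] moebius_Tpow[of 1] by (simp add: Tpow_1)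
    show "?P \<one>\<^bsub>Mp2Z\<^esub>" by (simp add: mp2_one)
  next
    fix g h assume gh: "g \<in> carrier Mp2Z" "h \<in> carrier Mp2Z" "?P g" "?P h"
    have d: "det (fst g) = 1" "det (fst h) = 1" using gh by (auto simp: mp2_iff)
    show "?P (g \<star> h)"
    proof (intro allI impI)
      fix f :: "complex \<Rightarrow> ennreal" assume [measurable]: "f \<in> borel_measurable borel"
      have "hint (\<lambda>\<tau>. f (act (g \<star> h) \<tau>)) = hint (\<lambda>\<tau>. (\<lambda>\<tau>. f (act g \<tau>)) (act h \<tau>))"
        by (rule hint_cong) (simp add: mp2_mult moebius_mult[OF d(2) _ d(1)])
      also have "\<dots> = hint (\<lambda>\<tau>. f (act g \<tau>))" by (rule gh(4)[rule_format]) measurable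
      also have "\<dots> = hint f" by (rule gh(3)[rule_format]) measurable
      finally show "hint (\<lambda>\<tau>. f (act (g \<star> h) \<tau>)) = hint f" .
    qed
  next
    fix g assume g: "g \<in> carrier Mp2Z" "?P g"
    let ?i = "inv\<^bsub>Mp2Z\<^esub> g"
    have i: "?i \<in> carrier Mp2Z" "?i \<star> g = \<one>\<^bsub>Mp2Z\<^esub>" using g by simp_all
    have d: "det (fst g) = 1" "det (fst ?i) = 1" using g i by (auto simp: mp2_iff)
    show "?P ?i"
    proof (intro allI impI)
      fix f :: "complex \<Rightarrow> ennreal" assume [measurable]: "f \<in> borel_measurable borel"
      have "hint (\<lambda>\<tau>. f (act ?i \<tau>)) = hint (\<lambda>\<tau>. (\<lambda>\<tau>. f (act ?i \<tau>)) (act g \<tau>))"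
        by (rule g(2)[rule_format, symmetric]) measurable
      also have "\<dots> = hint f"
      proof (rule hint_cong)
        fix \<tau> assume t: "\<tau> \<in> upper_half"
        have "act ?i (act g \<tau>) = \<tau>"
          using moebius_mult[OF d(1) t d(2)] i(2) by (simp add: mp2_mult mp2_one)
        then show "f (act ?i (act g \<tau>)) = f \<tau>" by simp
      qed
      finally show "hint (\<lambda>\<tau>. f (act ?i \<tau>)) = hint f" .
    qed
  qed
  then show ?thesis using f by blast
qed

section \<open>The fundamental domain and unfolding\<close>

definition FD :: "complex set" where "FD = {\<tau> \<in> upper_half. cmod \<tau> \<ge> 1 \<and> \<bar>Re \<tau>\<bar> \<le> 1/2}"
definition FDi :: "complex set" where "FDi = {\<tau> \<in> upper_half. cmod \<tau> > 1 \<and> \<bar>Re \<tau>\<bar> < 1/2}"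

text \<open>Since \<open>\<bar>Re \<tau>\<bar> \<le> 1/2\<close>, the mixed term is at most
  \<open>\<bar>c * d\<bar>\<close>, which is at most half of the sum of squares.\<close>

lemma autom_norm_FD:
  assumes t: "\<tau> \<in> FD"
  shows "(norm (autom_factor A \<tau>))\<^sup>2 \<ge> ((of_int (A$2$1))\<^sup>2 + (of_int (A$2$2))\<^sup>2) / 2"
proof -
  let ?c = "real_of_int (A$2$1)" and ?d = "real_of_int (A$2$2)"
  have n1: "(Re \<tau>)\<^sup>2 + (Im \<tau>)\<^sup>2 \<ge> 1" using t by (simp add: FD_def cmod_power2[symmetric])
  have "(norm (autom_factor A \<tau>))\<^sup>2 = ?c\<^sup>2 * ((Re \<tau>)\<^sup>2 + (Im \<tau>)\<^sup>2) + 2 * ?c * ?d * Re \<tau> + ?d\<^sup>2"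
    unfolding autom_factor_def cmod_power2 by (simp add: power2_eq_square algebra_simps)
  moreover have "?c\<^sup>2 * ((Re \<tau>)\<^sup>2 + (Im \<tau>)\<^sup>2) \<ge> ?c\<^sup>2 * 1" using n1 by (intro mult_left_mono) auto
  ultimately have 1: "(norm (autom_factor A \<tau>))\<^sup>2 \<ge> ?c\<^sup>2 + 2 * ?c * ?d * Re \<tau> + ?d\<^sup>2" by simp
  have "\<bar>2 * ?c * ?d * Re \<tau>\<bar> \<le> \<bar>?c * ?d\<bar>"
    using t mult_left_mono[of "\<bar>Re \<tau>\<bar>" "1/2" "2 * \<bar>?c * ?d\<bar>"] by (simp add: FD_def abs_mult)
  moreover have "\<bar>?c * ?d\<bar> \<le> (?c\<^sup>2 + ?d\<^sup>2) / 2"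
    using zero_le_power2[of "\<bar>?c\<bar> - \<bar>?d\<bar>"] by (simp add: power2_diff abs_mult)
  ultimately show ?thesis using 1 by (simp add: field_simps)
qed

text \<open>The squared norm strictly exceeds
  \<open>c\<^sup>2 - \<bar>c * d\<bar> + d\<^sup>2\<close>, a positive integer when \<open>c\<close>
  is nonzero.\<close>

lemma autom_norm_FDi:
  assumes t: "\<tau> \<in> FDi" and c: "A$2$1 \<noteq> 0"
  shows "norm (autom_factor A \<tau>) > 1"
proof -
  let ?c = "real_of_int (A$2$1)" and ?d = "real_of_int (A$2$2)"
  have "1 < (norm \<tau>)\<^sup>2" using t unfolding FDi_def by (intro one_less_power) auto
  then have n1: "(Re \<tau>)\<^sup>2 + (Im \<tau>)\<^sup>2 > 1" by (simp add: cmod_power2)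
  have c2: "?c\<^sup>2 > 0" using c by simp
  have "(norm (autom_factor A \<tau>))\<^sup>2 = ?c\<^sup>2 * ((Re \<tau>)\<^sup>2 + (Im \<tau>)\<^sup>2) + 2 * ?c * ?d * Re \<tau> + ?d\<^sup>2"
    unfolding autom_factor_def cmod_power2 by (simp add: power2_eq_square algebra_simps)
  moreover have "?c\<^sup>2 * ((Re \<tau>)\<^sup>2 + (Im \<tau>)\<^sup>2) > ?c\<^sup>2 * 1" using n1 c2 by (intro mult_strict_left_mono) auto
  ultimately have 1: "(norm (autom_factor A \<tau>))\<^sup>2 > ?c\<^sup>2 + 2 * ?c * ?d * Re \<tau> + ?d\<^sup>2" by simp
  have "\<bar>2 * ?c * ?d * Re \<tau>\<bar> \<le> \<bar>?c * ?d\<bar>"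
    using t mult_left_mono[of "\<bar>Re \<tau>\<bar>" "1/2" "2 * \<bar>?c * ?d\<bar>"] by (simp add: FDi_def abs_mult)
  then have 2: "(norm (autom_factor A \<tau>))\<^sup>2 > ?c\<^sup>2 - \<bar>?c * ?d\<bar> + ?d\<^sup>2" using 1 by linarith
  have "(1::int) \<le> (A$2$1)\<^sup>2 - \<bar>A$2$1 * A$2$2\<bar> + (A$2$2)\<^sup>2"
  proof -
    have "2 * ((A$2$1)\<^sup>2 - \<bar>A$2$1 * A$2$2\<bar> + (A$2$2)\<^sup>2) = (\<bar>A$2$1\<bar> - \<bar>A$2$2\<bar>)\<^sup>2 + (A$2$1)\<^sup>2 + (A$2$2)\<^sup>2"
      by (simp add: power2_diff abs_mult)
    moreover have "(A$2$1)\<^sup>2 > 0" using c by simp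
    ultimately have "0 < 2 * ((A$2$1)\<^sup>2 - \<bar>A$2$1 * A$2$2\<bar> + (A$2$2)\<^sup>2)"
      using zero_le_power2[of "\<bar>A$2$1\<bar> - \<bar>A$2$2\<bar>"] zero_le_power2[of "A$2$2"] by linarith
    then show ?thesis by simp
  qed
  then have "real_of_int 1 \<le> real_of_int ((A$2$1)\<^sup>2 - \<bar>A$2$1 * A$2$2\<bar> + (A$2$2)\<^sup>2)" by (simp only: of_int_le_iff)
  then have "(norm (autom_factor A \<tau>))\<^sup>2 > 1\<^sup>2" using 2 by simp
  then show ?thesis by (rule power2_less_imp_less) simp
qed

text \<open>Some image of \<open>\<tau>\<close> has maximal imaginary part. After a translation into
  the strip it must lie outside the open unit disc, since otherwise \<open>S\<close> would raise the
  imaginary part.\<close>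

lemma FD_reaches:
  assumes t: "\<tau> \<in> upper_half"
  shows "\<exists>g\<in>carrier Mp2Z. act g \<tau> \<in> FD"
proof -
  have y: "Im \<tau> > 0" using t by (simp add: upper_half_def)
  let ?N = "\<lambda>p::int \<times> int. norm (of_int (fst p) * \<tau> + of_int (snd p))"
  \<comment> \<open>Rows outside \<open>V\<close> have \<open>?N > 1\<close>, while the row
    \<open>(0, 1)\<close> of the identity lies in \<open>V\<close>; a minimum over the finite set
    \<open>V\<close> is therefore a minimum over all rows.\<close>
  define V where "V = {p \<in> (\<lambda>g. (fst g$2$1, fst g$2$2)) ` carrier Mp2Z. ?N p \<le> 1}"
  have finV: "finite V"
  proof (rule finite_subset)
    let ?a = "\<lceil>1 / Im \<tau>\<rceil>" 
    let ?b = "\<lceil>1 + of_int ?a * norm \<tau>\<rceil>"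
    show "V \<subseteq> {- ?a..?a} \<times> {- ?b..?b}"
    proof
      fix p assume "p \<in> V"
      then have p: "?N p \<le> 1" by (simp add: V_def)
      obtain c d where cd: "p = (c, d)" by (cases p)
      have "\<bar>of_int c * Im \<tau>\<bar> \<le> 1" using p abs_Im_le_cmod[of "of_int c * \<tau> + of_int d"] by (simp add: cd)
      then have "\<bar>real_of_int c\<bar> \<le> 1 / Im \<tau>" using y by (simp add: abs_mult field_simps)
      then have c: "\<bar>c\<bar> \<le> ?a" by linarith
      have "norm (complex_of_int d) \<le> ?N p + norm (of_int c * \<tau>)"
        using norm_triangle_ineq4[of "of_int c * \<tau> + of_int d" "of_int c * \<tau>"] by (simp add: cd)
      also have "\<dots> \<le> 1 + of_int ?a * norm \<tau>" using p c
        by (intro add_mono) (auto simp: norm_mult intro!: mult_right_mono)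
      finally have "\<bar>real_of_int d\<bar> \<le> 1 + of_int ?a * norm \<tau>" by simp
      then have "\<bar>d\<bar> \<le> ?b" by linarith
      then show "p \<in> {- ?a..?a} \<times> {- ?b..?b}" using c cd by auto
    qed
  qed auto
  have "(0, 1) \<in> V"
    unfolding V_def using Mp.one_closed by (auto simp: image_iff mp2_one intro!: bexI[of _ "\<one>\<^bsub>Mp2Z\<^esub>"])
  then have "V \<noteq> {}" by blast
  with finV obtain p where p: "p \<in> V" "\<And>p'. p' \<in> V \<Longrightarrow> ?N p \<le> ?N p'"
    using arg_min_least[of V _ ?N] arg_min_if_finite(1)[of V ?N] by meson
  obtain g0 where g0: "g0 \<in> carrier Mp2Z" "p = (fst g0$2$1, fst g0$2$2)" using p(1) by (auto simp: V_def)
  have min: "norm (autom_factor (fst g0) \<tau>) \<le> norm (autom_factor (fst g) \<tau>)" if "g \<in> carrier Mp2Z" for g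
  proof (cases "(fst g$2$1, fst g$2$2) \<in> V")
    case True
    then show ?thesis using p(2)[OF True] g0(2) by (simp add: autom_factor_def)
  next
    case False
    then have "norm (autom_factor (fst g) \<tau>) > 1" using that by (auto simp: V_def autom_factor_def)
    moreover have "norm (autom_factor (fst g0) \<tau>) \<le> 1" using p(1) g0(2) by (simp add: V_def autom_factor_def)
    ultimately show ?thesis by simp
  qed
  have dg: "det (fst g0) = 1" using g0 by (simp add: mp2_iff)
  have maxIm: "Im (act g \<tau>) \<le> Im (act g0 \<tau>)" if g: "g \<in> carrier Mp2Z" for g
  proof -
    have d: "det (fst g) = 1" using g by (simp add: mp2_iff)
    have "norm (autom_factor (fst g0) \<tau>) > 0" using autom_nonzero[OF dg y] by simp
    then show ?thesis unfolding Im_moebius[OF d y] Im_moebius[OF dg y]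
      using min[OF g] y by (intro divide_left_mono power_mono mult_pos_pos) auto
  qed
  define \<sigma> where "\<sigma> = act g0 \<tau>"
  have s: "\<sigma> \<in> upper_half" unfolding \<sigma>_def by (rule moebius_upper[OF dg t])
  let ?n = "- \<lfloor>Re \<sigma> + 1/2\<rfloor>"
  let ?g = "Tpow ?n \<star> g0"
  have gc: "?g \<in> carrier Mp2Z" using g0 Tpow_carrier by simp
  have act: "act ?g \<tau> = \<sigma> + of_int ?n"
    unfolding \<sigma>_def moebius_Tpow[symmetric] mp2_mult fst_conv
    by (rule moebius_mult[OF dg t]) (simp add: Tpow_def det2)
  have su: "\<sigma> + of_int ?n \<in> upper_half" using s by (simp add: upper_half_def)
  have re: "\<bar>Re (\<sigma> + of_int ?n)\<bar> \<le> 1/2"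
    using floor_correct[of "Re \<sigma> + 1/2"] by (simp only: abs_le_iff plus_complex.simps of_int_minus uminus_complex.simps complex_Re_of_int) linarith
  have "cmod (\<sigma> + of_int ?n) \<ge> 1"
  proof (rule ccontr)
    assume "\<not> ?thesis"
    then have lt: "cmod (\<sigma> + of_int ?n) < 1" by simp
    have Sg: "S_elt \<star> ?g \<in> carrier Mp2Z" using gc S_carrier by simp
    have dgg: "det (fst ?g) = 1" using gc by (simp add: mp2_iff)
    have dS: "det (fst S_elt) = 1" using S_carrier by (simp add: mp2_iff)
    have "act (S_elt \<star> ?g) \<tau> = act S_elt (\<sigma> + of_int ?n)"
      unfolding mp2_mult[of S_elt] fst_conv act[symmetric] by (rule moebius_mult[OF dgg t dS])
    then have "Im (act S_elt (\<sigma> + of_int ?n)) \<le> Im \<sigma>"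
      using maxIm[OF Sg] unfolding \<sigma>_def by simp
    moreover have "Im (act S_elt (\<sigma> + of_int ?n)) = Im \<sigma> / (cmod (\<sigma> + of_int ?n))\<^sup>2"
      using Im_moebius[OF dS, of "\<sigma> + of_int ?n"] su by (simp add: upper_half_def fst_S autom_factor_def)
    moreover have "(cmod (\<sigma> + of_int ?n))\<^sup>2 < 1" using lt by (simp add: power_less_one_iff abs_square_less_1)
    moreover have "(cmod (\<sigma> + of_int ?n))\<^sup>2 > 0" using su by (auto simp: upper_half_def complex_eq_iff)
    ultimately show False using s by (simp add: upper_half_def field_simps)
  qed
  then have "act ?g \<tau> \<in> FD" unfolding act FD_def using su re by simp
  then show ?thesis using gc by blast
qed

text \<open>With \<open>c \<noteq> 0\<close> both \<open>g\<close> and its inverse would strictly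
  lower the imaginary part on \<open>FDi\<close>. With \<open>c = 0\<close> the action is an integer
  translation, and the strip has width 1.\<close>

lemma FDi_unique:
  assumes g: "g \<in> carrier Mp2Z" and t: "\<tau> \<in> FDi" "act g \<tau> \<in> FDi"
  shows "fst g = mat 1 \<or> fst g = mat2 (-1) 0 0 (-1)"
proof -
  have d: "det (fst g) = 1" using g by (simp add: mp2_iff)
  have y: "Im \<tau> > 0" "\<tau> \<in> upper_half" using t by (auto simp: FDi_def upper_half_def)
  let ?i = "inv\<^bsub>Mp2Z\<^esub> g"
  have i: "?i \<in> carrier Mp2Z" "?i \<star> g = \<one>\<^bsub>Mp2Z\<^esub>" using g by simp_all
  have di: "det (fst ?i) = 1" using i by (simp add: mp2_iff)
  have lt: "Im (moebius_act A \<sigma>) < Im \<sigma>" if "\<sigma> \<in> FDi" "A$2$1 \<noteq> 0" "det A = 1" for A \<sigma>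
  proof -
    have "1 < (norm (autom_factor A \<sigma>))\<^sup>2" using autom_norm_FDi[OF that(1,2)] by (intro one_less_power) auto
    then show ?thesis using that Im_moebius[OF that(3), of \<sigma>] by (auto simp: FDi_def upper_half_def divide_less_eq)
  qed
  have c0: "fst g$2$1 = 0"
  proof (rule ccontr)
    assume c: "fst g$2$1 \<noteq> 0"
    have "fst ?i ** fst g = mat 1" using i(2) by (simp add: mp2_mult mp2_one)
    then have "fst ?i ** (fst g ** inv2 (fst g)) = inv2 (fst g)" by (simp add: matrix_mul_assoc)
    then have ii: "fst ?i = inv2 (fst g)" using inv2(3)[OF d] by simp
    then have ci: "fst ?i$2$1 \<noteq> 0" using c by (simp add: inv2_def)
    have "act ?i (act g \<tau>) = \<tau>"
      using moebius_mult[OF d y(2) di] i(2) by (simp add: mp2_mult mp2_one)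
    then show False using lt[OF t(1) c d] lt[OF t(2) ci di] by simp
  qed
  have "fst g$1$1 * fst g$2$2 = 1" using d c0 by (simp add: det2)
  then have ad: "fst g$1$1 = 1 \<and> fst g$2$2 = 1 \<or> fst g$1$1 = -1 \<and> fst g$2$2 = -1" by (simp add: zmult_eq_1_iff)
  have "\<exists>n::int. act g \<tau> = \<tau> + of_int n \<and> \<bar>n\<bar> = \<bar>fst g$1$2\<bar>"
    using ad c0 by (elim disjE) (rule exI[of _ "fst g$1$2"] exI[of _ "- fst g$1$2"], simp add: moebius_act_def autom_factor_def)+
  then obtain n :: int where n: "act g \<tau> = \<tau> + of_int n" "\<bar>n\<bar> = \<bar>fst g$1$2\<bar>" by blast
  have "\<bar>Re \<tau>\<bar> < 1/2" "\<bar>Re \<tau> + of_int n\<bar> < 1/2" using t unfolding n(1) by (auto simp: FDi_def)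
  then have "\<bar>real_of_int n\<bar> < 1" by linarith
  then have "fst g$1$2 = 0" using n(2) by linarith
  then show ?thesis using ad c0 by (auto intro!: mat2_eqI)
qed

text \<open>The elements acting trivially on the half plane. Their number is what the factor 1/4 of
  the Poincare series compensates.\<close>

definition center4 :: "mp2 set" where
  "center4 = {k \<in> carrier Mp2Z. fst k = mat 1 \<or> fst k = mat2 (-1) 0 0 (-1)}"

lemma moebius_center4: "k \<in> center4 \<Longrightarrow> act k \<tau> = \<tau>"
  by (auto simp: center4_def moebius_act_def autom_factor_def mat_def)

lemma center4_eq:
  "center4 = {(mat 1, \<lambda>\<tau>\<in>upper_half. 1), (mat 1, \<lambda>\<tau>\<in>upper_half. -1),
    (mat2 (-1) 0 0 (-1), \<lambda>\<tau>\<in>upper_half. \<i>), (mat2 (-1) 0 0 (-1), \<lambda>\<tau>\<in>upper_half. -\<i>)}" (is "_ = ?E")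
proof
  have c: "?E \<subseteq> carrier Mp2Z"
    by (auto simp: mp2_iff det2 autom_factor_def mat_def intro!: holo_restrict)
  then show "?E \<subseteq> center4" by (auto simp: center4_def)
  show "center4 \<subseteq> ?E"
  proof
    fix k assume k: "k \<in> center4"
    then have kc: "k \<in> carrier Mp2Z" by (simp add: center4_def)
    have *: "k = (M, \<lambda>\<tau>\<in>upper_half. w) \<or> k = (M, \<lambda>\<tau>\<in>upper_half. -w)"
      if h: "(M, \<lambda>\<tau>\<in>upper_half. w) \<in> carrier Mp2Z" "(M, \<lambda>\<tau>\<in>upper_half. -w) \<in> carrier Mp2Z" and M: "fst k = M" for M w
    proof -
      have "\<exists>e\<in>{1, -1}. \<forall>\<tau>\<in>upper_half. snd k \<tau> = e * snd (M, \<lambda>\<tau>\<in>upper_half. w) \<tau>"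
        by (rule mp2_same_matrix[OF kc h(1)]) (simp add: M)
      then obtain e where "e \<in> {1, -1}" "\<forall>\<tau>\<in>upper_half. snd k \<tau> = e * snd (M, \<lambda>\<tau>\<in>upper_half. w) \<tau>" by blast
      then show ?thesis using mp2_eqI[OF kc h(1)] mp2_eqI[OF kc h(2)] M by auto
    qed
    show "k \<in> ?E" using k *[of "mat 1" 1] *[of "mat2 (-1) 0 0 (-1)" \<i>] c unfolding center4_def by blast
  qed
qed

lemma card_center4: "card center4 = 4"
proof -
  have n: "(mat 1 :: int^2^2) \<noteq> mat2 (-1) 0 0 (-1)"
  proof
    assume "(mat 1 :: int^2^2) = mat2 (-1) 0 0 (-1)"
    then have "(mat 1 :: int^2^2)$1$1 = mat2 (-1) 0 0 (-1)$1$1" by simp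
    then show False by (simp add: mat_def)
  qed
  have f: "v = w" if "(\<lambda>\<tau>\<in>upper_half. v) = (\<lambda>\<tau>\<in>upper_half. w)" for v w :: complex
    using fun_cong[OF that, of \<i>] by (simp add: upper_half_def)
  have ne: "(\<lambda>\<tau>\<in>upper_half. 1::complex) \<noteq> (\<lambda>\<tau>\<in>upper_half. -1)" "(\<lambda>\<tau>\<in>upper_half. \<i>) \<noteq> (\<lambda>\<tau>\<in>upper_half. -\<i>)"
    using f[of 1 "-1"] f[of \<i> "-\<i>"] by (auto simp: complex_eq_iff)
  show ?thesis unfolding center4_eq using n ne by (simp add: card_insert_if)
qed

lemma snd_at_ii:
  assumes "g \<in> carrier Mp2Z"
  shows "snd g \<i> = csqrt (autom_factor (fst g) \<i>) \<or> snd g \<i> = - csqrt (autom_factor (fst g) \<i>)"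
proof -
  have "(snd g \<i>)\<^sup>2 = (csqrt (autom_factor (fst g) \<i>))\<^sup>2" using assms by (simp add: mp2_iff upper_half_def)
  then show ?thesis by (simp only: power2_eq_iff)
qed

text \<open>An element is determined by its matrix and by the sign of its root at
  \<open>\<i>\<close>.\<close>

lemma countable_Mp2Z: "countable (carrier Mp2Z)"
proof (rule countable_image_inj_on)
  let ?f = "\<lambda>g::mp2. ((fst g$1$1, fst g$1$2, fst g$2$1, fst g$2$2), snd g \<i> = csqrt (autom_factor (fst g) \<i>))"
  show "countable (?f ` carrier Mp2Z)" by (rule countable_subset[OF subset_UNIV]) simp
  show "inj_on ?f (carrier Mp2Z)"
  proof (rule inj_onI)
    fix g h assume g: "g \<in> carrier Mp2Z" and h: "h \<in> carrier Mp2Z" and e: "?f g = ?f h"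
    have m: "fst g = fst h" by (rule mat2_eqI) (use e in auto)
    obtain e' where e': "e' \<in> {1, -1}" "\<forall>\<tau>\<in>upper_half. snd g \<tau> = e' * snd h \<tau>"
      using mp2_same_matrix[OF g h m] by blast
    have i: "\<i> \<in> upper_half" by (simp add: upper_half_def)
    have "snd g \<i> = snd h \<i>" using e m snd_at_ii[OF g] snd_at_ii[OF h] by auto
    then have "e' = 1" using e' i mp2_phi_nonzero[OF h i] by auto
    then show "g = h" using e' m by (intro mp2_eqI[OF g h]) auto
  qed
qed

section \<open>Cosets of the translation subgroup\<close>

definition T_group :: "mp2 set" where "T_group = generate Mp2Z {T_elt}"

lemma T_group_eq: "T_group = range Tpow" unfolding T_group_def by (rule generate_T)

lemma subgroup_T: "subgroup T_group Mp2Z"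
  unfolding T_group_def using Tpow_carrier[of 1] by (intro Mp.generate_is_subgroup) (simp add: Tpow_1)

definition T_cosets :: "mp2 set set" where "T_cosets = rcosets\<^bsub>Mp2Z\<^esub> T_group"
text \<open>The same choice of representative as in the definition of the Poincare series.\<close>

definition crep :: "mp2 set \<Rightarrow> mp2" where "crep A = (SOME g. g \<in> A)"

lemma r_coset_T: "T_group #>\<^bsub>Mp2Z\<^esub> g = range (\<lambda>n. Tpow n \<star> g)"
  unfolding r_coset_def T_group_eq by auto

lemma crep_coset: assumes "A \<in> T_cosets" shows "crep A \<in> carrier Mp2Z" "A = T_group #>\<^bsub>Mp2Z\<^esub> crep A"
proof -
  obtain g where g: "g \<in> carrier Mp2Z" "A = T_group #>\<^bsub>Mp2Z\<^esub> g" using assms by (auto simp: T_cosets_def RCOSETS_def)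
  then have "g \<in> A" using Mp.rcos_self[OF g(1) subgroup_T] by simp
  then have "crep A \<in> A" unfolding crep_def by (rule someI)
  then obtain n where n: "crep A = Tpow n \<star> g" unfolding g(2) r_coset_T by blast
  then show c: "crep A \<in> carrier Mp2Z" using g Tpow_carrier by simp
  show "A = T_group #>\<^bsub>Mp2Z\<^esub> crep A"
    unfolding g(2) using \<open>crep A \<in> A\<close> g by (intro Mp.repr_independence[OF _ _ subgroup_T]) auto
qed

lemma r_coset_T_closed: "g \<in> carrier Mp2Z \<Longrightarrow> T_group #>\<^bsub>Mp2Z\<^esub> (Tpow n \<star> g) = T_group #>\<^bsub>Mp2Z\<^esub> g"
  by (rule Mp.repr_independence[OF _ _ subgroup_T, symmetric]) (auto simp: r_coset_T)

lemma r_coset_T_cosets: "g \<in> carrier Mp2Z \<Longrightarrow> T_group #>\<^bsub>Mp2Z\<^esub> g \<in> T_cosets"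
  by (auto simp: T_cosets_def RCOSETS_def)

lemma Tpow_inj: "Tpow n = Tpow k \<Longrightarrow> n = k"
  by (drule arg_cong[of _ _ "\<lambda>g. fst g$1$2"]) (simp add: Tpow_def)

lemma coset_bij: "bij_betw (\<lambda>(A, n). Tpow n \<star> crep A) (T_cosets \<times> UNIV) (carrier Mp2Z)"
  unfolding bij_betw_def
proof
  show "inj_on (\<lambda>(A, n). Tpow n \<star> crep A) (T_cosets \<times> UNIV)"
  proof (rule inj_onI, clarsimp)
    fix A A' n n' assume A: "A \<in> T_cosets" "A' \<in> T_cosets" and e: "Tpow n \<star> crep A = Tpow n' \<star> crep A'"
    have "A = A'"
      using crep_coset[OF A(1)] crep_coset[OF A(2)] r_coset_T_closed e by metis
    moreover from this have "Tpow n = Tpow n'" using e crep_coset(1)[OF A(2)] Tpow_carrier by simp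
    ultimately show "A = A' \<and> n = n'" using Tpow_inj by blast
  qed
  show "(\<lambda>(A, n). Tpow n \<star> crep A) ` (T_cosets \<times> UNIV) = carrier Mp2Z"
  proof
    show "(\<lambda>(A, n). Tpow n \<star> crep A) ` (T_cosets \<times> UNIV) \<subseteq> carrier Mp2Z"
      using crep_coset(1) Tpow_carrier by auto
    show "carrier Mp2Z \<subseteq> (\<lambda>(A, n). Tpow n \<star> crep A) ` (T_cosets \<times> UNIV)"
    proof
      fix g assume g: "g \<in> carrier Mp2Z"
      let ?A = "T_group #>\<^bsub>Mp2Z\<^esub> g"
      have A: "?A \<in> T_cosets" by (rule r_coset_T_cosets[OF g])
      have "g \<in> T_group #>\<^bsub>Mp2Z\<^esub> crep ?A" using crep_coset(2)[OF A] Mp.rcos_self[OF g subgroup_T] by simp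
      then obtain n where "g = Tpow n \<star> crep ?A" unfolding r_coset_T[of "crep ?A"] by blast
      then show "g \<in> (\<lambda>(A, n). Tpow n \<star> crep A) ` (T_cosets \<times> UNIV)"
        using A by (intro image_eqI[of _ _ "(?A, n)"]) auto
    qed
  qed
qed

lemma countable_T_cosets: "countable T_cosets"
proof -
  have "countable ((\<lambda>g. T_group #>\<^bsub>Mp2Z\<^esub> g) ` carrier Mp2Z)" by (rule countable_image[OF countable_Mp2Z])
  moreover have "T_cosets = (\<lambda>g. T_group #>\<^bsub>Mp2Z\<^esub> g) ` carrier Mp2Z" by (auto simp: T_cosets_def RCOSETS_def)
  ultimately show ?thesis by simp
qed

lemma upper_triangular_coset:
  assumes g: "g \<in> carrier Mp2Z" and c: "fst g$2$1 = 0"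
  shows "\<exists>n. Tpow n \<star> g \<in> center4" "\<exists>n::int. \<forall>\<tau>. act g \<tau> = \<tau> + of_int n"
proof -
  have "fst g$1$1 * fst g$2$2 = 1" using g c by (simp add: mp2_iff det2)
  then have ad: "fst g$1$1 = 1 \<and> fst g$2$2 = 1 \<or> fst g$1$1 = -1 \<and> fst g$2$2 = -1" by (simp add: zmult_eq_1_iff)
  let ?n = "fst g$1$2 * fst g$2$2"
  have "fst (Tpow (- ?n) \<star> g) = mat 1 \<or> fst (Tpow (- ?n) \<star> g) = mat2 (-1) 0 0 (-1)"
    using ad c by (elim disjE) (rule disjI1 disjI2; rule mat2_eqI; simp add: mp2_mult Tpow_def mm2 mat_def; fail)+
  then show "\<exists>n. Tpow n \<star> g \<in> center4" using g Tpow_carrier unfolding center4_def by auto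
  have "act g \<tau> = \<tau> + of_int ?n" for \<tau>
    using ad c by (elim disjE) (simp_all add: moebius_act_def autom_factor_def)
  then show "\<exists>n::int. \<forall>\<tau>. act g \<tau> = \<tau> + of_int n" by blast
qed

text \<open>Each upper triangular coset contains exactly one element that acts trivially.\<close>

lemma card_upper_triangular: "card {A \<in> T_cosets. fst (crep A)$2$1 = 0} = 4"
proof -
  have "bij_betw (\<lambda>k. T_group #>\<^bsub>Mp2Z\<^esub> k) center4 {A \<in> T_cosets. fst (crep A)$2$1 = 0}"
    unfolding bij_betw_def
  proof
    show "inj_on (\<lambda>k. T_group #>\<^bsub>Mp2Z\<^esub> k) center4"
    proof (rule inj_onI)
      fix k k' assume k: "k \<in> center4" "k' \<in> center4" and e: "T_group #>\<^bsub>Mp2Z\<^esub> k = T_group #>\<^bsub>Mp2Z\<^esub> k'"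
      have kc: "k \<in> carrier Mp2Z" "k' \<in> carrier Mp2Z" using k by (auto simp: center4_def)
      have "k \<in> T_group #>\<^bsub>Mp2Z\<^esub> k'" using Mp.rcos_self[OF kc(1) subgroup_T] e by simp
      then obtain n where n: "k = Tpow n \<star> k'" by (auto simp: r_coset_T)
      have "fst k$1$2 = n * fst k'$2$2 + fst k'$1$2" unfolding n by (simp add: mp2_mult Tpow_def mm2)
      then have "n = 0" using k by (auto simp: center4_def mat_def)
      then show "k = k'" using n kc by (simp add: Tpow_0)
    qed
    show "(\<lambda>k. T_group #>\<^bsub>Mp2Z\<^esub> k) ` center4 = {A \<in> T_cosets. fst (crep A)$2$1 = 0}"
    proof (intro equalityI subsetI)
      fix A assume "A \<in> (\<lambda>k. T_group #>\<^bsub>Mp2Z\<^esub> k) ` center4"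
      then obtain k where k: "k \<in> center4" "A = T_group #>\<^bsub>Mp2Z\<^esub> k" by blast
      have kc: "k \<in> carrier Mp2Z" using k by (auto simp: center4_def)
      have A: "A \<in> T_cosets" using k r_coset_T_cosets[OF kc] by simp
      have "crep A \<in> T_group #>\<^bsub>Mp2Z\<^esub> k"
        using crep_coset[OF A] Mp.rcos_self[OF crep_coset(1)[OF A] subgroup_T] k(2) by simp
      then obtain n where "crep A = Tpow n \<star> k" by (auto simp: r_coset_T)
      then have "fst (crep A)$2$1 = 0" using k by (auto simp: mp2_mult Tpow_def mm2 center4_def mat_def)
      then show "A \<in> {A \<in> T_cosets. fst (crep A)$2$1 = 0}" using A by simp
    next
      fix A assume "A \<in> {A \<in> T_cosets. fst (crep A)$2$1 = 0}"
      then have A: "A \<in> T_cosets" and c: "fst (crep A)$2$1 = 0" by auto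
      obtain n where n: "Tpow n \<star> crep A \<in> center4" using upper_triangular_coset(1)[OF crep_coset(1)[OF A] c] by blast
      have "A = T_group #>\<^bsub>Mp2Z\<^esub> (Tpow n \<star> crep A)"
        using r_coset_T_closed[OF crep_coset(1)[OF A]] crep_coset(2)[OF A] by simp
      then show "A \<in> (\<lambda>k. T_group #>\<^bsub>Mp2Z\<^esub> k) ` center4" using n by blast
    qed
  qed
  then show ?thesis using bij_betw_same_card card_center4 by fastforce
qed

section \<open>The invariant measure and generic points\<close>

definition hyp_measure :: "complex measure" where
  "hyp_measure = density lborel (\<lambda>\<tau>. ennreal (indicator upper_half \<tau> * (1 / (Im \<tau>)\<^sup>2)))"

lemma sets_hyp [measurable_cong, simp]: "sets hyp_measure = sets borel" by (simp add: hyp_measure_def)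
lemma space_hyp [simp]: "space hyp_measure = UNIV" by (simp add: hyp_measure_def)

lemma nn_integral_hyp: "f \<in> borel_measurable borel \<Longrightarrow> (\<integral>\<^sup>+\<tau>. f \<tau> \<partial>hyp_measure) = hint f"
  unfolding hyp_measure_def hint_def
  by (subst nn_integral_density) (auto intro!: nn_integral_cong simp: mult.commute split: split_indicator)

lemma sigma_finite_hyp: "sigma_finite_measure hyp_measure"
  unfolding hyp_measure_def by (subst sigma_finite_measure.sigma_finite_iff_density_finite[OF sigma_finite_lborel]) auto

lemma AE_hyp: "(AE \<tau> in hyp_measure. P \<tau>) \<longleftrightarrow> (AE \<tau> in lborel. \<tau> \<in> upper_half \<longrightarrow> P \<tau>)"
  unfolding hyp_measure_def
  by (subst AE_density) (auto intro!: AE_cong simp: indicator_def upper_half_def)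

lemma distr_hyp:
  assumes g: "g \<in> carrier Mp2Z"
  shows "distr hyp_measure borel (act g) = hyp_measure"
proof (rule measure_eqI)
  fix X assume "X \<in> sets (distr hyp_measure borel (act g))"
  then have X [measurable]: "X \<in> sets borel" by simp
  have "emeasure (distr hyp_measure borel (act g)) X = (\<integral>\<^sup>+\<tau>. indicator X \<tau> \<partial>distr hyp_measure borel (act g))"
    by simp
  also have "\<dots> = (\<integral>\<^sup>+\<tau>. indicator X (act g \<tau>) \<partial>hyp_measure)"
    by (rule nn_integral_distr) auto
  also have "\<dots> = hint (\<lambda>\<tau>. indicator X (act g \<tau>))" by (rule nn_integral_hyp) measurable
  also have "\<dots> = hint (indicator X)" by (rule hint_invariant[OF g]) measurable
  also have "\<dots> = emeasure hyp_measure X" using nn_integral_hyp[of "indicator X"] by simp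
  finally show "emeasure (distr hyp_measure borel (act g)) X = emeasure hyp_measure X" .
qed simp

lemma integral_moebius:
  fixes f :: "complex \<Rightarrow> 'b::{banach, second_countable_topology}"
  assumes g: "g \<in> carrier Mp2Z" and f [measurable]: "f \<in> borel_measurable borel"
  shows "integrable hyp_measure (\<lambda>\<tau>. f (act g \<tau>)) \<longleftrightarrow> integrable hyp_measure f"
    "(LINT \<tau>|hyp_measure. f (act g \<tau>)) = (LINT \<tau>|hyp_measure. f \<tau>)"
  using integrable_distr_eq[of "act g" hyp_measure borel f]
    integral_distr[of "act g" hyp_measure borel f]
  by (simp_all add: distr_hyp[OF g])

text \<open>For points of the half plane outside this null set, membership in \<open>FD\<close> and
  in \<open>FDi\<close> agree, and exactly one integer translate lies in the open strip.\<close>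

definition bad_set :: "complex set" where
  "bad_set = {\<tau>. cmod \<tau> = 1 \<or> (\<exists>n::int. Re \<tau> = of_int n + 1/2)}"

lemma AE_not_bad: "AE \<tau> in lborel. \<tau> \<notin> bad_set"
proof -
  have 1: "AE \<tau>::complex in lborel. cmod \<tau> \<noteq> 1"
  proof -
    have "sphere (0::complex) 1 \<in> null_sets lborel"
      using negligible_sphere[of "0::complex" 1] by (auto simp: null_sets_completion_iff negligible_iff_null_sets)
    from AE_not_in[OF this] show ?thesis by eventually_elim simp
  qed
  have 2: "AE \<tau> in lborel. Re \<tau> \<noteq> c" for c
  proof -
    have "negligible {\<tau>::complex. 1 \<bullet> \<tau> = c}" by (rule negligible_hyperplane) simp
    moreover have "{\<tau>::complex. 1 \<bullet> \<tau> = c} \<in> sets borel" by (intro borel_closed closed_hyperplane)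
    ultimately have "{\<tau>::complex. 1 \<bullet> \<tau> = c} \<in> null_sets lborel"
      by (auto simp: null_sets_completion_iff negligible_iff_null_sets)
    from AE_not_in[OF this] show ?thesis by eventually_elim (simp add: inner_complex_def)
  qed
  have "AE \<tau> in lborel. \<forall>n::int. Re \<tau> \<noteq> of_int n + 1/2" using 2 by (simp add: AE_all_countable)
  with 1 show ?thesis by eventually_elim (auto simp: bad_set_def)
qed

text \<open>The whole orbit is asked to avoid the null set; since the group is countable and
  preserves the measure, almost every point still qualifies.\<close>

definition generic :: "complex \<Rightarrow> bool" where
  "generic \<tau> \<longleftrightarrow> \<tau> \<in> upper_half \<and> (\<forall>g\<in>carrier Mp2Z. act g \<tau> \<notin> bad_set)"

lemma bad_set_borel [measurable]: "bad_set \<in> sets borel"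
proof -
  have "bad_set = {\<tau>. cmod \<tau> = 1} \<union> (\<Union>n::int. {\<tau>. Re \<tau> = of_int n + 1/2})" by (auto simp: bad_set_def)
  also have "\<dots> \<in> sets borel" by measurable
  finally show ?thesis .
qed

lemma AE_generic: "AE \<tau> in hyp_measure. generic \<tau>"
proof -
  have "AE \<tau> in hyp_measure. act g \<tau> \<notin> bad_set" if g: "g \<in> carrier Mp2Z" for g
  proof -
    have "AE \<tau> in hyp_measure. \<tau> \<notin> bad_set" using AE_not_bad unfolding AE_hyp by eventually_elim simp
    then have "AE \<tau> in distr hyp_measure borel (act g). \<tau> \<notin> bad_set" unfolding distr_hyp[OF g] .
    then show ?thesis by (subst (asm) AE_distr_iff) auto
  qed
  then have "AE \<tau> in hyp_measure. \<forall>g\<in>carrier Mp2Z. act g \<tau> \<notin> bad_set"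
    by (subst AE_ball_countable[OF countable_Mp2Z]) auto
  moreover have "AE \<tau> in hyp_measure. \<tau> \<in> upper_half" by (simp add: AE_hyp)
  ultimately show ?thesis by eventually_elim (simp add: generic_def)
qed

lemma FD_not_bad: "\<tau> \<in> FD \<Longrightarrow> \<tau> \<notin> bad_set \<Longrightarrow> \<tau> \<in> FDi"
proof -
  assume t: "\<tau> \<in> FD" "\<tau> \<notin> bad_set"
  have "Re \<tau> \<noteq> of_int 0 + 1/2" "Re \<tau> \<noteq> of_int (-1) + 1/2" "cmod \<tau> \<noteq> 1" using t(2) unfolding bad_set_def by blast+
  then show ?thesis using t(1) by (auto simp: FD_def FDi_def abs_le_iff abs_less_iff)
qed

lemma moebius_in_upper: "g \<in> carrier Mp2Z \<Longrightarrow> \<tau> \<in> upper_half \<Longrightarrow> act g \<tau> \<in> upper_half"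
  by (rule moebius_upper) (simp_all add: mp2_iff)

lemma moebius_comp:
  "g \<in> carrier Mp2Z \<Longrightarrow> h \<in> carrier Mp2Z \<Longrightarrow> \<tau> \<in> upper_half \<Longrightarrow>
    act (g \<star> h) \<tau> = act g (act h \<tau>)"
  by (simp add: mp2_mult mp2_iff moebius_mult)

lemma moebius_inv:
  "g \<in> carrier Mp2Z \<Longrightarrow> \<tau> \<in> upper_half \<Longrightarrow> act (inv\<^bsub>Mp2Z\<^esub> g) (act g \<tau>) = \<tau>"
  using moebius_comp[of "inv\<^bsub>Mp2Z\<^esub> g" g \<tau>] by (simp add: mp2_one)

text \<open>By \<open>FD_reaches\<close> one element moves \<open>\<tau>\<close> into
  \<open>FDi\<close>, and by \<open>FDi_unique\<close> any other one differs from it by a member of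
  \<open>center4\<close>.\<close>

lemma card_reach:
  assumes t: "generic \<tau>"
  shows "card {g \<in> carrier Mp2Z. act (inv\<^bsub>Mp2Z\<^esub> g) \<tau> \<in> FDi} = 4"
proof -
  have u: "\<tau> \<in> upper_half" using t by (simp add: generic_def)
  obtain g0 where g0: "g0 \<in> carrier Mp2Z" "act g0 \<tau> \<in> FD" using FD_reaches[OF u] by blast
  then have F: "act g0 \<tau> \<in> FDi" using t by (intro FD_not_bad) (auto simp: generic_def)
  let ?f = "\<lambda>k. inv\<^bsub>Mp2Z\<^esub> (k \<star> g0)"
  have "bij_betw ?f center4 {g \<in> carrier Mp2Z. act (inv\<^bsub>Mp2Z\<^esub> g) \<tau> \<in> FDi}"
    unfolding bij_betw_def
  proof
    have kc: "k \<in> carrier Mp2Z" if "k \<in> center4" for k using that by (simp add: center4_def)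
    show "inj_on ?f center4"
    proof (rule inj_onI)
      fix k k' assume k: "k \<in> center4" "k' \<in> center4" "?f k = ?f k'"
      then have "k \<star> g0 = k' \<star> g0" using kc g0 by (metis Mp.inv_inv Mp.m_closed)
      then show "k = k'" using kc k g0 by simp
    qed
    show "?f ` center4 = {g \<in> carrier Mp2Z. act (inv\<^bsub>Mp2Z\<^esub> g) \<tau> \<in> FDi}"
    proof (intro equalityI subsetI)
      fix g assume "g \<in> ?f ` center4"
      then obtain k where k: "k \<in> center4" "g = ?f k" by blast
      then have "g \<in> carrier Mp2Z" "inv\<^bsub>Mp2Z\<^esub> g = k \<star> g0" using kc g0 by auto
      then show "g \<in> {g \<in> carrier Mp2Z. act (inv\<^bsub>Mp2Z\<^esub> g) \<tau> \<in> FDi}"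
        using moebius_comp[OF kc[OF k(1)] g0(1) u] F by (simp add: moebius_center4[OF k(1)])
    next
      fix g assume "g \<in> {g \<in> carrier Mp2Z. act (inv\<^bsub>Mp2Z\<^esub> g) \<tau> \<in> FDi}"
      then have g: "g \<in> carrier Mp2Z" "act (inv\<^bsub>Mp2Z\<^esub> g) \<tau> \<in> FDi" by auto
      let ?k = "inv\<^bsub>Mp2Z\<^esub> g \<star> inv\<^bsub>Mp2Z\<^esub> g0"
      have kk: "?k \<in> carrier Mp2Z" using g g0 by simp
      have "act ?k (act g0 \<tau>) = act (inv\<^bsub>Mp2Z\<^esub> g) \<tau>"
        using moebius_comp[of "inv\<^bsub>Mp2Z\<^esub> g" "inv\<^bsub>Mp2Z\<^esub> g0" "act g0 \<tau>"] g g0 moebius_in_upper[OF g0(1) u] moebius_inv[OF g0(1) u] by simp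
      then have "?k \<in> center4" using FDi_unique[OF kk F] g(2) kk by (simp add: center4_def)
      moreover have "g = ?f ?k" using g g0 by (simp add: Mp.m_assoc)
      ultimately show "g \<in> ?f ` center4" by blast
    qed
  qed
  then show ?thesis using bij_betw_same_card card_center4 by fastforce
qed

lemma FDi_borel [measurable]: "FDi \<in> sets borel"
proof -
  have "FDi = upper_half \<inter> {\<tau>. cmod \<tau> > 1} \<inter> {\<tau>. \<bar>Re \<tau>\<bar> < 1/2}" by (auto simp: FDi_def)
  also have "\<dots> \<in> sets borel" by measurable
  finally show ?thesis .
qed

section \<open>Unfolding over the cosets\<close>

definition strip :: "complex set" where "strip = {\<tau>. \<bar>Re \<tau>\<bar> < 1/2}"

lemma strip_borel [measurable]: "strip \<in> sets borel" unfolding strip_def by measurable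

lemma strip_unique:
  assumes "\<tau> \<notin> bad_set"
  obtains n0 :: int where "\<And>n. \<tau> + of_int n \<in> strip \<longleftrightarrow> n = n0"
proof
  let ?n0 = "- \<lfloor>Re \<tau> + 1/2\<rfloor>"
  fix n :: int
  have ne: "Re \<tau> \<noteq> of_int k + 1/2" for k :: int using assms by (auto simp: bad_set_def)
  have "Re \<tau> + of_int ?n0 \<noteq> - (1/2)" using ne[of "- 1 - ?n0"] by auto
  then have "\<bar>Re \<tau> + of_int ?n0\<bar> < 1/2"
    using floor_correct[of "Re \<tau> + 1/2"] by (simp only: abs_less_iff of_int_minus of_int_add of_int_1) linarith
  moreover have "n = k" if "\<bar>Re \<tau> + of_int n\<bar> < 1/2" "\<bar>Re \<tau> + of_int k\<bar> < 1/2" for n k :: int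
  proof -
    have "\<bar>real_of_int (n - k)\<bar> < 1" using that unfolding abs_less_iff of_int_diff by linarith
    then show ?thesis by linarith
  qed
  ultimately show "\<tau> + of_int n \<in> strip \<longleftrightarrow> n = ?n0" unfolding strip_def by (auto simp del: of_int_minus)
qed

text \<open>At a generic point exactly four \<open>g\<close> have their inverse image in
  \<open>FDi\<close>, so the cut-off functions \<open>\<psi> g\<close> add up to four times the
  strip integrand. Substituting the image under \<open>g\<close> for the variable moves the cutoff
  to \<open>FDi\<close>; with \<open>g\<close> written as a translation times a coset
  representative, exactly one translation hits the strip. \<open>\<Phi>\<close> is described only
  almost everywhere because both counts need generic points.\<close>

proposition unfolding_Mp2Z:
  fixes h :: "complex \<Rightarrow> complex"
  assumes h [measurable]: "h \<in> borel_measurable borel"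
    and hT: "\<And>\<tau> n. \<tau> \<in> upper_half \<Longrightarrow> h (\<tau> + of_int n) = h \<tau>"
    and int: "integrable hyp_measure (\<lambda>\<tau>. indicator strip \<tau> *\<^sub>R h \<tau>)"
  obtains \<Phi> where "integrable hyp_measure \<Phi>"
    and "(LINT \<tau>|hyp_measure. \<Phi> \<tau>) = 4 * (LINT \<tau>|hyp_measure. indicator strip \<tau> *\<^sub>R h \<tau>)"
    and "AE \<tau> in hyp_measure. \<Phi> \<tau> = (if \<tau> \<in> FDi then \<Sum>\<^sub>\<infinity>A\<in>T_cosets. h (act (crep A) \<tau>) else 0)"
proof
  define reach where "reach \<tau> = {g \<in> carrier Mp2Z. act (inv\<^bsub>Mp2Z\<^esub> g) \<tau> \<in> FDi}" for \<tau>
  define \<psi> where "\<psi> g \<tau> = (indicator strip \<tau> * indicator FDi (act (inv\<^bsub>Mp2Z\<^esub> g) \<tau>)) *\<^sub>R h \<tau>" for g \<tau>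
  define \<psi>' where "\<psi>' p \<tau> = (case p of (A, n::int) \<Rightarrow>
    (indicator strip (act (crep A) \<tau> + of_int n) * indicator FDi \<tau>) *\<^sub>R h (act (crep A) \<tau>))" for p \<tau>
  let ?h = "\<lambda>\<tau>. indicator strip \<tau> *\<^sub>R h \<tau>"
  have psi_meas [measurable]: "\<psi> g \<in> borel_measurable borel" for g unfolding \<psi>_def[abs_def] by measurable
  have psi'_meas [measurable]: "\<psi>' p \<in> borel_measurable borel" for p
    unfolding \<psi>'_def[abs_def] by (cases p) simp
  have psi_int: "integrable hyp_measure (\<psi> g)" for g
    by (rule Bochner_Integration.integrable_bound[OF int]) (auto simp: \<psi>_def split: split_indicator)
  have reach4: "card (reach \<tau>) = 4" "finite (reach \<tau>)" if "generic \<tau>" for \<tau>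
  proof -
    show "card (reach \<tau>) = 4" unfolding reach_def by (rule card_reach[OF that])
    then show "finite (reach \<tau>)" using card.infinite[of "reach \<tau>"] by (cases "finite (reach \<tau>)") auto
  qed
  have psi_reach: "\<psi> g \<tau> = (if g \<in> reach \<tau> then ?h \<tau> else 0)" if "g \<in> carrier Mp2Z" for g \<tau>
    using that by (auto simp: \<psi>_def reach_def)
  \<comment> \<open>At a generic point at most four of the functions are nonzero, so every finite
    partial sum of norms is bounded by four times the norm of the strip integrand.\<close>
  have sum: "(\<lambda>g. LINT \<tau>|hyp_measure. norm (\<psi> g \<tau>)) summable_on carrier Mp2Z"
  proof (rule nonneg_bdd_above_summable_on)
    show "bdd_above (sum (\<lambda>g. LINT \<tau>|hyp_measure. norm (\<psi> g \<tau>)) ` {F. F \<subseteq> carrier Mp2Z \<and> finite F})"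
    proof (rule bdd_aboveI2)
      fix F assume "F \<in> {F. F \<subseteq> carrier Mp2Z \<and> finite F}"
      then have F: "F \<subseteq> carrier Mp2Z" "finite F" by auto
      have "(\<Sum>g\<in>F. LINT \<tau>|hyp_measure. norm (\<psi> g \<tau>)) = (LINT \<tau>|hyp_measure. (\<Sum>g\<in>F. norm (\<psi> g \<tau>)))"
        by (rule Bochner_Integration.integral_sum[symmetric]) (use psi_int in auto)
      also have "\<dots> \<le> (LINT \<tau>|hyp_measure. 4 * norm (?h \<tau>))"
      proof (rule integral_mono_AE)
        show "AE \<tau> in hyp_measure. (\<Sum>g\<in>F. norm (\<psi> g \<tau>)) \<le> 4 * norm (?h \<tau>)"
          using AE_generic
        proof eventually_elim
          case (elim \<tau>)
          have "(\<Sum>g\<in>F. norm (\<psi> g \<tau>)) = (\<Sum>g\<in>F. if g \<in> reach \<tau> then norm (?h \<tau>) else 0)"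
            using F by (intro sum.cong) (auto simp: psi_reach)
          also have "\<dots> = (\<Sum>g\<in>F \<inter> reach \<tau>. norm (?h \<tau>))" using F by (simp add: sum.If_cases)
          also have "\<dots> \<le> (\<Sum>g\<in>reach \<tau>. norm (?h \<tau>))" using reach4[OF elim] by (intro sum_mono2) auto
          finally show ?case using reach4[OF elim] by simp
        qed
        show "integrable hyp_measure (\<lambda>\<tau>. \<Sum>g\<in>F. norm (\<psi> g \<tau>))"
          by (intro Bochner_Integration.integrable_sum integrable_norm psi_int)
        show "integrable hyp_measure (\<lambda>\<tau>. 4 * norm (?h \<tau>))" by (intro integrable_mult_right integrable_norm int)
      qed
      finally show "(\<Sum>g\<in>F. LINT \<tau>|hyp_measure. norm (\<psi> g \<tau>)) \<le> (LINT \<tau>|hyp_measure. 4 * norm (?h \<tau>))" .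
    qed
  qed simp
  note I1 = integral_infsum[OF countable_Mp2Z sigma_finite_hyp psi_int sum]
  \<comment> \<open>Periodicity of \<open>h\<close> removes the translation from its argument and
    leaves it only in the indicator of the strip.\<close>
  have psi_move: "\<psi> (Tpow n \<star> crep A) (act (Tpow n \<star> crep A) \<tau>) = \<psi>' (A, n) \<tau>"
    if A: "A \<in> T_cosets" and t: "\<tau> \<in> upper_half" for A n \<tau>
  proof -
    have c: "crep A \<in> carrier Mp2Z" "Tpow n \<star> crep A \<in> carrier Mp2Z" using crep_coset(1)[OF A] Tpow_carrier by auto
    have "act (Tpow n \<star> crep A) \<tau> = act (crep A) \<tau> + of_int n"
      using moebius_comp[OF Tpow_carrier c(1) t] by (simp add: moebius_Tpow)
    moreover have "act (inv\<^bsub>Mp2Z\<^esub> (Tpow n \<star> crep A)) (act (Tpow n \<star> crep A) \<tau>) = \<tau>"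
      by (rule moebius_inv[OF c(2) t])
    ultimately show ?thesis unfolding \<psi>_def \<psi>'_def using hT[OF moebius_in_upper[OF c(1) t]] by simp
  qed
  have AEuh: "AE \<tau> in hyp_measure. \<tau> \<in> upper_half" by (simp add: AE_hyp)
  have psi'_int: "integrable hyp_measure (\<psi>' (A, n))"
    and psi'_eq: "(LINT \<tau>|hyp_measure. \<psi>' (A, n) \<tau>) = (LINT \<tau>|hyp_measure. \<psi> (Tpow n \<star> crep A) \<tau>)"
    and psi'_norm: "(LINT \<tau>|hyp_measure. norm (\<psi>' (A, n) \<tau>)) = (LINT \<tau>|hyp_measure. norm (\<psi> (Tpow n \<star> crep A) \<tau>))"
    if A: "A \<in> T_cosets" for A n
  proof -
    let ?g = "Tpow n \<star> crep A"
    have c: "?g \<in> carrier Mp2Z" using crep_coset(1)[OF A] Tpow_carrier by auto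
    have ae: "AE \<tau> in hyp_measure. \<psi>' (A, n) \<tau> = \<psi> ?g (act ?g \<tau>)"
      using AEuh by eventually_elim (simp add: psi_move[OF A])
    then have ae': "AE \<tau> in hyp_measure. norm (\<psi>' (A, n) \<tau>) = norm (\<psi> ?g (act ?g \<tau>))"
      by eventually_elim simp
    have "integrable hyp_measure (\<lambda>\<tau>. \<psi> ?g (act ?g \<tau>))"
      using integral_moebius(1)[OF c psi_meas] psi_int by blast
    then show "integrable hyp_measure (\<psi>' (A, n))" by (subst integrable_cong_AE[OF _ _ ae]) auto
    have "(LINT \<tau>|hyp_measure. \<psi>' (A, n) \<tau>) = (LINT \<tau>|hyp_measure. \<psi> ?g (act ?g \<tau>))"
      by (rule integral_cong_AE[OF _ _ ae]) auto
    also have "\<dots> = (LINT \<tau>|hyp_measure. \<psi> ?g \<tau>)" by (rule integral_moebius(2)[OF c psi_meas])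
    finally show "(LINT \<tau>|hyp_measure. \<psi>' (A, n) \<tau>) = (LINT \<tau>|hyp_measure. \<psi> ?g \<tau>)" .
    have "(LINT \<tau>|hyp_measure. norm (\<psi>' (A, n) \<tau>)) = (LINT \<tau>|hyp_measure. norm (\<psi> ?g (act ?g \<tau>)))"
      by (rule integral_cong_AE[OF _ _ ae']) auto
    also have "\<dots> = (LINT \<tau>|hyp_measure. norm (\<psi> ?g \<tau>))" by (rule integral_moebius(2)[OF c]) measurable
    finally show "(LINT \<tau>|hyp_measure. norm (\<psi>' (A, n) \<tau>)) = (LINT \<tau>|hyp_measure. norm (\<psi> ?g \<tau>))" .
  qed
  let ?P = "T_cosets \<times> (UNIV :: int set)"
  let ?m = "\<lambda>(A, n). Tpow n \<star> crep A"
  have sum': "(\<lambda>p. LINT \<tau>|hyp_measure. norm (\<psi>' p \<tau>)) summable_on ?P"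
  proof -
    have "(\<lambda>p. LINT \<tau>|hyp_measure. norm (\<psi> (?m p) \<tau>)) summable_on ?P"
      using sum summable_on_reindex_bij_betw[OF coset_bij, of "\<lambda>g. LINT \<tau>|hyp_measure. norm (\<psi> g \<tau>)"] by blast
    then show ?thesis by (rule summable_on_cong[THEN iffD1, rotated]) (auto simp: psi'_norm)
  qed
  have cP: "countable ?P" using countable_T_cosets by auto
  have psi'_int': "integrable hyp_measure (\<psi>' p)" if "p \<in> ?P" for p using that psi'_int by auto
  note I2 = integral_infsum[OF cP sigma_finite_hyp psi'_int' sum']
  show "integrable hyp_measure (\<lambda>\<tau>. \<Sum>\<^sub>\<infinity>p\<in>?P. \<psi>' p \<tau>)" by (rule I2(2))
  have "(LINT \<tau>|hyp_measure. (\<Sum>\<^sub>\<infinity>p\<in>?P. \<psi>' p \<tau>)) = (\<Sum>\<^sub>\<infinity>p\<in>?P. LINT \<tau>|hyp_measure. \<psi>' p \<tau>)" by (rule I2(4))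
  also have "\<dots> = (\<Sum>\<^sub>\<infinity>p\<in>?P. LINT \<tau>|hyp_measure. \<psi> (?m p) \<tau>)" by (rule infsum_cong) (auto simp: psi'_eq)
  also have "\<dots> = (\<Sum>\<^sub>\<infinity>g\<in>carrier Mp2Z. LINT \<tau>|hyp_measure. \<psi> g \<tau>)"
    by (rule infsum_reindex_bij_betw[OF coset_bij])
  also have "\<dots> = (LINT \<tau>|hyp_measure. (\<Sum>\<^sub>\<infinity>g\<in>carrier Mp2Z. \<psi> g \<tau>))" by (rule I1(4)[symmetric])
  also have "\<dots> = (LINT \<tau>|hyp_measure. 4 * ?h \<tau>)"
  proof (rule integral_cong_AE)
    show "AE \<tau> in hyp_measure. (\<Sum>\<^sub>\<infinity>g\<in>carrier Mp2Z. \<psi> g \<tau>) = 4 * ?h \<tau>"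
      using AE_generic
    proof eventually_elim
      case (elim \<tau>)
      have "(\<Sum>\<^sub>\<infinity>g\<in>carrier Mp2Z. \<psi> g \<tau>) = (\<Sum>\<^sub>\<infinity>g\<in>reach \<tau>. ?h \<tau>)"
        by (rule infsum_cong_neutral) (auto simp: psi_reach reach_def)
      also have "\<dots> = 4 * ?h \<tau>" using reach4[OF elim] by simp
      finally show ?case .
    qed
    show "(\<lambda>\<tau>. \<Sum>\<^sub>\<infinity>g\<in>carrier Mp2Z. \<psi> g \<tau>) \<in> borel_measurable hyp_measure"
      using I1(2) by (rule borel_measurable_integrable)
  qed measurable
  also have "\<dots> = 4 * (LINT \<tau>|hyp_measure. ?h \<tau>)" by (rule integral_mult_right_zero)
  finally show "(LINT \<tau>|hyp_measure. (\<Sum>\<^sub>\<infinity>p\<in>?P. \<psi>' p \<tau>)) = 4 * (LINT \<tau>|hyp_measure. ?h \<tau>)" .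
  have I2': "AE \<tau> in hyp_measure. (\<lambda>p. \<psi>' p \<tau>) abs_summable_on ?P" by (rule I2(1))
  show "AE \<tau> in hyp_measure. (\<Sum>\<^sub>\<infinity>p\<in>?P. \<psi>' p \<tau>) = (if \<tau> \<in> FDi then \<Sum>\<^sub>\<infinity>A\<in>T_cosets. h (act (crep A) \<tau>) else 0)"
    using AE_generic I2'
  proof eventually_elim
    case (elim \<tau>)
    show ?case
    proof (cases "\<tau> \<in> FDi")
      case True
      have "(\<lambda>p. \<psi>' p \<tau>) summable_on ?P" using elim(2) by (rule abs_summable_summable)
      then have "(\<Sum>\<^sub>\<infinity>p\<in>?P. \<psi>' p \<tau>) = (\<Sum>\<^sub>\<infinity>A\<in>T_cosets. \<Sum>\<^sub>\<infinity>n\<in>UNIV. \<psi>' (A, n) \<tau>)"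
        using infsum_Sigma'_banach[of "\<lambda>A n. \<psi>' (A, n) \<tau>" T_cosets "\<lambda>_. UNIV"]
        unfolding case_prod_eta[of "\<lambda>p. \<psi>' p \<tau>"] by simp
      also have "\<dots> = (\<Sum>\<^sub>\<infinity>A\<in>T_cosets. h (act (crep A) \<tau>))"
      proof (rule infsum_cong)
        fix A assume A: "A \<in> T_cosets"
        let ?w = "act (crep A) \<tau>"
        have "?w \<notin> bad_set" using elim(1) crep_coset(1)[OF A] by (simp add: generic_def)
        then have "\<exists>n0. \<forall>n. ?w + of_int n \<in> strip \<longleftrightarrow> n = n0" using strip_unique by metis
        then obtain n0 where n0: "\<And>n. ?w + of_int n \<in> strip \<longleftrightarrow> n = n0" by blast
        have "(\<Sum>\<^sub>\<infinity>n\<in>UNIV. \<psi>' (A, n) \<tau>) = (\<Sum>\<^sub>\<infinity>n\<in>{n0}. \<psi>' (A, n) \<tau>)"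
          by (rule infsum_cong_neutral) (auto simp: \<psi>'_def n0)
        then show "(\<Sum>\<^sub>\<infinity>n\<in>UNIV. \<psi>' (A, n) \<tau>) = h ?w" using n0[of n0] True by (simp add: \<psi>'_def)
      qed
      finally show ?thesis using True by simp
    next
      case False
      then show ?thesis by (simp add: \<psi>'_def case_prod_beta)
    qed
  qed
qed

text \<open>
  The fundamental domain avoids this union of unit discs, while a generic point of it is moved into
  the union by every element with \<open>c \<noteq> 0\<close>. Cutting off to it makes the seed integrable on the strip.
\<close>

definition E_set :: "complex set" where "E_set = {\<tau>. \<exists>n::int. cmod (\<tau> + of_int n) < 1}"

lemma E_set_borel [measurable]: "E_set \<in> sets borel"
proof -
  have "E_set = (\<Union>n::int. {\<tau>. cmod (\<tau> + of_int n) < 1})" by (auto simp: E_set_def)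
  also have "\<dots> \<in> sets borel" by measurable
  finally show ?thesis .
qed

lemma E_set_translate: "\<tau> + of_int n \<in> E_set \<longleftrightarrow> \<tau> \<in> E_set"
proof
  show "\<tau> + of_int n \<in> E_set \<Longrightarrow> \<tau> \<in> E_set" unfolding E_set_def
    by (clarsimp, rename_tac k, rule_tac x="n + k" in exI) (simp add: add.assoc)
  show "\<tau> \<in> E_set \<Longrightarrow> \<tau> + of_int n \<in> E_set" unfolding E_set_def
    by (clarsimp, rename_tac k, rule_tac x="k - n" in exI) (simp add: algebra_simps)
qed

lemma FDi_not_E: assumes "\<tau> \<in> FDi" shows "\<tau> \<notin> E_set"
proof
  assume "\<tau> \<in> E_set"
  then obtain n :: int where n: "cmod (\<tau> + of_int n) < 1" by (auto simp: E_set_def)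
  have t: "\<bar>Re \<tau>\<bar> < 1/2" "1 < cmod \<tau>" using assms by (auto simp: FDi_def)
  have "(cmod (\<tau> + of_int n))\<^sup>2 = (cmod \<tau>)\<^sup>2 + real_of_int n * (2 * Re \<tau> + real_of_int n)"
    unfolding cmod_power2 by (simp add: power2_eq_square algebra_simps)
  moreover have "real_of_int n * (2 * Re \<tau> + real_of_int n) \<ge> 0"
  proof (cases "n = 0")
    case False
    then have "n \<ge> 1 \<or> n \<le> -1" by linarith
    then show ?thesis
    proof
      assume "n \<ge> 1"
      then have "real_of_int n \<ge> 1" by simp
      then show ?thesis using t by (intro mult_nonneg_nonneg) (auto simp: abs_less_iff)
    next
      assume "n \<le> -1"
      then have "real_of_int n \<le> real_of_int (-1)" by (subst of_int_le_iff)
      then show ?thesis using t by (intro mult_nonpos_nonpos) (auto simp: abs_less_iff)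
    qed
  qed simp
  ultimately have "(cmod (\<tau> + of_int n))\<^sup>2 > 1" using one_less_power[OF t(2), of 2] by simp
  then show False using n by (metis less_irrefl less_trans norm_ge_zero one_power2 power_strict_mono zero_less_numeral pos2)
qed

text \<open>An image outside all the discs has a translate in \<open>FDi\<close>, so
  \<open>FDi_unique\<close> forces \<open>c = 0\<close>. Conversely, \<open>c = 0\<close> acts by an
  integer translation, which preserves the complement of the discs.\<close>

lemma generic_E_set:
  assumes t: "generic \<tau>" "\<tau> \<in> FDi" and g: "g \<in> carrier Mp2Z"
  shows "act g \<tau> \<in> E_set \<longleftrightarrow> fst g$2$1 \<noteq> 0"
proof
  assume E: "act g \<tau> \<in> E_set"
  show "fst g$2$1 \<noteq> 0"
  proof
    assume "fst g$2$1 = 0"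
    then obtain n :: int where "act g \<tau> = \<tau> + of_int n" using upper_triangular_coset(2)[OF g] by blast
    then show False using E FDi_not_E[OF t(2)] by (simp add: E_set_translate)
  qed
next
  assume c: "fst g$2$1 \<noteq> 0"
  show "act g \<tau> \<in> E_set"
  proof (rule ccontr)
    let ?w = "act g \<tau>"
    assume nE: "?w \<notin> E_set"
    have u: "\<tau> \<in> upper_half" using t by (simp add: generic_def)
    have "?w \<notin> bad_set" using t g by (simp add: generic_def)
    then obtain n where n: "?w + of_int n \<in> strip" using strip_unique by metis
    let ?g = "Tpow n \<star> g"
    have gc: "?g \<in> carrier Mp2Z" using g Tpow_carrier by simp
    have e: "act ?g \<tau> = ?w + of_int n" using moebius_comp[OF Tpow_carrier g u] by (simp add: moebius_Tpow)
    have "cmod (?w + of_int n) \<ge> 1" using nE by (auto simp: E_set_def not_less)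
    then have "act ?g \<tau> \<in> FD" using n moebius_in_upper[OF gc u] by (auto simp: FD_def e strip_def)
    then have "act ?g \<tau> \<in> FDi" using t gc by (intro FD_not_bad) (auto simp: generic_def)
    then have "fst ?g$2$1 = 0" using FDi_unique[OF gc t(2)] by auto
    then show False using c by (simp add: mp2_mult Tpow_def mm2)
  qed
qed

text \<open>The upper triangular cosets act by translations and contribute \<open>h \<tau>\<close>
  each; the remaining ones are precisely those whose image lies in a disc.\<close>

lemma sum_over_cosets_split:
  fixes h :: "complex \<Rightarrow> complex"
  assumes t: "generic \<tau>" "\<tau> \<in> FDi"
    and hT: "\<And>\<tau> n. \<tau> \<in> upper_half \<Longrightarrow> h (\<tau> + of_int n) = h \<tau>"
    and s: "(\<lambda>A. h (act (crep A) \<tau>)) summable_on T_cosets"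
  shows "(\<Sum>\<^sub>\<infinity>A\<in>T_cosets. h (act (crep A) \<tau>)) = 4 * h \<tau> +
    (\<Sum>\<^sub>\<infinity>A\<in>T_cosets. indicator E_set (act (crep A) \<tau>) *\<^sub>R h (act (crep A) \<tau>))"
proof -
  let ?w = "\<lambda>A. act (crep A) \<tau>"
  let ?R = "{A \<in> T_cosets. fst (crep A)$2$1 = 0}"
  have u: "\<tau> \<in> upper_half" using t by (simp add: generic_def)
  have fR: "finite ?R" 
  proof (rule ccontr)
    assume "infinite ?R"
    then have "card ?R = 0" by (rule card.infinite)
    then show False using card_upper_triangular by simp
  qed
  have R: "h (?w A) = h \<tau>" if "A \<in> ?R" for A
  proof -
    have "A \<in> T_cosets" "fst (crep A)$2$1 = 0" using that by auto
    then obtain n :: int where "?w A = \<tau> + of_int n" using upper_triangular_coset(2)[OF crep_coset(1)] by blast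
    then show ?thesis using hT[OF u] by simp
  qed
  have "(\<Sum>\<^sub>\<infinity>A\<in>T_cosets. h (?w A)) = (\<Sum>\<^sub>\<infinity>A\<in>?R \<union> (T_cosets - ?R). h (?w A))" by (rule arg_cong[of _ _ "infsum _"]) auto
  also have "\<dots> = (\<Sum>\<^sub>\<infinity>A\<in>?R. h (?w A)) + (\<Sum>\<^sub>\<infinity>A\<in>T_cosets - ?R. h (?w A))"
    by (rule infsum_Un_disjoint) (use fR s in \<open>auto intro: summable_on_finite summable_on_subset_banach\<close>)
  also have "(\<Sum>\<^sub>\<infinity>A\<in>?R. h (?w A)) = 4 * h \<tau>" using fR card_upper_triangular R by simp
  also have "(\<Sum>\<^sub>\<infinity>A\<in>T_cosets - ?R. h (?w A)) = (\<Sum>\<^sub>\<infinity>A\<in>T_cosets. indicator E_set (?w A) *\<^sub>R h (?w A))"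
    by (rule infsum_cong_neutral) (use generic_E_set[OF t crep_coset(1)] in auto)
  finally show ?thesis .
qed

section \<open>Laplace transform of the Whittaker function\<close>

lemma summable_ratio_limit:
  fixes u q :: "nat \<Rightarrow> real"
  assumes u: "\<And>n. u n \<ge> 0" and r: "\<And>n. u (Suc n) \<le> q n * u n" and l: "q \<longlonglongrightarrow> l" "l < 1"
  shows "summable u"
proof -
  let ?c = "(l + 1) / 2"
  have "eventually (\<lambda>n. q n < ?c) sequentially" using l by (intro order_tendstoD(2)[OF l(1)]) simp
  then obtain N where N: "\<And>n. n \<ge> N \<Longrightarrow> q n < ?c" by (auto simp: eventually_sequentially)
  show ?thesis
  proof (rule summable_ratio_test[of ?c N])
    show "?c < 1" using l by simp
    fix n assume "N \<le> n"
    then have "u (Suc n) \<le> ?c * u n" using N[of n] r[of n] mult_right_mono[of "q n" ?c "u n"] u[of n] by linarith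
    then show "norm (u (Suc n)) \<le> ?c * norm (u n)" using u by simp
  qed
qed

definition kcoef :: "complex \<Rightarrow> complex \<Rightarrow> nat \<Rightarrow> complex" where
  "kcoef a c n = pochhammer a n / pochhammer c n / fact n"

lemma norm_kcoef_Suc:
  assumes c: "Re c > 0"
  shows "norm (kcoef a c (Suc n)) \<le> (norm a + real n) / (Re c + real n) / (real n + 1) * norm (kcoef a c n)"
proof -
  have "kcoef a c (Suc n) = (a + of_nat n) / (c + of_nat n) / of_nat (Suc n) * kcoef a c n"
    by (simp add: kcoef_def pochhammer_Suc field_simps)
  then have "norm (kcoef a c (Suc n)) = norm (a + of_nat n) / norm (c + of_nat n) / (real n + 1) * norm (kcoef a c n)"
    by (simp add: norm_mult norm_divide del: of_nat_Suc)
  also have "\<dots> \<le> (norm a + real n) / (Re c + real n) / (real n + 1) * norm (kcoef a c n)"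
  proof (intro mult_right_mono divide_right_mono frac_le)
    show "norm (a + of_nat n) \<le> norm a + real n" using norm_triangle_ineq[of a "of_nat n"] by simp
    show "Re c + real n \<le> norm (c + of_nat n)" using complex_Re_le_cmod[of "c + of_nat n"] by simp
  qed (use c in auto)
  finally show ?thesis .
qed

lemma summable_kcoef:
  assumes c: "Re c > 0" and t: "t \<ge> 0"
  shows "summable (\<lambda>n. norm (kcoef a c n) * t ^ n)"
proof (rule summable_ratio_limit)
  let ?q = "\<lambda>n. (norm a + real n) / (Re c + real n) / (real n + 1) * t"
  show "norm (kcoef a c (Suc n)) * t ^ Suc n \<le> ?q n * (norm (kcoef a c n) * t ^ n)" for n
    using mult_right_mono[OF norm_kcoef_Suc[OF c, of a n], of "t ^ Suc n"] t by (simp add: mult_ac)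
  show "?q \<longlonglongrightarrow> 0" by real_asymp
qed (use t in auto)

text \<open>The growth of the Gamma factor cancels the decay from the factorial, so the ratio of
  consecutive bounds tends to \<open>x\<close>.\<close>

lemma summable_kcoef_Gamma:
  assumes c: "Re c > 0" and x: "x \<ge> 0" "x < 1" and R: "R > 0"
  shows "summable (\<lambda>n. norm (kcoef a c n) * x ^ n * Gamma (R + real n))"
proof (rule summable_ratio_limit)
  let ?q = "\<lambda>n. (norm a + real n) / (Re c + real n) / (real n + 1) * x * (R + real n)"
  fix n
  have G: "Gamma (R + real n) > 0" using R by (intro Gamma_real_pos) auto
  then show "0 \<le> norm (kcoef a c n) * x ^ n * Gamma (R + real n)" using x by simp
  have "R + real n \<notin> \<int>\<^sub>\<le>\<^sub>0" using R by (auto elim!: nonpos_Ints_cases)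
  then have "Gamma (R + real (Suc n)) = (R + real n) * Gamma (R + real n)"
    using Gamma_plus1[of "R + real n"] by (simp add: add_ac)
  then show "norm (kcoef a c (Suc n)) * x ^ Suc n * Gamma (R + real (Suc n)) \<le> ?q n * (norm (kcoef a c n) * x ^ n * Gamma (R + real n))"
    using mult_right_mono[OF norm_kcoef_Suc[OF c, of a n], of "x ^ Suc n * ((R + real n) * Gamma (R + real n))"] x R G by (simp add: mult_ac)
next
  show "(\<lambda>n. (norm a + real n) / (Re c + real n) / (real n + 1) * x * (R + real n)) \<longlonglongrightarrow> x" by real_asymp
qed (use x in auto)

lemma kummer_eq: "kummer_M a c t = (\<Sum>n. kcoef a c n * t ^ n)"
  unfolding kummer_M_def kcoef_def by (rule arg_cong[of _ _ suminf]) (simp add: fun_eq_iff)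

lemma Mks_eq:
  assumes t: "t > 0"
  shows "Mks k s t = of_real t powr (s - k / 2) * exp (- of_real t / 2) * kummer_M (s + k / 2) (2 * s) (of_real t)"
proof -
  have "of_real t powr (- k / 2) * of_real t powr s = (of_real t :: complex) powr (s - k / 2)"
    by (simp add: powr_add[symmetric] algebra_simps)
  then show ?thesis unfolding Mks_def whittaker_M_def by (simp add: algebra_simps)
qed

lemma norm_of_real_powr: "t > 0 \<Longrightarrow> norm ((of_real t :: complex) powr z) = t powr Re z"
  by (simp add: norm_powr_real_powr)

lemma norm_kummer_le:
  assumes s: "Re c > 0" and t: "0 \<le> t" "t \<le> T"
  shows "norm (kummer_M a c (of_real t)) \<le> (\<Sum>n. norm (kcoef a c n) * T ^ n)"
proof -
  have T: "T \<ge> 0" using t by simp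
  have S: "summable (\<lambda>n. norm (kcoef a c n * of_real t ^ n))"
    using summable_kcoef[OF s t(1)] t by (simp add: norm_mult norm_power)
  have "norm (kummer_M a c (of_real t)) \<le> (\<Sum>n. norm (kcoef a c n * of_real t ^ n))"
    unfolding kummer_eq by (rule summable_norm[OF S])
  also have "\<dots> \<le> (\<Sum>n. norm (kcoef a c n) * T ^ n)"
    by (rule suminf_le[OF _ S summable_kcoef[OF s T]]) (use t in \<open>auto simp: norm_mult norm_power intro!: mult_left_mono power_mono\<close>)
  finally show ?thesis .
qed

text \<open>Near 0 the function is of order \<open>t\<close> to the power \<open>s - k / 2\<close>;
  this exponent decides the convergence of the Poincare series.\<close>

lemma norm_Mks_le:
  assumes s: "Re s > 0" and t: "0 < t" "t \<le> T"
  shows "norm (Mks k s t) \<le> (\<Sum>n. norm (kcoef (s + k / 2) (2 * s) n) * T ^ n) * t powr (Re s - Re k / 2)"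
proof -
  have "norm (Mks k s t) = t powr (Re s - Re k / 2) * exp (- t / 2) * norm (kummer_M (s + k / 2) (2 * s) (of_real t))"
    using t unfolding Mks_eq[OF t(1)] by (simp add: norm_mult norm_of_real_powr norm_exp_eq_Re)
  also have "\<dots> \<le> t powr (Re s - Re k / 2) * 1 * (\<Sum>n. norm (kcoef (s + k / 2) (2 * s) n) * T ^ n)"
    using t s by (intro mult_mono norm_kummer_le) auto
  finally show ?thesis by (simp add: mult.commute)
qed

lemma measurable_kummer [measurable]: "(\<lambda>t::real. kummer_M a c (of_real t)) \<in> borel_measurable borel"
  unfolding kummer_eq by measurable

lemma measurable_Mks [measurable]: "Mks k s \<in> borel_measurable borel"
  unfolding Mks_def[abs_def] whittaker_M_def by measurable

lemma integrable_cancel: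
  fixes g :: "real \<Rightarrow> complex"
  assumes p: "p \<noteq> 0" and i: "integrable lborel (\<lambda>y. p * g y)"
  shows "integrable lborel g"
proof -
  have "(\<lambda>y. inverse p * (p * g y)) = g" using p by (simp add: fun_eq_iff mult.assoc[symmetric])
  then show ?thesis using integrable_mult_right[OF i, of "inverse p"] by simp
qed

lemma Gamma_lint:
  assumes z: "Re z > 0" and c: "c > 0"
  shows "integrable lborel (\<lambda>y. indicator {0<..} y *\<^sub>R (of_real y powr (z - 1) * exp (- (of_real (c * y)))))"
    and "(LINT y|lborel. indicator {0<..} y *\<^sub>R (of_real y powr (z - 1) * exp (- (of_real (c * y))))) = Gamma z * of_real c powr (- z)"
proof -
  let ?f = "\<lambda>y. indicator {0<..} y *\<^sub>R (of_real y powr (z - 1) * exp (- (of_real y)) :: complex)"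
  have e: "of_real y powr (z - 1) * exp (- (of_real y)) = of_real y powr (z - 1) / (of_real (exp y) :: complex)" for y :: real
    by (simp add: exp_minus divide_inverse exp_of_real)
  have m: "?f \<in> borel_measurable borel" by measurable
  have ai: "set_integrable lebesgue {0<..} (\<lambda>y. of_real y powr (z - 1) * exp (- (of_real y)) :: complex)"
    unfolding e using absolutely_integrable_Gamma_integral'[OF z] .
  then have i0: "integrable lborel ?f" unfolding set_integrable_def using m by (simp add: integrable_completion)
  have "(LINT y|lborel. ?f y) = (LINT y:{0<..}|lebesgue. of_real y powr (z - 1) * exp (- (of_real y)))"
    unfolding set_lebesgue_integral_def using m by (simp add: integral_completion)
  also have "\<dots> = integral {0<..} (\<lambda>y. of_real y powr (z - 1) * exp (- (of_real y)))"
    by (rule set_lebesgue_integral_eq_integral(2)[OF ai])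
  also have "\<dots> = Gamma z" unfolding e by (rule integral_unique[OF Gamma_integral_complex'[OF z]])
  finally have v0: "(LINT y|lborel. ?f y) = Gamma z" .
  have sc: "?f (0 + c * y) = of_real c powr (z - 1) * (indicator {0<..} y *\<^sub>R (of_real y powr (z - 1) * exp (- (of_real (c * y)))))" for y
  proof (cases "y > 0")
    case True
    then have "(of_real (c * y) :: complex) powr (z - 1) = of_real c powr (z - 1) * of_real y powr (z - 1)"
      using c by (simp add: powr_times_real)
    then show ?thesis using True c by (simp add: mult.assoc del: of_real_mult)
  next
    case False
    then show ?thesis using c by (simp add: indicator_def zero_less_mult_iff)
  qed
  have p: "(of_real c :: complex) powr (z - 1) \<noteq> 0" using c by simp
  have "integrable lborel (\<lambda>y. ?f (0 + c * y))" using c by (intro lborel_integrable_real_affine[OF i0]) simp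
  then have "integrable lborel (\<lambda>y. of_real c powr (z - 1) * (indicator {0<..} y *\<^sub>R (of_real y powr (z - 1) * exp (- (of_real (c * y))))))"
    unfolding sc .
  then show "integrable lborel (\<lambda>y. indicator {0<..} y *\<^sub>R (of_real y powr (z - 1) * exp (- (of_real (c * y)))))"
    by (rule integrable_cancel[OF p])
  have "Gamma z = \<bar>c\<bar> *\<^sub>R (LINT y|lborel. ?f (0 + c * y))"
    using lborel_integral_real_affine[of c ?f 0] c v0 by simp
  also have "\<dots> = of_real c * (of_real c powr (z - 1)) * (LINT y|lborel. indicator {0<..} y *\<^sub>R (of_real y powr (z - 1) * exp (- (of_real (c * y)))))"
    unfolding sc integral_mult_right_zero using c by (simp add: scaleR_conv_of_real)
  also have "of_real c * (of_real c powr (z - 1)) = (of_real c :: complex) powr z"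
    using c by (simp add: powr_diff)
  finally have G: "Gamma z = of_real c powr z * (LINT y|lborel. indicator {0<..} y *\<^sub>R (of_real y powr (z - 1) * exp (- (of_real (c * y)))))" .
  show "(LINT y|lborel. indicator {0<..} y *\<^sub>R (of_real y powr (z - 1) * exp (- (of_real (c * y))))) = Gamma z * of_real c powr (- z)"
    unfolding G using c by (simp add: powr_minus)
qed

lemma Gamma_lint_real:
  fixes x c :: real
  assumes x: "x > 0" and c: "c > 0"
  shows "integrable lborel (\<lambda>y. indicator {0<..} y * (y powr (x - 1) * exp (- (c * y))))"
    and "(LINT y|lborel. indicator {0<..} y * (y powr (x - 1) * exp (- (c * y)))) = Gamma x * c powr (- x)"
proof -
  have e: "norm (indicator {0<..} y *\<^sub>R (of_real y powr (complex_of_real x - 1) * exp (- (complex_of_real (c * y))))) = indicator {0<..} y * (y powr (x - 1) * exp (- (c * y)))" for y :: real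
    by (cases "y > 0") (simp_all add: norm_mult norm_of_real_powr norm_exp_eq_Re)
  have e': "indicator {0<..} y *\<^sub>R (of_real y powr (complex_of_real x - 1) * exp (- (complex_of_real (c * y)))) = complex_of_real (indicator {0<..} y * (y powr (x - 1) * exp (- (c * y))))" for y :: real
    by (cases "y > 0") (simp_all add: powr_of_real[symmetric] exp_of_real[symmetric])
  show "integrable lborel (\<lambda>y. indicator {0<..} y * (y powr (x - 1) * exp (- (c * y))))"
    using integrable_norm[OF Gamma_lint(1)[of "of_real x" c]] x c unfolding e by simp
  have "complex_of_real (LINT y|lborel. indicator {0<..} y * (y powr (x - 1) * exp (- (c * y)))) = of_real (Gamma x * c powr (- x))"
    using Gamma_lint(2)[of "of_real x" c] x c unfolding e' integral_complex_of_real
    by (simp add: Gamma_complex_of_real powr_of_real[symmetric])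
  then show "(LINT y|lborel. indicator {0<..} y * (y powr (x - 1) * exp (- (c * y)))) = Gamma x * c powr (- x)"
    by (simp only: of_real_eq_iff)
qed

lemma hyp_coef_identity:
  fixes ga gb gc Ga Gb Gc P F A C :: complex
  assumes "Ga \<noteq> 0"
  shows "A * C * ((gb / Gb) / (gc / Gc) / F * P * ga) = A * Ga * C * (ga * gb * Gc / (Ga * Gb * gc) * (P / F))"
  using assms by (simp add: divide_inverse mult_ac)

text \<open>The exponent \<open>c - R / 2\<close> completes the decay of the Whittaker function to
  \<open>exp (- c * y)\<close>. Termwise integration of the Kummer series gives the factors
  \<open>Gamma (a + n) / c ^ n\<close>, hence Gauss's series in \<open>R / c\<close>. The norm bound
  serves the later sum over lattice vectors.\<close>

lemma whittaker_laplace: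
  fixes k s :: complex and m :: nat and R c :: real
  defines "a \<equiv> s - k / 2 + of_nat m"
  assumes s: "Re s > 0" and b: "Re (s + k / 2) > 0" and a: "Re a > 0" and R: "0 < R" "R < c" and m: "m \<ge> 1"
  defines "w \<equiv> \<lambda>y. indicator {0<..} y *\<^sub>R (Mks k s (R * y) * of_real y ^ (m - 1) * exp (- of_real ((c - R / 2) * y)))"
  shows "integrable lborel w"
    and "(LINT y|lborel. w y) = of_real R powr (s - k / 2) * Gamma a * of_real c powr (- a) * hyp2F1 a (s + k / 2) (2 * s) (of_real (R / c))"
    and "(LINT y|lborel. norm (w y)) \<le> R powr Re (s - k / 2) * c powr (- Re a) * (\<Sum>n. norm (kcoef (s + k / 2) (2 * s) n) * (R / c) ^ n * Gamma (Re a + real n))"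
proof -
  let ?b = "s + k / 2"
  have c: "c > 0" and xc: "0 \<le> R / c" "R / c < 1" using R by (auto simp: field_simps)
  define f where "f n y = (kcoef ?b (2 * s) n * of_real R ^ n * of_real R powr (s - k / 2)) *
    (indicator {0<..} y *\<^sub>R (of_real y powr (a + of_nat n - 1) * exp (- (of_real (c * y)))))" for n y
  have an: "Re (a + of_nat n) > 0" for n using a by simp
  have fint: "integrable lborel (f n)" for n
    unfolding f_def[abs_def] using Gamma_lint(1)[OF an c] by (rule integrable_mult_right)
  have cp: "(of_real c :: complex) powr (- (a + of_nat n)) = of_real c powr (- a) / of_real c ^ n" for n
    using c by (simp add: powr_diff powr_minus powr_add powr_nat divide_inverse)
  have fval: "(LINT y|lborel. f n y) = of_real R powr (s - k / 2) * of_real c powr (- a) * (kcoef ?b (2 * s) n * of_real (R / c) ^ n * Gamma (a + of_nat n))" for n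
    unfolding f_def integral_mult_right_zero Gamma_lint(2)[OF an c] cp by (simp add: power_divide)
  have fnorm: "norm (f n y) = norm (kcoef ?b (2 * s) n) * R ^ n * R powr Re (s - k / 2) * (indicator {0<..} y * (y powr (Re a + real n - 1) * exp (- (c * y))))" for n y
    using R by (cases "y > 0") (simp_all add: f_def norm_mult norm_power norm_of_real_powr norm_exp_eq_Re)
  have cpr: "c powr (- (Re a + real n)) = c powr (- Re a) / c ^ n" for n
    using c by (simp add: powr_diff powr_minus powr_add powr_realpow divide_inverse)
  have fnormval: "(LINT y|lborel. norm (f n y)) = R powr Re (s - k / 2) * c powr (- Re a) * (norm (kcoef ?b (2 * s) n) * (R / c) ^ n * Gamma (Re a + real n))" for n
  proof -
    have "Re a + real n > 0" using a by simp
    then show ?thesis unfolding fnorm integral_mult_right_zero Gamma_lint_real(2)[OF \<open>Re a + real n > 0\<close> c] cpr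
      by (simp add: power_divide)
  qed
  have S: "summable (\<lambda>n. norm (kcoef ?b (2 * s) n) * (R / c) ^ n * Gamma (Re a + real n))"
    by (rule summable_kcoef_Gamma) (use s xc a in auto)
  then have S': "summable (\<lambda>n. LINT y|lborel. norm (f n y))" unfolding fnormval by (rule summable_mult)
  have w: "w y = (\<Sum>n. f n y)" and wn: "summable (\<lambda>n. norm (f n y))" for y
  proof -
    have "w y = (\<Sum>n. f n y) \<and> summable (\<lambda>n. norm (f n y))"
    proof (cases "y > 0")
      case True
      have 1: "summable (\<lambda>n. norm (kcoef ?b (2 * s) n) * (R * y) ^ n)" by (rule summable_kcoef) (use s True R in auto)
      have nk: "norm (kcoef ?b (2 * s) n * of_real (R * y) ^ n) = norm (kcoef ?b (2 * s) n) * (R * y) ^ n" for n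
        using R True by (simp only: norm_mult norm_power norm_of_real abs_of_pos mult_pos_pos)
      from 1 have sk: "summable (\<lambda>n. kcoef ?b (2 * s) n * of_real (R * y) ^ n)"
        unfolding nk[symmetric] by (rule summable_norm_cancel)
      let ?C = "of_real R powr (s - k / 2) * of_real y powr (a - 1) * exp (- (of_real (c * y))) :: complex"
      have feq: "f n y = ?C * (kcoef ?b (2 * s) n * of_real (R * y) ^ n)" for n
      proof -
        have "(of_real y :: complex) powr (a + of_nat n - 1) = of_real y powr (a - 1) * of_real y ^ n"
          using True powr_add[of "of_real y :: complex" "a - 1" "of_nat n"] by (simp add: powr_nat diff_add_eq)
        then show ?thesis using True by (simp add: f_def power_mult_distrib mult_ac)
      qed
      have "w y = ?C * kummer_M ?b (2 * s) (of_real (R * y))"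
      proof -
        have p1: "(of_real (R * y) :: complex) powr (s - k / 2) = of_real R powr (s - k / 2) * of_real y powr (s - k / 2)"
          using R True by (simp add: powr_times_real)
        have p2: "(of_real y :: complex) powr (a - 1) = of_real y powr (s - k / 2) * of_real y ^ (m - 1)"
        proof -
          \<comment> \<open>The natural subtraction is exact because
            \<open>m \<ge> 1\<close>.\<close>
          have "a - 1 = (s - k / 2) + of_nat (m - 1)" using m by (simp add: a_def of_nat_diff)
          then show ?thesis using True by (simp add: powr_add powr_nat)
        qed
        have p3: "exp (- of_real (R * y) / 2) * exp (- of_real ((c - R / 2) * y)) = (exp (- (of_real (c * y))) :: complex)"
          by (simp add: exp_add[symmetric] algebra_simps)
        have "w y = of_real R powr (s - k / 2) * (of_real y powr (s - k / 2) * of_real y ^ (m - 1)) * (exp (- of_real (R * y) / 2) * exp (- of_real ((c - R / 2) * y))) * kummer_M ?b (2 * s) (of_real (R * y))"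
          using True R unfolding w_def by (subst Mks_eq) (simp_all only: p1 mult_pos_pos, simp add: mult_ac)
        then show ?thesis unfolding p2 p3 by (simp only: mult_ac)
      qed
      also have "\<dots> = (\<Sum>n. f n y)" unfolding feq kummer_eq by (rule suminf_mult[OF sk, symmetric])
      finally have "w y = (\<Sum>n. f n y)" .
      moreover have "summable (\<lambda>n. norm (f n y))"
        unfolding feq norm_mult[of ?C] nk by (rule summable_mult[OF 1])
      ultimately show ?thesis by blast
    next
      case False
      then show ?thesis by (simp add: w_def f_def)
    qed
    then show "w y = (\<Sum>n. f n y)" "summable (\<lambda>n. norm (f n y))" by auto
  qed
  have wn': "AE y in lborel. summable (\<lambda>n. norm (f n y))" using wn by simp
  have weq: "w = (\<lambda>y. \<Sum>n. f n y)" using w by (simp add: fun_eq_iff)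
  show iw: "integrable lborel w" unfolding weq by (rule integrable_suminf[OF fint wn' S'])
  have "(LINT y|lborel. w y) = (\<Sum>n. LINT y|lborel. f n y)" unfolding weq by (rule integral_suminf[OF fint wn' S'])
  also have "\<dots> = (\<Sum>n. of_real R powr (s - k / 2) * of_real c powr (- a) * (kcoef ?b (2 * s) n * of_real (R / c) ^ n * Gamma (a + of_nat n)))"
    unfolding fval ..
  also have "\<dots> = (\<Sum>n. of_real R powr (s - k / 2) * Gamma a * of_real c powr (- a) *
      (Gamma (a + of_nat n) * Gamma (?b + of_nat n) * Gamma (2 * s) / (Gamma a * Gamma ?b * Gamma (2 * s + of_nat n)) * (of_real (R / c) ^ n / fact n)))"
  proof (rule arg_cong[of _ _ suminf], rule ext)
    fix n
    have ni: "z \<notin> \<int>\<^sub>\<le>\<^sub>0" if "Re z > 0" for z :: complex using that by (auto elim!: nonpos_Ints_cases)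
    have nb: "?b \<notin> \<int>\<^sub>\<le>\<^sub>0" "a \<notin> \<int>\<^sub>\<le>\<^sub>0" "2 * s \<notin> \<int>\<^sub>\<le>\<^sub>0" "2 * s + of_nat n \<notin> \<int>\<^sub>\<le>\<^sub>0" using ni b a s by (auto intro!: ni)
    have g0: "Gamma ?b \<noteq> 0" "Gamma a \<noteq> 0" "Gamma (2 * s) \<noteq> 0" "Gamma (2 * s + of_nat n) \<noteq> 0"
      using nb by (simp_all add: Gamma_eq_zero_iff)
    have kc: "kcoef ?b (2 * s) n = (Gamma (?b + of_nat n) / Gamma ?b) / (Gamma (2 * s + of_nat n) / Gamma (2 * s)) / fact n"
      unfolding kcoef_def by (simp only: pochhammer_Gamma[OF nb(1)] pochhammer_Gamma[OF nb(3)])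
    show "of_real R powr (s - k / 2) * of_real c powr (- a) * (kcoef ?b (2 * s) n * of_real (R / c) ^ n * Gamma (a + of_nat n)) =
      of_real R powr (s - k / 2) * Gamma a * of_real c powr (- a) *
      (Gamma (a + of_nat n) * Gamma (?b + of_nat n) * Gamma (2 * s) / (Gamma a * Gamma ?b * Gamma (2 * s + of_nat n)) * (of_real (R / c) ^ n / fact n))"
      unfolding kc by (rule hyp_coef_identity[OF g0(2)])
  qed
  also have "\<dots> = of_real R powr (s - k / 2) * Gamma a * of_real c powr (- a) * hyp2F1 a ?b (2 * s) (of_real (R / c))"
    unfolding hyp2F1_def
  proof (rule suminf_mult)
    have "Re (2 * s) > 0" using s by simp
    show "summable (\<lambda>n. Gamma (a + of_nat n) * Gamma (?b + of_nat n) * Gamma (2 * s) / (Gamma a * Gamma ?b * Gamma (2 * s + of_nat n)) * (of_real (R / c) ^ n / fact n))"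
    proof -
      have "summable (\<lambda>n. LINT y|lborel. f n y)" by (rule summable_norm_cancel, rule summable_comparison_test'[OF S']) simp
      then have "summable (\<lambda>n. of_real R powr (s - k / 2) * of_real c powr (- a) * (kcoef ?b (2 * s) n * of_real (R / c) ^ n * Gamma (a + of_nat n)))"
        unfolding fval .
      moreover have z: "(of_real R :: complex) powr (s - k / 2) * of_real c powr (- a) \<noteq> 0" using R c by simp
      ultimately have S3: "summable (\<lambda>n. kcoef ?b (2 * s) n * of_real (R / c) ^ n * Gamma (a + of_nat n))"
        using summable_cmult_iff by blast
      have ni: "z \<notin> \<int>\<^sub>\<le>\<^sub>0" if "Re z > 0" for z :: complex using that by (auto elim!: nonpos_Ints_cases)
      have nb: "?b \<notin> \<int>\<^sub>\<le>\<^sub>0" "2 * s \<notin> \<int>\<^sub>\<le>\<^sub>0" using b s by (auto intro!: ni)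
      have hyp': "ga * gb * Gc / (Ga * Gb * gc) * (P / F) = ((gb / Gb) / (gc / Gc) / F) * P * ga / Ga"
        for ga gb gc Ga Gb Gc P F :: complex by (simp add: divide_inverse mult_ac)
      have "Gamma (a + of_nat n) * Gamma (?b + of_nat n) * Gamma (2 * s) / (Gamma a * Gamma ?b * Gamma (2 * s + of_nat n)) * (of_real (R / c) ^ n / fact n) =
        kcoef ?b (2 * s) n * of_real (R / c) ^ n * Gamma (a + of_nat n) / Gamma a" for n
        unfolding kcoef_def pochhammer_Gamma[OF nb(1)] pochhammer_Gamma[OF nb(2)] by (rule hyp')
      then show ?thesis using summable_divide[OF S3, of "Gamma a"] by simp
    qed
  qed
  finally show "(LINT y|lborel. w y) = of_real R powr (s - k / 2) * Gamma a * of_real c powr (- a) * hyp2F1 a ?b (2 * s) (of_real (R / c))" .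
  have "(LINT y|lborel. norm (w y)) \<le> (LINT y|lborel. (\<Sum>n. norm (f n y)))"
  proof (rule integral_mono)
    show "integrable lborel (\<lambda>y. norm (w y))" using iw by (rule integrable_norm)
    show "integrable lborel (\<lambda>y. \<Sum>n. norm (f n y))"
      by (rule integrable_suminf) (use fint wn' S' in auto)
    show "norm (w y) \<le> (\<Sum>n. norm (f n y))" for y unfolding w by (rule summable_norm[OF wn])
  qed
  also have "\<dots> = (\<Sum>n. LINT y|lborel. norm (f n y))"
    by (rule integral_suminf) (use fint wn' S' in auto)
  also have "\<dots> = R powr Re (s - k / 2) * c powr (- Re a) * (\<Sum>n. norm (kcoef ?b (2 * s) n) * (R / c) ^ n * Gamma (Re a + real n))"
    unfolding fnormval by (rule suminf_mult[OF S])
  finally show "(LINT y|lborel. norm (w y)) \<le> \<dots>" .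
qed

section \<open>The integral over the strip\<close>

lemma borel_measurable_infsum:
  fixes f :: "'i \<Rightarrow> 'a \<Rightarrow> complex"
  assumes A: "countable A" and f: "\<And>i. i \<in> A \<Longrightarrow> f i \<in> borel_measurable M"
    and s: "\<And>x. x \<in> space M \<Longrightarrow> (\<lambda>i. f i x) summable_on A"
  shows "(\<lambda>x. \<Sum>\<^sub>\<infinity>i\<in>A. f i x) \<in> borel_measurable M"
proof (cases "finite A")
  case True
  then show ?thesis using f by (simp add: borel_measurable_sum)
next
  case False
  have bij: "bij_betw (from_nat_into A) UNIV A" using A False by (rule bij_betw_from_nat_into)
  have e: "(\<Sum>\<^sub>\<infinity>i\<in>A. f i x) = (\<Sum>n. f (from_nat_into A n) x)" if x: "x \<in> space M" for x
  proof -
    have "(\<lambda>n. f (from_nat_into A n) x) summable_on UNIV"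
      using s[OF x] summable_on_reindex_bij_betw[OF bij, of "\<lambda>i. f i x"] by simp
    then have "(\<lambda>n. f (from_nat_into A n) x) sums (\<Sum>\<^sub>\<infinity>n. f (from_nat_into A n) x)"
      by (intro has_sum_imp_sums has_sum_infsum)
    then show ?thesis using infsum_reindex_bij_betw[OF bij, of "\<lambda>i. f i x"] by (simp add: sums_unique)
  qed
  have "(\<lambda>x. \<Sum>n. f (from_nat_into A n) x) \<in> borel_measurable M"
    by (rule borel_measurable_suminf) (use f False from_nat_into[of A] in auto)
  then show ?thesis using e by (subst measurable_cong) auto
qed

lemma hyp_lborel:
  fixes f :: "complex \<Rightarrow> 'b::{banach, second_countable_topology}"
  assumes f [measurable]: "f \<in> borel_measurable borel"
  shows "integrable hyp_measure f \<longleftrightarrow> integrable lborel (\<lambda>\<tau>. (indicator upper_half \<tau> * (1 / (Im \<tau>)\<^sup>2)) *\<^sub>R f \<tau>)"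
    and "(LINT \<tau>|hyp_measure. f \<tau>) = (LINT \<tau>|lborel. (indicator upper_half \<tau> * (1 / (Im \<tau>)\<^sup>2)) *\<^sub>R f \<tau>)"
proof -
  have fm: "f \<in> borel_measurable lborel" by simp
  have gm: "(\<lambda>\<tau>. indicator upper_half \<tau> * (1 / (Im \<tau>)\<^sup>2) :: real) \<in> borel_measurable lborel" by measurable
  have ge: "AE \<tau> in lborel. 0 \<le> (indicator upper_half \<tau> * (1 / (Im \<tau>)\<^sup>2) :: real)" by simp
  show "integrable hyp_measure f \<longleftrightarrow> integrable lborel (\<lambda>\<tau>. (indicator upper_half \<tau> * (1 / (Im \<tau>)\<^sup>2)) *\<^sub>R f \<tau>)"
    unfolding hyp_measure_def by (rule integrable_density[OF fm gm ge])
  show "(LINT \<tau>|hyp_measure. f \<tau>) = (LINT \<tau>|lborel. (indicator upper_half \<tau> * (1 / (Im \<tau>)\<^sup>2)) *\<^sub>R f \<tau>)"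
    unfolding hyp_measure_def by (rule integral_density[OF fm gm ge])
qed

lemma borel_measurable_cnj [measurable (raw)]: "f \<in> borel_measurable M \<Longrightarrow> (\<lambda>x. cnj (f x)) \<in> borel_measurable M"
  using measurable_compose[of f M borel cnj borel] continuous_on_cnj[OF continuous_on_id, of UNIV]
  by (simp add: borel_measurable_continuous_onI)

lemma hyp_integral_product:
  fixes u v :: "real \<Rightarrow> 'b::{banach, real_normed_field, second_countable_topology}"
  assumes u: "integrable lborel u" and v [measurable]: "v \<in> borel_measurable borel"
    and vi: "integrable lborel (\<lambda>y. indicator {0<..} y *\<^sub>R (v y / of_real (y\<^sup>2)))"
  shows "integrable hyp_measure (\<lambda>\<tau>. u (Re \<tau>) * v (Im \<tau>))"
    and "(LINT \<tau>|hyp_measure. u (Re \<tau>) * v (Im \<tau>)) = (LINT x|lborel. u x) * (LINT y|lborel. indicator {0<..} y *\<^sub>R (v y / of_real (y\<^sup>2)))"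
proof -
  let ?v = "\<lambda>y. indicator {0<..} y *\<^sub>R (v y / of_real (y\<^sup>2))"
  have [measurable]: "u \<in> borel_measurable borel" using u by (auto dest: borel_measurable_integrable)
  let ?p = "\<lambda>(x, y). u x * ?v y"
  have d: "(indicator upper_half \<tau> * (1 / (Im \<tau>)\<^sup>2)) *\<^sub>R (u (Re \<tau>) * v (Im \<tau>)) = u (Re \<tau>) * ?v (Im \<tau>)" for \<tau>
    by (cases "Im \<tau> > 0") (auto simp: upper_half_def indicator_def scaleR_conv_of_real)
  have pi: "integrable (lborel \<Otimes>\<^sub>M lborel) ?p"
  proof (rule lborel_pair.Fubini_integrable)
    show "?p \<in> borel_measurable (lborel \<Otimes>\<^sub>M lborel)" by measurable
    show "integrable lborel (\<lambda>x. LINT y|lborel. norm (case (x, y) of (x, y) \<Rightarrow> u x * ?v y))"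
      unfolding case_prod_conv norm_mult[of "u _"] integral_mult_right_zero using u by simp
    show "AE x in lborel. integrable lborel (\<lambda>y. case (x, y) of (x, y) \<Rightarrow> u x * ?v y)"
      unfolding case_prod_conv using integrable_mult_right[OF vi] by simp
  qed
  have pv: "(LINT z|(lborel \<Otimes>\<^sub>M lborel). ?p z) = (LINT x|lborel. u x) * (LINT y|lborel. ?v y)"
    using lborel_pair.integral_fst[OF pi] by (simp only: integral_mult_right_zero integral_mult_left_zero)
  have cm: "(\<lambda>(x, y). Complex x y) \<in> measurable (lborel \<Otimes>\<^sub>M lborel) borel" by measurable
  have fm: "(\<lambda>\<tau>. u (Re \<tau>) * ?v (Im \<tau>)) \<in> borel_measurable borel" by measurable
  have comp: "(\<lambda>z. u (Re (case z of (x, y) \<Rightarrow> Complex x y)) * ?v (Im (case z of (x, y) \<Rightarrow> Complex x y))) = ?p"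
    by (auto simp: fun_eq_iff)
  have li: "integrable lborel (\<lambda>\<tau>. u (Re \<tau>) * ?v (Im \<tau>))"
    by (subst lborel_complex_eq, subst integrable_distr_eq[OF cm fm], subst comp, rule pi)
  have lv: "(LINT \<tau>|lborel. u (Re \<tau>) * ?v (Im \<tau>)) = (LINT x|lborel. u x) * (LINT y|lborel. ?v y)"
    by (subst lborel_complex_eq, subst integral_distr[OF cm fm], subst comp, rule pv)
  have m: "(\<lambda>\<tau>. u (Re \<tau>) * v (Im \<tau>)) \<in> borel_measurable borel" by measurable
  show "integrable hyp_measure (\<lambda>\<tau>. u (Re \<tau>) * v (Im \<tau>))"
    using hyp_lborel(1)[OF m] li unfolding d by simp
  show "(LINT \<tau>|hyp_measure. u (Re \<tau>) * v (Im \<tau>)) = (LINT x|lborel. u x) * (LINT y|lborel. ?v y)"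
    using hyp_lborel(2)[OF m] lv unfolding d by simp
qed

lemma character_lint:
  assumes j: "j \<in> \<int>"
  shows "integrable lborel (\<lambda>x. indicator {- (1/2)<..<1/2} x *\<^sub>R ee (of_real (j * x)))"
    "(LINT x|lborel. indicator {- (1/2)<..<1/2} x *\<^sub>R ee (of_real (j * x))) = (if j = 0 then 1 else 0)"
proof -
  obtain n where n: "j = of_int n" using j by (auto elim: Ints_cases)
  have c: "continuous_on S (\<lambda>x. ee (of_real (j * x)))" for S unfolding ee_def by (intro continuous_intros)
  have "set_integrable lborel {- (1/2)..1/2} (\<lambda>x. ee (of_real (j * x)))"
    by (rule borel_integrable_compact[THEN set_integrable_def[THEN meta_eq_to_obj_eq, THEN iffD2]]) (use c in auto)
  then have i: "set_integrable lborel {- (1/2)<..<1/2} (\<lambda>x. ee (of_real (j * x)))"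
    by (rule set_integrable_subset) auto
  then show "integrable lborel (\<lambda>x. indicator {- (1/2)<..<1/2} x *\<^sub>R ee (of_real (j * x)))"
    unfolding set_integrable_def .
  have "(LINT x:{- (1/2)<..<1/2}|lborel. ee (of_real (j * x))) = integral {- (1/2)<..<1/2} (\<lambda>x. ee (of_real (j * x)))"
    by (rule set_borel_integral_eq_integral(2)[OF i])
  also have "\<dots> = integral {- (1/2)..- (1/2)+1} (\<lambda>x. ee (of_real (j * x)))"
    by (simp add: integral_open_interval_real)
  also have "\<dots> = (if j = 0 then 1 else 0)" unfolding n using integral_character[of "- (1/2)" n] by simp
  finally show "(LINT x|lborel. indicator {- (1/2)<..<1/2} x *\<^sub>R ee (of_real (j * x))) = (if j = 0 then 1 else 0)"
    unfolding set_lebesgue_integral_def .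
qed

section \<open>Terms of the unfolded integrand\<close>

locale lift = quad_weil B L z \<zeta> Z b \<rho>
  for B :: "'a::euclidean_space \<Rightarrow> 'a \<Rightarrow> real" and L z \<zeta> Z b \<rho> +
  fixes m :: nat and r :: real and \<beta> :: 'a and s :: complex
  assumes m: "m \<ge> 1" and beta: "\<beta> \<in> dual_lattice B L" and r_neg: "r < 0"
    and r_cong: "r - B \<beta> \<beta> / 2 \<in> \<int>"
    and s: "Re s > 3/2 + real b / 4 + real m / 2"
    and np_off: "\<And>x. x \<in> lat_coset L \<beta> \<Longrightarrow> B x x = 2 * r \<Longrightarrow> np x > 0"
begin

definition k :: complex where "k = of_int (two_weight b m) / 2"
definition a :: complex where "a = s - k / 2 + of_nat m"
definition R :: real where "R = 4 * pi * \<bar>r\<bar>"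
text \<open>The decay left when \<open>pZ ^ m\<close>, of order \<open>Q\<close> to the power
  \<open>m / 2\<close>, is weighed against \<open>Q\<close> to the power \<open>- Re a\<close>. The
  bound on \<open>Re s\<close> puts it above half the rank \<open>2 + b\<close>, as
  \<open>Q_summable\<close> requires.\<close>

definition p :: real where "p = Re a - real m / 2"

abbreviation "Cb \<equiv> lat_coset L \<beta>"
abbreviation "Lam \<equiv> {x \<in> Cb. B x x = 2 * r}"

lemma Re_k: "Re k = 1 - real b / 2 + real m" by (simp add: k_def two_weight_def)
lemma Re_a: "Re a = Re s - 1/2 + real b / 4 + real m / 2" by (simp add: a_def Re_k field_simps)

lemma Re_pos: "Re s > 0" "Re (s + k / 2) > 0" "Re a > 0" "R > 0" "p > real (2 + b) / 2" "p > 0"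
proof -
  show "R > 0" unfolding R_def using r_neg by (intro mult_pos_pos) auto
qed (use s in \<open>auto simp: Re_a Re_k p_def field_simps\<close>)

lemma Cb_Ld: "x \<in> Cb \<Longrightarrow> x \<in> Ld" using coset_sub_Ld[OF beta] by auto

lemma countable_Cb: "countable Cb" using countable_subset[OF coset_sub_Ld[OF beta] countable_Ld] .

lemma r_int:
  assumes "x \<in> Cb"
  shows "r - B x x / 2 \<in> \<int>"
proof -
  obtain l where l: "l \<in> L" "x = \<beta> + l" using assms by (auto simp: lat_coset_def)
  have "B x x = B \<beta> \<beta> + 2 * B \<beta> l + B l l" unfolding l(2) by (simp add: B_simps symB[of l \<beta>])
  then have "r - B x x / 2 = (r - B \<beta> \<beta> / 2) - B \<beta> l - B l l / 2" by (simp add: field_simps)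
  also have "\<dots> \<in> \<int>" by (rule Ints_diff[OF Ints_diff[OF r_cong B_int[OF beta l(1)]] L_even[OF l(1)]])
  finally show ?thesis .
qed

text \<open>The exponent is unsimplified to match \<open>whittaker_laplace\<close> with \<open>c = R / 2 + \<pi>Q\<close>.\<close>

definition wfun :: "'a \<Rightarrow> real \<Rightarrow> complex" where
  "wfun x y = 2 * cnj (pZ x) ^ m * (indicator {0<..} y *\<^sub>R
     (Mks k s (R * y) * of_real y ^ (m - 1) * exp (- of_real ((R / 2 + pi * Q x - R / 2) * y))))"

text \<open>The 2 collects the equal contributions of \<open>\<beta>\<close> and
  \<open>- \<beta>\<close>. The cutoff to the half plane makes the sum over \<open>x\<close>
  converge at every complex point.\<close>

definition hterm :: "'a \<Rightarrow> complex \<Rightarrow> complex" where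
  "hterm x \<tau> = indicator upper_half \<tau> *\<^sub>R
     (2 * ee (of_real (r * Re \<tau>)) * Mks k s (R * Im \<tau>) * cnj (T m \<tau> x) * of_real (Im \<tau>) ^ (m + 1))"

definition h0 :: "complex \<Rightarrow> complex" where "h0 \<tau> = (\<Sum>\<^sub>\<infinity>x\<in>Cb. hterm x \<tau>)"

lemma wfun_measurable [measurable]: "wfun x \<in> borel_measurable borel"
  unfolding wfun_def[abs_def] by measurable

lemma hterm_measurable [measurable]: "hterm x \<in> borel_measurable borel"
  unfolding hterm_def[abs_def] T_def ee_def by measurable

lemma T_Cb_abs: "\<tau> \<in> upper_half \<Longrightarrow> (\<lambda>x. norm (T m \<tau> x)) summable_on Cb"
  by (rule summable_on_subset_banach[OF T_summable coset_sub_Ld[OF beta]]) (simp add: upper_half_def)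

lemma hterm_abs: "(\<lambda>x. hterm x \<tau>) abs_summable_on Cb"
proof (cases "\<tau> \<in> upper_half")
  case True
  have "(\<lambda>x. norm (2 * ee (of_real (r * Re \<tau>)) * Mks k s (R * Im \<tau>) * of_real (Im \<tau>) ^ (m + 1)) * norm (T m \<tau> x)) summable_on Cb"
    by (rule summable_on_cmult_right[OF T_Cb_abs[OF True]])
  then show ?thesis by (rule summable_on_cong[THEN iffD1, rotated]) (simp add: hterm_def True norm_mult)
qed (simp add: hterm_def)

lemma h0_measurable [measurable]: "h0 \<in> borel_measurable borel"
  unfolding h0_def[abs_def]
  by (rule borel_measurable_infsum[OF countable_Cb]) (auto intro: abs_summable_summable[OF hterm_abs])

lemma h0_eq:
  assumes t: "\<tau> \<in> upper_half"
  shows "h0 \<tau> = 2 * ee (of_real (r * Re \<tau>)) * Mks k s (R * Im \<tau>) * cnj (Th m \<tau> Cb) * of_real (Im \<tau>) ^ (m + 1)"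
proof -
  have "h0 \<tau> = (\<Sum>\<^sub>\<infinity>x\<in>Cb. (2 * ee (of_real (r * Re \<tau>)) * Mks k s (R * Im \<tau>) * of_real (Im \<tau>) ^ (m + 1)) * cnj (T m \<tau> x))"
    unfolding h0_def by (rule infsum_cong) (simp add: hterm_def t)
  also have "\<dots> = (2 * ee (of_real (r * Re \<tau>)) * Mks k s (R * Im \<tau>) * of_real (Im \<tau>) ^ (m + 1)) * (\<Sum>\<^sub>\<infinity>x\<in>Cb. cnj (T m \<tau> x))"
    by (rule infsum_cmult_right')
  also have "(\<Sum>\<^sub>\<infinity>x\<in>Cb. cnj (T m \<tau> x)) = cnj (Th m \<tau> Cb)" unfolding Th_coset[OF beta] by (rule infsum_cnj)
  finally show ?thesis by (simp add: mult_ac)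
qed

text \<open>As a function of \<open>Re \<tau>\<close> only a character remains, of frequency
  \<open>r - B x x / 2\<close>, which by \<open>r_int\<close> is an integer on the coset.\<close>

lemma hterm_split:
  "hterm x \<tau> = ee (of_real ((r - B x x / 2) * Re \<tau>)) *
     (indicator {0<..} (Im \<tau>) *\<^sub>R (2 * cnj (pZ x) ^ m * Mks k s (R * Im \<tau>) * exp (- of_real (pi * Q x * Im \<tau>)) * of_real (Im \<tau>) ^ (m + 1)))"
proof -
  have "cnj (ee (\<tau> * of_real (np x) / 2 + cnj \<tau> * of_real (nm x) / 2)) =
    ee (- of_real (B x x / 2 * Re \<tau>)) * exp (- of_real (pi * Q x * Im \<tau>))"
  proof -
    have "- (2 * of_real pi * \<i> * (cnj \<tau> * of_real (np x) / 2 + \<tau> * of_real (nm x) / 2)) =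
      2 * of_real pi * \<i> * (- of_real (B x x / 2 * Re \<tau>)) + (- of_real (pi * Q x * Im \<tau>))"
      by (simp add: complex_eq_iff Q_def nm_def field_simps)
    then show ?thesis unfolding ee_def by (simp add: exp_cnj exp_add[symmetric])
  qed
  moreover have "ee (of_real (r * Re \<tau>)) * ee (- of_real (B x x / 2 * Re \<tau>)) = ee (of_real ((r - B x x / 2) * Re \<tau>))"
    unfolding ee_add[symmetric] by (simp add: algebra_simps)
  ultimately show ?thesis
    by (cases "\<tau> \<in> upper_half") (auto simp: hterm_def T_def upper_half_def mult_ac)
qed

lemma h0_translate: "\<tau> \<in> upper_half \<Longrightarrow> h0 (\<tau> + of_int n) = h0 \<tau>"
  unfolding h0_def
proof (rule infsum_cong)
  fix x assume x: "x \<in> Cb"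
  obtain j where j: "r - B x x / 2 = of_int j" using r_int[OF x] by (auto elim: Ints_cases)
  have "ee (of_real ((r - B x x / 2) * Re (\<tau> + of_int n))) = ee (of_real ((r - B x x / 2) * Re \<tau>)) * ee (of_int (j * n))"
    unfolding j ee_add[symmetric] by (simp add: algebra_simps)
  also have "\<dots> = ee (of_real ((r - B x x / 2) * Re \<tau>))" by (simp only: ee_of_int mult_1_right)
  finally have e: "ee (of_real ((r - B x x / 2) * Re (\<tau> + of_int n))) = ee (of_real ((r - B x x / 2) * Re \<tau>))" .
  show "hterm x (\<tau> + of_int n) = hterm x \<tau>" unfolding hterm_split e by simp
qed

text \<open>Only finitely many dual vectors have \<open>Q x \<le> 1\<close>, so the nonzero ones
  stay away from 0.\<close>

lemma Q_lower: obtains \<delta> where "\<delta> > 0" "\<And>x. x \<in> Ld \<Longrightarrow> x \<noteq> 0 \<Longrightarrow> Q x \<ge> \<delta> * (1 + Q x)"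
proof
  let ?F = "{x \<in> Ld. Q x \<le> 1} - {0}"
  define \<delta> where "\<delta> = Min (insert (1/2) ((\<lambda>x. Q x / 2) ` ?F))"
  have fin: "finite (insert (1/2) ((\<lambda>x. Q x / 2) ` ?F))" using Q_finite[of 1] by simp
  show pos: "\<delta> > 0" unfolding \<delta>_def using fin Q_pos by (subst Min_gr_iff) auto
  fix x assume x: "x \<in> Ld" "x \<noteq> 0"
  show "Q x \<ge> \<delta> * (1 + Q x)"
  proof (cases "Q x \<le> 1")
    case True
    then have "\<delta> \<le> Q x / 2" unfolding \<delta>_def using x fin by (intro Min_le) auto
    then have "\<delta> * (1 + Q x) \<le> Q x / 2 * 2" using True Q_nonneg[of x] pos by (intro mult_mono) auto
    then show ?thesis by simp
  next
    case False
    have "\<delta> \<le> 1/2" unfolding \<delta>_def using fin by (intro Min_le) auto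
    then have "\<delta> * (1 + Q x) \<le> 1/2 * (1 + Q x)" using False by (intro mult_right_mono) auto
    also have "\<dots> \<le> Q x" using False by simp
    finally show ?thesis .
  qed
qed

lemma pZ_bound: "norm (pZ x) ^ m \<le> q powr (real m / 2) * Q x powr (real m / 2)"
proof -
  have "norm (pZ x) = sqrt (q * np x)" using norm_pZ[of x] by (metis norm_ge_zero real_sqrt_unique)
  also have "\<dots> \<le> sqrt (q * Q x)" using nm_nonpos[of x] q_pos by (simp add: Q_def mult_left_mono)
  finally have "norm (pZ x) ^ m \<le> sqrt (q * Q x) ^ m" by (rule power_mono) simp
  also have "\<dots> = q powr (real m / 2) * Q x powr (real m / 2)"
  proof (cases "Q x = 0")
    case True then show ?thesis using m by (simp add: power_0_left)
  next
    case False
    then have "q * Q x > 0" using q_pos Q_nonneg[of x] by (simp add: less_le)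
    then have "sqrt (q * Q x) ^ m = ((q * Q x) powr (1/2)) powr real m"
      using powr_realpow[of "(q * Q x) powr (1/2)" m] by (simp add: powr_half_sqrt)
    then have "sqrt (q * Q x) ^ m = (q * Q x) powr (real m / 2)" by (simp add: powr_powr)
    then show ?thesis using q_pos Q_nonneg[of x] by (simp add: powr_mult)
  qed
  finally show ?thesis .
qed

text \<open>At \<open>x = 0\<close> the factor \<open>pZ ^ m\<close> vanishes because
  \<open>m \<ge> 1\<close>; elsewhere \<open>Q_lower\<close> trades \<open>Q\<close> for
  \<open>1 + Q\<close>.\<close>

lemma weight_bound: obtains C0 where "C0 \<ge> 0" "\<And>x. x \<in> Ld \<Longrightarrow> norm (pZ x) ^ m * (pi * Q x) powr (- Re a) \<le> C0 * (1 + Q x) powr (- p)"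
proof -
  obtain \<delta> where \<delta>: "\<delta> > 0" "\<And>x. x \<in> Ld \<Longrightarrow> x \<noteq> 0 \<Longrightarrow> Q x \<ge> \<delta> * (1 + Q x)" using Q_lower by blast
  let ?C = "q powr (real m / 2) * pi powr (- Re a) * \<delta> powr (- p)"
  have "norm (pZ x) ^ m * (pi * Q x) powr (- Re a) \<le> ?C * (1 + Q x) powr (- p)" if x: "x \<in> Ld" for x
  proof (cases "x = 0")
    case True
    then have "Q x = 0" "pZ x = 0" by (auto simp: Q_def np_def nm_def pZ_def B_simps complex_eq_iff)
    then show ?thesis using m by (simp add: power_0_left)
  next
    case False
    have Q: "Q x > 0" by (rule Q_pos[OF False])
    have "norm (pZ x) ^ m * (pi * Q x) powr (- Re a) \<le> (q powr (real m / 2) * Q x powr (real m / 2)) * (pi * Q x) powr (- Re a)"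
      by (intro mult_right_mono pZ_bound) simp
    also have "\<dots> = q powr (real m / 2) * pi powr (- Re a) * Q x powr (- p)"
      using Q by (simp add: powr_mult p_def powr_add[symmetric] mult_ac)
    also have "\<dots> \<le> q powr (real m / 2) * pi powr (- Re a) * (\<delta> * (1 + Q x)) powr (- p)"
      using \<delta>(2)[OF x False] \<delta>(1) Q Re_pos by (intro mult_left_mono powr_mono2') auto
    also have "(\<delta> * (1 + Q x)) powr (- p) = \<delta> powr (- p) * (1 + Q x) powr (- p)" using \<delta>(1) Q by (simp add: powr_mult)
    finally show ?thesis by (simp only: mult_ac)
  qed
  then show ?thesis by (intro that[of ?C]) auto
qed

lemma wfun_0: assumes "Q x = 0" shows "wfun x y = 0"
proof -
  have "norm (pZ x) ^ m \<le> 0" using pZ_bound[of x] m assms by (simp add: power_0_left)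
  then have "norm (pZ x) ^ m = 0" using zero_le_power[OF norm_ge_zero, of "pZ x" m] by linarith
  then show ?thesis using m by (simp add: wfun_def)
qed

text \<open>Below height \<open>hh\<close> the Whittaker function is controlled by its behaviour at
  0 and its exponential growth is harmless. The Gamma integral therefore bounds the term for every
  vector of the coset, not only for those of norm \<open>2 * r\<close>.\<close>

lemma wfun_cut:
  assumes hh: "hh > 0"
  shows "integrable lborel (\<lambda>y. indicator {..hh} y *\<^sub>R wfun x y)"
    and "(LINT y|lborel. norm (indicator {..hh} y *\<^sub>R wfun x y)) \<le>
      (2 * (\<Sum>n. norm (kcoef (s + k / 2) (2 * s) n) * (R * hh) ^ n) * R powr (Re s - Re k / 2) * Gamma (Re a)) * (norm (pZ x) ^ m * (pi * Q x) powr (- Re a))"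
proof -
  let ?K = "\<Sum>n. norm (kcoef (s + k / 2) (2 * s) n) * (R * hh) ^ n"
  let ?g = "\<lambda>y. (2 * ?K * R powr (Re s - Re k / 2) * norm (pZ x) ^ m) * (indicator {0<..} y * (y powr (Re a - 1) * exp (- (pi * Q x * y))))"
  have "integrable lborel (\<lambda>y. indicator {..hh} y *\<^sub>R wfun x y) \<and>
    (LINT y|lborel. norm (indicator {..hh} y *\<^sub>R wfun x y)) \<le>
      (2 * ?K * R powr (Re s - Re k / 2) * Gamma (Re a)) * (norm (pZ x) ^ m * (pi * Q x) powr (- Re a))"
  proof (cases "Q x = 0")
    case True
    then show ?thesis by (simp add: wfun_0)
  next
    case False
    then have Q: "pi * Q x > 0" using Q_nonneg[of x] by (simp add: less_le)
    have g: "integrable lborel ?g" by (rule integrable_mult_right[OF Gamma_lint_real(1)[OF Re_pos(3) Q]])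
    have K: "?K \<ge> 0" using summable_kcoef[of "2 * s" "R * hh"] Re_pos hh by (intro suminf_nonneg) auto
    have le: "norm (indicator {..hh} y *\<^sub>R wfun x y) \<le> ?g y" for y
    proof (cases "0 < y \<and> y \<le> hh")
      case True
      have "norm (indicator {..hh} y *\<^sub>R wfun x y) = 2 * norm (pZ x) ^ m * (norm (Mks k s (R * y)) * y ^ (m - 1) * exp (- (pi * Q x * y)))"
        using True by (simp add: wfun_def norm_mult norm_power norm_exp_eq_Re)
      also have "\<dots> \<le> 2 * norm (pZ x) ^ m * (?K * (R * y) powr (Re s - Re k / 2) * y ^ (m - 1) * exp (- (pi * Q x * y)))"
        using True Re_pos by (intro mult_left_mono mult_right_mono norm_Mks_le) auto
      also have "(R * y) powr (Re s - Re k / 2) = R powr (Re s - Re k / 2) * y powr (Re s - Re k / 2)"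
        using True Re_pos by (simp add: powr_mult)
      also have "2 * norm (pZ x) ^ m * (?K * (R powr (Re s - Re k / 2) * y powr (Re s - Re k / 2)) * y ^ (m - 1) * exp (- (pi * Q x * y))) =
        (2 * ?K * R powr (Re s - Re k / 2) * norm (pZ x) ^ m) * ((y powr (Re s - Re k / 2) * y ^ (m - 1)) * exp (- (pi * Q x * y)))"
        by (simp only: mult_ac)
      also have "y powr (Re s - Re k / 2) * y ^ (m - 1) = y powr (Re a - 1)"
      proof -
        have "Re a - 1 = (Re s - Re k / 2) + real (m - 1)" using m by (simp add: a_def of_nat_diff)
        then show ?thesis using True by (simp only: powr_add powr_realpow)
      qed
      finally show ?thesis using True by simp
    next
      case False
      have "?g y \<ge> 0" using K by (simp add: indicator_def)
      moreover have "norm (indicator {..hh} y *\<^sub>R wfun x y) = 0" using False by (auto simp: wfun_def indicator_def)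
      ultimately show ?thesis by linarith
    qed
    have i: "integrable lborel (\<lambda>y. indicator {..hh} y *\<^sub>R wfun x y)"
    proof (rule Bochner_Integration.integrable_bound[OF g])
      show "AE y in lborel. norm (indicator {..hh} y *\<^sub>R wfun x y) \<le> norm (?g y)"
      proof (rule AE_I2)
        fix y show "norm (indicator {..hh} y *\<^sub>R wfun x y) \<le> norm (?g y)" using le[of y] abs_ge_self[of "?g y"] unfolding real_norm_def by linarith
      qed
    qed measurable
    have "(LINT y|lborel. norm (indicator {..hh} y *\<^sub>R wfun x y)) \<le> (LINT y|lborel. ?g y)"
      by (rule integral_mono[OF integrable_norm[OF i] g le])
    also have "\<dots> = (2 * ?K * R powr (Re s - Re k / 2) * norm (pZ x) ^ m) * (Gamma (Re a) * (pi * Q x) powr (- Re a))"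
      unfolding integral_mult_right_zero Gamma_lint_real(2)[OF Re_pos(3) Q] ..
    finally show ?thesis using i by (simp only: mult_ac)
  qed
  then show "integrable lborel (\<lambda>y. indicator {..hh} y *\<^sub>R wfun x y)"
    "(LINT y|lborel. norm (indicator {..hh} y *\<^sub>R wfun x y)) \<le>
      (2 * ?K * R powr (Re s - Re k / 2) * Gamma (Re a)) * (norm (pZ x) ^ m * (pi * Q x) powr (- Re a))" by auto
qed

lemma weight_summable: "A \<subseteq> Ld \<Longrightarrow> (\<lambda>x. C * (1 + Q x) powr (- p)) summable_on A"
  by (rule summable_on_subset_banach[of _ Ld], rule summable_on_cmult_right, rule Q_summable) (use Re_pos in auto)

text \<open>Each term is a product of a function of \<open>Re \<tau>\<close> and one of
  \<open>Im \<tau>\<close>; the first integrates to 0 unless its frequency is 0, that is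
  \<open>B x x = 2 * r\<close>. The bound of \<open>wfun_cut\<close>, which depends on
  \<open>hh\<close>, justifies the exchange of sum and integral.\<close>

lemma strip_integral:
  assumes hh: "hh > 0"
  defines "f \<equiv> \<lambda>\<tau>. indicator strip \<tau> *\<^sub>R (indicator {\<tau>. Im \<tau> \<le> hh} \<tau> *\<^sub>R h0 \<tau>)"
  shows "integrable hyp_measure f"
    and "(LINT \<tau>|hyp_measure. f \<tau>) = (\<Sum>\<^sub>\<infinity>x\<in>Lam. LINT y|lborel. indicator {..hh} y *\<^sub>R wfun x y)"
proof -
  define t where "t x \<tau> = indicator strip \<tau> *\<^sub>R (indicator {\<tau>. Im \<tau> \<le> hh} \<tau> *\<^sub>R hterm x \<tau>)" for x \<tau>
  define u where "u x \<xi> = indicator {- (1/2)<..<1/2} \<xi> *\<^sub>R ee (of_real ((r - B x x / 2) * \<xi>))" for x :: 'a and \<xi> :: real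
  define v where "v x y = indicator {..hh} y *\<^sub>R (indicator {0<..} y *\<^sub>R (2 * cnj (pZ x) ^ m * Mks k s (R * y) * exp (- of_real (pi * Q x * y)) * of_real y ^ (m + 1)))" for x y
  have tuv: "t x \<tau> = u x (Re \<tau>) * v x (Im \<tau>)" for x \<tau>
    unfolding t_def u_def v_def hterm_split strip_def by (auto simp: indicator_def abs_less_iff)
  have vm [measurable]: "v x \<in> borel_measurable borel" for x unfolding v_def[abs_def] by measurable
  have vw: "indicator {0<..} y *\<^sub>R (v x y / of_real (y\<^sup>2)) = indicator {..hh} y *\<^sub>R wfun x y" for x y
  proof (cases "y > 0")
    case True
    have "m + 1 = (m - 1) + 2" using m by simp
    then have "(of_real y :: complex) ^ (m + 1) = of_real y ^ (m - 1) * (of_real y)\<^sup>2" by (simp only: power_add)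
    then have "(of_real y :: complex) ^ (m + 1) / of_real (y\<^sup>2) = of_real y ^ (m - 1)" using True by simp
    then show ?thesis using True by (simp add: v_def wfun_def mult_ac) (simp add: field_simps)
  qed (simp add: v_def wfun_def)
  have u: "integrable lborel (u x)" "(LINT \<xi>|lborel. u x \<xi>) = (if B x x = 2 * r then 1 else 0)" if "x \<in> Cb" for x
    using character_lint[OF r_int[OF that]] unfolding u_def by auto
  have vi: "integrable lborel (\<lambda>y. indicator {0<..} y *\<^sub>R (v x y / of_real (y\<^sup>2)))" for x
    unfolding vw by (rule wfun_cut(1)[OF hh])
  have ti: "integrable hyp_measure (t x)" and tv: "(LINT \<tau>|hyp_measure. t x \<tau>) = (if B x x = 2 * r then LINT y|lborel. indicator {..hh} y *\<^sub>R wfun x y else 0)"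
    if "x \<in> Cb" for x
  proof -
    show "integrable hyp_measure (t x)" unfolding tuv[abs_def] by (rule hyp_integral_product(1)[OF u(1)[OF that] _ vi]) measurable
    show "(LINT \<tau>|hyp_measure. t x \<tau>) = (if B x x = 2 * r then LINT y|lborel. indicator {..hh} y *\<^sub>R wfun x y else 0)"
      unfolding tuv hyp_integral_product(2)[OF u(1)[OF that] vm vi] u(2)[OF that] vw by simp
  qed
  have tn: "(LINT \<tau>|hyp_measure. norm (t x \<tau>)) = (LINT y|lborel. norm (indicator {..hh} y *\<^sub>R wfun x y))" if x: "x \<in> Cb" for x
  proof -
    have vi': "integrable lborel (\<lambda>y. indicator {0<..} y *\<^sub>R (norm (v x y) / of_real (y\<^sup>2)))"
      and e: "(LINT y|lborel. indicator {0<..} y *\<^sub>R (norm (v x y) / of_real (y\<^sup>2))) = (LINT y|lborel. norm (indicator {..hh} y *\<^sub>R wfun x y))"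
    proof -
      have "indicator {0<..} y *\<^sub>R (norm (v x y) / of_real (y\<^sup>2)) = norm (indicator {..hh} y *\<^sub>R wfun x y)" for y
        unfolding vw[symmetric] by (simp add: norm_divide norm_power indicator_def)
      then show "integrable lborel (\<lambda>y. indicator {0<..} y *\<^sub>R (norm (v x y) / of_real (y\<^sup>2)))"
        "(LINT y|lborel. indicator {0<..} y *\<^sub>R (norm (v x y) / of_real (y\<^sup>2))) = (LINT y|lborel. norm (indicator {..hh} y *\<^sub>R wfun x y))"
        using integrable_norm[OF wfun_cut(1)[OF hh]] by simp_all
    qed
    have "norm (u x \<xi>) = indicator {- (1/2)<..<1/2} \<xi>" for \<xi> unfolding u_def norm_scaleR norm_ee_of_real by (simp add: indicator_def)
    then have "(LINT \<xi>|lborel. norm (u x \<xi>)) = 1" by simp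
    then show ?thesis
      unfolding tuv norm_mult by (subst hyp_integral_product(2)[OF integrable_norm[OF u(1)[OF x]] _ vi']) (auto simp only: e, auto)
  qed
  obtain C0 where C0: "C0 \<ge> 0" "\<And>x. x \<in> Ld \<Longrightarrow> norm (pZ x) ^ m * (pi * Q x) powr (- Re a) \<le> C0 * (1 + Q x) powr (- p)" using weight_bound by blast
  let ?K = "2 * (\<Sum>n. norm (kcoef (s + k / 2) (2 * s) n) * (R * hh) ^ n) * R powr (Re s - Re k / 2) * Gamma (Re a)"
  have K: "?K \<ge> 0"
    using summable_kcoef[of "2 * s" "R * hh"] Re_pos hh by (intro mult_nonneg_nonneg suminf_nonneg) (auto intro: less_imp_le Gamma_real_pos)
  have sum: "(\<lambda>x. LINT \<tau>|hyp_measure. norm (t x \<tau>)) summable_on Cb"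
  proof (rule summable_on_comparison_test[OF weight_summable[of Cb "?K * C0"]])
    fix x assume x: "x \<in> Cb"
    have "(LINT \<tau>|hyp_measure. norm (t x \<tau>)) \<le> ?K * (norm (pZ x) ^ m * (pi * Q x) powr (- Re a))"
      unfolding tn[OF x] by (rule wfun_cut(2)[OF hh])
    also have "\<dots> \<le> ?K * (C0 * (1 + Q x) powr (- p))" by (rule mult_left_mono[OF C0(2)[OF Cb_Ld[OF x]] K])
    finally show "(LINT \<tau>|hyp_measure. norm (t x \<tau>)) \<le> ?K * C0 * (1 + Q x) powr (- p)" by (simp only: mult.assoc)
  qed (use Cb_Ld in auto)
  have f: "f = (\<lambda>\<tau>. \<Sum>\<^sub>\<infinity>x\<in>Cb. t x \<tau>)"
  proof
    fix \<tau> show "f \<tau> = (\<Sum>\<^sub>\<infinity>x\<in>Cb. t x \<tau>)" unfolding f_def t_def h0_def by (auto simp: indicator_def)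
  qed
  show "integrable hyp_measure f" unfolding f by (rule integral_infsum(2)[OF countable_Cb sigma_finite_hyp ti sum])
  have "(LINT \<tau>|hyp_measure. f \<tau>) = (\<Sum>\<^sub>\<infinity>x\<in>Cb. LINT \<tau>|hyp_measure. t x \<tau>)"
    unfolding f by (rule integral_infsum(4)[OF countable_Cb sigma_finite_hyp ti sum])
  also have "\<dots> = (\<Sum>\<^sub>\<infinity>x\<in>Lam. LINT y|lborel. indicator {..hh} y *\<^sub>R wfun x y)"
    by (rule infsum_cong_neutral) (auto simp: tv)
  finally show "(LINT \<tau>|hyp_measure. f \<tau>) = (\<Sum>\<^sub>\<infinity>x\<in>Lam. LINT y|lborel. indicator {..hh} y *\<^sub>R wfun x y)" .
qed

section \<open>Convergence as the height tends to infinity\<close>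

definition cc :: "'a \<Rightarrow> real" where "cc x = R / 2 + pi * Q x"

text \<open>On vectors of norm \<open>2 * r\<close>, \<open>cc x\<close> equals
  \<open>R + 2 * pi * np x\<close>, so \<open>R < cc x\<close> is the condition that
  \<open>Z\<close> avoids the divisor of \<open>x\<close>.\<close>

lemma cc_Lam: assumes "x \<in> Lam" shows "cc x = 2 * pi * \<bar>nm x\<bar>" "cc x > R"
proof -
  have x: "B x x = 2 * r" "np x > 0" using assms np_off by auto
  have Q: "Q x = 2 * np x - 2 * r" and nm: "nm x = 2 * r - np x" using x by (simp_all add: Q_def nm_def)
  have ab: "\<bar>r\<bar> = - r" "\<bar>2 * r - np x\<bar> = np x - 2 * r" using x r_neg by auto
  show "cc x = 2 * pi * \<bar>nm x\<bar>" unfolding cc_def R_def Q nm ab by (simp add: algebra_simps)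
  show "cc x > R" unfolding cc_def R_def Q ab using mult_pos_pos[OF pi_gt_zero x(2)] by (simp add: algebra_simps)
qed

text \<open>Only finitely many \<open>x\<close> have \<open>Q x \<le> R\<close>, and for the others
  \<open>pi > 3\<close> gives \<open>2 * R \<le> cc x\<close>. A bound below 1 that is uniform in
  \<open>x\<close> lets one convergent series dominate all the hypergeometric ones.\<close>

lemma ratio_bound: obtains \<theta> where "\<theta> < 1" "\<theta> \<ge> 0" "\<And>x. x \<in> Lam \<Longrightarrow> R / cc x \<le> \<theta>"
proof
  let ?F = "{x \<in> Lam. Q x \<le> R}"
  define \<theta> where "\<theta> = Max (insert (1/2) ((\<lambda>x. R / cc x) ` ?F))"
  have "?F \<subseteq> {x \<in> Ld. Q x \<le> R}" using Cb_Ld by auto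
  then have "finite ?F" using Q_finite finite_subset by blast
  then have fin: "finite (insert (1/2) ((\<lambda>x. R / cc x) ` ?F))" by simp
  show "\<theta> < 1" unfolding \<theta>_def using fin cc_Lam(2) Re_pos(4) by (subst Max_less_iff) force+
  have h: "1/2 \<le> \<theta>" unfolding \<theta>_def by (rule Max_ge[OF fin]) simp
  then show "\<theta> \<ge> 0" by simp
  fix x assume x: "x \<in> Lam"
  show "R / cc x \<le> \<theta>"
  proof (cases "Q x \<le> R")
    case True
    then show ?thesis unfolding \<theta>_def using x by (intro Max_ge[OF fin]) auto
  next
    case False
    have "2 * R \<le> cc x"
    proof -
      have "3 * R \<le> pi * Q x" using False pi_gt3 Re_pos(4) by (intro mult_mono) auto
      then show ?thesis using Re_pos(4) by (simp add: cc_def)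
    qed
    then have "R / cc x \<le> 1/2" using Re_pos(4) by (simp add: field_simps)
    then show ?thesis using h by linarith
  qed
qed

lemma wfun_full:
  assumes x: "x \<in> Lam"
  shows "integrable lborel (wfun x)"
    and "(LINT y|lborel. wfun x y) = 2 * cnj (pZ x) ^ m * (of_real R powr (s - k / 2) * Gamma a * of_real (cc x) powr (- a) * hyp2F1 a (s + k / 2) (2 * s) (of_real (R / cc x)))"
    and "(LINT y|lborel. norm (wfun x y)) \<le> 2 * norm (pZ x) ^ m * (R powr Re (s - k / 2) * cc x powr (- Re a) * (\<Sum>n. norm (kcoef (s + k / 2) (2 * s) n) * (R / cc x) ^ n * Gamma (Re a + real n)))"
proof -
  note W = whittaker_laplace[OF Re_pos(1,2) Re_pos(3)[unfolded a_def] Re_pos(4) cc_Lam(2)[OF x] m, folded a_def]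
  have w: "wfun x = (\<lambda>y. 2 * cnj (pZ x) ^ m * (indicator {0<..} y *\<^sub>R (Mks k s (R * y) * of_real y ^ (m - 1) * exp (- of_real ((cc x - R / 2) * y)))))"
    by (simp add: fun_eq_iff wfun_def cc_def)
  show "integrable lborel (wfun x)" unfolding w by (rule integrable_mult_right[OF W(1)])
  show "(LINT y|lborel. wfun x y) = 2 * cnj (pZ x) ^ m * (of_real R powr (s - k / 2) * Gamma a * of_real (cc x) powr (- a) * hyp2F1 a (s + k / 2) (2 * s) (of_real (R / cc x)))"
    unfolding w integral_mult_right_zero W(2) ..
  have "(LINT y|lborel. norm (wfun x y)) = 2 * norm (pZ x) ^ m * (LINT y|lborel. norm (indicator {0<..} y *\<^sub>R (Mks k s (R * y) * of_real y ^ (m - 1) * exp (- of_real ((cc x - R / 2) * y)))))"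
    unfolding w norm_mult[of "2 * cnj (pZ x) ^ m"] integral_mult_right_zero by (simp add: norm_mult norm_power)
  also have "\<dots> \<le> 2 * norm (pZ x) ^ m * (R powr Re (s - k / 2) * cc x powr (- Re a) * (\<Sum>n. norm (kcoef (s + k / 2) (2 * s) n) * (R / cc x) ^ n * Gamma (Re a + real n)))"
    by (rule mult_left_mono[OF W(3)]) simp
  finally show "(LINT y|lborel. norm (wfun x y)) \<le> \<dots>" .
qed

lemma wfun_norm_summable: "(\<lambda>x. LINT y|lborel. norm (wfun x y)) summable_on Lam"
proof -
  obtain C0 where C0: "C0 \<ge> 0" "\<And>x. x \<in> Ld \<Longrightarrow> norm (pZ x) ^ m * (pi * Q x) powr (- Re a) \<le> C0 * (1 + Q x) powr (- p)" using weight_bound by blast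
  obtain \<theta> where th: "\<theta> < 1" "\<theta> \<ge> 0" "\<And>x. x \<in> Lam \<Longrightarrow> R / cc x \<le> \<theta>" using ratio_bound by blast
  let ?S = "\<lambda>t. \<Sum>n. norm (kcoef (s + k / 2) (2 * s) n) * t ^ n * Gamma (Re a + real n)"
  have G: "Gamma (Re a + real n) \<ge> 0" for n using Re_pos by (intro less_imp_le Gamma_real_pos) simp
  have sm: "summable (\<lambda>n. norm (kcoef (s + k / 2) (2 * s) n) * t ^ n * Gamma (Re a + real n))" if "0 \<le> t" "t < 1" for t
    by (rule summable_kcoef_Gamma) (use Re_pos that in auto)
  have S: "?S \<theta> \<ge> 0" using sm[OF th(2,1)] G th by (intro suminf_nonneg) auto
  show ?thesis
  proof (rule summable_on_comparison_test[OF weight_summable[of Lam "2 * R powr Re (s - k / 2) * ?S \<theta> * C0"]])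
    fix x assume x: "x \<in> Lam"
    have xL: "x \<in> Ld" using x Cb_Ld by auto
    have c: "cc x > 0" "0 \<le> R / cc x" "R / cc x < 1" using cc_Lam(2)[OF x] Re_pos(4) by auto
    have le: "?S (R / cc x) \<le> ?S \<theta>"
      using c th x G by (intro suminf_le sm mult_right_mono mult_left_mono power_mono) auto
    have x0: "x \<noteq> 0" using x r_neg by (auto simp: B_simps)
    then have Q: "Q x > 0" by (rule Q_pos)
    have "(LINT y|lborel. norm (wfun x y)) \<le> 2 * norm (pZ x) ^ m * (R powr Re (s - k / 2) * cc x powr (- Re a) * ?S (R / cc x))"
      by (rule wfun_full(3)[OF x])
    also have "\<dots> \<le> 2 * norm (pZ x) ^ m * (R powr Re (s - k / 2) * (pi * Q x) powr (- Re a) * ?S \<theta>)"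
    proof (intro mult_left_mono mult_mono le)
      show "cc x powr (- Re a) \<le> (pi * Q x) powr (- Re a)"
        using Q Re_pos by (intro powr_mono2') (auto simp: cc_def)
      show "0 \<le> ?S (R / cc x)" using c G by (intro suminf_nonneg sm) auto
    qed auto
    also have "\<dots> = 2 * R powr Re (s - k / 2) * ?S \<theta> * (norm (pZ x) ^ m * (pi * Q x) powr (- Re a))" by (simp only: mult_ac)
    also have "\<dots> \<le> 2 * R powr Re (s - k / 2) * ?S \<theta> * (C0 * (1 + Q x) powr (- p))"
      using S by (intro mult_left_mono C0(2)[OF xL]) auto
    finally show "(LINT y|lborel. norm (wfun x y)) \<le> 2 * R powr Re (s - k / 2) * ?S \<theta> * C0 * (1 + Q x) powr (- p)"
      by (simp only: mult.assoc)
  qed (use Cb_Ld in auto)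
qed

lemma countable_Lam: "countable Lam" by (rule countable_subset[OF _ countable_Cb]) auto

text \<open>For vectors of norm \<open>2 * r\<close> the terms are integrable up to infinite height
  with summable norms, so the truncation is removed by dominated convergence for the sum over all of
  them.\<close>

lemma strip_limit:
  "((\<lambda>hh. \<Sum>\<^sub>\<infinity>x\<in>Lam. LINT y|lborel. indicator {..hh} y *\<^sub>R wfun x y) \<longlongrightarrow> (\<Sum>\<^sub>\<infinity>x\<in>Lam. LINT y|lborel. wfun x y)) at_top"
  and wfun_lint_summable: "(\<lambda>x. LINT y|lborel. wfun x y) summable_on Lam"
proof -
  note I = integral_infsum[OF countable_Lam lborel.sigma_finite_measure_axioms wfun_full(1) wfun_norm_summable]
  let ?G = "\<lambda>y. \<Sum>\<^sub>\<infinity>x\<in>Lam. wfun x y"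
  have G: "integrable lborel ?G" by (rule I(2))
  have GH: "(\<Sum>\<^sub>\<infinity>x\<in>Lam. LINT y|lborel. indicator {..hh} y *\<^sub>R wfun x y) = (LINT y|lborel. indicator {..hh} y *\<^sub>R ?G y)" for hh
  proof -
    have i: "integrable lborel (\<lambda>y. indicator {..hh} y *\<^sub>R wfun x y)" if "x \<in> Lam" for x
      by (rule Bochner_Integration.integrable_bound[OF wfun_full(1)[OF that]]) (auto simp: indicator_def)
    have "(\<lambda>x. LINT y|lborel. norm (indicator {..hh} y *\<^sub>R wfun x y)) summable_on Lam"
    proof (rule summable_on_comparison_test[OF wfun_norm_summable])
      fix x assume x: "x \<in> Lam"
      show "(LINT y|lborel. norm (indicator {..hh} y *\<^sub>R wfun x y)) \<le> (LINT y|lborel. norm (wfun x y))"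
        by (rule integral_mono[OF integrable_norm[OF i[OF x]] integrable_norm[OF wfun_full(1)[OF x]]]) (auto simp: indicator_def)
    qed auto
    note J = integral_infsum(4)[OF countable_Lam lborel.sigma_finite_measure_axioms i this]
    have "(\<Sum>\<^sub>\<infinity>x\<in>Lam. LINT y|lborel. indicator {..hh} y *\<^sub>R wfun x y) = (LINT y|lborel. (\<Sum>\<^sub>\<infinity>x\<in>Lam. indicator {..hh} y *\<^sub>R wfun x y))"
      by (rule J[symmetric])
    also have "\<dots> = (LINT y|lborel. indicator {..hh} y *\<^sub>R ?G y)"
      by (rule Bochner_Integration.integral_cong) (auto simp: indicator_def)
    finally show ?thesis .
  qed
  have "((\<lambda>hh. LINT y|lborel. indicator {..hh} y *\<^sub>R ?G y) \<longlongrightarrow> (LINT y|lborel. ?G y)) at_top"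
  proof (rule integral_dominated_convergence_at_top[where w="\<lambda>y. norm (?G y)"])
    show "?G \<in> borel_measurable lborel" using G by (rule borel_measurable_integrable)
    then show "(\<lambda>y. indicator {..hh} y *\<^sub>R ?G y) \<in> borel_measurable lborel" for hh by measurable
    show "AE y in lborel. ((\<lambda>hh. indicator {..hh} y *\<^sub>R ?G y) \<longlongrightarrow> ?G y) at_top"
    proof (rule AE_I2)
      fix y :: real
      have "\<forall>\<^sub>F hh in at_top. indicator {..hh} y *\<^sub>R ?G y = ?G y"
        using eventually_ge_at_top[of y] by eventually_elim simp
      then show "((\<lambda>hh. indicator {..hh} y *\<^sub>R ?G y) \<longlongrightarrow> ?G y) at_top" by (rule tendsto_eventually)
    qed
    show "\<forall>\<^sub>F hh in at_top. AE y in lborel. norm (indicator {..hh} y *\<^sub>R ?G y) \<le> norm (?G y)"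
      by (rule always_eventually) (auto simp: indicator_def)
  qed (use G in auto)
  moreover have "(LINT y|lborel. ?G y) = (\<Sum>\<^sub>\<infinity>x\<in>Lam. LINT y|lborel. wfun x y)" by (rule I(4))
  ultimately show "((\<lambda>hh. \<Sum>\<^sub>\<infinity>x\<in>Lam. LINT y|lborel. indicator {..hh} y *\<^sub>R wfun x y) \<longlongrightarrow> (\<Sum>\<^sub>\<infinity>x\<in>Lam. LINT y|lborel. wfun x y)) at_top"
    unfolding GH by simp
  have "(\<lambda>x. LINT y|lborel. wfun x y) abs_summable_on Lam" by (rule I(3))
  then show "(\<lambda>x. LINT y|lborel. wfun x y) summable_on Lam" by (rule abs_summable_summable)
qed

end

section \<open>The lift of the Poincare series\<close>

text \<open>The boolean stands for the choice of square root, of which there are two for each lower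
  row.\<close>

lemma int_pair_summable:
  assumes p: "p > 1"
  shows "(\<lambda>((c::int, d::int), e::bool). ((1 + \<bar>of_int c\<bar>) * (1 + \<bar>of_int d\<bar>)) powr (- p :: real)) summable_on UNIV"
proof -
  let ?f = "\<lambda>n::int. (1 + \<bar>of_int n\<bar>) powr (- p :: real)"
  have S: "?f summable_on UNIV" by (rule summable_on_int_powr[OF p])
  have 1: "(\<lambda>(c, d). ?f c * ?f d) summable_on UNIV \<times> UNIV"
    by (rule summable_on_TimesI[where G="\<lambda>c. ?f c * infsum ?f UNIV"])
       (auto intro!: summable_on_cmult_right summable_on_cmult_left S simp: infsum_cmult_right')
  have "(\<lambda>(cd, e::bool). (\<lambda>(c, d). ?f c * ?f d) cd) summable_on UNIV \<times> UNIV"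
    by (rule summable_on_TimesI[where G="\<lambda>cd. (\<lambda>(c, d). ?f c * ?f d) cd * 2"])
       (use 1 in \<open>auto intro!: summable_on_cmult_left simp: UNIV_Times_UNIV\<close>)
  then show ?thesis by (simp add: powr_mult case_prod_unfold)
qed

text \<open>Matrices of determinant 1 with equal lower rows differ by a translation from the left,
  and the sign of the root is read off at \<open>\<i>\<close>.\<close>

lemma coset_bottom_row_inj:
  "inj_on (\<lambda>A. ((fst (crep A)$2$1, fst (crep A)$2$2), snd (crep A) \<i> = csqrt (autom_factor (fst (crep A)) \<i>))) T_cosets"
proof (rule inj_onI)
  fix A A' assume A: "A \<in> T_cosets" "A' \<in> T_cosets"
    and e: "((fst (crep A)$2$1, fst (crep A)$2$2), snd (crep A) \<i> = csqrt (autom_factor (fst (crep A)) \<i>)) =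
      ((fst (crep A')$2$1, fst (crep A')$2$2), snd (crep A') \<i> = csqrt (autom_factor (fst (crep A')) \<i>))"
  define g where "g = crep A"
  define g' where "g' = crep A'"
  have g: "g \<in> carrier Mp2Z" "g' \<in> carrier Mp2Z" unfolding g_def g'_def using A crep_coset(1) by auto
  \<comment> \<open>The upper right entry of the matrix of \<open>g'\<close> times the inverse of
    that of \<open>g\<close>.\<close>
  define n where "n = fst g'$1$2 * fst g$1$1 - fst g'$1$1 * fst g$1$2"
  define f where "f = Tpow n \<star> g"
  have cd: "fst g$2$1 = fst g'$2$1" "fst g$2$2 = fst g'$2$2" using e by (auto simp: g_def g'_def)
  have d: "fst g$1$1 * fst g$2$2 - fst g$1$2 * fst g$2$1 = 1" "fst g'$1$1 * fst g$2$2 - fst g'$1$2 * fst g$2$1 = 1"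
    using g cd by (auto simp: mp2_iff det2)
  have fc: "f \<in> carrier Mp2Z" unfolding f_def using g Tpow_carrier by simp
  have "fst g$1$1 + n * fst g$2$1 = fst g'$1$1" "fst g$1$2 + n * fst g$2$2 = fst g'$1$2"
    unfolding n_def using d by algebra+
  then have m: "fst f = fst g'"
    unfolding f_def by (intro mat2_eqI) (auto simp: mp2_mult Tpow_def mm2 cd)
  have i: "\<i> \<in> upper_half" by (simp add: upper_half_def)
  have si: "snd f \<i> = snd g \<i>"
    using i by (simp add: f_def mp2_mult Tpow_def moebius_upper[OF _ i] g(1)[unfolded mp2_iff] moebius_in_upper[OF g(1) i])
  have af: "autom_factor (fst g) \<i> = autom_factor (fst g') \<i>" by (simp add: autom_factor_def cd)
  have "snd g \<i> = snd g' \<i>" using e snd_at_ii[OF g(1)] snd_at_ii[OF g(2)] unfolding g_def[symmetric] g'_def[symmetric] af by auto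
  then have "snd f \<i> = snd g' \<i>" using si by simp
  moreover obtain e' where e': "e' \<in> {1, -1}" "\<forall>\<tau>\<in>upper_half. snd f \<tau> = e' * snd g' \<tau>"
    using mp2_same_matrix[OF fc g(2) m] by blast
  ultimately have "e' = 1" using i mp2_phi_nonzero[OF g(2) i] by auto
  then have "f = g'" using e' m by (intro mp2_eqI[OF fc g(2)]) auto
  then show "A = A'"
    using crep_coset(2)[OF A(1)] crep_coset(2)[OF A(2)] r_coset_T_closed[OF g(1), of n]
    unfolding f_def g_def g'_def by simp
qed

lemma bottom_row_norm:
  fixes A :: "int^2^2"
  assumes d: "det A = 1"
  shows "1 \<le> (of_int (A$2$1))\<^sup>2 + (of_int (A$2$2) :: real)\<^sup>2"
proof -
  have "A$2$1 \<noteq> 0 \<or> A$2$2 \<noteq> 0" using d by (auto simp: det2)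
  then have "(A$2$1)\<^sup>2 + (A$2$2)\<^sup>2 > 0" by (simp add: sum_power2_gt_zero_iff)
  then have "real_of_int 1 \<le> real_of_int ((A$2$1)\<^sup>2 + (A$2$2)\<^sup>2)" by (simp only: of_int_le_iff)
  then show ?thesis by simp
qed

text \<open>The product is at most four times \<open>c\<^sup>2 + d\<^sup>2\<close> because the
  latter is at least 1; together with the 1/2 from \<open>autom_norm_FD\<close> this makes the 8.
  The product form lets the sum over lower rows factor.\<close>

lemma autom_norm_lower:
  assumes t: "\<tau> \<in> FD" and d: "det A = 1"
  shows "(norm (autom_factor A \<tau>))\<^sup>2 \<ge> (1 + \<bar>of_int (A$2$1)\<bar>) * (1 + \<bar>of_int (A$2$2)\<bar>) / 8"
proof -
  let ?c = "\<bar>real_of_int (A$2$1)\<bar>" and ?d = "\<bar>real_of_int (A$2$2)\<bar>"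
  have "?c\<^sup>2 + ?d\<^sup>2 \<ge> 1" using bottom_row_norm[OF d] by simp
  moreover have "?c \<le> (1 + ?c\<^sup>2) / 2" "?d \<le> (1 + ?d\<^sup>2) / 2" "?c * ?d \<le> (?c\<^sup>2 + ?d\<^sup>2) / 2"
    using zero_le_power2[of "?c - 1"] zero_le_power2[of "?d - 1"] zero_le_power2[of "?c - ?d"]
    unfolding power2_diff by simp_all
  ultimately have "(1 + ?c) * (1 + ?d) \<le> 4 * (?c\<^sup>2 + ?d\<^sup>2)" unfolding distrib_left distrib_right by simp
  then show ?thesis using autom_norm_FD[OF t, of A] by simp
qed

lemma coset_sum_summable:
  assumes t: "\<tau> \<in> FD" and p: "p > 1"
  shows "(\<lambda>A. (norm (autom_factor (fst (crep A)) \<tau>))\<^sup>2 powr (- p)) summable_on T_cosets"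
proof -
  let ?j = "\<lambda>A. ((fst (crep A)$2$1, fst (crep A)$2$2), snd (crep A) \<i> = csqrt (autom_factor (fst (crep A)) \<i>))"
  let ?w = "\<lambda>((c::int, d::int), e::bool). ((1 + \<bar>of_int c\<bar>) * (1 + \<bar>of_int d\<bar>)) powr (- p)"
  have "?w summable_on ?j ` T_cosets" by (rule summable_on_subset_banach[OF int_pair_summable[OF p]]) simp
  then have "(?w \<circ> ?j) summable_on T_cosets" using summable_on_reindex[OF coset_bottom_row_inj] by blast
  then have S: "(\<lambda>A. 8 powr p * (?w \<circ> ?j) A) summable_on T_cosets" by (rule summable_on_cmult_right)
  show ?thesis
  proof (rule summable_on_comparison_test[OF S])
    fix A assume A: "A \<in> T_cosets"
    let ?x = "(1 + \<bar>real_of_int (fst (crep A)$2$1)\<bar>) * (1 + \<bar>real_of_int (fst (crep A)$2$2)\<bar>)"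
    have x: "?x > 0" by (simp add: add_pos_nonneg)
    have "det (fst (crep A)) = 1" using crep_coset(1)[OF A] by (simp add: mp2_iff)
    then have "?x / 8 \<le> (norm (autom_factor (fst (crep A)) \<tau>))\<^sup>2" by (rule autom_norm_lower[OF t])
    then have "(norm (autom_factor (fst (crep A)) \<tau>))\<^sup>2 powr (- p) \<le> (?x / 8) powr (- p)"
      using p x by (intro powr_mono2') auto
    also have "\<dots> = 8 powr p * (?w \<circ> ?j) A" using x by (simp add: powr_divide powr_minus field_simps)
    finally show "(norm (autom_factor (fst (crep A)) \<tau>))\<^sup>2 powr (- p) \<le> 8 powr p * (?w \<circ> ?j) A" .
  qed simp
qed

lemma FD_upper: "\<tau> \<in> FD \<Longrightarrow> \<tau> \<in> upper_half" by (simp add: FD_def)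

context lift
begin

abbreviation "seed \<equiv> poincare_seed L b m r \<beta> s"

lemma uminus_beta: "- \<beta> \<in> Ld" using beta by (simp add: dual_lattice_def B_simps)

lemma seed_eq: "seed \<tau> c = ee (of_real (r * Re \<tau>)) * Mks k s (R * Im \<tau>) * (basis_vec Cb c + (-1) ^ m * basis_vec (lat_coset L (- \<beta>)) c)"
  unfolding poincare_seed_def k_def R_def ..

lemma seed_GA: "seed \<tau> \<in> GA"
  using coset_in_DL[OF beta] coset_in_DL[OF uminus_beta] by (auto simp: group_alg_def seed_eq basis_vec_def)

lemma seed_norm: "norm (seed \<tau> c) \<le> 2 * norm (Mks k s (R * Im \<tau>))"
proof -
  have "norm (basis_vec Cb c + (-1) ^ m * basis_vec (lat_coset L (- \<beta>)) c) \<le> 1 + 1"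
    by (rule norm_triangle_le, rule add_mono) (auto simp: norm_mult norm_power norm_basis_vec)
  then have "norm (Mks k s (R * Im \<tau>)) * norm (basis_vec Cb c + (-1) ^ m * basis_vec (lat_coset L (- \<beta>)) c) \<le> norm (Mks k s (R * Im \<tau>)) * 2"
    by (intro mult_left_mono) auto
  then show ?thesis unfolding seed_eq norm_mult norm_ee_of_real by (simp add: mult.commute)
qed

text \<open>The theta component at \<open>- \<beta>\<close> is \<open>(-1) ^ m\<close> times the one
  at \<open>\<beta>\<close>, so the two halves of the seed pair to the same value.\<close>

lemma seed_pairing:
  assumes t: "\<tau> \<in> upper_half"
  shows "herm (seed \<tau>) (Th m \<tau>) * of_real (Im \<tau>) ^ (m + 1) = h0 \<tau>"
proof -
  let ?C = "ee (of_real (r * Re \<tau>)) * Mks k s (R * Im \<tau>)"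
  have 1: "(\<Sum>c\<in>DL. basis_vec d c * cnj (Th m \<tau> c)) = cnj (Th m \<tau> d)" if "d \<in> DL" for d
    using that finite_DL by (simp add: basis_vec_def if_distrib[of "\<lambda>x. x * _"] cong: if_cong)
  have "herm (seed \<tau>) (Th m \<tau>) = ?C * ((\<Sum>c\<in>DL. basis_vec Cb c * cnj (Th m \<tau> c)) + (-1) ^ m * (\<Sum>c\<in>DL. basis_vec (lat_coset L (- \<beta>)) c * cnj (Th m \<tau> c)))"
    unfolding herm_pair_def seed_eq sum_distrib_left sum.distrib[symmetric] by (intro sum.cong) (auto simp: algebra_simps)
  also have "\<dots> = ?C * (cnj (Th m \<tau> Cb) + (-1) ^ m * cnj ((-1) ^ m * Th m \<tau> Cb))"
    unfolding 1[OF coset_in_DL[OF beta]] 1[OF coset_in_DL[OF uminus_beta]] Th_uminus[OF beta] ..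
  also have "(-1) ^ m * cnj ((-1) ^ m * Th m \<tau> Cb) = ((-1) * (-1)) ^ m * cnj (Th m \<tau> Cb)"
    unfolding power_mult_distrib by simp
  finally show ?thesis unfolding h0_eq[OF t] by simp
qed

abbreviation "slashc A \<tau> \<equiv> slash B L \<rho> (two_weight b m) seed (crep A) \<tau>"

text \<open>The weight contributes the automorphy factor to the power \<open>- k\<close>, and the
  seed, of order \<open>s - k / 2\<close> in the imaginary part, contributes twice the negative of
  that exponent. The total exponent is \<open>- 2 * Re s\<close>, which is summable over the lower
  rows for \<open>Re s > 1\<close>.\<close>

lemma slash_summable:
  assumes t: "\<tau> \<in> FD"
  shows "(\<lambda>A. slashc A \<tau> c) abs_summable_on T_cosets"
proof -
  have u: "\<tau> \<in> upper_half" and y: "Im \<tau> > 0" using FD_upper[OF t] by (auto simp: upper_half_def)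
  have sg: "Re s > 1" using s by simp
  \<comment> \<open>On \<open>FD\<close> no image has imaginary part above
    \<open>2 * Im \<tau>\<close>, so one bound for the Whittaker function up to
    \<open>R * (2 * Im \<tau>)\<close> covers all cosets.\<close>
  let ?K = "\<Sum>n. norm (kcoef (s + k / 2) (2 * s) n) * (R * (2 * Im \<tau>)) ^ n"
  let ?e = "Re s - Re k / 2"
  let ?C = "sqrt (card DL) * (2 * (?K * (R * Im \<tau>) powr ?e))"
  have K: "?K \<ge> 0" using summable_kcoef[of "2 * s" "R * (2 * Im \<tau>)"] Re_pos y by (intro suminf_nonneg) auto
  show ?thesis
  proof (rule summable_on_comparison_test[OF summable_on_cmult_right[OF coset_sum_summable[OF t sg], of ?C]])
    fix A assume A: "A \<in> T_cosets"
    let ?g = "crep A"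
    define j where "j = norm (autom_factor (fst ?g) \<tau>)"
    have g: "?g \<in> carrier Mp2Z" by (rule crep_coset(1)[OF A])
    have d: "det (fst ?g) = 1" using g by (simp add: mp2_iff)
    have j0: "j > 0" using autom_nonzero[OF d y] by (simp add: j_def)
    have Im: "Im (act ?g \<tau>) = Im \<tau> / j\<^sup>2" unfolding j_def by (rule Im_moebius[OF d y])
    have j2: "j\<^sup>2 \<ge> 1/2" using autom_norm_FD[OF t, of "fst ?g"] bottom_row_norm[OF d] by (simp add: j_def)
    have le: "Im \<tau> / j\<^sup>2 \<le> 2 * Im \<tau>" using j2 y j0 by (simp add: field_simps)
    have M: "norm (Mks k s (R * (Im \<tau> / j\<^sup>2))) \<le> ?K * (R * (Im \<tau> / j\<^sup>2)) powr ?e"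
    proof (rule norm_Mks_le)
      show "0 < R * (Im \<tau> / j\<^sup>2)" using y j0 Re_pos(4) by simp
      show "R * (Im \<tau> / j\<^sup>2) \<le> R * (2 * Im \<tau>)" using le Re_pos(4) by (intro mult_left_mono) auto
    qed (rule Re_pos)
    have bd: "norm (seed (act ?g \<tau>) c) \<le> 2 * (?K * (R * (Im \<tau> / j\<^sup>2)) powr ?e)" for c
      using seed_norm[of "act ?g \<tau>" c] M unfolding Im by linarith
    have "norm (slashc A \<tau> c) \<le> norm (snd ?g \<tau>) powi (- two_weight b m) * sqrt (card DL) * (2 * (?K * (R * (Im \<tau> / j\<^sup>2)) powr ?e))"
      by (rule slash_norm[where F=seed, OF g seed_GA u bd])
    also have "norm (snd ?g \<tau>) powi (- two_weight b m) = (j\<^sup>2) powr (- Re k / 2)"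
    proof -
      have "(norm (snd ?g \<tau>))\<^sup>2 = j" unfolding j_def norm_power[symmetric] using g u by (simp add: mp2_iff)
      then have n: "norm (snd ?g \<tau>) = j powr (1/2)" using j0 by (metis norm_ge_zero powr_half_sqrt real_sqrt_unique less_imp_le)
      have "norm (snd ?g \<tau>) powi (- two_weight b m) = (j powr (1/2)) powr real_of_int (- two_weight b m)"
        unfolding n using j0 by (subst powr_real_of_int') auto
      also have "\<dots> = (j powr 2) powr (- Re k / 2)" unfolding powr_powr by (simp add: k_def)
      finally show ?thesis using j0 by (simp add: powr_numeral)
    qed
    also have "(R * (Im \<tau> / j\<^sup>2)) powr ?e = (R * Im \<tau>) powr ?e * (j\<^sup>2) powr (- ?e)"
      using j0 y Re_pos by (simp add: powr_mult powr_divide powr_minus field_simps)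
    also have "(j\<^sup>2) powr (- Re k / 2) * sqrt (card DL) * (2 * (?K * ((R * Im \<tau>) powr ?e * (j\<^sup>2) powr (- ?e)))) =
      ?C * ((j\<^sup>2) powr (- Re k / 2) * (j\<^sup>2) powr (- ?e))" by (simp only: mult_ac)
    also have "(j\<^sup>2) powr (- Re k / 2) * (j\<^sup>2) powr (- ?e) = (j\<^sup>2) powr (- Re s)"
      unfolding powr_add[symmetric] by (simp add: field_simps)
    finally show "norm (slashc A \<tau> c) \<le> ?C * (norm (autom_factor (fst (crep A)) \<tau>))\<^sup>2 powr (- Re s)"
      unfolding j_def .
  qed simp
qed

text \<open>The pairing is a finite sum over the discriminant group, so the sum over cosets passes
  through it; \<open>slash_pairing\<close> identifies each term.\<close>

lemma h0_sum:
  assumes t: "\<tau> \<in> FD"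
  shows "(\<lambda>A. h0 (act (crep A) \<tau>)) summable_on T_cosets"
    and "(\<Sum>\<^sub>\<infinity>A\<in>T_cosets. h0 (act (crep A) \<tau>)) =
      (\<Sum>c\<in>DL. (\<Sum>\<^sub>\<infinity>A\<in>T_cosets. slashc A \<tau> c) * cnj (Th m \<tau> c)) * of_real (Im \<tau>) ^ (m + 1)"
proof -
  have u: "\<tau> \<in> upper_half" by (rule FD_upper[OF t])
  let ?f = "\<lambda>c A. slashc A \<tau> c * (cnj (Th m \<tau> c) * of_real (Im \<tau>) ^ (m + 1))"
  have e: "h0 (act (crep A) \<tau>) = (\<Sum>c\<in>DL. ?f c A)" if A: "A \<in> T_cosets" for A
  proof -
    have g: "crep A \<in> carrier Mp2Z" by (rule crep_coset(1)[OF A])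
    have "h0 (act (crep A) \<tau>) = herm (slashc A \<tau>) (Th m \<tau>) * of_real (Im \<tau>) ^ (m + 1)"
      unfolding slash_pairing[OF g seed_GA u] seed_pairing[OF moebius_in_upper[OF g u]] ..
    then show ?thesis unfolding herm_pair_def sum_distrib_right by (simp only: mult.assoc)
  qed
  have s: "?f c summable_on T_cosets" for c
    by (rule summable_on_cmult_left, rule abs_summable_summable, rule slash_summable[OF t])
  note F = finite_sum_infsum[of DL ?f T_cosets, OF finite_DL s]
  have "(\<lambda>A. \<Sum>c\<in>DL. ?f c A) summable_on T_cosets" using F by blast
  then show "(\<lambda>A. h0 (act (crep A) \<tau>)) summable_on T_cosets"
    by (rule summable_on_cong[THEN iffD1, rotated]) (simp add: e)
  have "(\<Sum>\<^sub>\<infinity>A\<in>T_cosets. h0 (act (crep A) \<tau>)) = (\<Sum>\<^sub>\<infinity>A\<in>T_cosets. \<Sum>c\<in>DL. ?f c A)"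
    by (rule infsum_cong) (simp add: e)
  also have "\<dots> = (\<Sum>c\<in>DL. \<Sum>\<^sub>\<infinity>A\<in>T_cosets. ?f c A)" using F by blast
  also have "\<dots> = (\<Sum>c\<in>DL. (\<Sum>\<^sub>\<infinity>A\<in>T_cosets. slashc A \<tau> c) * (cnj (Th m \<tau> c) * of_real (Im \<tau>) ^ (m + 1)))"
    unfolding infsum_cmult_left' ..
  finally show "(\<Sum>\<^sub>\<infinity>A\<in>T_cosets. h0 (act (crep A) \<tau>)) =
      (\<Sum>c\<in>DL. (\<Sum>\<^sub>\<infinity>A\<in>T_cosets. slashc A \<tau> c) * cnj (Th m \<tau> c)) * of_real (Im \<tau>) ^ (m + 1)"
    unfolding sum_distrib_right by (simp only: mult.assoc)
qed

abbreviation "PF \<equiv> poincare_F B L \<rho> b m r \<beta> s"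

lemma theta_L_eq: "theta_L B L z \<zeta> m \<tau> Z c = Th m \<tau> c / of_real q ^ m"
proof -
  have "theta_L B L z \<zeta> m \<tau> Z c = (\<Sum>\<^sub>\<infinity>x\<in>Ld. (T m \<tau> x * basis_vec (lat_coset L x) c) / of_real q ^ m)"
    unfolding theta_L_def by (rule infsum_cong) (simp add: form_ZV norm_plus_eq norm_minus_eq T_def pZ_def q_def)
  then show ?thesis unfolding Th_def divide_inverse infsum_cmult_left' .
qed

definition "cst = 1 / (4 * Gamma (2 * s) * of_real q ^ m)"

lemma lift_integrand_eq:
  assumes t: "\<tau> \<in> FD"
  shows "lift_integrand B L z \<zeta> m Z PF \<tau> =
    cst * (\<Sum>\<^sub>\<infinity>A\<in>T_cosets. h0 (act (crep A) \<tau>)) / of_real (Im \<tau>) ^ 2"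
proof -
  have PF: "PF \<tau> c = 1 / (4 * Gamma (2 * s)) * (\<Sum>\<^sub>\<infinity>A\<in>T_cosets. slashc A \<tau> c)" for c
    unfolding poincare_F_def T_cosets_def T_group_def crep_def ..
  have "herm (PF \<tau>) (theta_L B L z \<zeta> m \<tau> Z) = cst * (\<Sum>c\<in>DL. (\<Sum>\<^sub>\<infinity>A\<in>T_cosets. slashc A \<tau> c) * cnj (Th m \<tau> c))"
    unfolding herm_pair_def PF theta_L_eq sum_distrib_left cst_def by (intro sum.cong) auto
  then show ?thesis unfolding lift_integrand_def h0_sum(2)[OF t] by (simp only: mult.assoc)
qed

lemma FD_borel [measurable]: "FD \<in> sets borel"
proof -
  have "FD = upper_half \<inter> {\<tau>. cmod \<tau> \<ge> 1} \<inter> {\<tau>. \<bar>Re \<tau>\<bar> \<le> 1/2}" by (auto simp: FD_def)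
  also have "\<dots> \<in> sets borel" by measurable
  finally show ?thesis .
qed

definition "hs \<tau> = indicator FD \<tau> *\<^sub>R (\<Sum>\<^sub>\<infinity>A\<in>T_cosets. h0 (act (crep A) \<tau>))"

lemma hs_measurable [measurable]: "hs \<in> borel_measurable borel"
proof -
  have "hs = (\<lambda>\<tau>. \<Sum>\<^sub>\<infinity>A\<in>T_cosets. indicator FD \<tau> *\<^sub>R h0 (act (crep A) \<tau>))"
    by (auto simp: fun_eq_iff hs_def indicator_def)
  also have "\<dots> \<in> borel_measurable borel"
    by (rule borel_measurable_infsum[OF countable_T_cosets]) (use h0_sum(1) in \<open>auto simp: indicator_def\<close>)
  finally show ?thesis .
qed

end

section \<open>Passage to the limit\<close>

lemma generic_trunc_iff:
  assumes t: "generic \<tau>"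
  shows "\<tau> \<in> trunc_domain hh \<longleftrightarrow> \<tau> \<in> FDi \<and> Im \<tau> \<le> hh" "\<tau> \<in> FDi \<longleftrightarrow> \<tau> \<in> strip \<and> \<tau> \<notin> E_set"
proof -
  have u: "\<tau> \<in> upper_half" using t by (simp add: generic_def)
  have nb: "\<tau> \<notin> bad_set" using t Mp.one_closed by (auto simp: generic_def mp2_one moebius_act_def autom_factor_def dest!: bspec[of _ _ "\<one>\<^bsub>Mp2Z\<^esub>"])
  have "\<tau> \<in> trunc_domain hh \<longleftrightarrow> \<tau> \<in> FD \<and> Im \<tau> \<le> hh" by (auto simp: trunc_domain_def FD_def)
  moreover have "\<tau> \<in> FD \<longleftrightarrow> \<tau> \<in> FDi" using FD_not_bad[OF _ nb] by (auto simp: FD_def FDi_def)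
  ultimately show "\<tau> \<in> trunc_domain hh \<longleftrightarrow> \<tau> \<in> FDi \<and> Im \<tau> \<le> hh" by simp
  show "\<tau> \<in> FDi \<longleftrightarrow> \<tau> \<in> strip \<and> \<tau> \<notin> E_set"
  proof
    assume "\<tau> \<in> FDi"
    then show "\<tau> \<in> strip \<and> \<tau> \<notin> E_set" using FDi_not_E by (auto simp: strip_def FDi_def)
  next
    assume a: "\<tau> \<in> strip \<and> \<tau> \<notin> E_set"
    then have "\<not> cmod (\<tau> + of_int 0) < 1" unfolding E_set_def by blast
    then have "\<tau> \<in> FD" using a u by (auto simp: FD_def strip_def)
    then show "\<tau> \<in> FDi" using FD_not_bad nb by blast
  qed
qed

context lift
begin

lemma lift_integrand_integral:
  assumes i: "integrable hyp_measure (\<lambda>\<tau>. indicator {\<tau>. Im \<tau> \<le> hh} \<tau> *\<^sub>R hs \<tau>)"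
  shows "set_integrable lborel (trunc_domain hh) (lift_integrand B L z \<zeta> m Z PF)"
    and "trunc_lift B L z \<zeta> m Z PF hh = cst * (LINT \<tau>|hyp_measure. indicator {\<tau>. Im \<tau> \<le> hh} \<tau> *\<^sub>R hs \<tau>)"
proof -
  let ?f = "\<lambda>\<tau>. indicator {\<tau>. Im \<tau> \<le> hh} \<tau> *\<^sub>R hs \<tau>"
  have m: "?f \<in> borel_measurable borel" by measurable
  have e: "indicator (trunc_domain hh) \<tau> *\<^sub>R lift_integrand B L z \<zeta> m Z PF \<tau> = cst * ((indicator upper_half \<tau> * (1 / (Im \<tau>)\<^sup>2)) *\<^sub>R ?f \<tau>)" for \<tau>
  proof (cases "\<tau> \<in> trunc_domain hh")
    case True
    then have F: "\<tau> \<in> FD" "Im \<tau> \<le> hh" "\<tau> \<in> upper_half" by (auto simp: trunc_domain_def FD_def)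
    then show ?thesis using True lift_integrand_eq[OF F(1)] by (simp add: hs_def scaleR_conv_of_real)
  next
    case False
    then show ?thesis by (auto simp: trunc_domain_def hs_def FD_def indicator_def)
  qed
  show "set_integrable lborel (trunc_domain hh) (lift_integrand B L z \<zeta> m Z PF)"
    unfolding set_integrable_def e using i hyp_lborel(1)[OF m] by (intro integrable_mult_right) simp
  show "trunc_lift B L z \<zeta> m Z PF hh = cst * (LINT \<tau>|hyp_measure. ?f \<tau>)"
    unfolding trunc_lift_def set_lebesgue_integral_def e integral_mult_right_zero hyp_lborel(2)[OF m] ..
qed

text \<open>On \<open>FDi\<close> the integrand is \<open>4 * h0\<close> from the upper triangular
  cosets plus \<open>\<Phi>\<close> from all the others. As \<open>FDi\<close> is almost everywhere
  the strip without the discs, the first part gives four strip integrals minus four disc integrals,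
  and the full integral of \<open>\<Phi>\<close> is exactly the missing disc part.\<close>

lemma trunc_lift_limit:
  shows "set_integrable lborel (trunc_domain hh) (lift_integrand B L z \<zeta> m Z PF)"
    and "(trunc_lift B L z \<zeta> m Z PF \<longlongrightarrow> 4 * cst * (\<Sum>\<^sub>\<infinity>x\<in>Lam. LINT y|lborel. wfun x y)) at_top"
proof -
  define h' where "h' \<tau> = indicator E_set \<tau> *\<^sub>R h0 \<tau>" for \<tau>
  let ?I = "\<lambda>hh \<tau>. indicator {\<tau>. Im \<tau> \<le> hh} \<tau> :: real"
  have h'm [measurable]: "h' \<in> borel_measurable borel" unfolding h'_def[abs_def] by measurable
  \<comment> \<open>The discs end at height 1, so truncation at \<open>hh \<ge> 1\<close> leaves
    them whole.\<close>
  have E1: "Im \<tau> \<le> 1" if E: "\<tau> \<in> E_set" for \<tau>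
  proof -
    obtain n :: int where n: "cmod (\<tau> + of_int n) < 1" using E by (auto simp: E_set_def)
    have "\<bar>Im (\<tau> + of_int n)\<bar> \<le> cmod (\<tau> + of_int n)" by (rule abs_Im_le_cmod)
    then show ?thesis using n by simp
  qed
  have i1: "integrable hyp_measure (\<lambda>\<tau>. indicator strip \<tau> *\<^sub>R h' \<tau>)"
    by (rule Bochner_Integration.integrable_bound[OF strip_integral(1)[of 1]])
       (use E1 in \<open>auto simp: h'_def indicator_def\<close>)
  have h'T: "h' (\<tau> + of_int n) = h' \<tau>" if "\<tau> \<in> upper_half" for \<tau> n
    by (simp add: h'_def h0_translate[OF that] indicator_def E_set_translate)
  obtain \<Phi> where \<Phi>: "integrable hyp_measure \<Phi>"
    "(LINT \<tau>|hyp_measure. \<Phi> \<tau>) = 4 * (LINT \<tau>|hyp_measure. indicator strip \<tau> *\<^sub>R h' \<tau>)"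
    "AE \<tau> in hyp_measure. \<Phi> \<tau> = (if \<tau> \<in> FDi then \<Sum>\<^sub>\<infinity>A\<in>T_cosets. h' (act (crep A) \<tau>) else 0)"
    using unfolding_Mp2Z[of h', OF h'm h'T i1] by blast
  have \<Phi>m [measurable]: "\<Phi> \<in> borel_measurable borel" using \<Phi>(1) by (auto dest: borel_measurable_integrable)
  \<comment> \<open>At a generic point of the strip outside \<open>FDi\<close>, which lies in a
    disc, \<open>h0\<close> and \<open>h'\<close> agree, so the first two terms on the right
    cancel.\<close>
  have ae: "AE \<tau> in hyp_measure. ?I hh \<tau> *\<^sub>R hs \<tau> =
    4 * (indicator strip \<tau> *\<^sub>R (?I hh \<tau> *\<^sub>R h0 \<tau>)) - 4 * (?I hh \<tau> *\<^sub>R (indicator strip \<tau> *\<^sub>R h' \<tau>)) + ?I hh \<tau> *\<^sub>R \<Phi> \<tau>" for hh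
    using AE_generic \<Phi>(3)
  proof eventually_elim
    case (elim \<tau>)
    note G = generic_trunc_iff[OF elim(1)]
    have FD: "\<tau> \<in> FD \<longleftrightarrow> \<tau> \<in> FDi"
      using G(1)[of "Im \<tau>"] elim(1) by (auto simp: trunc_domain_def FD_def generic_def)
    show ?case
    proof (cases "\<tau> \<in> FDi")
      case True
      then have "hs \<tau> = 4 * h0 \<tau> + \<Phi> \<tau>"
        using sum_over_cosets_split[OF elim(1) True h0_translate h0_sum(1)] elim(2) FD by (simp add: hs_def h'_def)
      then show ?thesis using True G(2) by (simp add: h'_def indicator_def)
    next
      case False
      then have "hs \<tau> = 0" "\<Phi> \<tau> = 0" using elim(2) FD by (simp_all add: hs_def)
      moreover have "indicator strip \<tau> *\<^sub>R h0 \<tau> = indicator strip \<tau> *\<^sub>R h' \<tau>" using False G(2) by (auto simp: h'_def indicator_def)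
      ultimately show ?thesis by (auto simp: indicator_def)
    qed
  qed
  have iA: "integrable hyp_measure (\<lambda>\<tau>. indicator strip \<tau> *\<^sub>R (?I hh \<tau> *\<^sub>R h0 \<tau>))" if "hh > 0" for hh
    by (rule strip_integral(1)[OF that])
  have iB: "integrable hyp_measure (\<lambda>\<tau>. ?I hh \<tau> *\<^sub>R (indicator strip \<tau> *\<^sub>R h' \<tau>))" for hh
    by (rule Bochner_Integration.integrable_bound[OF i1]) (auto simp: indicator_def)
  have iC: "integrable hyp_measure (\<lambda>\<tau>. ?I hh \<tau> *\<^sub>R \<Phi> \<tau>)" for hh
    by (rule Bochner_Integration.integrable_bound[OF \<Phi>(1)]) (auto simp: indicator_def)
  have iS: "integrable hyp_measure (\<lambda>\<tau>. ?I hh \<tau> *\<^sub>R hs \<tau>)" if h: "hh > 0" for hh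
  proof (subst integrable_cong_AE[OF _ _ ae])
    show "integrable hyp_measure (\<lambda>\<tau>. 4 * (indicator strip \<tau> *\<^sub>R (?I hh \<tau> *\<^sub>R h0 \<tau>)) - 4 * (?I hh \<tau> *\<^sub>R (indicator strip \<tau> *\<^sub>R h' \<tau>)) + ?I hh \<tau> *\<^sub>R \<Phi> \<tau>)"
      by (intro Bochner_Integration.integrable_add Bochner_Integration.integrable_diff integrable_mult_right iA iB iC h)
  qed measurable
  show "set_integrable lborel (trunc_domain hh) (lift_integrand B L z \<zeta> m Z PF)"
  proof (cases "hh > 0")
    case True
    then show ?thesis by (intro lift_integrand_integral(1) iS)
  next
    case False
    then have "trunc_domain hh = {}" by (auto simp: trunc_domain_def upper_half_def)
    then show ?thesis by (simp add: set_integrable_def)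
  qed
  let ?K = "LINT \<tau>|hyp_measure. indicator strip \<tau> *\<^sub>R h' \<tau>"
  have val: "trunc_lift B L z \<zeta> m Z PF hh = cst * (4 * (\<Sum>\<^sub>\<infinity>x\<in>Lam. LINT y|lborel. indicator {..hh} y *\<^sub>R wfun x y) - 4 * ?K + (LINT \<tau>|hyp_measure. ?I hh \<tau> *\<^sub>R \<Phi> \<tau>))"
    if h: "hh \<ge> 1" for hh
  proof -
    have h0: "hh > 0" using h by simp
    have B: "?I hh \<tau> *\<^sub>R (indicator strip \<tau> *\<^sub>R h' \<tau>) = indicator strip \<tau> *\<^sub>R h' \<tau>" for \<tau>
      using E1[of \<tau>] h by (auto simp: h'_def indicator_def)
    have "(LINT \<tau>|hyp_measure. ?I hh \<tau> *\<^sub>R hs \<tau>) =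
      (LINT \<tau>|hyp_measure. 4 * (indicator strip \<tau> *\<^sub>R (?I hh \<tau> *\<^sub>R h0 \<tau>)) - 4 * (?I hh \<tau> *\<^sub>R (indicator strip \<tau> *\<^sub>R h' \<tau>)) + ?I hh \<tau> *\<^sub>R \<Phi> \<tau>)"
      by (rule integral_cong_AE[OF _ _ ae]) measurable
    also have "\<dots> = 4 * (LINT \<tau>|hyp_measure. indicator strip \<tau> *\<^sub>R (?I hh \<tau> *\<^sub>R h0 \<tau>)) - 4 * (LINT \<tau>|hyp_measure. ?I hh \<tau> *\<^sub>R (indicator strip \<tau> *\<^sub>R h' \<tau>)) + (LINT \<tau>|hyp_measure. ?I hh \<tau> *\<^sub>R \<Phi> \<tau>)"
      by (subst Bochner_Integration.integral_add Bochner_Integration.integral_diff,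
          (intro Bochner_Integration.integrable_diff integrable_mult_right iA iB iC h0)+,
          subst Bochner_Integration.integral_diff,
          (intro integrable_mult_right iA iB iC h0)+,
          simp only: integral_mult_right_zero)
    finally show ?thesis unfolding lift_integrand_integral(2)[OF iS[OF h0]] strip_integral(2)[OF h0] B by simp
  qed
  have C: "((\<lambda>hh. LINT \<tau>|hyp_measure. ?I hh \<tau> *\<^sub>R \<Phi> \<tau>) \<longlongrightarrow> (LINT \<tau>|hyp_measure. \<Phi> \<tau>)) at_top"
  proof (rule integral_dominated_convergence_at_top[where w="\<lambda>\<tau>. norm (\<Phi> \<tau>)"])
    show "AE \<tau> in hyp_measure. ((\<lambda>hh. ?I hh \<tau> *\<^sub>R \<Phi> \<tau>) \<longlongrightarrow> \<Phi> \<tau>) at_top"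
    proof (rule AE_I2)
      fix \<tau> :: complex
      have "\<forall>\<^sub>F hh in at_top. ?I hh \<tau> *\<^sub>R \<Phi> \<tau> = \<Phi> \<tau>"
        using eventually_ge_at_top[of "Im \<tau>"] by eventually_elim simp
      then show "((\<lambda>hh. ?I hh \<tau> *\<^sub>R \<Phi> \<tau>) \<longlongrightarrow> \<Phi> \<tau>) at_top" by (rule tendsto_eventually)
    qed
    show "\<forall>\<^sub>F hh in at_top. AE \<tau> in hyp_measure. norm (?I hh \<tau> *\<^sub>R \<Phi> \<tau>) \<le> norm (\<Phi> \<tau>)"
      by (rule always_eventually) (auto simp: indicator_def)
    show "integrable hyp_measure (\<lambda>\<tau>. norm (\<Phi> \<tau>))" by (rule integrable_norm[OF \<Phi>(1)])
  qed measurable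
  have L1: "((\<lambda>hh. cst * (4 * (\<Sum>\<^sub>\<infinity>x\<in>Lam. LINT y|lborel. indicator {..hh} y *\<^sub>R wfun x y) - 4 * ?K + (LINT \<tau>|hyp_measure. ?I hh \<tau> *\<^sub>R \<Phi> \<tau>)))
    \<longlongrightarrow> cst * (4 * (\<Sum>\<^sub>\<infinity>x\<in>Lam. LINT y|lborel. wfun x y) - 4 * ?K + (LINT \<tau>|hyp_measure. \<Phi> \<tau>))) at_top"
    by (intro tendsto_intros strip_limit C)
  \<comment> \<open>The disc integral \<open>?K\<close> enters once with \<open>- 4\<close> and
    once, through \<open>\<Phi>\<close>, with \<open>+ 4\<close>.\<close>
  have L2: "cst * (4 * (\<Sum>\<^sub>\<infinity>x\<in>Lam. LINT y|lborel. wfun x y) - 4 * ?K + (LINT \<tau>|hyp_measure. \<Phi> \<tau>)) = 4 * cst * (\<Sum>\<^sub>\<infinity>x\<in>Lam. LINT y|lborel. wfun x y)"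
    unfolding \<Phi>(2) by simp
  have L3: "\<forall>\<^sub>F hh in at_top. cst * (4 * (\<Sum>\<^sub>\<infinity>x\<in>Lam. LINT y|lborel. indicator {..hh} y *\<^sub>R wfun x y) - 4 * ?K + (LINT \<tau>|hyp_measure. ?I hh \<tau> *\<^sub>R \<Phi> \<tau>)) = trunc_lift B L z \<zeta> m Z PF hh"
    using eventually_ge_at_top[of 1] by eventually_elim (simp add: val)
  show "(trunc_lift B L z \<zeta> m Z PF \<longlongrightarrow> 4 * cst * (\<Sum>\<^sub>\<infinity>x\<in>Lam. LINT y|lborel. wfun x y)) at_top"
    by (rule Lim_transform_eventually[OF L1[unfolded L2] L3])
qed

text \<open>Both \<open>R\<close> and \<open>cc x\<close> carry a factor \<open>2 * pi\<close>. Its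
  exponents \<open>s - k / 2\<close> and \<open>- a\<close> add up to \<open>- m\<close>, which
  leaves \<open>(2 * pi) ^ m\<close> in the denominator.\<close>

lemma wfun_value:
  assumes x: "x \<in> Lam"
  shows "(LINT y|lborel. wfun x y) / of_real q ^ m =
    2 * of_real (2 * \<bar>r\<bar>) powr (s - k / 2) * Gamma a *
    (cnj (pZ x) ^ m / of_real q ^ m / (of_real (2 * pi) ^ m * of_real \<bar>nm x\<bar> powr a) * hyp2F1 a (s + k / 2) (2 * s) (of_real (2 * \<bar>r\<bar> / \<bar>nm x\<bar>)))"
proof -
  have n: "\<bar>nm x\<bar> > 0" using cc_Lam[OF x] Re_pos(4) by (auto simp: zero_less_mult_iff)
  have r: "\<bar>r\<bar> > 0" using r_neg by simp
  have gen1: "inverse p * u * inverse w = u / (p * w)" for p u w :: complex by (simp add: divide_inverse mult_ac)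
  have gen2: "2 * c / d * g * (u / w) * h = 2 * u * g * (c / d / w * h)" for c d g u w h :: complex
    by (simp add: divide_inverse mult_ac)
  have gen3: "2 * c * (u * g * w * h) / d = 2 * c / d * g * (u * w) * h" for c d g u w h :: complex
    by (simp add: divide_inverse mult_ac)
  have ratio: "R / cc x = 2 * \<bar>r\<bar> / \<bar>nm x\<bar>" unfolding cc_Lam(1)[OF x] R_def by simp
  have "(of_real R :: complex) powr (s - k / 2) * of_real (cc x) powr (- a) =
    of_real (2 * \<bar>r\<bar>) powr (s - k / 2) / (of_real (2 * pi) ^ m * of_real \<bar>nm x\<bar> powr a)"
  proof -
    have "R = (2 * pi) * (2 * \<bar>r\<bar>)" by (simp add: R_def)
    then have 1: "(of_real R :: complex) powr (s - k / 2) = of_real (2 * pi) powr (s - k / 2) * of_real (2 * \<bar>r\<bar>) powr (s - k / 2)"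
      using r by (simp only: of_real_mult[of "2 * pi"] powr_times_real) (subst powr_times_real, auto)
    have 2: "(of_real (cc x) :: complex) powr (- a) = of_real (2 * pi) powr (- a) * of_real \<bar>nm x\<bar> powr (- a)"
      unfolding cc_Lam(1)[OF x] of_real_mult[of "2 * pi"] using n by (subst powr_times_real) auto
    have 3: "(of_real (2 * pi) :: complex) powr (s - k / 2) * of_real (2 * pi) powr (- a) = inverse (of_real (2 * pi) ^ m)"
    proof -
      have "(of_real (2 * pi) :: complex) powr (s - k / 2) * of_real (2 * pi) powr (- a) = of_real (2 * pi) powr (- of_nat m)"
        unfolding powr_add[symmetric] by (simp add: a_def)
      also have "\<dots> = inverse (of_real (2 * pi) powr of_nat m)" by (rule powr_minus)
      also have "(of_real (2 * pi) :: complex) powr of_nat m = of_real (2 * pi) ^ m" by (simp add: powr_nat)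
      finally show ?thesis .
    qed
    have "(of_real R :: complex) powr (s - k / 2) * of_real (cc x) powr (- a) =
      (of_real (2 * pi) powr (s - k / 2) * of_real (2 * pi) powr (- a)) * of_real (2 * \<bar>r\<bar>) powr (s - k / 2) * of_real \<bar>nm x\<bar> powr (- a)"
      unfolding 1 2 by (simp only: mult_ac)
    also have "\<dots> = of_real (2 * \<bar>r\<bar>) powr (s - k / 2) / (of_real (2 * pi) ^ m * of_real \<bar>nm x\<bar> powr a)"
      unfolding 3 powr_minus[of "of_real \<bar>nm x\<bar>" a] by (rule gen1)
    finally show ?thesis .
  qed
  note P = this
  have "(LINT y|lborel. wfun x y) / of_real q ^ m = 2 * cnj (pZ x) ^ m / of_real q ^ m * Gamma a * (of_real R powr (s - k / 2) * of_real (cc x) powr (- a)) * hyp2F1 a (s + k / 2) (2 * s) (of_real (R / cc x))"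
    unfolding wfun_full(2)[OF x] by (rule gen3)
  then show ?thesis unfolding P ratio gen2 .
qed

end

theorem theorem3p1:
  fixes B :: "'v::euclidean_space \<Rightarrow> 'v \<Rightarrow> real"
    and L C :: "'v set"
    and z \<zeta> \<beta> :: 'v
    and \<rho> :: "mp2 \<Rightarrow> ('v set \<Rightarrow> complex) \<Rightarrow> ('v set \<Rightarrow> complex)"
    and b m :: nat
    and r :: real
    and s a :: complex
    and Z :: "'v cpx"
    and summand :: "'v \<Rightarrow> complex"
  assumes lattice: "even_lattice B L 2 b"
    and weil: "weil_representation B L b \<rho>"
    and z_isotropic: "B z z = 0"
    and z_zeta: "B z \<zeta> = 1"
    and cone: "positive_cone B z \<zeta> C"
    and m: "m \<ge> 1"
    and beta: "\<beta> \<in> dual_lattice B L"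
    and r_neg: "r < 0"
    and r_rat: "r \<in> \<rat>"
    and r_cong: "r - B \<beta> \<beta> / 2 \<in> \<int>"
    and s: "Re s > 3/2 + real b / 4 + real m / 2"
    and Z: "Z \<in> K_space B z \<zeta> \<times> C"
    and Z_off: "\<And>x. x \<in> lat_coset L \<beta> \<Longrightarrow> B x x = 2 * r \<Longrightarrow> Z \<notin> perp_divisor B z \<zeta> C x"
    and a_def: "a = s - 1/2 + of_nat b / 4 + of_nat m / 2"
    and summand_def: "\<And>x. summand x =
      cpx_form B (cpx_emb x) (cpx_cnj (ZV B z \<zeta> Z)) ^ m / of_real (B (snd Z) (snd Z)) ^ m /
      (of_real (2 * pi) ^ m * of_real \<bar>norm_minus B z \<zeta> Z x\<bar> powr a) *
      hyp2F1 a (s + 1/2 - of_nat b / 4 + of_nat m / 2) (2 * s)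
        (of_real (2 * \<bar>r\<bar> / \<bar>norm_minus B z \<zeta> Z x\<bar>))"
  shows "theta_lift_converges B L z \<zeta> m Z (poincare_F B L \<rho> b m r \<beta> s) \<and>
    summand summable_on {x \<in> lat_coset L \<beta>. B x x = 2 * r} \<and>
    theta_lift B L z \<zeta> m Z (poincare_F B L \<rho> b m r \<beta> s) =
      2 * of_real (2 * \<bar>r\<bar>) powr (s - 1/2 + of_nat b / 4 - of_nat m / 2) * Gamma a / Gamma (2 * s) *
      (\<Sum>\<^sub>\<infinity>x\<in>{x \<in> lat_coset L \<beta>. B x x = 2 * r}. summand x)"
proof -
  have C: "C \<subseteq> {Y \<in> K_space B z \<zeta>. B Y Y > 0}"
    using cone unfolding positive_cone_def by (rule in_components_subset)
  have Zp: "fst Z \<in> K_space B z \<zeta>" "snd Z \<in> K_space B z \<zeta>" "B (snd Z) (snd Z) > 0" using Z C by auto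
  note a_eq = a_def
  interpret quad B L z \<zeta> Z b
    by unfold_locales (fact lattice z_isotropic z_zeta Zp)+
  interpret quad_weil B L z \<zeta> Z b \<rho> by unfold_locales (fact weil)
  interpret lift B L z \<zeta> Z b \<rho> m r \<beta> s
  proof unfold_locales
    fix x assume x: "x \<in> lat_coset L \<beta>" "B x x = 2 * r"
    \<comment> \<open>Being off the divisor means a nonzero projection to v_+, which is positive
      definite, so \<open>np x > 0\<close>.\<close>
    have "x \<notin> v_minus B z \<zeta> Z" using Z_off[OF x] Z by (simp add: perp_divisor_def)
    then have "(B x X)\<^sup>2 + (B x Y)\<^sup>2 > 0" unfolding v_minus_iff by (simp add: sum_power2_gt_zero_iff)
    then show "np x > 0" using q_pos by (simp add: np_def)
  qed (fact m beta r_neg r_cong s)+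
  let ?Lam = "{x \<in> lat_coset L \<beta>. B x x = 2 * r}"
  have k2: "k / 2 = 1/2 - of_nat b / 4 + of_nat m / 2" by (simp add: k_def two_weight_def field_simps)
  have a: "lift.a b m s = a" unfolding a_eq lift.a_def[OF lift_axioms] by (simp add: k2)
  let ?P = "2 * of_real (2 * \<bar>r\<bar>) powr (s - k / 2) * Gamma a"
  have cancel: "p \<noteq> 0 \<Longrightarrow> inverse p * (p * w) = w" for p w :: complex by simp
  \<comment> \<open>Since the common constant is nonzero, summability of \<open>summand\<close> can
    be recovered from that of the integrals.\<close>
  have P0: "?P \<noteq> 0"
  proof -
    have "a \<notin> \<int>\<^sub>\<le>\<^sub>0" using Re_pos(3) unfolding a by (auto elim!: nonpos_Ints_cases)
    then show ?thesis using r_neg by (simp add: Gamma_eq_zero_iff)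
  qed
  have sm: "(LINT y|lborel. wfun x y) / of_real q ^ m = ?P * summand x" if "x \<in> ?Lam" for x
    unfolding wfun_value[OF that, unfolded a] summand_def form_ZV_cnj norm_minus_eq pZ_def[symmetric] q_def[symmetric]
    by (simp add: k2 algebra_simps)
  have S: "(\<lambda>x. (LINT y|lborel. wfun x y) / of_real q ^ m) summable_on ?Lam"
    unfolding divide_inverse by (rule summable_on_cmult_left[OF wfun_lint_summable])
  then have "(\<lambda>x. ?P * summand x) summable_on ?Lam"
    by (rule summable_on_cong[THEN iffD1, rotated]) (rule sm)
  then have "(\<lambda>x. inverse ?P * (?P * summand x)) summable_on ?Lam" by (rule summable_on_cmult_right)
  moreover have "(\<lambda>x. inverse ?P * (?P * summand x)) = summand" by (rule ext) (rule cancel[OF P0])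
  ultimately have sum: "summand summable_on ?Lam" by (simp only:)
  have gen1: "4 * (1 * inverse (4 * g * d)) * S = 1 * inverse g * (S * inverse d)" for g d S :: complex
    by (simp add: mult_ac)
  have gen2: "1 / g * (2 * w * c * S) = 2 * w * c / g * S" for g w c S :: complex by simp
  have "4 * cst * (\<Sum>\<^sub>\<infinity>x\<in>?Lam. LINT y|lborel. wfun x y) = 1 / Gamma (2 * s) * (\<Sum>\<^sub>\<infinity>x\<in>?Lam. (LINT y|lborel. wfun x y) / of_real q ^ m)"
    unfolding divide_inverse infsum_cmult_left' cst_def by (rule gen1)
  also have "(\<Sum>\<^sub>\<infinity>x\<in>?Lam. (LINT y|lborel. wfun x y) / of_real q ^ m) = (\<Sum>\<^sub>\<infinity>x\<in>?Lam. ?P * summand x)"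
    by (rule infsum_cong) (rule sm)
  also have "\<dots> = ?P * (\<Sum>\<^sub>\<infinity>x\<in>?Lam. summand x)" by (rule infsum_cmult_right')
  finally have V0: "4 * cst * (\<Sum>\<^sub>\<infinity>x\<in>?Lam. LINT y|lborel. wfun x y) = 1 / Gamma (2 * s) * (?P * (\<Sum>\<^sub>\<infinity>x\<in>?Lam. summand x))" .
  have sk: "s - 1/2 + of_nat b / 4 - of_nat m / 2 = s - k / 2" by (simp add: k2)
  have V: "4 * cst * (\<Sum>\<^sub>\<infinity>x\<in>?Lam. LINT y|lborel. wfun x y) =
    2 * of_real (2 * \<bar>r\<bar>) powr (s - 1/2 + of_nat b / 4 - of_nat m / 2) * Gamma a / Gamma (2 * s) * (\<Sum>\<^sub>\<infinity>x\<in>?Lam. summand x)"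
    unfolding V0 sk by (rule gen2)
  show ?thesis
    using trunc_lift_limit sum tendsto_Lim[OF trivial_limit_at_top_linorder trunc_lift_limit(2)]
    unfolding theta_lift_converges_def theta_lift_def V by blast
qed

end
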